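(* Let $r\mapsto P(r)$ be a collection of possibly random $(r\times r)$ covariance matrices such that, for every integer $n\ge1$, one has the almost sure convergence $r^{-1}\mathrm{Tr}(P(r)^n)\to\tau_n(P)$ as $r\to\infty$. Write $P$ for $P(r)$ and $\mathcal{H}$ for $\mathcal{H}(r)$. In this situation, the central matrix moments $M_{2n,n}(P)$ coincide with those of the limiting Gaussian matrix $\mathcal{H}$. In addition, for any $n\ge m\ge1$ we have the matrix moment estimates $$M_{2n,n}(P)=\mathbb{E}\left(\mathcal{H}^{2n}\right)=\Sigma_n(P)+\mathrm{O}(r^{n-1})\,I,\qquad M^{\circ}_{n,m}(P)=\Sigma^{\circ}_{n,m}(P)+\mathrm{O}(r^{n-m-1})\,I,$$ where $I$ is the $(r\times r)$ identity matrix.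
   Context: The matrix functions below are defined for a given covariance matrix $P$ and then evaluated at $P=P(r)$. $X$ is a centered Gaussian column vector in $\mathbb{R}^r$ with covariance $P$, $\mathbb{X}:=XX'$ (prime denotes transposition), and $\mathbb{X}_1,\mathbb{X}_2,\ldots$ are independent copies of $\mathbb{X}$. $\mathcal{H}$ is equal in law to $P^{1/2}\big(\frac{\mathcal{W}+\mathcal{W}'}{\sqrt2}\big)P^{1/2}$, where $\mathcal{W}$ is an $(r\times r)$-matrix with independent centered Gaussian entries of unit variance; it is the limit in law, as $N\to\infty$, of $N^{-1/2}\sum_{1\le i\le N}(\mathbb{X}_i-P)$. Partitions of $[n]=\{1,\ldots,n\}$ have blocks $\pi_1\le\pi_2\le\cdots$ ordered by smallest element; $\alpha^\pi(i)$ is the index of the block containing $i$. $\mathcal{P}_{n,m}$: partitions of $[n]$ with $m$ blocks; $\mathcal{Q}_{n,m}\subset\mathcal{P}_{n,m}$: those without singleton blocks; $\mathcal{N}_n$, $\mathcal{N}_{n,m}$: non-crossing partitions of $[n]$ (resp. with $m$ blocks), where a partition is crossing if there are $i<j<k<l$ with $i,k$ in one block and $j,l$ in another block. $r_i(\pi)$ is the number of blocks of $\pi$ of size $i\ge1$. Define $$M_{n,m}(P):=\sum_{\pi\in\mathcal{Q}_{n,m}}\mathbb{E}\Big(\prod_{1\le i\le n}(\mathbb{X}_{\alpha^\pi(i)}-P)\Big),\qquad M^\circ_{n,m}(P):=\sum_{\pi\in\mathcal{P}_{n,m}}\mathbb{E}\Big(\prod_{1\le i\le n}\mathbb{X}_{\alpha^\pi(i)}\Big)$$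 (ordered products, left to right), and $$\Sigma_n(P):=\mathrm{Tr}(P)\sum_{\pi\in\mathcal{N}_n}\Big[\prod_{i\ge0}\mathrm{Tr}(P^{1+i})^{r_i(\pi)}\Big]\frac{P^{|\pi_1|}}{\mathrm{Tr}(P^{|\pi_1|+1})},\qquad r_0(\pi):=n-\sum_{i\ge1}r_i(\pi),$$ $$\Sigma^\circ_{n,m}(P):=\sum_{\pi\in\mathcal{N}_{n,m}}\Big[\prod_{i\ge1}\mathrm{Tr}(P^i)^{r_i(\Xi(\pi))}\Big]\frac{P^{\iota(\pi)}}{\mathrm{Tr}(P^{\iota(\pi)})}.$$ Here $\iota(\pi)$ is the number of blocks of $\pi$ visible from above in its arc (Murasaki) diagram, i.e. the number of blocks $B$ for which there is no other block $B'$ with $\min B'<\min B\le\max B<\max B'$. The partition $\Xi(\pi)\in\mathcal{N}_{n,n+1-m}$ is obtained as follows: place the points $1,\ldots,n$ clockwise on a circle and insert new nodes $\bar1,\ldots,\bar n$, with $\bar i$ on the arc between $i$ and $i+1$ ($\bar n$ between $n$ and $1$); $\Xi(\pi)$ is the coarsest non-crossing partition of the new nodes (identified with $[n]$) whose chords do not cross those of $\pi$.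
   Formalization: The O(·)I bounds fail in the Loewner order if the norm of P(r) is unbounded, e.g. P(r)=diag(log r,1,…,1). They are proved in that order when P(r) is bounded in operator norm, and otherwise only as bounds on all normalized trace moments of the remainder. *)

theory Defs
  imports
    "HOL-Probability.Probability"
    "HOL-Library.Landau_Symbols"
    "HOL-Library.Disjoint_Sets"
    "Jordan_Normal_Form.Matrix"
begin

section \<open>Real matrices whose size is a value\<close>

text \<open>The size \<open>r\<close> of the matrices tends to infinity, so square matrices are elements of
  \<open>carrier_mat r r\<close>; rows and columns are numbered from \<open>0\<close>.\<close>

definition mtrace :: "real mat \<Rightarrow> real" where
  "mtrace A = (\<Sum>i<dim_row A. A $$ (i, i))"

definition psd_mat :: "nat \<Rightarrow> real mat \<Rightarrow> bool" where
  "psd_mat r A \<longleftrightarrow> A \<in> carrier_mat r r \<and> transpose_mat A = A \<and>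
     (\<forall>v \<in> carrier_vec r. 0 \<le> v \<bullet> (A *\<^sub>v v))"

definition loewner_le :: "nat \<Rightarrow> real mat \<Rightarrow> real mat \<Rightarrow> bool" where
  "loewner_le r A B \<longleftrightarrow> A \<in> carrier_mat r r \<and> B \<in> carrier_mat r r \<and> psd_mat r (B - A)"

text \<open>The principal square root \<open>P\<^sup>1\<^sup>/\<^sup>2\<close>; the choice is from a singleton whenever \<open>P\<close> is
  symmetric positive semidefinite.\<close>

definition psd_sqrt :: "real mat \<Rightarrow> real mat" where
  "psd_sqrt P = (SOME S. psd_mat (dim_row P) S \<and> S * S = P)"

definition mat_sum :: "nat \<Rightarrow> ('a \<Rightarrow> real mat) \<Rightarrow> 'a set \<Rightarrow> real mat" where
  "mat_sum r F A = mat r r (\<lambda>ij. \<Sum>a\<in>A. F a $$ ij)"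

text \<open>\<open>mat_prod r n F\<close> is the ordered product \<open>F 1 * F 2 * \<dots> * F n\<close>.\<close>

definition mat_prod :: "nat \<Rightarrow> nat \<Rightarrow> (nat \<Rightarrow> real mat) \<Rightarrow> real mat" where
  "mat_prod r n F = foldr (\<lambda>i A. F i * A) [1..<Suc n] (1\<^sub>m r)"

definition mat_expectation :: "nat \<Rightarrow> 'a measure \<Rightarrow> ('a \<Rightarrow> real mat) \<Rightarrow> real mat" where
  "mat_expectation r \<mu> F = mat r r (\<lambda>ij. \<integral>x. F x $$ ij \<partial>\<mu>)"

section \<open>Gaussian vectors and the Gaussian matrix\<close>

definition std_normal :: "real measure" where
  "std_normal = density lborel std_normal_density"

text \<open>The centered Gaussian law with covariance \<open>P\<close> on \<open>r\<close>-dimensional space, i.e. the law of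
  \<open>P\<^sup>1\<^sup>/\<^sup>2 Z\<close> for \<open>Z\<close> with independent standard normal coordinates; \<open>P\<close> may be singular. Vectors are
  functions on \<open>{..<r}\<close> here, as in the library's product measures.\<close>

definition gaussian_law :: "real mat \<Rightarrow> (nat \<Rightarrow> real) measure" where
  "gaussian_law P = (let r = dim_row P in
     distr (\<Pi>\<^sub>M i\<in>{..<r}. std_normal) (\<Pi>\<^sub>M i\<in>{..<r}. borel)
       (\<lambda>z. \<lambda>i\<in>{..<r}. \<Sum>j<r. psd_sqrt P $$ (i, j) * z j))"

text \<open>The joint law of independent copies \<open>X 0, X 1, X 2, \<dots>\<close> of such a vector.\<close>

definition gaussian_copies :: "real mat \<Rightarrow> (nat \<Rightarrow> nat \<Rightarrow> real) measure" where
  "gaussian_copies P = (\<Pi>\<^sub>M k\<in>UNIV. gaussian_law P)"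

definition outer :: "nat \<Rightarrow> (nat \<Rightarrow> real) \<Rightarrow> real mat" where
  "outer r x = mat r r (\<lambda>(i, j). x i * x j)"

definition gauss_entries :: "nat \<Rightarrow> (nat \<times> nat \<Rightarrow> real) measure" where
  "gauss_entries r = (\<Pi>\<^sub>M ij\<in>{..<r} \<times> {..<r}. std_normal)"

definition H_mat :: "real mat \<Rightarrow> (nat \<times> nat \<Rightarrow> real) \<Rightarrow> real mat" where
  "H_mat P w = (let r = dim_row P; W = mat r r w in
     psd_sqrt P * ((1 / sqrt 2) \<cdot>\<^sub>m (W + transpose_mat W)) * psd_sqrt P)"

definition H_moment :: "nat \<Rightarrow> real mat \<Rightarrow> real mat" where
  "H_moment n P = mat_expectation (dim_row P) (gauss_entries (dim_row P))
     (\<lambda>w. H_mat P w ^\<^sub>m n)"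

section \<open>Set partitions\<close>

definition parts :: "nat \<Rightarrow> nat \<Rightarrow> nat set set set" where
  "parts n m = {\<pi>. partition_on {1..n} \<pi> \<and> card \<pi> = m}"

definition parts_no_singleton :: "nat \<Rightarrow> nat \<Rightarrow> nat set set set" where
  "parts_no_singleton n m = {\<pi> \<in> parts n m. \<forall>B\<in>\<pi>. card B \<noteq> 1}"

definition crossing :: "nat set set \<Rightarrow> bool" where
  "crossing \<pi> \<longleftrightarrow> (\<exists>i j k l. \<exists>B\<in>\<pi>. \<exists>B'\<in>\<pi>. i < j \<and> j < k \<and> k < l \<and> B \<noteq> B' \<and>
     i \<in> B \<and> k \<in> B \<and> j \<in> B' \<and> l \<in> B')"

definition nc_parts :: "nat \<Rightarrow> nat set set set" where
  "nc_parts n = {\<pi>. partition_on {1..n} \<pi> \<and> \<not> crossing \<pi>}"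

definition nc_parts_card :: "nat \<Rightarrow> nat \<Rightarrow> nat set set set" where
  "nc_parts_card n m = {\<pi> \<in> nc_parts n. card \<pi> = m}"

definition block_of :: "nat set set \<Rightarrow> nat \<Rightarrow> nat set" where
  "block_of \<pi> i = (THE B. B \<in> \<pi> \<and> i \<in> B)"

text \<open>Position (starting from \<open>1\<close>) of the block of \<open>i\<close> when the blocks are ordered by their
  smallest elements.\<close>

definition block_index :: "nat set set \<Rightarrow> nat \<Rightarrow> nat" where
  "block_index \<pi> i = card {B \<in> \<pi>. Min B \<le> Min (block_of \<pi> i)}"

text \<open>In that order, the first block of a partition of \<open>{1..n}\<close> is the one containing \<open>1\<close>.\<close>

definition first_block :: "nat set set \<Rightarrow> nat set" where
  "first_block \<pi> = block_of \<pi> 1"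

text \<open>\<open>r\<^sub>i(\<pi>)\<close>: for \<open>i \<ge> 1\<close> the number of blocks of size \<open>i\<close>, and the complementary count for
  \<open>i = 0\<close>.\<close>

definition block_count :: "nat \<Rightarrow> nat set set \<Rightarrow> nat \<Rightarrow> nat" where
  "block_count n \<pi> i =
     (if i = 0 then n - (\<Sum>k=1..n. card {B \<in> \<pi>. card B = k}) else card {B \<in> \<pi>. card B = i})"

definition visible_blocks :: "nat set set \<Rightarrow> nat" where
  "visible_blocks \<pi> =
     card {B \<in> \<pi>. \<not> (\<exists>B'\<in>\<pi>. B' \<noteq> B \<and> Min B' < Min B \<and> Max B < Max B')}"

text \<open>The circle \<open>1, 1', 2, 2', \<dots>, n, n'\<close> with the new nodes \<open>i'\<close> inserted is numbered
  \<open>1, \<dots>, 2n\<close>: the node \<open>i\<close> gets number \<open>2i - 1\<close> and the node \<open>i'\<close> gets number \<open>2i\<close>.\<close>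

definition interleave :: "nat set set \<Rightarrow> nat set set \<Rightarrow> nat set set" where
  "interleave \<pi> \<sigma> = (\<lambda>B. (\<lambda>i. 2 * i - 1) ` B) ` \<pi> \<union> (\<lambda>B. (\<lambda>i. 2 * i) ` B) ` \<sigma>"

text \<open>The coarsest non-crossing partition of the new nodes whose chords do not cross those
  of \<open>\<pi>\<close>.\<close>

definition Xi :: "nat \<Rightarrow> nat set set \<Rightarrow> nat set set" where
  "Xi n \<pi> = (THE \<sigma>. \<sigma> \<in> nc_parts n \<and> \<not> crossing (interleave \<pi> \<sigma>) \<and>
     (\<forall>\<sigma>'\<in>nc_parts n. \<not> crossing (interleave \<pi> \<sigma>') \<longrightarrow> refines {1..n} \<sigma>' \<sigma>))"

section \<open>The matrix moments and their leading terms\<close>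

definition M_central :: "nat \<Rightarrow> nat \<Rightarrow> real mat \<Rightarrow> real mat" where
  "M_central n m P = (let r = dim_row P in
     mat_sum r (\<lambda>\<pi>. mat_expectation r (gaussian_copies P)
         (\<lambda>X. mat_prod r n (\<lambda>i. outer r (X (block_index \<pi> i)) - P)))
       (parts_no_singleton n m))"

definition M_raw :: "nat \<Rightarrow> nat \<Rightarrow> real mat \<Rightarrow> real mat" where
  "M_raw n m P = (let r = dim_row P in
     mat_sum r (\<lambda>\<pi>. mat_expectation r (gaussian_copies P)
         (\<lambda>X. mat_prod r n (\<lambda>i. outer r (X (block_index \<pi> i)))))
       (parts n m))"

text \<open>For a covariance matrix, the traces in the denominators below vanish only if \<open>P = 0\<close>; then
  the summands are \<open>0\<close> by \<open>x / 0 = 0\<close>. The products over all block sizes are cut off at \<open>n\<close>, above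
  which the exponents are \<open>0\<close>.\<close>

definition Sigma_central :: "nat \<Rightarrow> real mat \<Rightarrow> real mat" where
  "Sigma_central n P = mtrace P \<cdot>\<^sub>m mat_sum (dim_row P)
     (\<lambda>\<pi>. ((\<Prod>i=0..n. mtrace (P ^\<^sub>m (1 + i)) ^ block_count n \<pi> i) /
             mtrace (P ^\<^sub>m (card (first_block \<pi>) + 1))) \<cdot>\<^sub>m P ^\<^sub>m card (first_block \<pi>))
     (nc_parts n)"

definition Sigma_raw :: "nat \<Rightarrow> nat \<Rightarrow> real mat \<Rightarrow> real mat" where
  "Sigma_raw n m P = mat_sum (dim_row P)
     (\<lambda>\<pi>. ((\<Prod>i=1..n. mtrace (P ^\<^sub>m i) ^ block_count n (Xi n \<pi>) i) /
             mtrace (P ^\<^sub>m visible_blocks \<pi>)) \<cdot>\<^sub>m P ^\<^sub>m visible_blocks \<pi>)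
     (nc_parts_card n m)"

section \<open>Matrix remainders of order \<open>O(g(r)) I\<close>\<close>

text \<open>Below, \<open>R r\<close> is an \<open>r \<times> r\<close> matrix. The first notion is the Loewner sandwich
  \<open>- C g(r) I \<le> R(r) \<le> C g(r) I\<close> for large \<open>r\<close>.\<close>

definition loewner_bigo :: "(nat \<Rightarrow> real mat) \<Rightarrow> (nat \<Rightarrow> real) \<Rightarrow> bool" where
  "loewner_bigo R g \<longleftrightarrow> (\<exists>C. \<forall>\<^sub>F r in sequentially.
     loewner_le r ((- (C * g r)) \<cdot>\<^sub>m 1\<^sub>m r) (R r) \<and> loewner_le r (R r) ((C * g r) \<cdot>\<^sub>m 1\<^sub>m r))"

text \<open>The second notion bounds every moment of \<open>R(r) / g(r)\<close> under the normalized trace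
  \<open>r\<^sup>-\<^sup>1 Tr\<close>. For symmetric \<open>R(r)\<close> the even exponents say that all normalized Schatten norms of
  \<open>R(r)\<close> are \<open>O(g(r))\<close>; the operator norm may grow.\<close>

definition trace_bigo :: "(nat \<Rightarrow> real mat) \<Rightarrow> (nat \<Rightarrow> real) \<Rightarrow> bool" where
  "trace_bigo R g \<longleftrightarrow> (\<forall>\<^sub>F r in sequentially. R r \<in> carrier_mat r r \<and> transpose_mat (R r) = R r) \<and>
     (\<forall>p\<ge>1. (\<lambda>r. mtrace (R r ^\<^sub>m p) / real r) \<in> O(\<lambda>r. g r ^ p))"

text \<open>Convergence of all normalized traces of \<open>P(r)\<close> does not bound its operator norm: the matrices
  \<open>P(r) = diag (ln r, 1, \<dots>, 1)\<close> have convergent normalized traces, and a remainder such as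
  \<open>P(r)\<^sup>2\<close> is then not \<open>O(1) I\<close> in the Loewner order. So the Loewner bound is claimed along families
  that are bounded in operator norm, and the trace bound always.\<close>

definition matrix_bigo :: "(nat \<Rightarrow> real mat) \<Rightarrow> (nat \<Rightarrow> real mat) \<Rightarrow> (nat \<Rightarrow> real) \<Rightarrow> bool" where
  "matrix_bigo P R g \<longleftrightarrow> trace_bigo R g \<and>
     ((\<exists>K. \<forall>\<^sub>F r in sequentially. loewner_le r (P r) (K \<cdot>\<^sub>m 1\<^sub>m r)) \<longrightarrow> loewner_bigo R g)"

end

theory Submission
  imports Defs
begin

text \<open>Integration by parts reduces every expectation below to a polynomial in the traces
  \<open>Tr(P\<^sup>b)\<close> times powers of \<open>P\<close>, and each trace is \<open>O(r)\<close>, so the order of a term is the number of its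
  traces. Contracting the first factor of \<open>Tr(H A H B)\<close> with the second gives \<open>Tr(P A) Tr(P B)\<close> and the
  trace \<open>Tr(P A' P B)\<close>; the second has one factor \<open>r\<close> less, and so have contractions between different
  traces. The leading term of \<open>E(H\<^sup>2\<^sup>n)\<close> therefore obeys the recursion of plane trees with \<open>n\<close> edges, the
  first subtree being split off. Non-crossing partitions obey the same recursion: a block of size \<open>k\<close> is a
  vertex with \<open>k\<close> children.

  The exact equality of the central moments with those of \<open>H\<close> is Wick's formula along index paths: a
  partition of \<open>[2n]\<close> with \<open>n\<close> blocks and no singleton is a pairing, and the entries of \<open>XX' - P\<close> and of \<open>H\<close>
  have the same covariance.

  For the raw moments the product \<open>X\<^sub>1X\<^sub>1' \<dots> X\<^sub>nX\<^sub>n'\<close> of a partition is a chain of bilinear forms. A vector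
  that occurs once is integrated out without a trace. Two equal neighbours give a trace, and all other
  contractions of the form between them lose one. A chain without these is crossing and has too few traces.
  So the leading term is a product over the faces of the arc diagram, which are the blocks of
  \<open>\<Xi>(\<pi>)\<close>; the outer face consists of the gaps that follow the visible blocks.\<close>

section \<open>Powers of positive semidefinite matrices\<close>

text \<open>Since r varies, all bounds must be uniform in r. Hence no limit is taken before the end:
  each remainder is shown to equal one fixed finite list of terms (a constant times traces of powers
  of P times a power of P), the same list for every r and every P, which is what
  \<open>trace_poly\<close> records. The assumed convergence serves only to bound each trace by a
  multiple of r. This form survives multiplication, so powers of a remainder are controlled as well,
  without any bound on the operator norm. Matrices are read off entry by entry through two fixed
  vectors u and v, so that every expectation is a scalar and integration by parts for polynomials
  applies. As P may be singular, there need not be a density: the laws are linear images of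
  independent standard normals under a square root, whose existence is part of the proof.
  \<open>trace_poly d\<close> allows fewer than d traces; with d = 0 nothing is left, and for n = m
  the remainder is exactly zero, in accordance with the exponent -1. The denominators of the leading
  terms may vanish; then the accompanying power of P vanishes too.\<close>

lemma pow_mat_add:
  assumes "(A :: real mat) \<in> carrier_mat r r"
  shows "A ^\<^sub>m (i + j) = A ^\<^sub>m i * A ^\<^sub>m j"
proof (induction j)
  case 0
  then show ?case using assms by (simp add: right_mult_one_mat[of _ r r])
next
  case (Suc j)
  have "A ^\<^sub>m i * A ^\<^sub>m j * A = A ^\<^sub>m i * (A ^\<^sub>m j * A)"
    by (rule assoc_mult_mat[of _ r r _ r _ r]) (use assms in auto)
  then show ?case using Suc by simp
qed

lemma pow_mat_1: "(A :: real mat) \<in> carrier_mat r r \<Longrightarrow> A ^\<^sub>m (Suc 0) = A"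
  by (simp add: left_mult_one_mat[of _ r r])

lemma transpose_pow_mat:
  assumes "(A :: real mat) \<in> carrier_mat r r" "transpose_mat A = A"
  shows "transpose_mat (A ^\<^sub>m k) = A ^\<^sub>m k"
proof (induction k)
  case 0
  then show ?case using assms by simp
next
  case (Suc k)
  have "transpose_mat (A ^\<^sub>m k * A) = transpose_mat A * transpose_mat (A ^\<^sub>m k)"
    by (rule transpose_mult[of _ r r _ r]) (use assms in auto)
  also have "\<dots> = A ^\<^sub>m (Suc 0) * A ^\<^sub>m k" using Suc assms pow_mat_1 by auto
  also have "\<dots> = A ^\<^sub>m (Suc 0 + k)" by (rule pow_mat_add[symmetric]) (rule assms)
  finally show ?case by simp
qed

lemma mult_mat_index:
  assumes "(A :: real mat) \<in> carrier_mat r r" "B \<in> carrier_mat r r" "i < r" "j < r"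
  shows "(A * B) $$ (i, j) = (\<Sum>k<r. A $$ (i, k) * B $$ (k, j))"
  using assms by (auto simp: scalar_prod_def atLeast0LessThan intro!: sum.cong)

lemma psd_matD:
  assumes "psd_mat r P"
  shows "P \<in> carrier_mat r r" "transpose_mat P = P" "dim_row P = r"
    "P ^\<^sub>m k \<in> carrier_mat r r"
    "v \<in> carrier_vec r \<Longrightarrow> 0 \<le> scalar_prod v (P *\<^sub>v v)"
  using assms by (auto simp: psd_mat_def pow_carrier_mat)

lemma symmetric_scalar_prod:
  assumes "(A :: real mat) \<in> carrier_mat r r" "transpose_mat A = A" "v \<in> carrier_vec r" "w \<in> carrier_vec r"
  shows "scalar_prod (A *\<^sub>v v) w = scalar_prod v (A *\<^sub>v w)"
  using transpose_vec_mult_scalar[OF assms(1,4,3)] assms(2) 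
  by (smt (verit) assms comm_scalar_prod mult_mat_vec_carrier)

lemma smult_mat_vec:
  assumes "(A :: real mat) \<in> carrier_mat nr nc" "v \<in> carrier_vec nc"
  shows "(c \<cdot>\<^sub>m A) *\<^sub>v v = c \<cdot>\<^sub>v (A *\<^sub>v v)"
  using assms by (auto intro!: eq_vecI)

lemma scalar_prod_ge_0_real: "0 \<le> scalar_prod (v :: real vec) v"
  by (auto simp: scalar_prod_def intro!: sum_nonneg)

lemma pow_mat_mult_vec:
  assumes "(A :: real mat) \<in> carrier_mat r r" "v \<in> carrier_vec r"
  shows "A ^\<^sub>m (i + j) *\<^sub>v v = A ^\<^sub>m i *\<^sub>v (A ^\<^sub>m j *\<^sub>v v)"
  using assms by (simp add: pow_mat_add[OF assms(1)] assoc_mult_mat_vec[of _ r r _ r])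

text \<open>With w = P^j v the form v' P^k v is w' w for k = 2j and w' P w for k = 2j + 1.\<close>

lemma psd_mat_pow:
  assumes "psd_mat r P"
  shows "psd_mat r (P ^\<^sub>m k)"
proof -
  note P = psd_matD[OF assms]
  have "0 \<le> scalar_prod v (P ^\<^sub>m k *\<^sub>v v)" if v: "v \<in> carrier_vec r" for v
  proof -
    have "k = k div 2 + k div 2 \<or> k = k div 2 + (Suc 0 + k div 2)" by presburger
    then obtain j where "k = j + j \<or> k = j + (Suc 0 + j)" by blast
    moreover define w where "w = P ^\<^sub>m j *\<^sub>v v"
    have w: "w \<in> carrier_vec r" unfolding w_def by (rule mult_mat_vec_carrier[OF P(4) v])
    have sym: "scalar_prod v (P ^\<^sub>m j *\<^sub>v u) = scalar_prod w u" if "u \<in> carrier_vec r" for u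
      using symmetric_scalar_prod[OF P(4) transpose_pow_mat[OF P(1,2)] v that] by (simp add: w_def)
    ultimately show ?thesis
    proof (elim disjE)
      assume k: "k = j + j"
      have "scalar_prod v (P ^\<^sub>m k *\<^sub>v v) = scalar_prod w w"
        unfolding k by (subst pow_mat_mult_vec[OF P(1) v], subst sym) (use w in \<open>auto simp: w_def\<close>)
      then show ?thesis using scalar_prod_ge_0_real by simp
    next
      assume k: "k = j + (Suc 0 + j)"
      have c: "P ^\<^sub>m (Suc 0 + j) *\<^sub>v v = P *\<^sub>v w"
        by (subst pow_mat_mult_vec[OF P(1) v]) (simp add: w_def pow_mat_1[OF P(1)] del: pow_mat.simps)
      have "scalar_prod v (P ^\<^sub>m k *\<^sub>v v) = scalar_prod w (P *\<^sub>v w)"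
        unfolding k by (subst pow_mat_mult_vec[OF P(1) v], subst c, subst sym) (use w P in auto)
      then show ?thesis using P(5)[OF w] by simp
    qed
  qed
  then show ?thesis using P transpose_pow_mat[OF P(1,2)] unfolding psd_mat_def by auto
qed

lemma quadratic_sum:
  assumes "(A :: real mat) \<in> carrier_mat r r" "v \<in> carrier_vec r" "w \<in> carrier_vec r"
  shows "scalar_prod v (A *\<^sub>v w) = (\<Sum>i<r. \<Sum>j<r. v $ i * A $$ (i, j) * w $ j)"
  using assms
  by (auto simp: scalar_prod_def atLeast0LessThan sum_distrib_left mult.assoc intro!: sum.cong)

text \<open>Expanding 0 \<le> u' A u for u = K v - A v and using w' A w \<le> K w' w at w = A v
  gives w' w \<le> K v' A v. This passes from A \<le> K to A^2 \<le> K^2 without diagonalizing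
  A.\<close>

lemma psd_bound:
  assumes psd: "psd_mat r A" and K: "K > 0"
    and le: "\<And>v. v \<in> carrier_vec r \<Longrightarrow> scalar_prod v (A *\<^sub>v v) \<le> K * scalar_prod v v"
    and v: "v \<in> carrier_vec r"
  shows "scalar_prod (A *\<^sub>v v) (A *\<^sub>v v) \<le> K * (K * scalar_prod v v)"
proof -
  note A = psd_matD[OF psd]
  define w where "w = A *\<^sub>v v"
  have w: "w \<in> carrier_vec r" using A v by (auto simp: w_def)
  define u where "u = K \<cdot>\<^sub>v v - w"
  have u: "u \<in> carrier_vec r" using v w by (auto simp: u_def)
  have Au: "A *\<^sub>v u = K \<cdot>\<^sub>v w - A *\<^sub>v w"
    unfolding u_def using A v w by (simp add: mult_minus_distrib_mat_vec[of _ r r] mult_mat_vec[of _ r r] w_def)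
  have e1: "scalar_prod v (A *\<^sub>v w) = scalar_prod w w"
    using symmetric_scalar_prod[OF A(1,2) v w] by (simp add: w_def)
  have Aw: "A *\<^sub>v w \<in> carrier_vec r" using A w by auto
  have "0 \<le> scalar_prod u (A *\<^sub>v u)" using A(5)[OF u] .
  also have "\<dots> = K * K * scalar_prod v w - 2 * K * scalar_prod w w + scalar_prod w (A *\<^sub>v w)"
  proof -
    have "scalar_prod u (A *\<^sub>v u) = scalar_prod (K \<cdot>\<^sub>v v) (A *\<^sub>v u) - scalar_prod w (A *\<^sub>v u)"
      unfolding u_def using v w A by (intro minus_scalar_prod_distrib[of _ r]) auto
    also have "scalar_prod (K \<cdot>\<^sub>v v) (A *\<^sub>v u) = K * (K * scalar_prod v w - scalar_prod w w)"
      unfolding Au using v w Aw e1 by (simp add: scalar_prod_minus_distrib[of _ r] right_diff_distrib)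
    also have "scalar_prod w (A *\<^sub>v u) = K * scalar_prod w w - scalar_prod w (A *\<^sub>v w)"
      unfolding Au using v w Aw e1 by (simp add: scalar_prod_minus_distrib[of _ r] right_diff_distrib)
    finally show ?thesis by (simp add: algebra_simps)
  qed
  also have "\<dots> \<le> K * K * scalar_prod v w - 2 * K * scalar_prod w w + K * scalar_prod w w"
    using le[OF w] by simp
  finally have "K * scalar_prod w w \<le> K * (K * scalar_prod v w)" by (simp add: algebra_simps)
  then have "scalar_prod w w \<le> K * scalar_prod v w" using K by simp
  also have "\<dots> \<le> K * (K * scalar_prod v v)" using le[OF v] K by (simp add: w_def)
  finally show ?thesis by (simp add: w_def)
qed

section \<open>Square roots\<close>

text \<open>The polynomials in A with non-negative coefficients. This cone is closed under products
  and consists of positive semidefinite matrices if A is one; the iterates below and their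
  increments stay in it, which yields their monotonicity.\<close>

inductive npow :: "nat \<Rightarrow> real mat \<Rightarrow> real mat \<Rightarrow> bool" for r A where
  zero: "npow r A (0\<^sub>m r r)"
| add_pow: "npow r A B \<Longrightarrow> c \<ge> 0 \<Longrightarrow> npow r A (c \<cdot>\<^sub>m A ^\<^sub>m k + B)"

context
  fixes r :: nat and A :: "real mat"
  assumes A: "A \<in> carrier_mat r r"
begin

lemma npow_carrier: "npow r A B \<Longrightarrow> B \<in> carrier_mat r r"
  by (induction rule: npow.induct) (use A in auto)

lemma npow_add: "npow r A B \<Longrightarrow> npow r A C \<Longrightarrow> npow r A (B + C)"
proof (induction rule: npow.induct)
  case zero
  then show ?case using npow_carrier[of C] by simp
next
  case (add_pow B c k)
  have "c \<cdot>\<^sub>m A ^\<^sub>m k + B + C = c \<cdot>\<^sub>m A ^\<^sub>m k + (B + C)"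
    by (rule assoc_add_mat[of _ r r]) (use A npow_carrier add_pow in auto)
  then show ?case using npow.add_pow[OF add_pow.IH[OF add_pow.prems] add_pow.hyps(2)] by simp
qed

lemma npow_pow: "npow r A (A ^\<^sub>m k)"
proof -
  have "npow r A (1 \<cdot>\<^sub>m A ^\<^sub>m k + 0\<^sub>m r r)" by (intro npow.intros) auto
  moreover have "1 \<cdot>\<^sub>m A ^\<^sub>m k + 0\<^sub>m r r = A ^\<^sub>m k" using A by (auto intro!: eq_matI)
  ultimately show ?thesis by simp
qed

lemma npow_smult: "npow r A B \<Longrightarrow> a \<ge> 0 \<Longrightarrow> npow r A (a \<cdot>\<^sub>m B)"
proof (induction rule: npow.induct)
  case zero
  have "a \<cdot>\<^sub>m 0\<^sub>m r r = 0\<^sub>m r r" by auto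
  then show ?case using npow.zero by simp
next
  case (add_pow B c k)
  have "a \<cdot>\<^sub>m (c \<cdot>\<^sub>m A ^\<^sub>m k + B) = (a * c) \<cdot>\<^sub>m A ^\<^sub>m k + a \<cdot>\<^sub>m B"
    using npow_carrier[OF add_pow.hyps(1)] A by (auto intro!: eq_matI simp: distrib_left)
  then show ?case using npow.add_pow[OF add_pow.IH, of "a * c" k] add_pow by simp
qed

lemma npow_pow_mult: "npow r A B \<Longrightarrow> npow r A (A ^\<^sub>m i * B)"
proof (induction rule: npow.induct)
  case zero
  have "A ^\<^sub>m i * 0\<^sub>m r r = 0\<^sub>m r r" using A by (intro right_mult_zero_mat[of _ r]) auto
  then show ?case using npow.zero by simp
next
  case (add_pow B c k)
  have B: "B \<in> carrier_mat r r" using npow_carrier add_pow by auto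
  have "A ^\<^sub>m i * (c \<cdot>\<^sub>m A ^\<^sub>m k + B) = c \<cdot>\<^sub>m A ^\<^sub>m (i + k) + A ^\<^sub>m i * B"
    using B A by (simp add: mult_add_distrib_mat[of _ r r _ r] pow_mat_add[OF A]
        mult_smult_distrib[of _ r r _ r])
  then show ?case using npow.add_pow[OF add_pow.IH add_pow.hyps(2)] by simp
qed

lemma npow_mult: "npow r A B \<Longrightarrow> npow r A C \<Longrightarrow> npow r A (B * C)"
proof (induction rule: npow.induct)
  case zero
  have "0\<^sub>m r r * C = 0\<^sub>m r r" using npow_carrier[OF zero] by (intro left_mult_zero_mat) auto
  then show ?case using npow.zero by simp
next
  case (add_pow B c k)
  have BC: "B \<in> carrier_mat r r" "C \<in> carrier_mat r r" using npow_carrier add_pow by auto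
  have "(c \<cdot>\<^sub>m A ^\<^sub>m k + B) * C = c \<cdot>\<^sub>m (A ^\<^sub>m k * C) + B * C"
    using BC A by (simp add: add_mult_distrib_mat[of _ r r _ _ r] mult_smult_assoc_mat[of _ r r _ r])
  then show ?case using npow_add npow_smult npow_pow_mult add_pow by simp
qed

lemma npow_psd: "npow r A B \<Longrightarrow> psd_mat r A \<Longrightarrow> psd_mat r B"
proof (induction rule: npow.induct)
  case zero
  then show ?case by (auto simp: psd_mat_def scalar_prod_def)
next
  case (add_pow B c k)
  have B: "psd_mat r B" using add_pow by auto
  note p = psd_mat_pow[OF add_pow.prems, of k]
  have "0 \<le> scalar_prod v ((c \<cdot>\<^sub>m A ^\<^sub>m k + B) *\<^sub>v v)" if v: "v \<in> carrier_vec r" for v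
  proof -
    have "(c \<cdot>\<^sub>m A ^\<^sub>m k + B) *\<^sub>v v = c \<cdot>\<^sub>v (A ^\<^sub>m k *\<^sub>v v) + B *\<^sub>v v"
      using psd_matD[OF B] A v by (simp add: add_mult_distrib_mat_vec[of _ r r] smult_mat_vec[of _ r r])
    then have "scalar_prod v ((c \<cdot>\<^sub>m A ^\<^sub>m k + B) *\<^sub>v v) 
        = c * scalar_prod v (A ^\<^sub>m k *\<^sub>v v) + scalar_prod v (B *\<^sub>v v)"
      using psd_matD(1)[OF B] mult_mat_vec_carrier[OF psd_matD(1)[OF p] v] v by (simp add: scalar_prod_add_distrib[of _ r])
    then show ?thesis using psd_matD(5)[OF B v] psd_matD(5)[OF p v] add_pow by simp
  qed
  moreover have "transpose_mat (c \<cdot>\<^sub>m A ^\<^sub>m k + B) = c \<cdot>\<^sub>m A ^\<^sub>m k + B"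
  proof -
    have "transpose_mat (c \<cdot>\<^sub>m A ^\<^sub>m k + B) = c \<cdot>\<^sub>m transpose_mat (A ^\<^sub>m k) + transpose_mat B"
      using psd_matD(1)[OF B] A by (auto intro!: eq_matI)
    then show ?thesis using psd_matD(2)[OF p] psd_matD(2)[OF B] by simp
  qed
  ultimately show ?case using psd_matD[OF B] A unfolding psd_mat_def by auto
qed

end

text \<open>A fixed point Y of this iteration satisfies (1 - Y)^2 = 1 - A, so 1 - Y is a square root
  of 1 - A.\<close>

primrec sqrt_iter :: "nat \<Rightarrow> real mat \<Rightarrow> nat \<Rightarrow> real mat" where
  "sqrt_iter r A 0 = 0\<^sub>m r r"
| "sqrt_iter r A (Suc n) = (1 / 2) \<cdot>\<^sub>m (A + sqrt_iter r A n * sqrt_iter r A n)"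

lemma sqrt_iter_npow:
  assumes A: "A \<in> carrier_mat r r"
  shows "npow r A (sqrt_iter r A n)"
proof (induction n)
  case 0
  show ?case by (simp add: npow.zero)
next
  case (Suc n)
  have "npow r A A" using npow_pow[OF A, of "Suc 0"] pow_mat_1[OF A] by metis
  then show ?case using npow_smult[OF A] npow_add[OF A] npow_mult[OF A] Suc by simp
qed

text \<open>If Y is one iterate and Y + D the next, the following increment is (Y D + D Y + D^2) /
  2. No subtraction is left, so its coefficients are non-negative whenever those of Y and D
  are.\<close>

lemma sqrt_iter_diff:
  assumes A: "A \<in> carrier_mat r r"
  shows "npow r A (sqrt_iter r A (Suc n) - sqrt_iter r A n)"
proof (induction n)
  case 0
  have "sqrt_iter r A (Suc 0) - sqrt_iter r A 0 = (1 / 2) \<cdot>\<^sub>m A ^\<^sub>m Suc 0"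
    using A by (auto intro!: eq_matI)
  then show ?case using npow_smult[OF A npow_pow[OF A, of "Suc 0"], of "1/2"] by simp
next
  case (Suc n)
  define Y D where "Y = sqrt_iter r A n" and "D = sqrt_iter r A (Suc n) - Y"
  have np: "npow r A Y" "npow r A D" using sqrt_iter_npow[OF A] Suc by (auto simp: Y_def D_def)
  have c: "Y \<in> carrier_mat r r" "D \<in> carrier_mat r r" using np npow_carrier[OF A] by auto
  have S: "sqrt_iter r A (Suc n) = Y + D"
    using c npow_carrier[OF A sqrt_iter_npow[OF A]] by (auto simp: D_def Y_def intro!: eq_matI)
  have e: "(Y + D) * (Y + D) = Y * Y + (Y * D + (D * Y + D * D))"
  proof -
    have "(Y + D) * (Y + D) = Y * (Y + D) + D * (Y + D)" 
      using c by (intro add_mult_distrib_mat) auto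
    also have "Y * (Y + D) = Y * Y + Y * D" using c by (intro mult_add_distrib_mat) auto
    also have "D * (Y + D) = D * Y + D * D" using c by (intro mult_add_distrib_mat) auto
    also have "Y * Y + Y * D + (D * Y + D * D) = Y * Y + (Y * D + (D * Y + D * D))"
      using c by (intro assoc_add_mat) auto
    finally show ?thesis .
  qed
  have "sqrt_iter r A (Suc (Suc n)) = (1 / 2) \<cdot>\<^sub>m (A + (Y + D) * (Y + D))" 
    by (subst sqrt_iter.simps(2), subst S, subst S) (rule refl)
  moreover have "sqrt_iter r A (Suc n) = (1 / 2) \<cdot>\<^sub>m (A + Y * Y)" by (simp add: Y_def)
  ultimately have "sqrt_iter r A (Suc (Suc n)) - sqrt_iter r A (Suc n) 
      = (1 / 2) \<cdot>\<^sub>m (A + (Y * Y + (Y * D + (D * Y + D * D)))) - (1 / 2) \<cdot>\<^sub>m (A + Y * Y)"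
    unfolding e by presburger
  also have "\<dots> = (1 / 2) \<cdot>\<^sub>m (Y * D + (D * Y + D * D))"
  proof -
    have "(1 / 2) \<cdot>\<^sub>m (A + (U + V)) - (1 / 2) \<cdot>\<^sub>m (A + U) = (1 / 2) \<cdot>\<^sub>m V"
      if "U \<in> carrier_mat r r" "V \<in> carrier_mat r r" for U V
      using that A by (intro eq_matI) (auto simp: field_simps)
    moreover have "Y * Y \<in> carrier_mat r r" "Y * D + (D * Y + D * D) \<in> carrier_mat r r" using c by auto
    ultimately show ?thesis by blast
  qed
  finally have "sqrt_iter r A (Suc (Suc n)) - sqrt_iter r A (Suc n) = (1 / 2) \<cdot>\<^sub>m (Y * D + (D * Y + D * D))" .
  moreover have "npow r A \<dots>"
    using npow_smult[OF A] npow_add[OF A] npow_mult[OF A] np by simp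
  ultimately show ?case by metis
qed

lemma norm_half_sum:
  assumes "(a :: real vec) \<in> carrier_vec r" "b \<in> carrier_vec r"
  shows "scalar_prod ((1 / 2) \<cdot>\<^sub>v (a + b)) ((1 / 2) \<cdot>\<^sub>v (a + b)) \<le> (scalar_prod a a + scalar_prod b b) / 2"
proof -
  have "(\<Sum>i<r. ((1 / 2) * (a $ i + b $ i)) * ((1 / 2) * (a $ i + b $ i))) 
      \<le> (\<Sum>i<r. (a $ i * a $ i + b $ i * b $ i) / 2)"
  proof (rule sum_mono)
    fix i
    have "0 \<le> (a $ i - b $ i)\<^sup>2" by simp
    then show "((1 / 2) * (a $ i + b $ i)) * ((1 / 2) * (a $ i + b $ i)) \<le> (a $ i * a $ i + b $ i * b $ i) / 2"
      by (simp add: power2_eq_square field_simps)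
  qed
  then show ?thesis using assms
    by (simp add: scalar_prod_def atLeast0LessThan sum.distrib sum_divide_distrib[symmetric])
qed

lemma scalar_prod_le_half:
  assumes "(a :: real vec) \<in> carrier_vec r" "b \<in> carrier_vec r"
  shows "scalar_prod a b \<le> (scalar_prod a a + scalar_prod b b) / 2"
proof -
  have "(\<Sum>i<r. a $ i * b $ i) \<le> (\<Sum>i<r. (a $ i * a $ i + b $ i * b $ i) / 2)"
  proof (rule sum_mono)
    fix i
    have "0 \<le> (a $ i - b $ i)\<^sup>2" by simp
    then show "a $ i * b $ i \<le> (a $ i * a $ i + b $ i * b $ i) / 2"
      by (simp add: power2_eq_square field_simps)
  qed
  then show ?thesis using assms
    by (simp add: scalar_prod_def atLeast0LessThan sum.distrib sum_divide_distrib[symmetric])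
qed

text \<open>The squared norm is convex, and an iterate is the average of A and the square of the
  previous iterate, hence an average of two contractions.\<close>

lemma sqrt_iter_contraction:
  assumes A: "A \<in> carrier_mat r r"
    and le: "\<And>v. v \<in> carrier_vec r \<Longrightarrow> scalar_prod (A *\<^sub>v v) (A *\<^sub>v v) \<le> scalar_prod v v"
    and v: "v \<in> carrier_vec r"
  shows "scalar_prod (sqrt_iter r A n *\<^sub>v v) (sqrt_iter r A n *\<^sub>v v) \<le> scalar_prod v v"
  using v
proof (induction n arbitrary: v)
  case 0
  moreover have "0\<^sub>m r r *\<^sub>v v = 0\<^sub>v r" using 0 by (intro eq_vecI) auto
  ultimately show ?case using scalar_prod_ge_0_real[of v] by simp
next
  case (Suc n)
  define Y where "Y = sqrt_iter r A n"
  have Y: "Y \<in> carrier_mat r r" using npow_carrier[OF A sqrt_iter_npow[OF A]] by (simp add: Y_def)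
  have Yv: "Y *\<^sub>v v \<in> carrier_vec r" using Y Suc by auto
  have "((1 / 2) \<cdot>\<^sub>m (A + Y * Y)) *\<^sub>v v = (1 / 2) \<cdot>\<^sub>v (A *\<^sub>v v + Y *\<^sub>v (Y *\<^sub>v v))"
    using A Y Suc.prems by (simp add: smult_mat_vec[of _ r r] add_mult_distrib_mat_vec[of _ r r]
        assoc_mult_mat_vec[of _ r r _ r])
  then have "scalar_prod (sqrt_iter r A (Suc n) *\<^sub>v v) (sqrt_iter r A (Suc n) *\<^sub>v v)
     \<le> (scalar_prod (A *\<^sub>v v) (A *\<^sub>v v) + scalar_prod (Y *\<^sub>v (Y *\<^sub>v v)) (Y *\<^sub>v (Y *\<^sub>v v))) / 2"
    using norm_half_sum[of "A *\<^sub>v v" r "Y *\<^sub>v (Y *\<^sub>v v)"] A Y Yv Suc.prems by (simp add: Y_def)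
  then show ?case 
    using le[OF Suc.prems] Suc.IH[OF Yv] Suc.IH[OF Suc.prems] by (simp add: Y_def)
qed

text \<open>The quadratic forms of the iterates increase and are bounded by v' v, so they converge;
  polarization turns this into convergence of all entries. The limit Z solves 2 Z = A + Z^2, and Z
  \<le> 1 makes 1 - Z positive semidefinite.\<close>

lemma psd_sqrt_exists_contraction:
  assumes psd: "psd_mat r A"
    and le: "\<And>v. v \<in> carrier_vec r \<Longrightarrow> scalar_prod (A *\<^sub>v v) (A *\<^sub>v v) \<le> scalar_prod v v"
  shows "\<exists>S. psd_mat r S \<and> S * S = 1\<^sub>m r - A"
proof -
  note A = psd_matD[OF psd]
  define Y where "Y = sqrt_iter r A"
  have Ypsd: "psd_mat r (Y n)" for n using npow_psd[OF A(1) sqrt_iter_npow[OF A(1)] psd] by (simp add: Y_def)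
  note Yc = psd_matD(1)[OF Ypsd]
  have Ysym: "Y n $$ (i, j) = Y n $$ (j, i)" if "i < r" "j < r" for n i j
    using psd_matD(2)[OF Ypsd[of n]] Yc[of n] that by (metis carrier_matD index_transpose_mat(1))
  define q where "q v n = scalar_prod v (Y n *\<^sub>v v)" for v n
  have qle: "q v n \<le> scalar_prod v v" if v: "v \<in> carrier_vec r" for v n
    using scalar_prod_le_half[OF v, of "Y n *\<^sub>v v"] sqrt_iter_contraction[OF A(1) le v, of n] Yc[of n] v
    by (auto simp: q_def Y_def)
  have conv_q: "convergent (q v)" if v: "v \<in> carrier_vec r" for v
  proof -
    have "q v n \<le> q v (Suc n)" for n
    proof -
      have "0 \<le> scalar_prod v ((Y (Suc n) - Y n) *\<^sub>v v)"
        using psd_matD(5)[OF npow_psd[OF A(1) sqrt_iter_diff[OF A(1)] psd] v] by (simp add: Y_def)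
      also have "\<dots> = q v (Suc n) - q v n"
        using Yc[of n] Yc[of "Suc n"] v
        by (simp add: minus_mult_distrib_mat_vec[of _ r r] scalar_prod_minus_distrib[of _ r] q_def)
      finally show ?thesis by simp
    qed
    then have "incseq (q v)" by (rule incseq_SucI)
    then obtain L where "q v \<longlonglongrightarrow> L" using incseq_convergent[of "q v" "scalar_prod v v"] qle[OF v] by blast
    then show ?thesis by (rule convergentI)
  qed
  have conv: "convergent (\<lambda>n. Y n $$ (i, j))" if ij: "i < r" "j < r" for i j
  proof -
    let ?e = "unit_vec r :: nat \<Rightarrow> real vec"
    have b: "scalar_prod (?e a) (Y n *\<^sub>v ?e b) = Y n $$ (a, b)" if "a < r" "b < r" for a b n
      using Yc[of n] that by (simp add: scalar_prod_left_unit[of _ r])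
    have e: "Y n $$ (i, j) = (q (?e i + ?e j) n - q (?e i) n - q (?e j) n) * (1 / 2)" for n
      unfolding q_def using Yc[of n] ij b[of i j n] b[of j i n] Ysym[of i j n]
      by (simp add: mult_add_distrib_mat_vec[of _ r r] scalar_prod_add_distrib[of _ r]
          add_scalar_prod_distrib[of _ r])
    have c: "convergent (\<lambda>n. (q (?e i + ?e j) n - q (?e i) n - q (?e j) n) * (1 / 2))"
      by (intro convergent_mult convergent_const convergent_diff conv_q) auto
    show ?thesis unfolding e by (rule c)
  qed
  define Z where "Z = mat r r (\<lambda>(i, j). lim (\<lambda>n. Y n $$ (i, j)))"
  have Zc: "Z \<in> carrier_mat r r" by (simp add: Z_def)
  have lim: "(\<lambda>n. Y n $$ (i, j)) \<longlonglongrightarrow> Z $$ (i, j)" if "i < r" "j < r" for i j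
    using conv[OF that] that by (simp add: Z_def convergent_LIMSEQ_iff)
  have Zeq: "Z $$ (i, j) = (A $$ (i, j) + (Z * Z) $$ (i, j)) / 2" if ij: "i < r" "j < r" for i j
  proof -
    have t: "(\<lambda>n. (A $$ (i, j) + (\<Sum>k<r. Y n $$ (i, k) * Y n $$ (k, j))) / 2) \<longlonglongrightarrow> 
        (A $$ (i, j) + (\<Sum>k<r. Z $$ (i, k) * Z $$ (k, j))) / 2"
      by (intro tendsto_intros lim) (use ij in auto)
    have e: "(A $$ (i, j) + (\<Sum>k<r. Y n $$ (i, k) * Y n $$ (k, j))) / 2 = Y (Suc n) $$ (i, j)" for n
    proof -
      have "((1 / 2) \<cdot>\<^sub>m (A + Q)) $$ (i, j) = (A $$ (i, j) + Q $$ (i, j)) / 2" if "Q \<in> carrier_mat r r" for Q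
        using ij A(1) that by simp
      moreover have "Y n * Y n \<in> carrier_mat r r" using Yc[of n] by simp
      ultimately have "Y (Suc n) $$ (i, j) = (A $$ (i, j) + (Y n * Y n) $$ (i, j)) / 2"
        by (simp add: Y_def)
      then show ?thesis using mult_mat_index[OF Yc[of n] Yc[of n] ij] by simp
    qed
    have "(\<lambda>n. Y (Suc n) $$ (i, j)) \<longlonglongrightarrow> Z $$ (i, j)"
      using LIMSEQ_Suc[OF lim[OF ij]] .
    then have "Z $$ (i, j) = (A $$ (i, j) + (\<Sum>k<r. Z $$ (i, k) * Z $$ (k, j))) / 2"
      using t unfolding e by (rule LIMSEQ_unique)
    then show ?thesis using mult_mat_index[OF Zc Zc ij] by simp
  qed
  define S where "S = 1\<^sub>m r - Z"
  have Sc: "S \<in> carrier_mat r r" unfolding S_def using Zc by (intro minus_carrier_mat)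
  have "S * S = 1\<^sub>m r - A"
  proof (rule eq_matI)
    fix i j assume "i < dim_row (1\<^sub>m r - A)" "j < dim_col (1\<^sub>m r - A)"
    then have ij: "i < r" "j < r" using A by auto
    have "S * S = S - Z * S" unfolding S_def
      using Zc by (subst minus_mult_distrib_mat[of _ r r _ _ r]) auto
    also have "Z * S = Z - Z * Z" unfolding S_def
      using Zc by (subst mult_minus_distrib_mat[of _ r r _ r]) auto
    finally have "(S * S) $$ (i, j) = S $$ (i, j) - (Z $$ (i, j) - (Z * Z) $$ (i, j))"
      using ij Zc Sc by simp
    moreover have "S $$ (i, j) = 1\<^sub>m r $$ (i, j) - Z $$ (i, j)" using ij Zc by (simp add: S_def)
    moreover have "(1\<^sub>m r - A) $$ (i, j) = 1\<^sub>m r $$ (i, j) - A $$ (i, j)" using ij A(1) by simp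
    moreover have "s = m" if "s = a - (z - w)" "a = e - z" "m = e - x" "z = (x + w) / 2" for s a z w e m x :: real
      using that by (simp add: add_divide_distrib diff_divide_distrib)
    ultimately show "(S * S) $$ (i, j) = (1\<^sub>m r - A) $$ (i, j)" using Zeq[OF ij] by blast
  qed (use Sc A in auto)
  moreover have "psd_mat r S"
    unfolding psd_mat_def
  proof (intro conjI ballI)
    have "Z $$ (i, j) = Z $$ (j, i)" if "i < r" "j < r" for i j
      using LIMSEQ_unique[OF lim[OF that]] lim[OF that(2,1)] Ysym[OF that] by simp
    then show "transpose_mat S = S" using Zc unfolding S_def by (auto intro!: eq_matI)
    fix v :: "real vec" assume v: "v \<in> carrier_vec r"
    have "(\<lambda>n. \<Sum>i<r. \<Sum>j<r. v $ i * Y n $$ (i, j) * v $ j) \<longlonglongrightarrow> (\<Sum>i<r. \<Sum>j<r. v $ i * Z $$ (i, j) * v $ j)"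
      by (intro tendsto_intros lim) auto
    then have "q v \<longlonglongrightarrow> scalar_prod v (Z *\<^sub>v v)"
      using quadratic_sum[OF Yc v v] quadratic_sum[OF Zc v v] by (simp add: q_def[abs_def])
    then have "scalar_prod v (Z *\<^sub>v v) \<le> scalar_prod v v"
      by (rule LIMSEQ_le_const2) (use qle[OF v] in auto)
    then show "0 \<le> scalar_prod v (S *\<^sub>v v)"
      using v Zc unfolding S_def
      by (simp add: minus_mult_distrib_mat_vec[of _ r r] scalar_prod_minus_distrib[of _ r])
  qed (rule Sc)
  ultimately show ?thesis by blast
qed

text \<open>The iteration wants a matrix between 0 and 1, so it is applied to 1 - P / c, and the
  root of P / c is rescaled by sqrt c. Existence is what gives the choice in \<open>psd_sqrt\<close>
  its meaning.\<close>

lemma psd_sqrt: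
  assumes psd: "psd_mat r P"
  shows "psd_mat r (psd_sqrt P)" "psd_sqrt P * psd_sqrt P = P"
proof -
  note P = psd_matD[OF psd]
  \<comment> \<open>\<open>c\<close> bounds the quadratic form of P because |v_i v_j| \<le> v' v;
    the summand 1 keeps it positive, so that 0 \<le> 1 - P / c \<le> 1.\<close>
  define c where "c = 1 + (\<Sum>i<r. \<Sum>j<r. \<bar>P $$ (i, j)\<bar>)"
  have c: "c \<ge> 1" unfolding c_def by (simp add: sum_nonneg)
  have Pc: "scalar_prod v (P *\<^sub>v v) \<le> c * scalar_prod v v" if v: "v \<in> carrier_vec r" for v
  proof -
    have sq: "\<bar>v $ i * v $ j\<bar> \<le> scalar_prod v v" if "i < r" "j < r" for i j
    proof -
      have "(v $ k)\<^sup>2 \<le> scalar_prod v v" if "k < r" for k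
        using v that member_le_sum[of k "{0..<r}" "\<lambda>i. v $ i * v $ i"]
        by (simp add: scalar_prod_def power2_eq_square)
      from this[OF that(1)] this[OF that(2)] have "(v $ i)\<^sup>2 + (v $ j)\<^sup>2 \<le> 2 * scalar_prod v v" by simp
      moreover have "0 \<le> (\<bar>v $ i\<bar> - \<bar>v $ j\<bar>)\<^sup>2" by simp
      ultimately show ?thesis by (simp add: power2_diff abs_mult)
    qed
    have "scalar_prod v (P *\<^sub>v v) \<le> (\<Sum>i<r. \<Sum>j<r. \<bar>P $$ (i, j)\<bar> * scalar_prod v v)"
      unfolding quadratic_sum[OF P(1) v v]
    proof (intro sum_mono)
      fix i j assume "i \<in> {..<r}" "j \<in> {..<r}"
      then have "\<bar>P $$ (i, j)\<bar> * \<bar>v $ i * v $ j\<bar> \<le> \<bar>P $$ (i, j)\<bar> * scalar_prod v v"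
        using sq by (intro mult_left_mono) auto
      moreover have "v $ i * P $$ (i, j) * v $ j \<le> \<bar>P $$ (i, j)\<bar> * \<bar>v $ i * v $ j\<bar>"
        by (simp add: abs_mult[symmetric] mult.commute mult.left_commute)
      ultimately show "v $ i * P $$ (i, j) * v $ j \<le> \<bar>P $$ (i, j)\<bar> * scalar_prod v v" by linarith
    qed
    also have "\<dots> \<le> c * scalar_prod v v"
      using scalar_prod_ge_0_real[of v] by (simp add: c_def sum_distrib_right[symmetric] distrib_right)
    finally show ?thesis .
  qed
  define A where "A = 1\<^sub>m r - (1 / c) \<cdot>\<^sub>m P"
  have Av: "A *\<^sub>v v = v - (1 / c) \<cdot>\<^sub>v (P *\<^sub>v v)" if "v \<in> carrier_vec r" for v
    unfolding A_def using P that by (simp add: minus_mult_distrib_mat_vec[of _ r r] smult_mat_vec[of _ r r])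
  have q: "scalar_prod v (A *\<^sub>v v) = scalar_prod v v - scalar_prod v (P *\<^sub>v v) / c" if v: "v \<in> carrier_vec r" for v
    unfolding Av[OF v] using v P by (simp add: scalar_prod_minus_distrib[of _ r])
  have A: "psd_mat r A"
    unfolding psd_mat_def
  proof (intro conjI ballI)
    show "A \<in> carrier_mat r r" using P(1) unfolding A_def by (intro minus_carrier_mat) auto
    have "P $$ (i, j) = P $$ (j, i)" if "i < r" "j < r" for i j
      using P(1,2) that by (metis carrier_matD index_transpose_mat(1))
    then show "transpose_mat A = A" using P unfolding A_def by (auto intro!: eq_matI)
    fix v :: "real vec" assume "v \<in> carrier_vec r"
    then have "scalar_prod v (P *\<^sub>v v) / c \<le> scalar_prod v v" "scalar_prod v (A *\<^sub>v v) = scalar_prod v v - scalar_prod v (P *\<^sub>v v) / c"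
      using Pc[of v] c q[of v] by (simp_all add: divide_le_eq mult.commute)
    then show "0 \<le> scalar_prod v (A *\<^sub>v v)" by simp
  qed
  have "scalar_prod (A *\<^sub>v v) (A *\<^sub>v v) \<le> scalar_prod v v" if v: "v \<in> carrier_vec r" for v
    using psd_bound[OF A, of 1 v] q P(5) v c by simp
  then obtain S where S: "psd_mat r S" "S * S = 1\<^sub>m r - A"
    using psd_sqrt_exists_contraction[OF A] by blast
  have "psd_mat r (sqrt c \<cdot>\<^sub>m S)"
    unfolding psd_mat_def
  proof (intro conjI ballI)
    show "sqrt c \<cdot>\<^sub>m S \<in> carrier_mat r r" using psd_matD[OF S(1)] by simp
    have "S $$ (i, j) = S $$ (j, i)" if "i < r" "j < r" for i j
      using psd_matD(1,2)[OF S(1)] that by (metis carrier_matD index_transpose_mat(1))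
    then show "transpose_mat (sqrt c \<cdot>\<^sub>m S) = sqrt c \<cdot>\<^sub>m S" using psd_matD(1)[OF S(1)] by (auto intro!: eq_matI)
    fix v :: "real vec" assume "v \<in> carrier_vec r"
    then show "0 \<le> scalar_prod v (sqrt c \<cdot>\<^sub>m S *\<^sub>v v)" using psd_matD[OF S(1)] c
      by (simp add: smult_mat_vec[of _ r r])
  qed
  moreover have "(sqrt c \<cdot>\<^sub>m S) * (sqrt c \<cdot>\<^sub>m S) = P"
  proof -
    have "(sqrt c \<cdot>\<^sub>m S) * (sqrt c \<cdot>\<^sub>m S) = sqrt c \<cdot>\<^sub>m (sqrt c \<cdot>\<^sub>m (S * S))"
      using psd_matD(1)[OF S(1)] by (simp add: mult_smult_distrib[of _ r r _ r] mult_smult_assoc_mat[of _ r r _ r])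
    also have "\<dots> = P" unfolding S(2) using P(1) c
      by (auto intro!: eq_matI simp: A_def mult.assoc[symmetric])
    finally show ?thesis .
  qed
  ultimately have "\<exists>S. psd_mat (dim_row P) S \<and> S * S = P" using P(3) by auto
  then have "psd_mat (dim_row P) (psd_sqrt P) \<and> psd_sqrt P * psd_sqrt P = P"
    unfolding psd_sqrt_def by (rule someI_ex)
  then show "psd_mat r (psd_sqrt P)" "psd_sqrt P * psd_sqrt P = P" using P(3) by auto
qed

section \<open>Bounds and vanishing of powers\<close>

lemma pow_mat_bound:
  assumes psd: "psd_mat r P" and K: "K > 0"
    and le: "\<And>v. v \<in> carrier_vec r \<Longrightarrow> scalar_prod v (P *\<^sub>v v) \<le> K * scalar_prod v v"
    and v: "v \<in> carrier_vec r"
  shows "scalar_prod (P ^\<^sub>m k *\<^sub>v v) (P ^\<^sub>m k *\<^sub>v v) \<le> (K ^ k)\<^sup>2 * scalar_prod v v"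
  using v
proof (induction k arbitrary: v)
  case 0
  then show ?case using psd_matD(3)[OF psd] by simp
next
  case (Suc k)
  note P = psd_matD[OF psd]
  have Pv: "P *\<^sub>v v \<in> carrier_vec r" using P Suc.prems by auto
  have "P ^\<^sub>m Suc k *\<^sub>v v = P ^\<^sub>m k *\<^sub>v (P *\<^sub>v v)"
    using assoc_mult_mat_vec[OF P(4) P(1) Suc.prems] by simp
  then have "scalar_prod (P ^\<^sub>m Suc k *\<^sub>v v) (P ^\<^sub>m Suc k *\<^sub>v v) \<le> (K ^ k)\<^sup>2 * scalar_prod (P *\<^sub>v v) (P *\<^sub>v v)"
    using Suc.IH[OF Pv] by simp
  also have "\<dots> \<le> (K ^ k)\<^sup>2 * (K * (K * scalar_prod v v))"
    using psd_bound[OF psd K le Suc.prems] by (intro mult_left_mono) auto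
  finally show ?case by (simp add: power2_eq_square algebra_simps)
qed

text \<open>The constant comes from v' w \<le> (v' v + w' w) / 2 with w = P^k v and the bound K^(2k)
  v' v for w' w; what matters is that it depends on K and k only.\<close>

lemma pow_mat_form_bound:
  assumes psd: "psd_mat r P" and K: "K > 0"
    and le: "\<And>v. v \<in> carrier_vec r \<Longrightarrow> scalar_prod v (P *\<^sub>v v) \<le> K * scalar_prod v v"
    and v: "v \<in> carrier_vec r"
  shows "\<bar>scalar_prod v (P ^\<^sub>m k *\<^sub>v v)\<bar> \<le> (1 + (K ^ k)\<^sup>2) * scalar_prod v v"
proof -
  note P = psd_matD[OF psd]
  have Pv: "P ^\<^sub>m k *\<^sub>v v \<in> carrier_vec r" using P(4) v by (intro mult_mat_vec_carrier)
  have "0 \<le> scalar_prod v (P ^\<^sub>m k *\<^sub>v v)" using psd_matD(5)[OF psd_mat_pow[OF psd] v] .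
  moreover have "scalar_prod v (P ^\<^sub>m k *\<^sub>v v) \<le> (scalar_prod v v + (K ^ k)\<^sup>2 * scalar_prod v v) / 2"
    using scalar_prod_le_half[OF v Pv] pow_mat_bound[OF psd K le v, of k] by simp
  moreover have "0 \<le> (K ^ k)\<^sup>2 * scalar_prod v v" using scalar_prod_ge_0_real[of v] by simp
  ultimately show ?thesis using scalar_prod_ge_0_real[of v] by (simp add: algebra_simps)
qed

text \<open>The trace of S^2 is the sum of the squared entries of a symmetric root S.\<close>

lemma psd_trace_0:
  assumes psd: "psd_mat r A" and tr: "mtrace A = 0"
  shows "A = 0\<^sub>m r r"
proof -
  note A = psd_matD[OF psd]
  obtain S where S: "psd_mat r S" "S * S = A" using psd_sqrt[OF psd] by blast
  note Sc = psd_matD(1)[OF S(1)]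
  have sym: "S $$ (i, j) = S $$ (j, i)" if "i < r" "j < r" for i j
    using psd_matD(1,2)[OF S(1)] that by (metis carrier_matD index_transpose_mat(1))
  have "mtrace A = (\<Sum>i<r. \<Sum>j<r. (S $$ (i, j))\<^sup>2)"
    unfolding mtrace_def A(3) 
  proof (intro sum.cong refl)
    fix i assume "i \<in> {..<r}"
    then show "A $$ (i, i) = (\<Sum>j<r. (S $$ (i, j))\<^sup>2)"
      using sym unfolding S(2)[symmetric] by (auto simp: mult_mat_index[OF Sc Sc] power2_eq_square intro!: sum.cong)
  qed
  then have "S $$ (i, j) = 0" if "i < r" "j < r" for i j
    using tr that by (simp add: sum_nonneg_eq_0_iff sum_nonneg)
  then have "S = 0\<^sub>m r r" using Sc by (auto intro!: eq_matI)
  then show ?thesis using S(2) by simp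
qed

text \<open>P^(2k) = P^(k-1) P^(k+1) vanishes, and its diagonal consists of sums of squared entries
  of P^k. This settles the summands of the leading term whose denominator Tr(P^(k+1)) is 0.\<close>

lemma psd_pow_Suc_0:
  assumes psd: "psd_mat r P" and k: "k \<ge> 1" and z: "P ^\<^sub>m (Suc k) = 0\<^sub>m r r"
  shows "P ^\<^sub>m k = 0\<^sub>m r r"
proof -
  note P = psd_matD[OF psd]
  have sym: "(P ^\<^sub>m k) $$ (i, j) = (P ^\<^sub>m k) $$ (j, i)" if "i < r" "j < r" for i j
    using transpose_pow_mat[OF P(1,2), of k] P(4)[of k] that by (metis carrier_matD index_transpose_mat(1))
  have "P ^\<^sub>m (k + k) = P ^\<^sub>m (k - 1) * P ^\<^sub>m Suc k"
    using pow_mat_add[OF P(1), of "k - 1" "Suc k"] k by (simp del: pow_mat.simps)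
  then have z2: "P ^\<^sub>m k * P ^\<^sub>m k = 0\<^sub>m r r" using z pow_mat_add[OF P(1), of k k] right_mult_zero_mat[OF P(4)[of "k - 1"], of r] by metis
  have "(P ^\<^sub>m k) $$ (i, j) = 0" if "i < r" "j < r" for i j
  proof -
    have "(\<Sum>j<r. ((P ^\<^sub>m k) $$ (i, j))\<^sup>2) = (P ^\<^sub>m k * P ^\<^sub>m k) $$ (i, i)"
      using sym that by (auto simp: mult_mat_index[OF P(4) P(4)] power2_eq_square intro!: sum.cong)
    also have "\<dots> = 0" using z2 that by simp
    finally show ?thesis using that by (simp add: sum_nonneg_eq_0_iff)
  qed
  then show ?thesis using P(4)[of k] by (auto intro!: eq_matI)
qed

section \<open>Polynomials in Gaussian variables\<close>

lemma prob_space_std_normal: "prob_space std_normal"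
  unfolding std_normal_def by (rule prob_space_normal_density) simp

lemma sets_std_normal [simp, measurable_cong]: "sets std_normal = sets borel"
  by (simp add: std_normal_def)

lemma integrable_std_normal_pow: "integrable std_normal (\<lambda>x. x ^ n)"
  unfolding std_normal_def
  by (subst integrable_real_density) (use integrable_std_normal_moment[of n] in auto)

lemma std_normal_pow_eq: "(\<integral>x. x ^ n \<partial>std_normal) = (\<integral>x. std_normal_density x * x ^ n \<partial>lborel)"
  unfolding std_normal_def by (subst integral_real_density) auto

text \<open>Integration by parts for powers, read off from the explicit moments. At n = 0 the
  truncated exponent is harmless because of the factor n.\<close>

lemma std_normal_moment_Suc:
  "(\<integral>x. x ^ Suc n \<partial>std_normal) = real n * (\<integral>x. x ^ (n - 1) \<partial>std_normal)"
proof (cases "even n")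
  case True
  then obtain k where k: "n = 2 * k" by (elim evenE)
  have "(\<integral>x. x ^ Suc n \<partial>std_normal) = 0"
    unfolding std_normal_pow_eq using integral_std_normal_moment_odd[of k] by (simp add: k)
  moreover have "real n * (\<integral>x. x ^ (n - 1) \<partial>std_normal) = 0"
  proof (cases k)
    case (Suc l)
    then have "n - 1 = 2 * l + 1" using k by simp
    then show ?thesis unfolding std_normal_pow_eq using integral_std_normal_moment_odd[of l] by simp
  qed (simp add: k)
  ultimately show ?thesis by simp
next
  case False
  then obtain k where k: "n = 2 * k + 1" by (elim oddE)
  have s: "Suc n = 2 * Suc k" "n - 1 = 2 * k" using k by auto
  have f: "fact (2 * Suc k) = (2 * real k + 2) * (2 * real k + 1) * (fact (2 * k) :: real)"
    by (simp add: algebra_simps)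
  have "fact (2 * Suc k) / (2 ^ Suc k * fact (Suc k)) = real n * (fact (2 * k) / (2 ^ k * fact k) :: real)"
    unfolding f by (simp add: k divide_simps) (simp add: algebra_simps)
  then show ?thesis
    unfolding std_normal_pow_eq s integral_std_normal_moment_even .
qed

section \<open>Monomials, polynomials and their gradients\<close>

definition mval :: "'a set \<Rightarrow> ('a \<Rightarrow> nat) \<Rightarrow> ('a \<Rightarrow> real) \<Rightarrow> real" where
  "mval A \<alpha> x = (\<Prod>a\<in>A. x a ^ \<alpha> a)"

text \<open>The partial derivative in coordinate b; where \<open>\<alpha> b\<close> is 0, the factor
  kills the truncated exponent.\<close>

definition dmval :: "'a set \<Rightarrow> 'a \<Rightarrow> ('a \<Rightarrow> nat) \<Rightarrow> ('a \<Rightarrow> real) \<Rightarrow> real" where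
  "dmval A b \<alpha> x = real (\<alpha> b) * mval A (\<alpha>(b := \<alpha> b - 1)) x"

lemma mval_split:
  assumes "finite A" "b \<in> A"
  shows "mval A \<alpha> x = x b ^ \<alpha> b * mval (A - {b}) \<alpha> x"
  using assms by (simp add: mval_def prod.remove)

lemma dmval_split:
  assumes "finite A" "b \<in> A"
  shows "dmval A b \<alpha> x = real (\<alpha> b) * x b ^ (\<alpha> b - 1) * mval (A - {b}) \<alpha> x"
  unfolding dmval_def mval_split[OF assms] by (simp add: mval_def)

lemma mval_add: "mval A (\<lambda>a. \<alpha> a + \<beta> a) x = mval A \<alpha> x * mval A \<beta> x"
  by (simp add: mval_def power_add prod.distrib)

lemma dmval_add:
  assumes "finite A" "b \<in> A"
  shows "dmval A b (\<lambda>a. \<alpha> a + \<beta> a) x = dmval A b \<alpha> x * mval A \<beta> x + mval A \<alpha> x * dmval A b \<beta> x"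
proof -
  have "real (i + j) * y ^ (i + j - 1) = real i * y ^ (i - 1) * y ^ j + y ^ i * (real j * y ^ (j - 1))" 
    for i j and y :: real
    by (cases i; cases j) (simp_all add: algebra_simps power_add)
  from this[of "\<alpha> b" "\<beta> b" "x b"] show ?thesis
    unfolding dmval_split[OF assms] mval_split[OF assms] mval_add by (simp add: algebra_simps)
qed

text \<open>One list of monomials witnesses both G and its gradient. Products of traces and bilinear
  forms can thus stay ordinary functions: the rules of calculus below produce D along with G,
  without a syntax for polynomials.\<close>

definition poly_grad :: "'a set \<Rightarrow> (('a \<Rightarrow> real) \<Rightarrow> real) \<Rightarrow> ('a \<Rightarrow> ('a \<Rightarrow> real) \<Rightarrow> real) \<Rightarrow> bool" where
  "poly_grad A G D \<longleftrightarrow> finite A \<and> (\<exists>ts. (\<forall>x. G x = (\<Sum>(c, \<alpha>)\<leftarrow>ts. c * mval A \<alpha> x)) \<and>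
     (\<forall>b\<in>A. \<forall>x. D b x = (\<Sum>(c, \<alpha>)\<leftarrow>ts. c * dmval A b \<alpha> x)))"

lemma poly_grad_cong:
  assumes "poly_grad A G D" "\<And>x. G x = G' x" "\<And>b x. b \<in> A \<Longrightarrow> D b x = D' b x"
  shows "poly_grad A G' D'"
proof -
  have "G' = G" using assms(2) by auto
  then show ?thesis using assms(1,3) unfolding poly_grad_def by fastforce
qed

lemma poly_grad_zero: "finite A \<Longrightarrow> poly_grad A (\<lambda>x. 0) (\<lambda>b x. 0)"
  unfolding poly_grad_def by (intro conjI exI[of _ "[]"]) auto

lemma poly_grad_mon: "finite A \<Longrightarrow> poly_grad A (\<lambda>x. c * mval A \<alpha> x) (\<lambda>b x. c * dmval A b \<alpha> x)"
  unfolding poly_grad_def by (intro conjI exI[of _ "[(c, \<alpha>)]"]) auto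

lemma poly_grad_const: "finite A \<Longrightarrow> poly_grad A (\<lambda>x. c) (\<lambda>b x. 0)"
  by (rule poly_grad_cong[OF poly_grad_mon[of A c "\<lambda>_. 0"]]) (auto simp: mval_def dmval_def)

lemma poly_grad_var:
  assumes "finite A" "a \<in> A"
  shows "poly_grad A (\<lambda>x. x a) (\<lambda>b x. of_bool (b = a))"
proof (rule poly_grad_cong[OF poly_grad_mon[of A 1 "\<lambda>b. of_bool (b = a)"]])
  have m: "mval (A - {a}) (\<lambda>b. of_bool (b = a)) x = 1" for x :: "'a \<Rightarrow> real"
    unfolding mval_def by (rule prod.neutral) auto
  fix x show "1 * mval A (\<lambda>b. of_bool (b = a)) x = x a"
    using assms by (simp add: mval_split[OF assms] m)
  fix b assume "b \<in> A"
  then show "1 * dmval A b (\<lambda>b. of_bool (b = a)) x = of_bool (b = a)" for x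
    using assms m by (cases "b = a") (simp_all add: dmval_split)
qed (rule assms)

lemma poly_grad_add:
  assumes "poly_grad A G D" "poly_grad A G' D'"
  shows "poly_grad A (\<lambda>x. G x + G' x) (\<lambda>b x. D b x + D' b x)"
proof -
  obtain ts ts' where "\<forall>x. G x = (\<Sum>(c, \<alpha>)\<leftarrow>ts. c * mval A \<alpha> x)" "\<forall>b\<in>A. \<forall>x. D b x = (\<Sum>(c, \<alpha>)\<leftarrow>ts. c * dmval A b \<alpha> x)"
    "\<forall>x. G' x = (\<Sum>(c, \<alpha>)\<leftarrow>ts'. c * mval A \<alpha> x)" "\<forall>b\<in>A. \<forall>x. D' b x = (\<Sum>(c, \<alpha>)\<leftarrow>ts'. c * dmval A b \<alpha> x)"
    using assms unfolding poly_grad_def by blast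
  then show ?thesis using assms(1) unfolding poly_grad_def by (intro conjI exI[of _ "ts @ ts'"]) auto
qed

lemma poly_grad_mon_mult:
  assumes "poly_grad A G D"
  shows "poly_grad A (\<lambda>x. c * mval A \<alpha> x * G x) (\<lambda>b x. c * dmval A b \<alpha> x * G x + c * mval A \<alpha> x * D b x)"
proof -
  have fin: "finite A" using assms by (simp add: poly_grad_def)
  have "poly_grad A (\<lambda>x. c * mval A \<alpha> x * (\<Sum>(c, \<alpha>)\<leftarrow>ts. c * mval A \<alpha> x)) 
    (\<lambda>b x. c * dmval A b \<alpha> x * (\<Sum>(c, \<alpha>)\<leftarrow>ts. c * mval A \<alpha> x) + c * mval A \<alpha> x * (\<Sum>(c, \<alpha>)\<leftarrow>ts. c * dmval A b \<alpha> x))" for ts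
  proof (induction ts)
    case Nil
    then show ?case using fin by (simp add: poly_grad_zero)
  next
    case (Cons t ts)
    obtain d \<beta> where t: "t = (d, \<beta>)" by force
    show ?case
      by (rule poly_grad_cong[OF poly_grad_add[OF poly_grad_mon[OF fin, of "c * d" "\<lambda>a. \<alpha> a + \<beta> a"] Cons]])
        (simp_all add: t mval_add dmval_add[OF fin] algebra_simps)
  qed
  note L = this
  obtain ts where "\<forall>x. G x = (\<Sum>(c, \<alpha>)\<leftarrow>ts. c * mval A \<alpha> x)" 
    "\<forall>b\<in>A. \<forall>x. D b x = (\<Sum>(c, \<alpha>)\<leftarrow>ts. c * dmval A b \<alpha> x)" 
    using assms unfolding poly_grad_def by blast
  then show ?thesis by (intro poly_grad_cong[OF L[of ts]]) auto
qed

lemma poly_grad_mult: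
  assumes "poly_grad A G D" "poly_grad A H E"
  shows "poly_grad A (\<lambda>x. G x * H x) (\<lambda>b x. D b x * H x + G x * E b x)"
proof -
  have fin: "finite A" using assms by (simp add: poly_grad_def)
  have "poly_grad A (\<lambda>x. (\<Sum>(c, \<alpha>)\<leftarrow>ts. c * mval A \<alpha> x) * H x) 
    (\<lambda>b x. (\<Sum>(c, \<alpha>)\<leftarrow>ts. c * dmval A b \<alpha> x) * H x + (\<Sum>(c, \<alpha>)\<leftarrow>ts. c * mval A \<alpha> x) * E b x)" for ts
  proof (induction ts)
    case Nil
    then show ?case using fin by (simp add: poly_grad_zero)
  next
    case (Cons t ts)
    obtain d \<beta> where t: "t = (d, \<beta>)" by force
    show ?case
      by (rule poly_grad_cong[OF poly_grad_add[OF poly_grad_mon_mult[OF assms(2), of d \<beta>] Cons]])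
        (simp_all add: t algebra_simps)
  qed
  note L = this
  obtain ts where "\<forall>x. G x = (\<Sum>(c, \<alpha>)\<leftarrow>ts. c * mval A \<alpha> x)" 
    "\<forall>b\<in>A. \<forall>x. D b x = (\<Sum>(c, \<alpha>)\<leftarrow>ts. c * dmval A b \<alpha> x)" 
    using assms unfolding poly_grad_def by blast
  then show ?thesis by (intro poly_grad_cong[OF L[of ts]]) auto
qed

lemma poly_grad_cmult:
  assumes "poly_grad A G D"
  shows "poly_grad A (\<lambda>x. c * G x) (\<lambda>b x. c * D b x)"
proof -
  have fin: "finite A" using assms by (simp add: poly_grad_def)
  show ?thesis by (rule poly_grad_cong[OF poly_grad_mult[OF poly_grad_const[OF fin, of c] assms]]) simp_all
qed

lemma poly_grad_sum:
  assumes "finite A" "\<And>i. i \<in> I \<Longrightarrow> poly_grad A (G i) (D i)"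
  shows "poly_grad A (\<lambda>x. \<Sum>i\<in>I. G i x) (\<lambda>b x. \<Sum>i\<in>I. D i b x)"
  using assms(2)
proof (induction I rule: infinite_finite_induct)
  case (insert i I)
  then show ?case by (simp add: poly_grad_add)
qed (simp_all add: poly_grad_zero assms(1))

lemma poly_grad_prod:
  assumes "finite A" "finite I" "\<And>i. i \<in> I \<Longrightarrow> poly_grad A (G i) (D i)"
  shows "poly_grad A (\<lambda>x. \<Prod>i\<in>I. G i x) (\<lambda>b x. \<Sum>i\<in>I. D i b x * (\<Prod>j\<in>I - {i}. G j x))"
  using assms(2,3)
proof (induction I rule: finite_induct)
  case empty
  then show ?case by (simp add: poly_grad_const assms(1))
next
  case (insert i I)
  have "poly_grad A (\<lambda>x. G i x * (\<Prod>j\<in>I. G j x)) 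
    (\<lambda>b x. D i b x * (\<Prod>j\<in>I. G j x) + G i x * (\<Sum>i\<in>I. D i b x * (\<Prod>j\<in>I - {i}. G j x)))"
    by (rule poly_grad_mult) (use insert in auto)
  then show ?case
  proof (rule poly_grad_cong)
    fix b x
    have "(\<Prod>j\<in>insert i I - {k}. G j x) = G i x * (\<Prod>j\<in>I - {k}. G j x)" if "k \<in> I" for k
    proof -
      have "insert i I - {k} = insert i (I - {k})" using insert that by auto
      then show ?thesis using insert by simp
    qed
    then show "D i b x * (\<Prod>j\<in>I. G j x) + G i x * (\<Sum>i\<in>I. D i b x * (\<Prod>j\<in>I - {i}. G j x)) 
      = (\<Sum>k\<in>insert i I. D k b x * (\<Prod>j\<in>insert i I - {k}. G j x))"
      using insert by (simp add: sum_distrib_left mult.left_commute)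
  qed (use insert in simp)
qed

lemma poly_grad_power:
  assumes "poly_grad A G D"
  shows "poly_grad A (\<lambda>x. G x ^ n) (\<lambda>b x. real n * G x ^ (n - 1) * D b x)"
proof (induction n)
  case 0
  then show ?case using assms by (simp add: poly_grad_const poly_grad_def[of A G])
next
  case (Suc n)
  show ?case
    by (rule poly_grad_cong[OF poly_grad_mult[OF assms Suc]])
      (cases n; simp add: algebra_simps)+
qed

text \<open>The chain rule for a monomial composed with a linear map; it transports integration by
  parts to linear images.\<close>

lemma poly_grad_linear_image:
  assumes "finite A" "finite B"
  shows "poly_grad B (\<lambda>z. mval A \<alpha> (\<lambda>i. \<Sum>j\<in>B. L i j * z j))
    (\<lambda>b z. \<Sum>i\<in>A. dmval A i \<alpha> (\<lambda>i. \<Sum>j\<in>B. L i j * z j) * L i b)"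
proof -
  have l: "poly_grad B (\<lambda>z. \<Sum>j\<in>B. L i j * z j) (\<lambda>b z. L i b)" for i
    by (rule poly_grad_cong[OF poly_grad_sum[OF assms(2) poly_grad_cmult[OF poly_grad_var[OF assms(2)]]]])
      (use assms in \<open>auto simp: of_bool_def if_distrib[of "\<lambda>x. _ * x"] cong: if_cong\<close>)
  have p: "poly_grad B (\<lambda>z. (\<Sum>j\<in>B. L i j * z j) ^ \<alpha> i)
    (\<lambda>b z. real (\<alpha> i) * (\<Sum>j\<in>B. L i j * z j) ^ (\<alpha> i - 1) * L i b)" for i
    by (rule poly_grad_power[OF l])
  show ?thesis
    by (rule poly_grad_cong[OF poly_grad_prod[OF assms(2,1) p]])
      (auto simp: dmval_split[OF assms(1)] mval_def mult_ac cong: sum.cong)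
qed

section \<open>Families with Gaussian integration by parts\<close>

text \<open>That \<xi> is centered Gaussian with covariance c is encoded as integration by parts
  against monomials. This form covers singular covariances, passes to linear images and to
  independent copies, and is what every contraction below rests on.\<close>

locale gauss_family =
  fixes M :: "'w measure" and A :: "'a set" and \<xi> :: "'w \<Rightarrow> 'a \<Rightarrow> real" and c :: "'a \<Rightarrow> 'a \<Rightarrow> real"
  assumes fin: "finite A"
    and integrable_mval: "\<And>\<alpha>. integrable M (\<lambda>\<omega>. mval A \<alpha> (\<xi> \<omega>))"
    and stein_mon: "\<And>a \<alpha>. a \<in> A \<Longrightarrow>
      (\<integral>\<omega>. \<xi> \<omega> a * mval A \<alpha> (\<xi> \<omega>) \<partial>M) = (\<Sum>b\<in>A. c a b * (\<integral>\<omega>. dmval A b \<alpha> (\<xi> \<omega>) \<partial>M))"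
begin

lemma integrable_list: "integrable M (\<lambda>\<omega>. \<Sum>(d, \<alpha>)\<leftarrow>ts. d * mval A \<alpha> (\<xi> \<omega>))"
  by (induction ts) (auto intro!: Bochner_Integration.integrable_add integrable_mval)

lemma integrable_poly:
  assumes "poly_grad A G D"
  shows "integrable M (\<lambda>\<omega>. G (\<xi> \<omega>))"
proof -
  obtain ts where "\<forall>x. G x = (\<Sum>(c, \<alpha>)\<leftarrow>ts. c * mval A \<alpha> x)" using assms unfolding poly_grad_def by blast
  then show ?thesis using integrable_list[of ts] by simp
qed

lemma integrable_var_mult:
  assumes "poly_grad A G D" "a \<in> A"
  shows "integrable M (\<lambda>\<omega>. \<xi> \<omega> a * G (\<xi> \<omega>))"
  using integrable_poly[OF poly_grad_mult[OF poly_grad_var[OF fin assms(2)] assms(1)]] by simp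

lemma integrable_dmval: "integrable M (\<lambda>\<omega>. dmval A b \<alpha> (\<xi> \<omega>))"
  unfolding dmval_def by (simp add: integrable_mval)

lemma integrable_dlist: "integrable M (\<lambda>\<omega>. \<Sum>(d, \<alpha>)\<leftarrow>ts. d * dmval A b \<alpha> (\<xi> \<omega>))"
  by (induction ts) (auto intro!: Bochner_Integration.integrable_add integrable_dmval)

lemma integrable_grad:
  assumes "poly_grad A G D" "b \<in> A"
  shows "integrable M (\<lambda>\<omega>. D b (\<xi> \<omega>))"
proof -
  obtain ts where "\<forall>b\<in>A. \<forall>x. D b x = (\<Sum>(c, \<alpha>)\<leftarrow>ts. c * dmval A b \<alpha> x)"
    using assms unfolding poly_grad_def by blast
  then show ?thesis using integrable_dlist[of b ts] assms by simp
qed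

lemma stein:
  assumes "poly_grad A G D" and a: "a \<in> A"
  shows "(\<integral>\<omega>. \<xi> \<omega> a * G (\<xi> \<omega>) \<partial>M) = (\<Sum>b\<in>A. c a b * (\<integral>\<omega>. D b (\<xi> \<omega>) \<partial>M))"
proof -
  note i = integrable_dlist
  have j: "integrable M (\<lambda>\<omega>. \<xi> \<omega> a * mval A \<alpha> (\<xi> \<omega>))" for \<alpha>
    using integrable_var_mult[OF poly_grad_mon[OF fin, of 1 \<alpha>] a] by simp
  have k: "integrable M (\<lambda>\<omega>. \<xi> \<omega> a * (\<Sum>(d, \<alpha>)\<leftarrow>ts. d * mval A \<alpha> (\<xi> \<omega>)))" for ts
  proof (induction ts)
    case (Cons t ts)
    obtain d \<beta> where t: "t = (d, \<beta>)" by force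
    have "(\<lambda>\<omega>. \<xi> \<omega> a * (\<Sum>(d, \<alpha>)\<leftarrow>t # ts. d * mval A \<alpha> (\<xi> \<omega>))) =
      (\<lambda>\<omega>. d * (\<xi> \<omega> a * mval A \<beta> (\<xi> \<omega>)) + \<xi> \<omega> a * (\<Sum>(d, \<alpha>)\<leftarrow>ts. d * mval A \<alpha> (\<xi> \<omega>)))"
      by (simp add: t algebra_simps)
    then show ?case using Cons j[of \<beta>] by (simp only:) (intro Bochner_Integration.integrable_add; simp)
  qed simp
  have "(\<integral>\<omega>. \<xi> \<omega> a * (\<Sum>(d, \<alpha>)\<leftarrow>ts. d * mval A \<alpha> (\<xi> \<omega>)) \<partial>M) 
    = (\<Sum>b\<in>A. c a b * (\<integral>\<omega>. (\<Sum>(d, \<alpha>)\<leftarrow>ts. d * dmval A b \<alpha> (\<xi> \<omega>)) \<partial>M))" for ts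
  proof (induction ts)
    case (Cons t ts)
    obtain d \<beta> where t: "t = (d, \<beta>)" by force
    have "(\<integral>\<omega>. \<xi> \<omega> a * (\<Sum>(d, \<alpha>)\<leftarrow>t # ts. d * mval A \<alpha> (\<xi> \<omega>)) \<partial>M) =
      (\<integral>\<omega>. d * (\<xi> \<omega> a * mval A \<beta> (\<xi> \<omega>)) + \<xi> \<omega> a * (\<Sum>(d, \<alpha>)\<leftarrow>ts. d * mval A \<alpha> (\<xi> \<omega>)) \<partial>M)"
      by (simp add: t algebra_simps)
    also have "\<dots> = d * (\<integral>\<omega>. \<xi> \<omega> a * mval A \<beta> (\<xi> \<omega>) \<partial>M) + (\<integral>\<omega>. \<xi> \<omega> a * (\<Sum>(d, \<alpha>)\<leftarrow>ts. d * mval A \<alpha> (\<xi> \<omega>)) \<partial>M)"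
      using j k by (subst Bochner_Integration.integral_add) auto
    also have "\<dots> = (\<Sum>b\<in>A. c a b * (d * (\<integral>\<omega>. dmval A b \<beta> (\<xi> \<omega>) \<partial>M) + (\<integral>\<omega>. (\<Sum>(d, \<alpha>)\<leftarrow>ts. d * dmval A b \<alpha> (\<xi> \<omega>)) \<partial>M)))"
      unfolding stein_mon[OF a] Cons by (simp add: sum_distrib_left sum.distrib algebra_simps)
    also have "\<dots> = (\<Sum>b\<in>A. c a b * (\<integral>\<omega>. (\<Sum>(d, \<alpha>)\<leftarrow>t # ts. d * dmval A b \<alpha> (\<xi> \<omega>)) \<partial>M))"
    proof (rule sum.cong[OF refl])
      fix b
      have "(\<integral>\<omega>. d * dmval A b \<beta> (\<xi> \<omega>) + (\<Sum>(d, \<alpha>)\<leftarrow>ts. d * dmval A b \<alpha> (\<xi> \<omega>)) \<partial>M) =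
        d * (\<integral>\<omega>. dmval A b \<beta> (\<xi> \<omega>) \<partial>M) + (\<integral>\<omega>. (\<Sum>(d, \<alpha>)\<leftarrow>ts. d * dmval A b \<alpha> (\<xi> \<omega>)) \<partial>M)"
        using integrable_dmval i by (subst Bochner_Integration.integral_add) auto
      then show "c a b * (d * (\<integral>\<omega>. dmval A b \<beta> (\<xi> \<omega>) \<partial>M) + (\<integral>\<omega>. (\<Sum>(d, \<alpha>)\<leftarrow>ts. d * dmval A b \<alpha> (\<xi> \<omega>)) \<partial>M)) =
        c a b * (\<integral>\<omega>. (\<Sum>(d, \<alpha>)\<leftarrow>t # ts. d * dmval A b \<alpha> (\<xi> \<omega>)) \<partial>M)" by (simp add: t)
    qed
    finally show ?case .
  qed simp
  moreover obtain ts where "\<forall>x. G x = (\<Sum>(c, \<alpha>)\<leftarrow>ts. c * mval A \<alpha> x)" 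
    "\<forall>b\<in>A. \<forall>x. D b x = (\<Sum>(c, \<alpha>)\<leftarrow>ts. c * dmval A b \<alpha> x)" 
    using assms unfolding poly_grad_def by blast
  ultimately show ?thesis by (auto cong: sum.cong)
qed

end

text \<open>The product measure factorizes, so only the coordinate a is affected, and the
  one-dimensional recursion for moments applies.\<close>

lemma gauss_family_iid:
  assumes fin: "finite A"
  shows "gauss_family (\<Pi>\<^sub>M a\<in>A. std_normal) A (\<lambda>\<omega>. \<omega>) (\<lambda>a b. of_bool (a = b))"
proof
  interpret prob_space std_normal by (rule prob_space_std_normal)
  interpret product_sigma_finite "\<lambda>_ :: 'a. std_normal" ..
  show "finite A" by fact
  have "integrable (Pi\<^sub>M A (\<lambda>_. std_normal)) (\<lambda>x. \<Prod>a\<in>A. (\<lambda>y. y ^ \<alpha> a) (x a))" for \<alpha> :: "'a \<Rightarrow> nat"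
    by (rule product_integrable_prod) (use fin integrable_std_normal_pow in auto)
  then show "integrable (Pi\<^sub>M A (\<lambda>_. std_normal)) (\<lambda>\<omega>. mval A \<alpha> \<omega>)" for \<alpha>
    unfolding mval_def by simp
  have E: "(\<integral>\<omega>. mval A \<alpha> \<omega> \<partial>Pi\<^sub>M A (\<lambda>_. std_normal)) = (\<Prod>a\<in>A. \<integral>x. x ^ \<alpha> a \<partial>std_normal)" for \<alpha>
    unfolding mval_def by (rule product_integral_prod[OF fin integrable_std_normal_pow])
  fix a \<alpha> assume a: "a \<in> A"
  define R where "R = (\<Prod>b\<in>A - {a}. \<integral>x. x ^ \<alpha> b \<partial>std_normal)"
  have upd: "(\<integral>\<omega>. mval A (\<alpha>(a := n)) \<omega> \<partial>Pi\<^sub>M A (\<lambda>_. std_normal)) = (\<integral>x. x ^ n \<partial>std_normal) * R" for n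
    unfolding E R_def using prod.remove[OF fin a, of "\<lambda>b. \<integral>x. x ^ (\<alpha>(a := n)) b \<partial>std_normal"] by simp
  have "\<omega> a * mval A \<alpha> \<omega> = mval A (\<alpha>(a := Suc (\<alpha> a))) \<omega>" for \<omega> :: "'a \<Rightarrow> real"
    unfolding mval_split[OF fin a] by (simp add: mval_def)
  then have "(\<integral>\<omega>. \<omega> a * mval A \<alpha> \<omega> \<partial>Pi\<^sub>M A (\<lambda>_. std_normal)) = (\<integral>x. x ^ Suc (\<alpha> a) \<partial>std_normal) * R"
    using upd[of "Suc (\<alpha> a)"] by simp
  also have "\<dots> = (\<integral>\<omega>. dmval A a \<alpha> \<omega> \<partial>Pi\<^sub>M A (\<lambda>_. std_normal))"
    unfolding std_normal_moment_Suc dmval_def using upd[of "\<alpha> a - 1"] by simp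
  also have "\<dots> = (\<Sum>b\<in>A. of_bool (a = b) * (\<integral>\<omega>. dmval A b \<alpha> \<omega> \<partial>Pi\<^sub>M A (\<lambda>_. std_normal)))"
    using a fin by (simp add: of_bool_def if_distrib[of "\<lambda>x. x * _"] cong: if_cong)
  finally show "(\<integral>\<omega>. \<omega> a * mval A \<alpha> \<omega> \<partial>Pi\<^sub>M A (\<lambda>_. std_normal)) =
    (\<Sum>b\<in>A. of_bool (a = b) * (\<integral>\<omega>. dmval A b \<alpha> \<omega> \<partial>Pi\<^sub>M A (\<lambda>_. std_normal)))" .
qed

subsection \<open>Gaussian vectors and their independent copies\<close>

definition lin_val :: "nat \<Rightarrow> (nat \<Rightarrow> nat \<Rightarrow> real) \<Rightarrow> (nat \<Rightarrow> real) \<Rightarrow> nat \<Rightarrow> real" where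
  "lin_val r L z = (\<lambda>i. \<Sum>j<r. L i j * z j)"

lemma sqrt_entries:
  assumes "psd_mat r P" "i < r" "k < r"
  shows "(\<Sum>j<r. psd_sqrt P $$ (i, j) * psd_sqrt P $$ (k, j)) = P $$ (i, k)"
proof -
  note S = psd_matD[OF psd_sqrt(1)[OF assms(1)]]
  have "psd_sqrt P $$ (k, j) = psd_sqrt P $$ (j, k)" if "j < r" for j
    using S(1,2) assms that by (metis carrier_matD index_transpose_mat(1))
  then show ?thesis using mult_mat_index[OF S(1) S(1) assms(2,3)] psd_sqrt(2)[OF assms(1)] by simp
qed

text \<open>The law is a linear image of independent standard normals; by the chain rule the
  covariances become the sums over j of S_ij S_kj for the root S, which are the entries of
  P.\<close>

lemma gauss_family_vector:
  assumes psd: "psd_mat r P"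
  shows "gauss_family (gaussian_law P) {..<r} (\<lambda>\<omega>. \<omega>) (\<lambda>i j. P $$ (i, j))"
    and "prob_space (gaussian_law P)"
    and "sets (gaussian_law P) = sets (\<Pi>\<^sub>M i\<in>{..<r}. borel)"
proof -
  define L where "L = (\<lambda>i j. psd_sqrt P $$ (i, j))"
  define N where "N = (\<Pi>\<^sub>M i\<in>{..<r}. std_normal)"
  define f where "f = (\<lambda>z. \<lambda>i\<in>{..<r}. \<Sum>j<r. L i j * z j)"
  have law: "gaussian_law P = distr N (\<Pi>\<^sub>M i\<in>{..<r}. borel) f"
    using psd_matD(3)[OF psd] by (simp add: gaussian_law_def Let_def N_def f_def L_def)
  interpret z: gauss_family N "{..<r}" "\<lambda>\<omega>. \<omega>" "\<lambda>a b. of_bool (a = b)"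
    unfolding N_def by (rule gauss_family_iid) simp
  interpret prob_space std_normal by (rule prob_space_std_normal)
  interpret pN: product_prob_space "\<lambda>_. std_normal" "{..<r}" ..
  have f [measurable]: "f \<in> N \<rightarrow>\<^sub>M (\<Pi>\<^sub>M i\<in>{..<r}. borel)"
    unfolding f_def N_def by (intro measurable_restrict) measurable
  show "prob_space (gaussian_law P)" unfolding law 
    by (intro prob_space.prob_space_distr f) (auto simp: N_def intro!: prob_space_PiM prob_space_std_normal)
  show "sets (gaussian_law P) = sets (\<Pi>\<^sub>M i\<in>{..<r}. borel)" unfolding law by simp
  have meas [measurable]: "(\<lambda>x. mval {..<r} \<alpha> x) \<in> borel_measurable (\<Pi>\<^sub>M i\<in>{..<r}. borel)" for \<alpha>
    unfolding mval_def by measurable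
  have mf: "mval {..<r} \<alpha> (f z) = mval {..<r} \<alpha> (lin_val r L z)" for \<alpha> z
    by (simp add: mval_def f_def lin_val_def)
  have pg: "poly_grad {..<r} (\<lambda>z. mval {..<r} \<alpha> (lin_val r L z))
     (\<lambda>b z. \<Sum>i<r. dmval {..<r} i \<alpha> (lin_val r L z) * L i b)" for \<alpha>
    unfolding lin_val_def by (rule poly_grad_linear_image) auto
  have int: "integrable N (\<lambda>z. mval {..<r} \<alpha> (lin_val r L z))" for \<alpha>
    by (rule z.integrable_poly[OF pg])
  have intd: "integrable N (\<lambda>z. dmval {..<r} i \<alpha> (lin_val r L z))" for \<alpha> i
    unfolding dmval_def using int by auto
  have E: "(\<integral>x. mval {..<r} \<alpha> x \<partial>gaussian_law P) = (\<integral>z. mval {..<r} \<alpha> (lin_val r L z) \<partial>N)" for \<alpha>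
    unfolding law by (subst integral_distr) (auto simp: mf)
  show "gauss_family (gaussian_law P) {..<r} (\<lambda>\<omega>. \<omega>) (\<lambda>i j. P $$ (i, j))"
  proof
    show "integrable (gaussian_law P) (\<lambda>\<omega>. mval {..<r} \<alpha> \<omega>)" for \<alpha>
      unfolding law by (subst integrable_distr_eq) (auto simp: mf int)
    fix i \<alpha> assume i: "i \<in> {..<r}"
    have "(\<integral>x. x i * mval {..<r} \<alpha> x \<partial>gaussian_law P) = (\<integral>z. f z i * mval {..<r} \<alpha> (f z) \<partial>N)"
      unfolding law using i by (subst integral_distr) auto
    also have "\<dots> = (\<integral>z. (\<Sum>j<r. L i j * (z j * mval {..<r} \<alpha> (lin_val r L z))) \<partial>N)"
      using i unfolding mf by (simp add: f_def sum_distrib_right mult.assoc)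
    also have "\<dots> = (\<Sum>j<r. L i j * (\<integral>z. z j * mval {..<r} \<alpha> (lin_val r L z) \<partial>N))"
      by (subst Bochner_Integration.integral_sum) (auto intro!: z.integrable_var_mult[OF pg])
    also have "\<dots> = (\<Sum>j<r. L i j * (\<Sum>k<r. (\<integral>z. dmval {..<r} k \<alpha> (lin_val r L z) \<partial>N) * L k j))"
    proof (intro sum.cong refl arg_cong[where f = "\<lambda>x. _ * x"])
      fix j assume j: "j \<in> {..<r}"
      have "(\<integral>z. z j * mval {..<r} \<alpha> (lin_val r L z) \<partial>N) = 
          (\<integral>z. (\<Sum>k<r. dmval {..<r} k \<alpha> (lin_val r L z) * L k j) \<partial>N)"
        using j by (simp add: z.stein[OF pg j] of_bool_def if_distrib[of "\<lambda>x. x * _"] cong: if_cong)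
      also have "\<dots> = (\<Sum>k<r. (\<integral>z. dmval {..<r} k \<alpha> (lin_val r L z) \<partial>N) * L k j)"
        by (subst Bochner_Integration.integral_sum) (auto intro!: intd)
      finally show "(\<integral>z. z j * mval {..<r} \<alpha> (lin_val r L z) \<partial>N) = 
        (\<Sum>k<r. (\<integral>z. dmval {..<r} k \<alpha> (lin_val r L z) \<partial>N) * L k j)" .
    qed
    also have "\<dots> = (\<Sum>k<r. (\<Sum>j<r. L i j * L k j) * (\<integral>z. dmval {..<r} k \<alpha> (lin_val r L z) \<partial>N))"
      unfolding sum_distrib_left sum_distrib_right
      by (subst sum.swap) (simp add: mult_ac)
    also have "\<dots> = (\<Sum>k<r. P $$ (i, k) * (\<integral>x. dmval {..<r} k \<alpha> x \<partial>gaussian_law P))"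
    proof (intro sum.cong refl)
      fix k assume "k \<in> {..<r}"
      then have "(\<Sum>j<r. L i j * L k j) = P $$ (i, k)" using sqrt_entries[OF psd] i by (simp add: L_def)
      then show "(\<Sum>j<r. L i j * L k j) * (\<integral>z. dmval {..<r} k \<alpha> (lin_val r L z) \<partial>N)
          = P $$ (i, k) * (\<integral>x. dmval {..<r} k \<alpha> x \<partial>gaussian_law P)"
        unfolding dmval_def by (simp add: E)
    qed
    finally show "(\<integral>x. x i * mval {..<r} \<alpha> x \<partial>gaussian_law P) =
      (\<Sum>k<r. P $$ (i, k) * (\<integral>x. dmval {..<r} k \<alpha> x \<partial>gaussian_law P))" .
  qed simp
qed

text \<open>Finitely many copies occur, those in K; restriction to them maps the infinite product
  onto a finite one, where the integral of a product factorizes.\<close>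

lemma gaussian_copies_prod:
  fixes f :: "nat \<Rightarrow> (nat \<Rightarrow> real) \<Rightarrow> real"
  assumes psd: "psd_mat r P" and K: "finite K"
    and int: "\<And>k. k \<in> K \<Longrightarrow> integrable (gaussian_law P) (f k)"
  shows "integrable (gaussian_copies P) (\<lambda>X. \<Prod>k\<in>K. f k (X k))"
    and "(\<integral>X. (\<Prod>k\<in>K. f k (X k)) \<partial>gaussian_copies P) = (\<Prod>k\<in>K. \<integral>x. f k x \<partial>gaussian_law P)"
proof -
  interpret prob_space "gaussian_law P" by (rule gauss_family_vector(2)[OF psd])
  interpret product_prob_space "\<lambda>_ :: nat. gaussian_law P" UNIV ..
  have d: "distr (gaussian_copies P) (PiM K (\<lambda>_. gaussian_law P)) (\<lambda>x. restrict x K) = PiM K (\<lambda>_. gaussian_law P)"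
    unfolding gaussian_copies_def by (rule distr_PiM_restrict_finite) (use K in auto)
  have m: "(\<lambda>x. restrict x K) \<in> gaussian_copies P \<rightarrow>\<^sub>M PiM K (\<lambda>_. gaussian_law P)"
    unfolding gaussian_copies_def by (rule measurable_restrict_subset) simp
  have i: "integrable (PiM K (\<lambda>_. gaussian_law P)) (\<lambda>X. \<Prod>k\<in>K. f k (X k))"
    by (rule product_integrable_prod[OF K int])
  have "integrable (distr (gaussian_copies P) (PiM K (\<lambda>_. gaussian_law P)) (\<lambda>x. restrict x K)) (\<lambda>X. \<Prod>k\<in>K. f k (X k))"
    unfolding d by (rule i)
  then show "integrable (gaussian_copies P) (\<lambda>X. \<Prod>k\<in>K. f k (X k))"
    using integrable_distr_eq[OF m, of "\<lambda>X. \<Prod>k\<in>K. f k (X k)"] i by (auto cong: prod.cong)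
  have "(\<integral>X. (\<Prod>k\<in>K. f k (X k)) \<partial>gaussian_copies P) 
    = (\<integral>X. (\<Prod>k\<in>K. f k (X k)) \<partial>distr (gaussian_copies P) (PiM K (\<lambda>_. gaussian_law P)) (\<lambda>x. restrict x K))"
    using i by (subst integral_distr[OF m]) (auto cong: prod.cong)
  also have "\<dots> = (\<Prod>k\<in>K. \<integral>x. f k x \<partial>gaussian_law P)"
    unfolding d by (rule product_integral_prod[OF K int])
  finally show "(\<integral>X. (\<Prod>k\<in>K. f k (X k)) \<partial>gaussian_copies P) = (\<Prod>k\<in>K. \<integral>x. f k x \<partial>gaussian_law P)" .
qed

text \<open>Copies with different index are independent, so in the monomial split along K only the
  factor of copy k is differentiated; this gives the block-diagonal covariance.\<close>

lemma gauss_family_copies: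
  assumes psd: "psd_mat r P" and K: "finite K"
  shows "gauss_family (gaussian_copies P) (K \<times> {..<r}) (\<lambda>X (k, i). X k i)
    (\<lambda>(k, i) (l, j). of_bool (k = l) * P $$ (i, j))"
proof -
  interpret v: gauss_family "gaussian_law P" "{..<r}" "\<lambda>\<omega>. \<omega>" "\<lambda>i j. P $$ (i, j)"
    by (rule gauss_family_vector[OF psd])
  let ?\<xi> = "\<lambda>X (k, i). X k i :: real"
  have m: "mval (K \<times> {..<r}) \<alpha> (?\<xi> X) = (\<Prod>k\<in>K. mval {..<r} (\<lambda>i. \<alpha> (k, i)) (X k))" for \<alpha> X
    unfolding mval_def by (simp add: prod.cartesian_product case_prod_unfold)
  show ?thesis
  proof
    show "finite (K \<times> {..<r})" using K by simp
    show "integrable (gaussian_copies P) (\<lambda>X. mval (K \<times> {..<r}) \<alpha> (?\<xi> X))" for \<alpha>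
      unfolding m by (rule gaussian_copies_prod[OF psd K v.integrable_mval])
    fix a \<alpha> assume a: "a \<in> K \<times> {..<r}"
    then obtain k i where ki: "a = (k, i)" "k \<in> K" "i < r" by auto
    define R where "R = (\<Prod>l\<in>K - {k}. \<integral>x. mval {..<r} (\<lambda>i. \<alpha> (l, i)) x \<partial>gaussian_law P)"
    have split: "(\<integral>X. h (X k) * (\<Prod>l\<in>K - {k}. mval {..<r} (\<lambda>i. \<alpha> (l, i)) (X l)) \<partial>gaussian_copies P)
      = (\<integral>x. h x \<partial>gaussian_law P) * R" if "integrable (gaussian_law P) h" for h
    proof -
      define g where "g = (\<lambda>l. if l = k then h else mval {..<r} (\<lambda>i. \<alpha> (l, i)))"
      have "(\<integral>X. (\<Prod>l\<in>K. g l (X l)) \<partial>gaussian_copies P) = (\<Prod>l\<in>K. \<integral>x. g l x \<partial>gaussian_law P)"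
        by (rule gaussian_copies_prod[OF psd K]) (auto simp: g_def that v.integrable_mval)
      moreover have "(\<Prod>l\<in>K. g l (X l)) = h (X k) * (\<Prod>l\<in>K - {k}. mval {..<r} (\<lambda>i. \<alpha> (l, i)) (X l))" for X
        using prod.remove[OF K ki(2), of "\<lambda>l. g l (X l)"] by (simp add: g_def)
      moreover have "(\<Prod>l\<in>K. \<integral>x. g l x \<partial>gaussian_law P) = (\<integral>x. h x \<partial>gaussian_law P) * R"
        using prod.remove[OF K ki(2), of "\<lambda>l. \<integral>x. g l x \<partial>gaussian_law P"] by (simp add: g_def R_def)
      ultimately show ?thesis by simp
    qed
    have mr: "mval (K \<times> {..<r}) \<beta> (?\<xi> X) = mval {..<r} (\<lambda>j. \<beta> (k, j)) (X k) * (\<Prod>l\<in>K - {k}. mval {..<r} (\<lambda>i. \<beta> (l, i)) (X l))"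
      for \<beta> X
      unfolding m using prod.remove[OF K ki(2), of "\<lambda>l. mval {..<r} (\<lambda>i. \<beta> (l, i)) (X l)"] by simp
    have d: "(\<integral>X. dmval (K \<times> {..<r}) (k, j) \<alpha> (?\<xi> X) \<partial>gaussian_copies P) =
      (\<integral>x. dmval {..<r} j (\<lambda>i. \<alpha> (k, i)) x \<partial>gaussian_law P) * R" for j
    proof -
      define \<beta> where "\<beta> = \<alpha>((k, j) := \<alpha> (k, j) - 1)"
      have b1: "(\<lambda>i. \<beta> (k, i)) = (\<lambda>i. \<alpha> (k, i))(j := \<alpha> (k, j) - 1)" by (auto simp: \<beta>_def)
      have "(\<Prod>l\<in>K - {k}. mval {..<r} (\<lambda>i. \<beta> (l, i)) (X l)) = (\<Prod>l\<in>K - {k}. mval {..<r} (\<lambda>i. \<alpha> (l, i)) (X l))" for X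
        by (intro prod.cong) (auto simp: \<beta>_def)
      then have "dmval (K \<times> {..<r}) (k, j) \<alpha> (?\<xi> X) = 
        dmval {..<r} j (\<lambda>i. \<alpha> (k, i)) (X k) * (\<Prod>l\<in>K - {k}. mval {..<r} (\<lambda>i. \<alpha> (l, i)) (X l))" for X
        unfolding dmval_def \<beta>_def[symmetric] mr b1 by simp
      then show ?thesis using split[OF v.integrable_dmval] by simp
    qed
    have "(\<integral>X. ?\<xi> X a * mval (K \<times> {..<r}) \<alpha> (?\<xi> X) \<partial>gaussian_copies P) 
      = (\<integral>X. (X k i * mval {..<r} (\<lambda>i. \<alpha> (k, i)) (X k)) * (\<Prod>l\<in>K - {k}. mval {..<r} (\<lambda>i. \<alpha> (l, i)) (X l)) \<partial>gaussian_copies P)"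
      unfolding mr by (simp add: ki mult.assoc)
    also have "\<dots> = (\<integral>x. x i * mval {..<r} (\<lambda>i. \<alpha> (k, i)) x \<partial>gaussian_law P) * R"
      using v.integrable_var_mult[OF poly_grad_mon[of "{..<r}" 1 "\<lambda>i. \<alpha> (k, i)"], of i] ki
      by (intro split) simp
    also have "\<dots> = (\<Sum>j<r. P $$ (i, j) * (\<integral>X. dmval (K \<times> {..<r}) (k, j) \<alpha> (?\<xi> X) \<partial>gaussian_copies P))"
      unfolding d using ki by (simp add: v.stein_mon sum_distrib_right mult.assoc)
    also have "\<dots> = (\<Sum>l\<in>K. of_bool (k = l) * (\<Sum>j<r. P $$ (i, j) * (\<integral>X. dmval (K \<times> {..<r}) (l, j) \<alpha> (?\<xi> X) \<partial>gaussian_copies P)))"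
      using ki K by (simp add: of_bool_def if_distrib[of "\<lambda>x. x * _"] cong: if_cong)
    also have "\<dots> = (\<Sum>b\<in>K \<times> {..<r}. (case a of (k, i) \<Rightarrow> \<lambda>(l, j). of_bool (k = l) * P $$ (i, j)) b *
        (\<integral>X. dmval (K \<times> {..<r}) b \<alpha> (?\<xi> X) \<partial>gaussian_copies P))"
      unfolding sum_distrib_left by (simp add: sum.cartesian_product case_prod_unfold ki mult.assoc del: sum_of_bool_mult_eq sum_mult_of_bool_eq)
    finally show "(\<integral>X. ?\<xi> X a * mval (K \<times> {..<r}) \<alpha> (?\<xi> X) \<partial>gaussian_copies P) =
      (\<Sum>b\<in>K \<times> {..<r}. (case a of (k, i) \<Rightarrow> \<lambda>(l, j). of_bool (k = l) * P $$ (i, j)) b *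
        (\<integral>X. dmval (K \<times> {..<r}) b \<alpha> (?\<xi> X) \<partial>gaussian_copies P))" .
  qed
qed

section \<open>Contractions of chains of bilinear forms\<close>

datatype endpoint = LeftEnd | RightEnd | Colour nat

fun end_val :: "(nat \<Rightarrow> real) \<Rightarrow> (nat \<Rightarrow> real) \<Rightarrow> (nat \<times> nat \<Rightarrow> real) \<Rightarrow> endpoint \<Rightarrow> nat \<Rightarrow> real" where
  "end_val u v x LeftEnd i = u i"
| "end_val u v x RightEnd i = v i"
| "end_val u v x (Colour k) i = x (k, i)"

definition form :: "nat \<Rightarrow> real mat \<Rightarrow> nat \<Rightarrow> (nat \<Rightarrow> real) \<Rightarrow> (nat \<Rightarrow> real) \<Rightarrow> real" where
  "form r P e u v = (\<Sum>a<r. \<Sum>b<r. u a * (P ^\<^sub>m e) $$ (a, b) * v b)"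

text \<open>The expectation of \<open>\<Prod>i\<in>I. l(i)' P\<^sup>e\<^sup>(\<^sup>i\<^sup>) q(i)\<close>, where the end points \<open>l(i)\<close> and \<open>q(i)\<close> are
  Gaussian vectors or one of the two fixed vectors \<open>u\<close>, \<open>v\<close>.\<close>

definition edge_exp :: "nat set \<Rightarrow> (nat \<Rightarrow> endpoint) \<Rightarrow> (nat \<Rightarrow> nat) \<Rightarrow> (nat \<Rightarrow> endpoint) \<Rightarrow>
    nat \<Rightarrow> real mat \<Rightarrow> (nat \<Rightarrow> real) \<Rightarrow> (nat \<Rightarrow> real) \<Rightarrow> real" where
  "edge_exp I l e q r P u v = (\<integral>X. (\<Prod>i\<in>I. form r P (e i)
      (end_val u v (\<lambda>(k, i). X k i) (l i)) (end_val u v (\<lambda>(k, i). X k i) (q i))) \<partial>gaussian_copies P)"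

definition mv :: "nat \<Rightarrow> real mat \<Rightarrow> nat \<Rightarrow> (nat \<Rightarrow> real) \<Rightarrow> nat \<Rightarrow> real" where
  "mv r P e v a = (\<Sum>b<r. (P ^\<^sub>m e) $$ (a, b) * v b)"

lemma form_mv: "form r P e u v = (\<Sum>a<r. u a * mv r P e v a)"
  by (simp add: form_def mv_def sum_distrib_left mult.assoc)

context
  fixes r :: nat and P :: "real mat"
  assumes psd: "psd_mat r P"
begin

lemma pow_sym: "a < r \<Longrightarrow> b < r \<Longrightarrow> (P ^\<^sub>m e) $$ (a, b) = (P ^\<^sub>m e) $$ (b, a)"
  using transpose_pow_mat[OF psd_matD(1,2)[OF psd], of e] psd_matD(4)[OF psd, of e]
  by (metis carrier_matD index_transpose_mat(1))

lemma pow_mult_entry: "a < r \<Longrightarrow> c < r \<Longrightarrow> (\<Sum>b<r. (P ^\<^sub>m e) $$ (a, b) * (P ^\<^sub>m f) $$ (b, c)) = (P ^\<^sub>m (e + f)) $$ (a, c)"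
  using mult_mat_index[OF psd_matD(4)[OF psd] psd_matD(4)[OF psd], of a c e f]
    pow_mat_add[OF psd_matD(1)[OF psd], of e f] by simp

lemma pow_1_entry: "(P ^\<^sub>m (Suc 0)) $$ (a, b) = P $$ (a, b)"
  using pow_mat_1[OF psd_matD(1)[OF psd]] by simp

lemma form_sym: "form r P e u v = form r P e v u"
  unfolding form_def by (subst sum.swap) (auto simp: pow_sym mult_ac intro!: sum.cong)

lemma mv_mv: "a < r \<Longrightarrow> mv r P e (mv r P f v) a = mv r P (e + f) v a"
  unfolding mv_def sum_distrib_left
  by (subst sum.swap) (auto simp: pow_mult_entry[symmetric] sum_distrib_right mult.assoc intro!: sum.cong)

text \<open>The covariance P glues P^e u to P^f v; it accounts for the successor in the
  exponent.\<close>

lemma form_contract: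
  "(\<Sum>a<r. \<Sum>c<r. mv r P e u a * P $$ (a, c) * mv r P f v c) = form r P (Suc (e + f)) u v"
proof -
  have "(\<Sum>c<r. mv r P e u a * P $$ (a, c) * mv r P f v c) = mv r P e u a * mv r P (Suc f) v a" if "a < r" for a
    using mv_mv[OF that, of "Suc 0" f v]
    by (simp add: mv_def[of r P "Suc 0"] pow_1_entry sum_distrib_left[symmetric] mult.assoc del: pow_mat.simps)
  then have "(\<Sum>a<r. \<Sum>c<r. mv r P e u a * P $$ (a, c) * mv r P f v c) = form r P e (mv r P (Suc f) v) u"
    by (simp add: form_mv mult.commute)
  also have "\<dots> = form r P e u (mv r P (Suc f) v)" by (rule form_sym)
  also have "\<dots> = form r P (Suc (e + f)) u v"
    unfolding form_mv by (auto simp: mv_mv intro!: sum.cong)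
  finally show ?thesis .
qed

text \<open>The same gluing within a single form closes it to a trace.\<close>

lemma trace_contract: "(\<Sum>a<r. \<Sum>c<r. P $$ (a, c) * (P ^\<^sub>m e) $$ (a, c)) = mtrace (P ^\<^sub>m Suc e)"
proof -
  have "(\<Sum>c<r. P $$ (a, c) * (P ^\<^sub>m e) $$ (a, c)) = (P ^\<^sub>m Suc e) $$ (a, a)" if a: "a < r" for a
  proof -
    have "(\<Sum>c<r. P $$ (a, c) * (P ^\<^sub>m e) $$ (a, c)) = (\<Sum>c<r. (P ^\<^sub>m Suc 0) $$ (a, c) * (P ^\<^sub>m e) $$ (c, a))"
      using a by (intro sum.cong) (auto simp: pow_1_entry pow_sym[of a _ e] simp del: pow_mat.simps)
    then show ?thesis using pow_mult_entry[OF a a, of "Suc 0" e] by (simp del: pow_mat.simps)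
  qed
  then show ?thesis unfolding mtrace_def using psd_matD(3,4)[OF psd] by (simp del: pow_mat.simps)
qed

context
  fixes u v :: "nat \<Rightarrow> real" and K :: "nat set"
  assumes K: "finite K"
begin

abbreviation "endv x y \<equiv> end_val u v x y"

lemma poly_grad_end:
  assumes "\<And>k. y = Colour k \<Longrightarrow> k \<in> K" "i < r"
  shows "poly_grad (K \<times> {..<r}) (\<lambda>x. endv x y i) (\<lambda>(k, c) x. of_bool (y = Colour k \<and> c = i))"
proof (cases y)
  case (Colour k)
  show ?thesis
    by (rule poly_grad_cong[OF poly_grad_var[of _ "(k, i)"]]) (use assms K Colour in \<open>auto simp: of_bool_def split: if_splits\<close>)
qed (rule poly_grad_cong[OF poly_grad_const], use K in auto)+

lemma poly_grad_mv:
  assumes "\<And>k. y = Colour k \<Longrightarrow> k \<in> K"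
  shows "poly_grad (K \<times> {..<r}) (\<lambda>x. mv r P e (endv x y) a)
    (\<lambda>(k, c) x. of_bool (y = Colour k) * (P ^\<^sub>m e) $$ (a, c))"
proof -
  have "poly_grad (K \<times> {..<r}) (\<lambda>x. \<Sum>b<r. (P ^\<^sub>m e) $$ (a, b) * endv x y b)
     (\<lambda>kc x. \<Sum>b<r. (P ^\<^sub>m e) $$ (a, b) * (case kc of (k, c) \<Rightarrow> \<lambda>x. of_bool (y = Colour k \<and> c = b)) x)"
    by (intro poly_grad_sum poly_grad_cmult poly_grad_end) (use K assms in auto)
  then show ?thesis unfolding mv_def
    by (rule poly_grad_cong) (auto simp: of_bool_def if_distrib[of "\<lambda>x. _ * x"] cong: if_cong)
qed

lemma poly_grad_form:
  assumes "\<And>k. y = Colour k \<Longrightarrow> k \<in> K" "\<And>k. z = Colour k \<Longrightarrow> k \<in> K"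
  shows "poly_grad (K \<times> {..<r}) (\<lambda>x. form r P e (endv x y) (endv x z))
    (\<lambda>(k, c) x. of_bool (y = Colour k) * mv r P e (endv x z) c + of_bool (z = Colour k) * mv r P e (endv x y) c)"
proof -
  have g: "poly_grad (K \<times> {..<r}) (\<lambda>x. \<Sum>a<r. endv x y a * mv r P e (endv x z) a)
    (\<lambda>kc x. \<Sum>a<r. (case kc of (k, c) \<Rightarrow> \<lambda>x. of_bool (y = Colour k \<and> c = a)) x * mv r P e (endv x z) a +
      endv x y a * (case kc of (k, c) \<Rightarrow> \<lambda>x. of_bool (z = Colour k) * (P ^\<^sub>m e) $$ (a, c)) x)"
    by (intro poly_grad_sum poly_grad_mult poly_grad_end poly_grad_mv) (use K assms in auto)
  show ?thesis
    unfolding form_mv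
  proof (rule poly_grad_cong[OF g])
    fix kc x assume "kc \<in> K \<times> {..<r}"
    then obtain k c where kc: "kc = (k, c)" "c < r" by auto
    have "(\<Sum>a<r. of_bool (y = Colour k \<and> c = a) * mv r P e (endv x z) a) = of_bool (y = Colour k) * mv r P e (endv x z) c"
      using kc by (cases "y = Colour k") (auto simp: of_bool_def if_distrib[of "\<lambda>x. x * _"] cong: if_cong)
    moreover have "(\<Sum>a<r. endv x y a * (of_bool (z = Colour k) * (P ^\<^sub>m e) $$ (a, c))) = of_bool (z = Colour k) * mv r P e (endv x y) c"
      unfolding mv_def sum_distrib_left using kc
      by (intro sum.cong) (auto simp: pow_sym[of _ c])
    ultimately show "(\<Sum>a<r. (case kc of (k, c) \<Rightarrow> \<lambda>x. of_bool (y = Colour k \<and> c = a)) x * mv r P e (endv x z) a +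
      endv x y a * (case kc of (k, c) \<Rightarrow> \<lambda>x. of_bool (z = Colour k) * (P ^\<^sub>m e) $$ (a, c)) x)
      = (case kc of (k, c) \<Rightarrow> \<lambda>x. of_bool (y = Colour k) * mv r P e (endv x z) c + of_bool (z = Colour k) * mv r P e (endv x y) c) x"
      by (simp add: kc sum.distrib)
  qed simp
qed

end

text \<open>X(k) at the left end of the edge i0 is paired with every other occurrence of X(k). Its
  own right end closes the edge to a trace; an occurrence in another edge j joins the two edges, and
  j inherits the free end \<open>q i0\<close> and both exponents, enlarged by the
  covariance.\<close>

lemma edge_exp_stein:
  fixes e :: "nat \<Rightarrow> nat" and q :: "nat \<Rightarrow> endpoint"
  assumes I: "finite I" and i0: "i0 \<in> I" and li0: "l i0 = Colour k"
  defines "J \<equiv> I - {i0}"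
  defines "e' \<equiv> \<lambda>j. e(j := Suc (e i0 + e j))"
  shows "edge_exp I l e q r P u v =
    of_bool (q i0 = Colour k) * (mtrace (P ^\<^sub>m Suc (e i0)) * edge_exp J l e q r P u v) +
    (\<Sum>j\<in>J. of_bool (l j = Colour k) * edge_exp J (l(j := q i0)) (e' j) q r P u v +
       of_bool (q j = Colour k) * edge_exp J l (e' j) (q(j := q i0)) r P u v)"
proof -
  \<comment> \<open>The copies that occur in the product; together they form the finite Gaussian
    family to which integration by parts is applied.\<close>
  define K where "K = {k. \<exists>i\<in>I. l i = Colour k \<or> q i = Colour k}"
  have "Colour ` K \<subseteq> l ` I \<union> q ` I" unfolding K_def image_def by auto metis+
  then have "finite (Colour ` K)" using I finite_subset by blast
  then have K: "finite K" by (rule finite_imageD) (simp add: inj_on_def)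
  have cl: "l i = Colour k' \<Longrightarrow> k' \<in> K" "q i = Colour k' \<Longrightarrow> k' \<in> K" if "i \<in> I" for i k'
    using that by (auto simp: K_def)
  have J: "finite J" "J \<subseteq> I" using I by (auto simp: J_def)
  let ?A = "K \<times> {..<r}"
  let ?\<xi> = "\<lambda>(X :: nat \<Rightarrow> nat \<Rightarrow> real) (k, i). X k i"
  let ?M = "gaussian_copies P"
  interpret g: gauss_family ?M ?A ?\<xi> "\<lambda>(k, i) (l, j). of_bool (k = l) * P $$ (i, j)"
    by (rule gauss_family_copies[OF psd K])
  define F where "F = (\<lambda>l e q (i :: nat) x. form r P (e i) (end_val u v x (l i)) (end_val u v x (q i)))"
  define D where "D = (\<lambda>(j :: nat) (k, c) x. of_bool (l j = Colour k) * mv r P (e j) (end_val u v x (q j)) c 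
     + of_bool (q j = Colour k) * mv r P (e j) (end_val u v x (l j)) c)"
  define V where "V = (\<lambda>a x. mv r P (e i0) (end_val u v x (q i0)) a)"
  define G where "G = (\<lambda>a x. V a x * (\<Prod>j\<in>J. F l e q j x))"
  define DG where "DG = (\<lambda>a (k, c) x. of_bool (q i0 = Colour k) * (P ^\<^sub>m (e i0)) $$ (a, c) * (\<Prod>j\<in>J. F l e q j x) 
      + V a x * (\<Sum>j\<in>J. D j (k, c) x * (\<Prod>i\<in>J - {j}. F l e q i x)))"
  have E: "edge_exp J' l' e'' q' r P u v = (\<integral>X. (\<Prod>i\<in>J'. F l' e'' q' i (?\<xi> X)) \<partial>?M)" for J' l' e'' q'
    by (simp add: edge_exp_def F_def)
  have Fpoly: "poly_grad ?A (F l' e'' q' i) (\<lambda>(k, c) x. of_bool (l' i = Colour k) * mv r P (e'' i) (end_val u v x (q' i)) c 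
     + of_bool (q' i = Colour k) * mv r P (e'' i) (end_val u v x (l' i)) c)" 
    if "\<And>k. l' i = Colour k \<Longrightarrow> k \<in> K" "\<And>k. q' i = Colour k \<Longrightarrow> k \<in> K" for l' e'' q' i
    unfolding F_def by (rule poly_grad_form[OF K that])
  have Fprod: "\<exists>D. poly_grad ?A (\<lambda>x. \<Prod>i\<in>J'. F l' e'' q' i x) D"
    if "finite J'" "\<And>i k. i \<in> J' \<Longrightarrow> l' i = Colour k \<Longrightarrow> k \<in> K" "\<And>i k. i \<in> J' \<Longrightarrow> q' i = Colour k \<Longrightarrow> k \<in> K" for J' l' e'' q'
    by (rule exI, rule poly_grad_prod[OF _ _ Fpoly]) (use that K in auto)
  have Fint: "integrable ?M (\<lambda>X. \<Prod>i\<in>J'. F l' e'' q' i (?\<xi> X))"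
    if "finite J'" "\<And>i k. i \<in> J' \<Longrightarrow> l' i = Colour k \<Longrightarrow> k \<in> K" "\<And>i k. i \<in> J' \<Longrightarrow> q' i = Colour k \<Longrightarrow> k \<in> K" for J' l' e'' q'
  proof -
    have "\<exists>D. poly_grad ?A (\<lambda>x. \<Prod>i\<in>J'. F l' e'' q' i x) D" by (rule Fprod) (use that in auto)
    then obtain D where "poly_grad ?A (\<lambda>x. \<Prod>i\<in>J'. F l' e'' q' i x) D" by blast
    from g.integrable_poly[OF this] show ?thesis .
  qed
  have Fl: "poly_grad ?A (\<lambda>x. F l e q i x) (D i)" if "i \<in> I" for i
    unfolding D_def by (rule Fpoly) (use cl that in auto)
  have Vp: "poly_grad ?A (V a) (\<lambda>(k, c) x. of_bool (q i0 = Colour k) * (P ^\<^sub>m (e i0)) $$ (a, c))" for a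
    unfolding V_def by (rule poly_grad_mv[OF K]) (use cl[OF i0] in auto)
  have Gp: "poly_grad ?A (G a) (DG a)" for a
    unfolding G_def 
    by (rule poly_grad_cong[OF poly_grad_mult[OF Vp poly_grad_prod[OF _ J(1) Fl]]])
       (use K J in \<open>auto simp: DG_def\<close>)
  have kK: "k \<in> K" using cl[OF i0] li0 by auto
  have "edge_exp I l e q r P u v = (\<integral>X. (\<Sum>a<r. ?\<xi> X (k, a) * G a (?\<xi> X)) \<partial>?M)"
    unfolding E
  proof (rule Bochner_Integration.integral_cong[OF refl])
    fix X
    have "(\<Prod>i\<in>I. F l e q i (?\<xi> X)) = F l e q i0 (?\<xi> X) * (\<Prod>i\<in>J. F l e q i (?\<xi> X))"
      unfolding J_def by (rule prod.remove[OF I i0])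
    also have "F l e q i0 (?\<xi> X) = (\<Sum>a<r. ?\<xi> X (k, a) * V a (?\<xi> X))"
      by (simp add: F_def form_mv li0 V_def)
    finally show "(\<Prod>i\<in>I. F l e q i (?\<xi> X)) = (\<Sum>a<r. ?\<xi> X (k, a) * G a (?\<xi> X))"
      by (simp add: G_def sum_distrib_right mult.assoc)
  qed
  also have "\<dots> = (\<Sum>a<r. \<integral>X. ?\<xi> X (k, a) * G a (?\<xi> X) \<partial>?M)"
    by (rule Bochner_Integration.integral_sum, rule g.integrable_var_mult[OF Gp]) (use kK in auto)
  also have "\<dots> = (\<Sum>a<r. \<Sum>c<r. P $$ (a, c) * (\<integral>X. DG a (k, c) (?\<xi> X) \<partial>?M))"
  proof (rule sum.cong[OF refl])
    fix a assume a: "a \<in> {..<r}"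
    have "(\<integral>X. ?\<xi> X (k, a) * G a (?\<xi> X) \<partial>?M) =
      (\<Sum>b\<in>?A. (case (k, a) of (k, i) \<Rightarrow> \<lambda>(l, j). of_bool (k = l) * P $$ (i, j)) b * (\<integral>X. DG a b (?\<xi> X) \<partial>?M))"
      by (rule g.stein[OF Gp]) (use kK a in auto)
    also have "\<dots> = (\<Sum>l\<in>K. \<Sum>j<r. of_bool (k = l) * (P $$ (a, j) * (\<integral>X. DG a (l, j) (?\<xi> X) \<partial>?M)))"
      by (simp add: sum.cartesian_product case_prod_unfold mult.assoc del: sum_of_bool_mult_eq sum_mult_of_bool_eq)
    also have "\<dots> = (\<Sum>l\<in>K. of_bool (k = l) * (\<Sum>j<r. P $$ (a, j) * (\<integral>X. DG a (l, j) (?\<xi> X) \<partial>?M)))"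
      by (simp only: sum_distrib_left)
    also have "\<dots> = (\<Sum>c<r. P $$ (a, c) * (\<integral>X. DG a (k, c) (?\<xi> X) \<partial>?M))"
      using kK K by (simp add: of_bool_def if_distrib[of "\<lambda>x. x * _"] cong: if_cong)
    finally show "(\<integral>X. ?\<xi> X (k, a) * G a (?\<xi> X) \<partial>?M) = \<dots>" .
  qed
  also have "\<dots> = (\<integral>X. (\<Sum>a<r. \<Sum>c<r. P $$ (a, c) * DG a (k, c) (?\<xi> X)) \<partial>?M)"
  proof -
    have "integrable ?M (\<lambda>X. DG a (k, c) (?\<xi> X))" if "c < r" for a c
      by (rule g.integrable_grad[OF Gp]) (use kK that in auto)
    then show ?thesis by (subst Bochner_Integration.integral_sum; auto)+
  qed
  also have "\<dots> = (\<integral>X. of_bool (q i0 = Colour k) * (mtrace (P ^\<^sub>m Suc (e i0)) * (\<Prod>j\<in>J. F l e q j (?\<xi> X))) +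
    (\<Sum>j\<in>J. of_bool (l j = Colour k) * (\<Prod>i\<in>J. F (l(j := q i0)) (e' j) q i (?\<xi> X)) +
       of_bool (q j = Colour k) * (\<Prod>i\<in>J. F l (e' j) (q(j := q i0)) i (?\<xi> X))) \<partial>?M)"
  proof (rule Bochner_Integration.integral_cong[OF refl])
    fix X
    define x where "x = ?\<xi> X"
    define Pi where "Pi = (\<Prod>j\<in>J. F l e q j x)"
    define Pj where "Pj = (\<lambda>j. \<Prod>i\<in>J - {j}. F l e q i x)"
    have DG: "DG a (k, c) x = of_bool (q i0 = Colour k) * (P ^\<^sub>m (e i0)) $$ (a, c) * Pi 
        + V a x * (\<Sum>j\<in>J. D j (k, c) x * Pj j)" for a c
      by (simp add: DG_def Pi_def Pj_def)
    have "(\<Sum>a<r. \<Sum>c<r. P $$ (a, c) * DG a (k, c) x) = 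
      of_bool (q i0 = Colour k) * (\<Sum>a<r. \<Sum>c<r. P $$ (a, c) * (P ^\<^sub>m (e i0)) $$ (a, c)) * Pi +
      (\<Sum>a<r. \<Sum>c<r. \<Sum>j\<in>J. V a x * P $$ (a, c) * D j (k, c) x * Pj j)"
      by (simp add: DG distrib_left sum.distrib sum_distrib_left sum_distrib_right mult_ac)
    also have "(\<Sum>a<r. \<Sum>c<r. \<Sum>j\<in>J. V a x * P $$ (a, c) * D j (k, c) x * Pj j) = 
      (\<Sum>j\<in>J. (\<Sum>a<r. \<Sum>c<r. V a x * P $$ (a, c) * D j (k, c) x) * Pj j)"
      unfolding sum_distrib_right
      by (rule trans[OF sum.cong[OF refl sum.swap] sum.swap])
    also have "\<dots> = (\<Sum>j\<in>J. of_bool (l j = Colour k) * (\<Prod>i\<in>J. F (l(j := q i0)) (e' j) q i x) +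
       of_bool (q j = Colour k) * (\<Prod>i\<in>J. F l (e' j) (q(j := q i0)) i x))"
    proof (rule sum.cong[OF refl])
      fix j assume j: "j \<in> J"
      have "(\<Sum>a<r. \<Sum>c<r. V a x * P $$ (a, c) * D j (k, c) x) = 
         of_bool (l j = Colour k) * (\<Sum>a<r. \<Sum>c<r. V a x * P $$ (a, c) * mv r P (e j) (end_val u v x (q j)) c) +
         of_bool (q j = Colour k) * (\<Sum>a<r. \<Sum>c<r. V a x * P $$ (a, c) * mv r P (e j) (end_val u v x (l j)) c)"
        unfolding D_def by (simp add: distrib_left sum.distrib sum_distrib_left mult_ac)
      also have "\<dots> = of_bool (l j = Colour k) * form r P (Suc (e i0 + e j)) (end_val u v x (q i0)) (end_val u v x (q j)) +
         of_bool (q j = Colour k) * form r P (Suc (e i0 + e j)) (end_val u v x (l j)) (end_val u v x (q i0))"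
        unfolding V_def form_contract by (simp add: form_sym[of _ "end_val u v x (l j)"])
      finally have c: "(\<Sum>a<r. \<Sum>c<r. V a x * P $$ (a, c) * D j (k, c) x) = \<dots>" .
      have upd: "(\<Prod>i\<in>J. F l' (e' j) q' i x) = F l' (e' j) q' j x * Pj j" 
        if "\<And>i. i \<noteq> j \<Longrightarrow> l' i = l i" "\<And>i. i \<noteq> j \<Longrightarrow> q' i = q i" for l' q'
      proof -
        have "(\<Prod>i\<in>J - {j}. F l' (e' j) q' i x) = Pj j"
          unfolding Pj_def using that by (intro prod.cong) (auto simp: F_def e'_def)
        then show ?thesis using prod.remove[OF J(1) j, of "\<lambda>i. F l' (e' j) q' i x"] by simp
      qed
      have "(\<Prod>i\<in>J. F (l(j := q i0)) (e' j) q i x) = F (l(j := q i0)) (e' j) q j x * Pj j"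
        by (rule upd) auto
      moreover have "(\<Prod>i\<in>J. F l (e' j) (q(j := q i0)) i x) = F l (e' j) (q(j := q i0)) j x * Pj j"
        by (rule upd) auto
      ultimately show "(\<Sum>a<r. \<Sum>c<r. V a x * P $$ (a, c) * D j (k, c) x) * Pj j =
        of_bool (l j = Colour k) * (\<Prod>i\<in>J. F (l(j := q i0)) (e' j) q i x) +
        of_bool (q j = Colour k) * (\<Prod>i\<in>J. F l (e' j) (q(j := q i0)) i x)"
        unfolding c by (simp add: F_def e'_def distrib_right mult.assoc)
    qed
    finally show "(\<Sum>a<r. \<Sum>c<r. P $$ (a, c) * DG a (k, c) (?\<xi> X)) =
      of_bool (q i0 = Colour k) * (mtrace (P ^\<^sub>m Suc (e i0)) * (\<Prod>j\<in>J. F l e q j (?\<xi> X))) +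
      (\<Sum>j\<in>J. of_bool (l j = Colour k) * (\<Prod>i\<in>J. F (l(j := q i0)) (e' j) q i (?\<xi> X)) +
       of_bool (q j = Colour k) * (\<Prod>i\<in>J. F l (e' j) (q(j := q i0)) i (?\<xi> X)))"
      unfolding trace_contract x_def[symmetric] Pi_def by (simp add: mult.assoc)
  qed
  also have "\<dots> = of_bool (q i0 = Colour k) * (mtrace (P ^\<^sub>m Suc (e i0)) * edge_exp J l e q r P u v) +
    (\<Sum>j\<in>J. of_bool (l j = Colour k) * edge_exp J (l(j := q i0)) (e' j) q r P u v +
       of_bool (q j = Colour k) * edge_exp J l (e' j) (q(j := q i0)) r P u v)"
  proof -
    have i1: "integrable ?M (\<lambda>X. \<Prod>j\<in>J. F l e q j (?\<xi> X))"
      by (rule Fint) (use J cl in auto)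
    have i2: "integrable ?M (\<lambda>X. \<Prod>i\<in>J. F (l(j := q i0)) (e' j) q i (?\<xi> X))" 
      "integrable ?M (\<lambda>X. \<Prod>i\<in>J. F l (e' j) (q(j := q i0)) i (?\<xi> X))" for j
      by (rule Fint; use J cl i0 in \<open>auto split: if_splits\<close>)+
    show ?thesis unfolding E
      using i1 i2 
      by (subst Bochner_Integration.integral_add, simp, simp, subst Bochner_Integration.integral_sum) 
        (auto simp del: of_bool_eq_0_iff)
  qed
  finally show ?thesis .
qed

end

section \<open>Trace polynomials\<close>

definition tp_eval :: "(real \<times> nat list \<times> nat) list \<Rightarrow> nat \<Rightarrow> real mat \<Rightarrow> (nat \<Rightarrow> real) \<Rightarrow> (nat \<Rightarrow> real) \<Rightarrow> real" where
  "tp_eval ts r P u v = (\<Sum>(c, bs, a)\<leftarrow>ts. c * (\<Prod>b\<leftarrow>bs. mtrace (P ^\<^sub>m b)) * form r P a u v)"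

text \<open>The list is chosen before r, P, u and v, so the coefficients are universal and the
  number of traces alone decides the order in r. The bound is strict in order that d = 0 means g =
  0.\<close>

definition trace_poly :: "nat \<Rightarrow> (nat \<Rightarrow> real mat \<Rightarrow> (nat \<Rightarrow> real) \<Rightarrow> (nat \<Rightarrow> real) \<Rightarrow> real) \<Rightarrow> bool" where
  "trace_poly d g \<longleftrightarrow> (\<exists>ts. (\<forall>(c, bs, a)\<in>set ts. length bs < d) \<and>
     (\<forall>r P u v. psd_mat r P \<longrightarrow> g r P u v = tp_eval ts r P u v))"

lemma trace_poly_cong:
  assumes "trace_poly d g" "\<And>r P u v. psd_mat r P \<Longrightarrow> g r P u v = h r P u v"
  shows "trace_poly d h"
  using assms unfolding trace_poly_def by metis

lemma trace_poly_mono: "trace_poly d g \<Longrightarrow> d \<le> d' \<Longrightarrow> trace_poly d' g"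
  unfolding trace_poly_def by (fastforce intro: less_le_trans)

lemma trace_poly_zero: "trace_poly d (\<lambda>r P u v. 0)"
  unfolding trace_poly_def by (rule exI[of _ "[]"]) (simp add: tp_eval_def)

lemma trace_poly_form: "trace_poly (Suc d) (\<lambda>r P u v. form r P a u v)"
  unfolding trace_poly_def by (rule exI[of _ "[(1, [], a)]"]) (simp add: tp_eval_def)

lemma trace_poly_add:
  assumes "trace_poly d g" "trace_poly d h"
  shows "trace_poly d (\<lambda>r P u v. g r P u v + h r P u v)"
proof -
  obtain ts ts' where "\<forall>(c, bs, a)\<in>set ts. length bs < d" "\<forall>r P u v. psd_mat r P \<longrightarrow> g r P u v = tp_eval ts r P u v"
    "\<forall>(c, bs, a)\<in>set ts'. length bs < d" "\<forall>r P u v. psd_mat r P \<longrightarrow> h r P u v = tp_eval ts' r P u v"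
    using assms unfolding trace_poly_def by blast
  then show ?thesis unfolding trace_poly_def
    by (intro exI[of _ "ts @ ts'"]) (auto simp: tp_eval_def)
qed

lemma trace_poly_cmult:
  assumes "trace_poly d g"
  shows "trace_poly d (\<lambda>r P u v. k * g r P u v)"
proof -
  obtain ts where ts: "\<forall>(c, bs, a)\<in>set ts. length bs < d" "\<forall>r P u v. psd_mat r P \<longrightarrow> g r P u v = tp_eval ts r P u v"
    using assms unfolding trace_poly_def by blast
  have "tp_eval (map (\<lambda>(c, x). (k * c, x)) ts) r P u v = k * tp_eval ts r P u v" for r P u v
    by (induction ts) (auto simp: tp_eval_def algebra_simps)
  then show ?thesis using ts unfolding trace_poly_def
    by (intro exI[of _ "map (\<lambda>(c, x). (k * c, x)) ts"]) auto
qed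

lemma trace_poly_trace_mult:
  assumes "trace_poly d g"
  shows "trace_poly (Suc d) (\<lambda>r P u v. mtrace (P ^\<^sub>m b) * g r P u v)"
proof -
  obtain ts where ts: "\<forall>(c, bs, a)\<in>set ts. length bs < d" "\<forall>r P u v. psd_mat r P \<longrightarrow> g r P u v = tp_eval ts r P u v"
    using assms unfolding trace_poly_def by blast
  have "tp_eval (map (\<lambda>(c, bs, a). (c, b # bs, a)) ts) r P u v = mtrace (P ^\<^sub>m b) * tp_eval ts r P u v" for r P u v
    by (induction ts) (auto simp: tp_eval_def algebra_simps)
  then show ?thesis using ts unfolding trace_poly_def
    by (intro exI[of _ "map (\<lambda>(c, bs, a). (c, b # bs, a)) ts"]) auto
qed

lemma trace_poly_sum:
  assumes "\<And>i. i \<in> I \<Longrightarrow> trace_poly d (g i)"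
  shows "trace_poly d (\<lambda>r P u v. \<Sum>i\<in>I. g i r P u v)"
  using assms by (induction I rule: infinite_finite_induct) (auto simp: trace_poly_zero trace_poly_add)

section \<open>The number of traces in a contraction\<close>

text \<open>Twice the share of an edge in the possible number of traces: 2 if it can close up at
  once, 1 if it needs at least one other edge to close, 0 if it ends in u or v, since it then
  belongs to the path from u to v.\<close>

definition edge_wt :: "endpoint \<Rightarrow> endpoint \<Rightarrow> nat" where
  "edge_wt y z = (if y \<in> {LeftEnd, RightEnd} \<or> z \<in> {LeftEnd, RightEnd} then 0 else if y = z then 2 else 1)"

lemma edge_wt_sym: "edge_wt y z = edge_wt z y"
  by (simp add: edge_wt_def)

text \<open>This is the inequality behind joining an edge from k to y and an edge from k to z along
  k.\<close>

lemma edge_wt_triangle: "edge_wt y z \<le> edge_wt (Colour k) y + edge_wt (Colour k) z"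
  by (auto simp: edge_wt_def)

lemma edge_exp_cong:
  assumes "\<And>i. i \<in> I \<Longrightarrow> l i = l' i" "\<And>i. i \<in> I \<Longrightarrow> e i = e' i" "\<And>i. i \<in> I \<Longrightarrow> q i = q' i"
  shows "edge_exp I l e q = edge_exp I l' e' q'"
  unfolding edge_exp_def using assms by (auto cong: prod.cong)

lemma edge_exp_flip:
  assumes "psd_mat r P"
  shows "edge_exp I (l(j := q j)) e (q(j := l j)) r P u v = edge_exp I l e q r P u v"
  unfolding edge_exp_def
  by (intro Bochner_Integration.integral_cong refl prod.cong) (auto simp: form_sym[OF assms])

lemma edge_exp_const:
  assumes "psd_mat r P"
  shows "l i = LeftEnd \<Longrightarrow> q i = RightEnd \<Longrightarrow> edge_exp {i} l e q r P u v = form r P (e i) u v"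
    and "l i = RightEnd \<Longrightarrow> q i = LeftEnd \<Longrightarrow> edge_exp {i} l e q r P u v = form r P (e i) u v"
proof -
  interpret prob_space "gaussian_copies P"
    unfolding gaussian_copies_def by (intro prob_space_PiM gauss_family_vector(2)[OF assms])
  show "edge_exp {i} l e q r P u v = form r P (e i) u v" if "l i = LeftEnd" "q i = RightEnd"
    unfolding edge_exp_def by (simp add: that prob_space end_val.simps form_def)
  show "edge_exp {i} l e q r P u v = form r P (e i) u v" if "l i = RightEnd" "q i = LeftEnd"
    using form_sym[OF assms, of "e i" u v]
    unfolding edge_exp_def by (simp add: that prob_space end_val.simps form_def)
qed

text \<open>A contraction merges two edges or closes a loop. Merging does not increase the total weight and
  closing a loop removes an edge of weight two, so there are at most half as many traces as the weight.\<close>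

lemma edge_exp_trace_poly:
  assumes "finite I"
    and "(\<Sum>i\<in>I. of_bool (l i = LeftEnd) + of_bool (q i = LeftEnd)) = (1 :: nat)"
    and "(\<Sum>i\<in>I. of_bool (l i = RightEnd) + of_bool (q i = RightEnd)) = (1 :: nat)"
  shows "trace_poly (Suc ((\<Sum>i\<in>I. edge_wt (l i) (q i)) div 2)) (edge_exp I l e q)"
  using assms
proof (induction "card I" arbitrary: I l e q rule: less_induct)
  case less
  define Bound where "Bound = (\<lambda>(I :: nat set) l q. Suc ((\<Sum>i\<in>I. edge_wt (l i) (q i)) div 2))"
  \<comment> \<open>Stated for arbitrary l and q, because the case of a Gaussian vector at a right
    end is reduced to it by flipping the edge.\<close>
  have main: "trace_poly (Bound I l q) (edge_exp I l e q)"
    if i0: "i0 \<in> I" and li0: "l i0 = Colour k"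
      and LE: "(\<Sum>i\<in>I. of_bool (l i = LeftEnd) + of_bool (q i = LeftEnd)) = (1 :: nat)"
      and RE: "(\<Sum>i\<in>I. of_bool (l i = RightEnd) + of_bool (q i = RightEnd)) = (1 :: nat)"
    for l q and i0 k
  proof -
    define J where "J = I - {i0}"
    have fJ: "finite J" and cJ: "card J < card I" 
      unfolding J_def using less.prems(1) card_Diff1_less[OF less.prems(1) i0] by simp_all
    define e' where "e' = (\<lambda>j. e(j := Suc (e i0 + e j)))"
    have split_I: "(\<Sum>i\<in>I. h (l i) (q i)) = h (l i0) (q i0) + (\<Sum>i\<in>J. h (l i) (q i))" for h :: "_ \<Rightarrow> _ \<Rightarrow> nat"
      unfolding J_def by (rule sum.remove[OF less.prems(1) i0])
    have split_J: "(\<Sum>i\<in>J. h (l' i) (q' i)) = h (l' j) (q' j) + (\<Sum>i\<in>J - {j}. h (l i) (q i))"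
      if "j \<in> J" "\<And>i. i \<noteq> j \<Longrightarrow> l' i = l i" "\<And>i. i \<noteq> j \<Longrightarrow> q' i = q i" for h :: "_ \<Rightarrow> _ \<Rightarrow> nat" and j l' q'
      unfolding sum.remove[OF fJ that(1)] using that(2,3) by (auto intro!: sum.cong)
    have upd: "trace_poly (Bound I l q) (edge_exp J l' e'' q')"
      if j: "j \<in> J" and lq: "\<And>i. i \<noteq> j \<Longrightarrow> l' i = l i" "\<And>i. i \<noteq> j \<Longrightarrow> q' i = q i" 
        and le: "edge_wt (l' j) (q' j) \<le> edge_wt (l i0) (q i0) + edge_wt (l j) (q j)"
        and oc: "\<And>x. x \<in> {LeftEnd, RightEnd} \<Longrightarrow> of_bool (l' j = x) + of_bool (q' j = x) = 
           (of_bool (l i0 = x) + of_bool (q i0 = x)) + (of_bool (l j = x) + of_bool (q j = x) :: nat)"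
      for j l' q' e''
    proof -
      have s1: "(\<Sum>i\<in>J. h (l' i) (q' i)) = h (l' j) (q' j) + (\<Sum>i\<in>J - {j}. h (l i) (q i))" for h :: "_ \<Rightarrow> _ \<Rightarrow> nat"
        by (rule split_J[OF j]) (use lq in auto)
      have s2: "(\<Sum>i\<in>J. h (l i) (q i)) = h (l j) (q j) + (\<Sum>i\<in>J - {j}. h (l i) (q i))" for h :: "_ \<Rightarrow> _ \<Rightarrow> nat"
        by (rule split_J[OF j]) auto
      have "trace_poly (Bound J l' q') (edge_exp J l' e'' q')"
        unfolding Bound_def
      proof (rule less.hyps[OF cJ fJ])
        show "(\<Sum>i\<in>J. of_bool (l' i = LeftEnd) + of_bool (q' i = LeftEnd)) = (1 :: nat)"
          using LE oc[of LeftEnd]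
          unfolding split_I[of "\<lambda>y z. of_bool (y = LeftEnd) + of_bool (z = LeftEnd)"]
            s1[of "\<lambda>y z. of_bool (y = LeftEnd) + of_bool (z = LeftEnd)"]
            s2[of "\<lambda>y z. of_bool (y = LeftEnd) + of_bool (z = LeftEnd)"]
          by simp
        show "(\<Sum>i\<in>J. of_bool (l' i = RightEnd) + of_bool (q' i = RightEnd)) = (1 :: nat)"
          using RE oc[of RightEnd]
          unfolding split_I[of "\<lambda>y z. of_bool (y = RightEnd) + of_bool (z = RightEnd)"]
            s1[of "\<lambda>y z. of_bool (y = RightEnd) + of_bool (z = RightEnd)"]
            s2[of "\<lambda>y z. of_bool (y = RightEnd) + of_bool (z = RightEnd)"]
          by simp
      qed
      moreover have "Bound J l' q' \<le> Bound I l q"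
        unfolding Bound_def split_I[of edge_wt] s1[of edge_wt]
          s2[of edge_wt]
        using le by (intro Suc_le_mono[THEN iffD2] div_le_mono) simp
      ultimately show ?thesis by (rule trace_poly_mono)
    qed
    have tr: "trace_poly (Bound I l q) (\<lambda>r P u v. of_bool (q i0 = Colour k) * (mtrace (P ^\<^sub>m Suc (e i0)) * edge_exp J l e q r P u v))"
    proof (cases "q i0 = Colour k")
      case True
      have "trace_poly (Bound J l q) (edge_exp J l e q)"
        unfolding Bound_def
        using LE RE unfolding split_I[of "\<lambda>y z. of_bool (y = LeftEnd) + of_bool (z = LeftEnd)"]
          split_I[of "\<lambda>y z. of_bool (y = RightEnd) + of_bool (z = RightEnd)"] 
        by (intro less.hyps[OF cJ fJ]) (simp_all add: True li0)
      moreover have "Suc (Bound J l q) = Bound I l q"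
        unfolding Bound_def split_I[of edge_wt] by (simp add: True li0 edge_wt_def)
      ultimately show ?thesis using trace_poly_trace_mult[of "Bound J l q" "edge_exp J l e q" "Suc (e i0)"] True
        by simp
    qed (simp add: trace_poly_zero)
    have "trace_poly (Bound I l q) (\<lambda>r P u v. of_bool (l j = Colour k) * edge_exp J (l(j := q i0)) (e' j) q r P u v)"
      if "j \<in> J" for j
    proof (cases "l j = Colour k")
      case True
      have "trace_poly (Bound I l q) (edge_exp J (l(j := q i0)) (e' j) q)"
        by (rule upd[OF that]) (use True li0 edge_wt_triangle[of "q i0" "q j" k] in auto)
      then show ?thesis using True by simp
    qed (simp add: trace_poly_zero)
    moreover have "trace_poly (Bound I l q) (\<lambda>r P u v. of_bool (q j = Colour k) * edge_exp J l (e' j) (q(j := q i0)) r P u v)"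
      if "j \<in> J" for j
    proof (cases "q j = Colour k")
      case True
      have "trace_poly (Bound I l q) (edge_exp J l (e' j) (q(j := q i0)))"
        by (rule upd[OF that])
          (use True li0 edge_wt_triangle[of "q i0" "l j" k] in \<open>auto simp: edge_wt_sym[of "l j"]\<close>)
      then show ?thesis using True by simp
    qed (simp add: trace_poly_zero)
    ultimately have "trace_poly (Bound I l q) (\<lambda>r P u v. 
      of_bool (q i0 = Colour k) * (mtrace (P ^\<^sub>m Suc (e i0)) * edge_exp J l e q r P u v) +
      (\<Sum>j\<in>J. of_bool (l j = Colour k) * edge_exp J (l(j := q i0)) (e' j) q r P u v +
       of_bool (q j = Colour k) * edge_exp J l (e' j) (q(j := q i0)) r P u v))"
      by (intro trace_poly_add trace_poly_sum tr)
    then show ?thesis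
      by (rule trace_poly_cong) (use edge_exp_stein[where l = l and k = k, OF _ less.prems(1) i0 li0] in \<open>simp add: J_def e'_def\<close>)
  qed
  consider i k where "i \<in> I" "l i = Colour k" | i k where "i \<in> I" "q i = Colour k" 
    | "\<And>i. i \<in> I \<Longrightarrow> l i \<in> {LeftEnd, RightEnd} \<and> q i \<in> {LeftEnd, RightEnd}"
    by (metis endpoint.exhaust insertCI)
  then show ?case
  proof cases
    case 1
    then show ?thesis using main[OF 1 less.prems(2,3)] by (simp add: Bound_def)
  next
    case (2 j k)
    have inv: "(\<Sum>i\<in>I. h ((l(j := q j)) i) ((q(j := l j)) i)) = (\<Sum>i\<in>I. h (l i) (q i))" 
      if "\<And>y z. h y z = h z y" for h :: "_ \<Rightarrow> _ \<Rightarrow> nat"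
      using that by (intro sum.cong) auto
    have "trace_poly (Bound I (l(j := q j)) (q(j := l j))) (edge_exp I (l(j := q j)) e (q(j := l j)))"
    proof (rule main[OF 2(1)])
      show "(l(j := q j)) j = Colour k" using 2 by simp
      show "(\<Sum>i\<in>I. of_bool ((l(j := q j)) i = LeftEnd) + of_bool ((q(j := l j)) i = LeftEnd)) = (1 :: nat)"
        using less.prems(2) by (subst inv[of "\<lambda>y z. of_bool (y = LeftEnd) + of_bool (z = LeftEnd)"]) auto
      show "(\<Sum>i\<in>I. of_bool ((l(j := q j)) i = RightEnd) + of_bool ((q(j := l j)) i = RightEnd)) = (1 :: nat)"
        using less.prems(3) by (subst inv[of "\<lambda>y z. of_bool (y = RightEnd) + of_bool (z = RightEnd)"]) auto
    qed
    moreover have "Bound I (l(j := q j)) (q(j := l j)) = Bound I l q"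
      unfolding Bound_def using inv[of edge_wt] edge_wt_sym by simp
    ultimately have "trace_poly (Bound I l q) (edge_exp I (l(j := q j)) e (q(j := l j)))" by (simp only:)
    then have "trace_poly (Bound I l q) (edge_exp I l e q)"
      by (rule trace_poly_cong) (rule edge_exp_flip)
    then show ?thesis by (simp add: Bound_def)
  next
    \<comment> \<open>No Gaussian vector is left; as u and v occur once each, there is exactly one
      edge, and it joins them.\<close>
    case 3
    have "(\<Sum>i\<in>I. of_bool (l i = LeftEnd) + of_bool (q i = LeftEnd)) + 
      (\<Sum>i\<in>I. of_bool (l i = RightEnd) + of_bool (q i = RightEnd)) = (\<Sum>i\<in>I. 2 :: nat)"
      unfolding sum.distrib[symmetric] using 3 by (intro sum.cong) force+
    then have "card I = 1" using less.prems(2,3) by simp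
    then obtain i where i: "I = {i}" by (auto simp: card_1_singleton_iff)
    have "l i = LeftEnd \<and> q i = RightEnd \<or> l i = RightEnd \<and> q i = LeftEnd"
      using 3[of i] less.prems(2,3) by (auto simp: i)
    then show ?thesis
      by (intro trace_poly_cong[OF trace_poly_form[of _ "e i"]]) (auto simp: i edge_exp_const)
  qed
qed

section \<open>Words in the Gaussian matrix\<close>

text \<open>By the chain rule the covariance c turns into L c L'; this is how H inherits integration
  by parts from the entries of W.\<close>

lemma (in gauss_family) linear_image:
  fixes L :: "'b \<Rightarrow> 'a \<Rightarrow> real"
  assumes B: "finite B"
  shows "gauss_family M B (\<lambda>\<omega> i. \<Sum>a\<in>A. L i a * \<xi> \<omega> a) (\<lambda>i j. \<Sum>a\<in>A. \<Sum>b\<in>A. L i a * c a b * L j b)"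
proof
  define T where "T = (\<lambda>x i. \<Sum>a\<in>A. L i a * x a)"
  have pg: "poly_grad A (\<lambda>x. mval B \<alpha> (T x)) (\<lambda>b x. \<Sum>i\<in>B. dmval B i \<alpha> (T x) * L i b)" for \<alpha>
    unfolding T_def by (rule poly_grad_linear_image[OF B fin])
  have int: "integrable M (\<lambda>\<omega>. mval B \<alpha> (T (\<xi> \<omega>)))" for \<alpha>
    by (rule integrable_poly[OF pg])
  have intd: "integrable M (\<lambda>\<omega>. dmval B i \<alpha> (T (\<xi> \<omega>)))" for i \<alpha>
    unfolding dmval_def using int by auto
  show "finite B" by fact
  show "integrable M (\<lambda>\<omega>. mval B \<alpha> (\<lambda>i. \<Sum>a\<in>A. L i a * \<xi> \<omega> a))" for \<alpha>
    using int[of \<alpha>] by (simp add: T_def)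
  fix i \<alpha> assume "i \<in> B"
  have "(\<integral>\<omega>. T (\<xi> \<omega>) i * mval B \<alpha> (T (\<xi> \<omega>)) \<partial>M) = (\<integral>\<omega>. (\<Sum>a\<in>A. L i a * (\<xi> \<omega> a * mval B \<alpha> (T (\<xi> \<omega>)))) \<partial>M)"
    by (simp add: T_def sum_distrib_right mult.assoc)
  also have "\<dots> = (\<Sum>a\<in>A. L i a * (\<integral>\<omega>. \<xi> \<omega> a * mval B \<alpha> (T (\<xi> \<omega>)) \<partial>M))"
    by (subst Bochner_Integration.integral_sum) (auto intro!: integrable_var_mult[OF pg])
  also have "\<dots> = (\<Sum>a\<in>A. \<Sum>b\<in>A. \<Sum>j\<in>B. L i a * c a b * L j b * (\<integral>\<omega>. dmval B j \<alpha> (T (\<xi> \<omega>)) \<partial>M))"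
  proof (intro sum.cong refl)
    fix a assume a: "a \<in> A"
    have "(\<integral>\<omega>. (\<Sum>j\<in>B. dmval B j \<alpha> (T (\<xi> \<omega>)) * L j b) \<partial>M) = (\<Sum>j\<in>B. (\<integral>\<omega>. dmval B j \<alpha> (T (\<xi> \<omega>)) \<partial>M) * L j b)" for b
      by (subst Bochner_Integration.integral_sum) (auto intro!: intd)
    then show "L i a * (\<integral>\<omega>. \<xi> \<omega> a * mval B \<alpha> (T (\<xi> \<omega>)) \<partial>M) =
        (\<Sum>b\<in>A. \<Sum>j\<in>B. L i a * c a b * L j b * (\<integral>\<omega>. dmval B j \<alpha> (T (\<xi> \<omega>)) \<partial>M))"
      unfolding stein[OF pg a] by (simp add: sum_distrib_left mult_ac)
  qed
  also have "\<dots> = (\<Sum>j\<in>B. (\<Sum>a\<in>A. \<Sum>b\<in>A. L i a * c a b * L j b) * (\<integral>\<omega>. dmval B j \<alpha> (T (\<xi> \<omega>)) \<partial>M))"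
  proof -
    let ?f = "\<lambda>a b j. L i a * c a b * L j b * (\<integral>\<omega>. dmval B j \<alpha> (T (\<xi> \<omega>)) \<partial>M)"
    have "(\<Sum>a\<in>A. \<Sum>b\<in>A. \<Sum>j\<in>B. ?f a b j) = (\<Sum>a\<in>A. \<Sum>j\<in>B. \<Sum>b\<in>A. ?f a b j)"
      by (intro sum.cong refl sum.swap)
    also have "\<dots> = (\<Sum>j\<in>B. \<Sum>a\<in>A. \<Sum>b\<in>A. ?f a b j)" by (rule sum.swap)
    finally show ?thesis by (simp add: sum_distrib_right)
  qed
  finally show "(\<integral>\<omega>. (\<Sum>a\<in>A. L i a * \<xi> \<omega> a) * mval B \<alpha> (\<lambda>i. \<Sum>a\<in>A. L i a * \<xi> \<omega> a) \<partial>M) =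
      (\<Sum>j\<in>B. (\<Sum>a\<in>A. \<Sum>b\<in>A. L i a * c a b * L j b) * (\<integral>\<omega>. dmval B j \<alpha> (\<lambda>i. \<Sum>a\<in>A. L i a * \<xi> \<omega> a) \<partial>M))"
    by (simp add: T_def)
qed

section \<open>The entries of H\<close>

definition H_ent :: "real mat \<Rightarrow> (nat \<times> nat \<Rightarrow> real) \<Rightarrow> nat \<times> nat \<Rightarrow> real" where
  "H_ent P w = (\<lambda>(i, j). H_mat P w $$ (i, j))"

text \<open>The covariance of the entries of H. The entries of XX' - P have the same one
  (\<open>gaussian_law_moments\<close>), which is the reason for the exact equality of the central
  moments.\<close>

definition H_cov :: "real mat \<Rightarrow> nat \<times> nat \<Rightarrow> nat \<times> nat \<Rightarrow> real" where
  "H_cov P = (\<lambda>(a, b) (c, d). P $$ (a, c) * P $$ (b, d) + P $$ (a, d) * P $$ (b, c))"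

lemma H_mat_entry:
  assumes psd: "psd_mat r P" and ij: "i < r" "j < r"
  shows "H_mat P w $$ (i, j) = (\<Sum>(c, d)\<in>{..<r} \<times> {..<r}.
     (psd_sqrt P $$ (i, c) * psd_sqrt P $$ (d, j) + psd_sqrt P $$ (i, d) * psd_sqrt P $$ (c, j)) / sqrt 2 * w (c, d))"
proof -
  define S where "S = psd_sqrt P"
  have S: "S \<in> carrier_mat r r" using psd_matD(1)[OF psd_sqrt(1)[OF psd]] by (simp add: S_def)
  define W where "W = (1 / sqrt 2) \<cdot>\<^sub>m (mat r r w + transpose_mat (mat r r w))"
  have W: "W \<in> carrier_mat r r" by (simp add: W_def)
  have SW: "S * W \<in> carrier_mat r r" using S W by simp
  have e: "(S * W) $$ (i, d) = (\<Sum>c<r. S $$ (i, c) * ((w (c, d) + w (d, c)) / sqrt 2))" if "d < r" for d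
    unfolding mult_mat_index[OF S W ij(1) that] using that by (intro sum.cong) (auto simp: W_def)
  have "H_mat P w $$ (i, j) = (S * W * S) $$ (i, j)"
    using psd_matD(3)[OF psd] by (simp add: H_mat_def Let_def S_def W_def)
  also have "\<dots> = (\<Sum>d<r. \<Sum>c<r. S $$ (i, c) * ((w (c, d) + w (d, c)) / sqrt 2) * S $$ (d, j))"
    unfolding mult_mat_index[OF SW S ij]
    by (intro sum.cong refl) (simp add: e sum_distrib_right)
  also have "\<dots> = (\<Sum>d<r. \<Sum>c<r. S $$ (i, c) * S $$ (d, j) / sqrt 2 * w (c, d)) + (\<Sum>d<r. \<Sum>c<r. S $$ (i, c) * S $$ (d, j) / sqrt 2 * w (d, c))"
    unfolding sum.distrib[symmetric] by (intro sum.cong refl) (simp add: algebra_simps add_divide_distrib)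
  also have "(\<Sum>d<r. \<Sum>c<r. S $$ (i, c) * S $$ (d, j) / sqrt 2 * w (c, d)) = (\<Sum>c<r. \<Sum>d<r. S $$ (i, c) * S $$ (d, j) / sqrt 2 * w (c, d))"
    by (rule sum.swap)
  finally show ?thesis
    unfolding sum.cartesian_product[symmetric] S_def[symmetric] sum.distrib[symmetric]
    by (simp add: algebra_simps add_divide_distrib)
qed

lemma H_mat_carrier: "psd_mat r P \<Longrightarrow> H_mat P w \<in> carrier_mat r r"
  using psd_matD(1)[OF psd_sqrt(1), of r P] psd_matD(3)[of r P]
  by (auto simp: H_mat_def Let_def intro!: mult_carrier_mat[of _ r r])

lemma H_ent_sym:
  assumes psd: "psd_mat r P" and ij: "i < r" "j < r"
  shows "H_ent P w (i, j) = H_ent P w (j, i)"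
proof -
  have sym: "psd_sqrt P $$ (a, b) = psd_sqrt P $$ (b, a)" if "a < r" "b < r" for a b
    using psd_matD(1,2)[OF psd_sqrt(1)[OF psd]] that by (metis carrier_matD index_transpose_mat(1))
  show ?thesis
    unfolding H_ent_def prod.case H_mat_entry[OF psd ij] H_mat_entry[OF psd ij(2,1)]
    by (intro sum.cong refl) (auto simp: sym ij mult_ac add_ac)
qed

text \<open>H is linear in W, so only its covariance has to be computed.\<close>

lemma gauss_family_H:
  assumes psd: "psd_mat r P"
  shows "gauss_family (gauss_entries r) ({..<r} \<times> {..<r}) (H_ent P) (H_cov P)"
proof -
  let ?A = "{..<r} \<times> {..<r}"
  define S where "S = (\<lambda>a b. psd_sqrt P $$ (a, b))"
  define L where "L = (\<lambda>(i, j) (c, d). (S i c * S d j + S i d * S c j) / sqrt 2)"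
  have fin: "finite ?A" by simp
  interpret z: gauss_family "gauss_entries r" ?A "\<lambda>\<omega>. \<omega>" "\<lambda>a b. of_bool (a = b)"
    unfolding gauss_entries_def by (rule gauss_family_iid[OF fin])
  have sym: "S a b = S b a" if "a < r" "b < r" for a b
    using psd_matD(1,2)[OF psd_sqrt(1)[OF psd]] that unfolding S_def by (metis carrier_matD index_transpose_mat(1))
  have H: "H_ent P w ij = (\<Sum>a\<in>?A. L ij a * w a)" if "ij \<in> ?A" for ij w
    using that H_mat_entry[OF psd, of "fst ij" "snd ij" w]
    by (auto simp: H_ent_def L_def S_def case_prod_unfold)
  have SS: "(\<Sum>c<r. S i c * S k c) = P $$ (i, k)" if "i < r" "k < r" for i k
    using sqrt_entries[OF psd that] by (simp add: S_def)
  have C: "(\<Sum>a\<in>?A. \<Sum>b\<in>?A. L x a * of_bool (a = b) * L y b) = H_cov P x y" if xy: "x \<in> ?A" "y \<in> ?A" for x y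
  proof -
    obtain i j k l where e: "x = (i, j)" "y = (k, l)" "i < r" "j < r" "k < r" "l < r" using xy by auto
    have "(\<Sum>a\<in>?A. \<Sum>b\<in>?A. L x a * of_bool (a = b) * L y b) = (\<Sum>a\<in>?A. L x a * L y a)"
      by (intro sum.cong refl) (simp add: of_bool_def if_distrib[of "\<lambda>x. _ * x"] if_distrib[of "\<lambda>x. x * _"] cong: if_cong)
    also have "\<dots> = (\<Sum>c<r. \<Sum>d<r. L x (c, d) * L y (c, d))"
      by (simp add: sum.cartesian_product case_prod_unfold)
    \<comment> \<open>The two factors 1 / sqrt 2 give 1/2. After summation the four terms agree in
      pairs, which leaves two terms with coefficient 1.\<close>
    also have "\<dots> = (\<Sum>c<r. \<Sum>d<r. 1/2 * ((S i c * S k c) * (S j d * S l d)) + 1/2 * ((S i c * S l c) * (S j d * S k d))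
        + 1/2 * ((S j c * S k c) * (S i d * S l d)) + 1/2 * ((S j c * S l c) * (S i d * S k d)))"
      unfolding e L_def prod.case
      using e by (intro sum.cong refl) (simp add: sym[of _ j] sym[of _ l] field_simps)
    also have "\<dots> = H_cov P x y"
      unfolding sum.distrib sum_distrib_left[symmetric]
      using e by (simp add: H_cov_def SS sum_distrib_right[symmetric])
    finally show ?thesis .
  qed
  interpret l: gauss_family "gauss_entries r" ?A "\<lambda>\<omega> i. \<Sum>a\<in>?A. L i a * \<omega> a" "\<lambda>i j. \<Sum>a\<in>?A. \<Sum>b\<in>?A. L i a * of_bool (a = b) * L j b"
    by (rule z.linear_image[OF fin])
  have m: "mval ?A \<alpha> (H_ent P w) = mval ?A \<alpha> (\<lambda>i. \<Sum>a\<in>?A. L i a * w a)" for \<alpha> w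
    unfolding mval_def by (intro prod.cong refl arg_cong2[where f = "(^)"] H)
  show ?thesis
  proof
    show "integrable (gauss_entries r) (\<lambda>\<omega>. mval ?A \<alpha> (H_ent P \<omega>))" for \<alpha>
      unfolding m by (rule l.integrable_mval)
    show "(\<integral>\<omega>. H_ent P \<omega> a * mval ?A \<alpha> (H_ent P \<omega>) \<partial>gauss_entries r) =
       (\<Sum>b\<in>?A. H_cov P a b * (\<integral>\<omega>. dmval ?A b \<alpha> (H_ent P \<omega>) \<partial>gauss_entries r))" if "a \<in> ?A" for a \<alpha>
      unfolding dmval_def m H[OF that] using l.stein_mon[OF that, of \<alpha>] C[OF that] unfolding dmval_def by simp
  qed (rule fin)
qed

text \<open>The letters \<open>PL\<close>, \<open>HL\<close>, \<open>RL\<close>, \<open>RT\<close> stand for \<open>P\<close>, \<open>H\<close>, \<open>R = v u'\<close> and \<open>R'\<close>. Since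
  \<open>u' A v = Tr(R A)\<close>, bilinear forms are traces of words too, and all words are cyclic.\<close>

datatype letter = PL | HL | RL | RT

fun lent :: "real mat \<Rightarrow> (nat \<Rightarrow> real) \<Rightarrow> (nat \<Rightarrow> real) \<Rightarrow> (nat \<times> nat \<Rightarrow> real) \<Rightarrow> letter \<Rightarrow> nat \<Rightarrow> nat \<Rightarrow> real" where
  "lent P u v x PL a b = P $$ (a, b)"
| "lent P u v x HL a b = x (a, b)"
| "lent P u v x RL a b = v a * u b"
| "lent P u v x RT a b = u a * v b"

fun flip :: "letter \<Rightarrow> letter" where
  "flip RL = RT" | "flip RT = RL" | "flip z = z"

text \<open>The word of the transposed matrix: P and H are symmetric, R and R' are
  exchanged.\<close>

definition wrev :: "letter list \<Rightarrow> letter list" where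
  "wrev w = rev (map flip w)"

section \<open>Entries and traces of words, and their derivatives\<close>

primrec wm :: "nat \<Rightarrow> real mat \<Rightarrow> (nat \<Rightarrow> real) \<Rightarrow> (nat \<Rightarrow> real) \<Rightarrow> (nat \<times> nat \<Rightarrow> real) \<Rightarrow> letter list \<Rightarrow> nat \<Rightarrow> nat \<Rightarrow> real" where
  "wm r P u v x [] a b = of_bool (a = b)"
| "wm r P u v x (z # w) a b = (\<Sum>c<r. lent P u v x z a c * wm r P u v x w c b)"

definition wt :: "nat \<Rightarrow> real mat \<Rightarrow> (nat \<Rightarrow> real) \<Rightarrow> (nat \<Rightarrow> real) \<Rightarrow> (nat \<times> nat \<Rightarrow> real) \<Rightarrow> letter list \<Rightarrow> real" where
  "wt r P u v x w = (\<Sum>a<r. wm r P u v x w a a)"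

lemma wm_append: "a < r \<Longrightarrow> wm r P u v x (w @ w') a b = (\<Sum>c<r. wm r P u v x w a c * wm r P u v x w' c b)"
proof (induction w arbitrary: a)
  case Nil
  then show ?case by (simp add: of_bool_def if_distrib[of "\<lambda>x. x * _"] cong: if_cong)
next
  case (Cons z w)
  then show ?case by (simp add: sum_distrib_left sum_distrib_right mult.assoc) (rule sum.swap)
qed

lemma wt_rotate: "wt r P u v x (w @ w') = wt r P u v x (w' @ w)"
  unfolding wt_def
  by (simp add: wm_append) (subst sum.swap, simp add: mult.commute)

lemma wm_single: "b < r \<Longrightarrow> wm r P u v x [z] a b = lent P u v x z a b"
  by (simp add: of_bool_def if_distrib[of "\<lambda>x. _ * x"] cong: if_cong)

lemma wm_wrev:
  assumes "\<And>a b. a < r \<Longrightarrow> b < r \<Longrightarrow> P $$ (a, b) = P $$ (b, a)" "\<And>a b. a < r \<Longrightarrow> b < r \<Longrightarrow> x (a, b) = x (b, a)"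
  shows "a < r \<Longrightarrow> b < r \<Longrightarrow> wm r P u v x (wrev w) a b = wm r P u v x w b a"
proof (induction w arbitrary: a b)
  case Nil
  then show ?case by (auto simp: wrev_def)
next
  case (Cons z w)
  have fl: "lent P u v x (flip z) c b = lent P u v x z b c" if "c < r" for c
    using assms that Cons.prems by (cases z) auto
  have "wrev (z # w) = wrev w @ [flip z]" by (simp add: wrev_def)
  then show ?case using Cons by (simp add: wm_append wm_single fl mult.commute del: wm.simps(2))
      (simp add: mult.commute)
qed

text \<open>The rest of a cyclic word once its letter i is removed, read from the successor of that
  letter on.\<close>

definition sdr :: "nat \<Rightarrow> 'a list \<Rightarrow> 'a list" where
  "sdr i w = drop (Suc i) w @ take i w"

context
  fixes r :: nat and P :: "real mat" and u v :: "nat \<Rightarrow> real"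
  assumes psd: "psd_mat r P"
begin

lemma poly_grad_lent:
  assumes "a < r" "b < r"
  shows "poly_grad ({..<r} \<times> {..<r}) (\<lambda>x. lent P u v x z a b) (\<lambda>(c, d) x. of_bool (z = HL) * of_bool (c = a) * of_bool (d = b))"
proof (cases "z = HL")
  case True
  then show ?thesis
    by (intro poly_grad_cong[OF poly_grad_var[of _ "(a, b)"]]) (use assms in auto)
next
  case False
  then obtain k where "\<And>x. lent P u v x z a b = k" by (cases z) auto
  then show ?thesis using False by (intro poly_grad_cong[OF poly_grad_const[of _ k]]) auto
qed

lemma poly_grad_wm:
  assumes "a < r" "b < r"
  shows "poly_grad ({..<r} \<times> {..<r}) (\<lambda>x. wm r P u v x w a b)
    (\<lambda>(c, d) x. \<Sum>i<length w. of_bool (w ! i = HL) * (wm r P u v x (take i w) a c * wm r P u v x (drop (Suc i) w) d b))"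
  using assms
proof (induction w arbitrary: a)
  case Nil
  show ?case by (rule poly_grad_cong[OF poly_grad_const]) auto
next
  case (Cons z w)
  have "poly_grad ({..<r} \<times> {..<r}) (\<lambda>x. \<Sum>c'<r. lent P u v x z a c' * wm r P u v x w c' b)
    (\<lambda>b' x. \<Sum>c'<r. (case b' of (c, d) \<Rightarrow> \<lambda>x. of_bool (z = HL) * of_bool (c = a) * of_bool (d = c')) x * wm r P u v x w c' b
     + lent P u v x z a c' * (case b' of (c, d) \<Rightarrow> \<lambda>x. \<Sum>i<length w. of_bool (w ! i = HL) * (wm r P u v x (take i w) c' c * wm r P u v x (drop (Suc i) w) d b)) x)"
    by (intro poly_grad_sum poly_grad_mult poly_grad_lent Cons) (use Cons.prems in auto)
  then show ?case
    unfolding wm.simps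
  proof (rule poly_grad_cong)
    fix cd x assume "cd \<in> {..<r} \<times> {..<r}"
    then obtain c d where cd: "cd = (c, d)" "c < r" "d < r" by auto
    have 1: "(\<Sum>c'<r. of_bool (z = HL) * of_bool (c = a) * of_bool (d = c') * wm r P u v x w c' b)
      = of_bool (z = HL) * (of_bool (a = c) * wm r P u v x w d b)"
      using cd by (auto simp: of_bool_def if_distrib[of "\<lambda>x. x * _"] cong: if_cong)
    have 2: "(\<Sum>c'<r. lent P u v x z a c' * (\<Sum>i<length w. of_bool (w ! i = HL) * (wm r P u v x (take i w) c' c * wm r P u v x (drop (Suc i) w) d b)))
      = (\<Sum>i<length w. of_bool (w ! i = HL) * ((\<Sum>c'<r. lent P u v x z a c' * wm r P u v x (take i w) c' c) * wm r P u v x (drop (Suc i) w) d b))"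
      unfolding sum_distrib_left sum_distrib_right by (subst sum.swap) (simp add: mult_ac)
    show "(\<Sum>c'<r. (case cd of (c, d) \<Rightarrow> \<lambda>x. of_bool (z = HL) * of_bool (c = a) * of_bool (d = c')) x * wm r P u v x w c' b
     + lent P u v x z a c' * (case cd of (c, d) \<Rightarrow> \<lambda>x. \<Sum>i<length w. of_bool (w ! i = HL) * (wm r P u v x (take i w) c' c * wm r P u v x (drop (Suc i) w) d b)) x)
     = (case cd of (c, d) \<Rightarrow> \<lambda>x. \<Sum>i<length (z # w). of_bool ((z # w) ! i = HL) * (wm r P u v x (take i (z # w)) a c * wm r P u v x (drop (Suc i) (z # w)) d b)) x"
      unfolding cd prod.case sum.distrib 1 2 by (simp add: sum.lessThan_Suc_shift del: sum.lessThan_Suc)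
  qed simp
qed

text \<open>Differentiating the trace of a word in an entry of H opens the cyclic word at each H in
  turn.\<close>

definition wtD :: "(nat \<times> nat) \<Rightarrow> (nat \<times> nat \<Rightarrow> real) \<Rightarrow> letter list \<Rightarrow> real" where
  "wtD = (\<lambda>(c, d) x w. \<Sum>i<length w. of_bool (w ! i = HL) * wm r P u v x (sdr i w) d c)"

lemma poly_grad_wt: "poly_grad ({..<r} \<times> {..<r}) (\<lambda>x. wt r P u v x w) (\<lambda>cd x. wtD cd x w)"
  unfolding wt_def
proof (rule poly_grad_cong[OF poly_grad_sum[OF _ poly_grad_wm[of _ _ w]]])
  fix cd x assume "cd \<in> {..<r} \<times> {..<r}"
  then obtain c d where cd: "cd = (c, d)" "c < r" "d < r" by auto
  have "(\<Sum>a<r. \<Sum>i<length w. of_bool (w ! i = HL) * (wm r P u v x (take i w) a c * wm r P u v x (drop (Suc i) w) d a))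
    = (\<Sum>i<length w. of_bool (w ! i = HL) * (\<Sum>a<r. wm r P u v x (drop (Suc i) w) d a * wm r P u v x (take i w) a c))"
    by (subst sum.swap) (simp add: sum_distrib_left mult_ac)
  then show "(\<Sum>i<r. (case cd of (c, d) \<Rightarrow> \<lambda>x. \<Sum>ia<length w. of_bool (w ! ia = HL) *
     (wm r P u v x (take ia w) i c * wm r P u v x (drop (Suc ia) w) d i)) x) = wtD cd x w"
    using cd by (simp add: wtD_def sdr_def wm_append)
qed auto

lemma poly_grad_wts: "poly_grad ({..<r} \<times> {..<r}) (\<lambda>x. \<Prod>t\<leftarrow>ts. wt r P u v x t)
   (\<lambda>cd x. \<Sum>j<length ts. wtD cd x (ts ! j) * (\<Prod>t\<leftarrow>take j ts @ drop (Suc j) ts. wt r P u v x t))"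
proof (induction ts)
  case Nil
  show ?case by (rule poly_grad_cong[OF poly_grad_const]) auto
next
  case (Cons t ts)
  show ?case
    by (rule poly_grad_cong[OF poly_grad_mult[OF poly_grad_wt[of t] Cons]])
      (auto simp: sum.lessThan_Suc_shift sum_distrib_left mult_ac simp del: sum.lessThan_Suc)
qed

lemma P_sym: "a < r \<Longrightarrow> b < r \<Longrightarrow> P $$ (a, b) = P $$ (b, a)"
  using psd_matD(1,2)[OF psd] by (metis carrier_matD index_transpose_mat(1))

lemma wm_wrev':
  assumes "\<And>a b. a < r \<Longrightarrow> b < r \<Longrightarrow> x (a, b) = x (b, a)" "a < r" "b < r"
  shows "wm r P u v x (wrev w) a b = wm r P u v x w b a"
  using assms P_sym by (intro wm_wrev) auto

lemma wt_PL: "wt r P u v x (PL # w) = (\<Sum>a<r. \<Sum>b<r. P $$ (a, b) * wm r P u v x w b a)"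
  by (simp add: wt_def)

lemma wt_PL_PL: "wt r P u v x (PL # w @ PL # w') =
    (\<Sum>a<r. \<Sum>b<r. \<Sum>c<r. \<Sum>d<r. P $$ (a, c) * P $$ (b, d) * wm r P u v x w c b * wm r P u v x w' d a)"
proof -
  have "wt r P u v x (PL # w @ PL # w') = (\<Sum>a<r. \<Sum>c<r. \<Sum>b<r. \<Sum>d<r. P $$ (a, c) * (wm r P u v x w c b * (P $$ (b, d) * wm r P u v x w' d a)))"
    by (simp add: wt_def wm_append sum_distrib_left)
  also have "\<dots> = (\<Sum>a<r. \<Sum>b<r. \<Sum>c<r. \<Sum>d<r. P $$ (a, c) * (wm r P u v x w c b * (P $$ (b, d) * wm r P u v x w' d a)))"
    by (intro sum.cong refl sum.swap)
  finally show ?thesis by (simp add: mult_ac)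
qed

lemma sum4_factor: "(\<Sum>a<r. \<Sum>b<r. \<Sum>c<r. \<Sum>d<r. f a d * g b c) = (\<Sum>a<r. \<Sum>d<r. f a d) * (\<Sum>b<r. \<Sum>c<r. g b c :: real)"
proof -
  have "(\<Sum>a<r. \<Sum>b<r. \<Sum>c<r. \<Sum>d<r. f a d * g b c) = (\<Sum>a<r. \<Sum>b<r. \<Sum>c<r. (\<Sum>d<r. f a d) * g b c)"
    by (simp add: sum_distrib_right)
  also have "\<dots> = (\<Sum>a<r. (\<Sum>d<r. f a d) * (\<Sum>b<r. \<Sum>c<r. g b c))"
    by (simp add: sum_distrib_left)
  finally show ?thesis by (simp add: sum_distrib_right)
qed

text \<open>The two terms of \<open>H_cov\<close> act differently on a cyclic word H w H w'. Pairing
  the inner indices with each other and the outer ones with each other cuts it into two traces, a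
  gain of one; the other pairing reads w backwards and keeps a single trace.\<close>

lemma contract_split:
  assumes sx: "\<And>a b. a < r \<Longrightarrow> b < r \<Longrightarrow> x (a, b) = x (b, a)"
  shows "(\<Sum>a<r. \<Sum>b<r. \<Sum>c<r. \<Sum>d<r. H_cov P (a, b) (c, d) * (wm r P u v x w b c * wm r P u v x w' d a)) =
    wt r P u v x (PL # w) * wt r P u v x (PL # w') + wt r P u v x (PL # wrev w @ PL # w')"
proof -
  have tr: "wm r P u v x (wrev w) a b = wm r P u v x w b a" if "a < r" "b < r" for w a b
    by (rule wm_wrev') (use sx that in auto)
  have "(\<Sum>a<r. \<Sum>b<r. \<Sum>c<r. \<Sum>d<r. P $$ (a, c) * P $$ (b, d) * (wm r P u v x w b c * wm r P u v x w' d a))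
     = wt r P u v x (PL # wrev w @ PL # w')"
    unfolding wt_PL_PL by (intro sum.cong refl) (simp add: tr)
  moreover have "(\<Sum>a<r. \<Sum>b<r. \<Sum>c<r. \<Sum>d<r. P $$ (a, d) * P $$ (b, c) * (wm r P u v x w b c * wm r P u v x w' d a))
     = wt r P u v x (PL # w') * wt r P u v x (PL # w)"
  proof -
    have "(\<Sum>a<r. \<Sum>b<r. \<Sum>c<r. \<Sum>d<r. P $$ (a, d) * P $$ (b, c) * (wm r P u v x w b c * wm r P u v x w' d a)) =
      (\<Sum>a<r. \<Sum>b<r. \<Sum>c<r. \<Sum>d<r. (P $$ (a, d) * wm r P u v x w' d a) * (P $$ (c, b) * wm r P u v x w b c))"
      by (intro sum.cong refl) (simp add: P_sym)
    also have "\<dots> = wt r P u v x (PL # w') * (\<Sum>b<r. \<Sum>c<r. P $$ (c, b) * wm r P u v x w b c)"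
      unfolding sum4_factor wt_PL ..
    also have "(\<Sum>b<r. \<Sum>c<r. P $$ (c, b) * wm r P u v x w b c) = wt r P u v x (PL # w)"
      unfolding wt_PL by (rule sum.swap)
    finally show ?thesis .
  qed
  ultimately show ?thesis by (simp add: H_cov_def distrib_right sum.distrib)
qed

lemma sum3_swap:
  "(\<Sum>b\<in>B. \<Sum>c\<in>C. \<Sum>d\<in>D. g b c d) = (\<Sum>c\<in>C. \<Sum>d\<in>D. \<Sum>b\<in>B. g b c d)"
  "(\<Sum>b\<in>B. \<Sum>c\<in>C. \<Sum>d\<in>D. g b c d) = (\<Sum>d\<in>D. \<Sum>c\<in>C. \<Sum>b\<in>B. g b c d)"
proof -
  show *: "(\<Sum>b\<in>B. \<Sum>c\<in>C. \<Sum>d\<in>D. g b c d) = (\<Sum>c\<in>C. \<Sum>d\<in>D. \<Sum>b\<in>B. g b c d)"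
    by (rule trans[OF sum.swap]) (intro sum.cong refl sum.swap)
  show "(\<Sum>b\<in>B. \<Sum>c\<in>C. \<Sum>d\<in>D. g b c d) = (\<Sum>d\<in>D. \<Sum>c\<in>C. \<Sum>b\<in>B. g b c d)"
    unfolding * by (rule sum.swap)
qed

text \<open>Here the two H lie in different traces: either pairing joins the two words into one, in
  one case after a reversal.\<close>

lemma contract_merge:
  assumes sx: "\<And>a b. a < r \<Longrightarrow> b < r \<Longrightarrow> x (a, b) = x (b, a)"
  shows "(\<Sum>a<r. \<Sum>b<r. \<Sum>c<r. \<Sum>d<r. H_cov P (a, b) (c, d) * (wm r P u v x w b a * wm r P u v x w' d c)) =
    wt r P u v x (PL # w' @ PL # w) + wt r P u v x (PL # wrev w' @ PL # w)"
proof -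
  have tr: "wm r P u v x (wrev w) a b = wm r P u v x w b a" if "a < r" "b < r" for w a b
    by (rule wm_wrev') (use sx that in auto)
  have "(\<Sum>a<r. \<Sum>b<r. \<Sum>c<r. \<Sum>d<r. P $$ (a, c) * P $$ (b, d) * (wm r P u v x w b a * wm r P u v x w' d c))
     = (\<Sum>a<r. \<Sum>d<r. \<Sum>c<r. \<Sum>b<r. P $$ (a, c) * P $$ (d, b) * wm r P u v x (wrev w') c d * wm r P u v x w b a)"
    by (rule sum.cong[OF refl], subst sum3_swap(2), intro sum.cong refl) (simp add: tr P_sym mult_ac)
  then have 1: "(\<Sum>a<r. \<Sum>b<r. \<Sum>c<r. \<Sum>d<r. P $$ (a, c) * P $$ (b, d) * (wm r P u v x w b a * wm r P u v x w' d c))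
     = wt r P u v x (PL # wrev w' @ PL # w)" unfolding wt_PL_PL .
  have "(\<Sum>a<r. \<Sum>b<r. \<Sum>c<r. \<Sum>d<r. P $$ (a, d) * P $$ (b, c) * (wm r P u v x w b a * wm r P u v x w' d c))
     = (\<Sum>a<r. \<Sum>c<r. \<Sum>d<r. \<Sum>b<r. P $$ (a, d) * P $$ (c, b) * wm r P u v x w' d c * wm r P u v x w b a)"
    by (rule sum.cong[OF refl], subst sum3_swap(1), intro sum.cong refl) (simp add: P_sym mult_ac)
  then have "(\<Sum>a<r. \<Sum>b<r. \<Sum>c<r. \<Sum>d<r. P $$ (a, d) * P $$ (b, c) * (wm r P u v x w b a * wm r P u v x w' d c))
     = wt r P u v x (PL # w' @ PL # w)" unfolding wt_PL_PL .
  with 1 show ?thesis by (simp add: H_cov_def distrib_right sum.distrib)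
qed

end

section \<open>Expected products of traces of words\<close>

definition word_exp :: "letter list list \<Rightarrow> nat \<Rightarrow> real mat \<Rightarrow> (nat \<Rightarrow> real) \<Rightarrow> (nat \<Rightarrow> real) \<Rightarrow> real" where
  "word_exp ts r P u v = (\<integral>w. (\<Prod>t\<leftarrow>ts. wt r P u v (H_ent P w) t) \<partial>gauss_entries r)"

text \<open>The leading H is paired with each other H of its own word (splitting or reversing) and
  with each H of the other words (joining). Every pairing replaces the two H by two P.\<close>

lemma word_exp_stein:
  assumes psd: "psd_mat r P"
  shows "word_exp ((HL # w) # ts) r P u v =
    (\<Sum>i<length w. of_bool (w ! i = HL) *
       (word_exp ((PL # take i w) # (PL # drop (Suc i) w) # ts) r P u v +
        word_exp ((PL # wrev (take i w) @ PL # drop (Suc i) w) # ts) r P u v)) +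
    (\<Sum>j<length ts. \<Sum>i<length (ts ! j). of_bool (ts ! j ! i = HL) *
       (word_exp ((PL # sdr i (ts ! j) @ PL # w) # take j ts @ drop (Suc j) ts) r P u v +
        word_exp ((PL # wrev (sdr i (ts ! j)) @ PL # w) # take j ts @ drop (Suc j) ts) r P u v))"
proof -
  let ?A = "{..<r} \<times> {..<r}"
  interpret g: gauss_family "gauss_entries r" ?A "H_ent P" "H_cov P"
    by (rule gauss_family_H[OF psd])
  define W where "W = wm r P u v"
  define T where "T = (\<lambda>x ts. \<Prod>t\<leftarrow>ts. wt r P u v x t)"
  define rest where "rest = (\<lambda>j. take j ts @ drop (Suc j) ts)"
  define DW where "DW = (\<lambda>a b (c, d) x. \<Sum>i<length w. of_bool (w ! i = HL) * (W x (take i w) b c * W x (drop (Suc i) w) d a))"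
  define DT where "DT = (\<lambda>(c, d) x. \<Sum>j<length ts. (\<Sum>i<length (ts ! j). of_bool (ts ! j ! i = HL) * W x (sdr i (ts ! j)) d c) * T x (rest j))"
  define D where "D = (\<lambda>a b cd x. DW a b cd x * T x ts + W x w b a * DT cd x)"
  have iT: "integrable (gauss_entries r) (\<lambda>w. T (H_ent P w) ss)" for ss
    unfolding T_def by (rule g.integrable_poly[OF poly_grad_wts[OF psd]])
  have pg: "poly_grad ?A (\<lambda>x. W x w b a * T x ts) (D a b)" if "a < r" "b < r" for a b
    unfolding W_def T_def
    by (rule poly_grad_cong[OF poly_grad_mult[OF poly_grad_wm[OF psd that(2,1), of u v w] poly_grad_wts[OF psd, of u v ts]]])
      (auto simp: D_def DW_def DT_def W_def T_def wtD_def[OF psd] rest_def)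
  have "word_exp ((HL # w) # ts) r P u v = (\<integral>\<omega>. (\<Sum>a<r. \<Sum>b<r. H_ent P \<omega> (a, b) * (W (H_ent P \<omega>) w b a * T (H_ent P \<omega>) ts)) \<partial>gauss_entries r)"
    by (simp add: word_exp_def wt_def sum_distrib_right W_def T_def mult.assoc)
  also have "\<dots> = (\<Sum>a<r. \<Sum>b<r. \<integral>\<omega>. H_ent P \<omega> (a, b) * (W (H_ent P \<omega>) w b a * T (H_ent P \<omega>) ts) \<partial>gauss_entries r)"
    by (subst Bochner_Integration.integral_sum, (intro Bochner_Integration.integrable_sum g.integrable_var_mult[OF pg]; simp),
      intro sum.cong refl Bochner_Integration.integral_sum g.integrable_var_mult[OF pg]) auto
  also have "\<dots> = (\<Sum>a<r. \<Sum>b<r. \<Sum>c<r. \<Sum>d<r. \<integral>\<omega>. H_cov P (a, b) (c, d) * D a b (c, d) (H_ent P \<omega>) \<partial>gauss_entries r)"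
    by (intro sum.cong refl) (simp add: g.stein[OF pg] sum.cartesian_product case_prod_unfold)
  also have "\<dots> = (\<integral>\<omega>. (\<Sum>a<r. \<Sum>b<r. \<Sum>c<r. \<Sum>d<r. H_cov P (a, b) (c, d) * D a b (c, d) (H_ent P \<omega>)) \<partial>gauss_entries r)"
  proof -
    have i: "integrable (gauss_entries r) (\<lambda>\<omega>. H_cov P (a, b) (c, d) * D a b (c, d) (H_ent P \<omega>))" 
      if "a < r" "b < r" "c < r" "d < r" for a b c d
      using g.integrable_grad[OF pg[OF that(1,2)]] that by auto
    have "(\<integral>\<omega>. (\<Sum>d<r. H_cov P (a, b) (c, d) * D a b (c, d) (H_ent P \<omega>)) \<partial>gauss_entries r) =
      (\<Sum>d<r. \<integral>\<omega>. H_cov P (a, b) (c, d) * D a b (c, d) (H_ent P \<omega>) \<partial>gauss_entries r)" if "a < r" "b < r" "c < r" for a b c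
      by (rule Bochner_Integration.integral_sum) (intro Bochner_Integration.integrable_sum i; use that in simp)
    moreover have "(\<integral>\<omega>. (\<Sum>c<r. \<Sum>d<r. H_cov P (a, b) (c, d) * D a b (c, d) (H_ent P \<omega>)) \<partial>gauss_entries r) =
      (\<Sum>c<r. \<integral>\<omega>. (\<Sum>d<r. H_cov P (a, b) (c, d) * D a b (c, d) (H_ent P \<omega>)) \<partial>gauss_entries r)" if "a < r" "b < r" for a b
      by (rule Bochner_Integration.integral_sum) (intro Bochner_Integration.integrable_sum i; use that in simp)
    moreover have "(\<integral>\<omega>. (\<Sum>b<r. \<Sum>c<r. \<Sum>d<r. H_cov P (a, b) (c, d) * D a b (c, d) (H_ent P \<omega>)) \<partial>gauss_entries r) =
      (\<Sum>b<r. \<integral>\<omega>. (\<Sum>c<r. \<Sum>d<r. H_cov P (a, b) (c, d) * D a b (c, d) (H_ent P \<omega>)) \<partial>gauss_entries r)" if "a < r" for a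
      by (rule Bochner_Integration.integral_sum) (intro Bochner_Integration.integrable_sum i; use that in simp)
    moreover have "(\<integral>\<omega>. (\<Sum>a<r. \<Sum>b<r. \<Sum>c<r. \<Sum>d<r. H_cov P (a, b) (c, d) * D a b (c, d) (H_ent P \<omega>)) \<partial>gauss_entries r) =
      (\<Sum>a<r. \<integral>\<omega>. (\<Sum>b<r. \<Sum>c<r. \<Sum>d<r. H_cov P (a, b) (c, d) * D a b (c, d) (H_ent P \<omega>)) \<partial>gauss_entries r)"
      by (rule Bochner_Integration.integral_sum) (intro Bochner_Integration.integrable_sum i; simp)
    ultimately show ?thesis by simp
  qed
  also have "\<dots> = (\<integral>\<omega>. (\<Sum>i<length w. of_bool (w ! i = HL) *
       (T (H_ent P \<omega>) ((PL # take i w) # (PL # drop (Suc i) w) # ts) +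
        T (H_ent P \<omega>) ((PL # wrev (take i w) @ PL # drop (Suc i) w) # ts))) +
    (\<Sum>j<length ts. \<Sum>i<length (ts ! j). of_bool (ts ! j ! i = HL) *
       (T (H_ent P \<omega>) ((PL # sdr i (ts ! j) @ PL # w) # rest j) +
        T (H_ent P \<omega>) ((PL # wrev (sdr i (ts ! j)) @ PL # w) # rest j))) \<partial>gauss_entries r)"
  proof (intro Bochner_Integration.integral_cong refl)
    fix \<omega>
    define x where "x = H_ent P \<omega>"
    have sx: "\<And>a b. a < r \<Longrightarrow> b < r \<Longrightarrow> x (a, b) = x (b, a)"
      unfolding x_def by (rule H_ent_sym[OF psd])
    define S where "S = (\<lambda>f. \<Sum>a<r. \<Sum>b<r. \<Sum>c<r. \<Sum>d<r. H_cov P (a, b) (c, d) * f a b c d :: real)"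
    have S_sum: "S (\<lambda>a b c d. \<Sum>i\<in>I. f i a b c d) = (\<Sum>i\<in>I. S (f i))" for f and I :: "nat set"
      by (induction I rule: infinite_finite_induct) (simp_all add: S_def distrib_left sum.distrib)
    have S_add: "S (\<lambda>a b c d. f a b c d + g a b c d) = S f + S g" for f g
      by (simp add: S_def distrib_left sum.distrib)
    have S_mult: "S (\<lambda>a b c d. f a b c d * k) = S f * k" "S (\<lambda>a b c d. k * f a b c d) = k * S f" for f k
      by (simp_all add: S_def sum_distrib_left sum_distrib_right mult_ac)
    have "S (\<lambda>a b c d. D a b (c, d) x) = 
       S (\<lambda>a b c d. (\<Sum>i<length w. of_bool (w ! i = HL) * (W x (take i w) b c * W x (drop (Suc i) w) d a)) * T x ts + 
         (\<Sum>j<length ts. (\<Sum>i<length (ts ! j). of_bool (ts ! j ! i = HL) * (W x w b a * W x (sdr i (ts ! j)) d c)) * T x (rest j)))"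
      unfolding D_def DW_def DT_def prod.case
      by (simp add: sum_distrib_left mult_ac del: sum_of_bool_mult_eq sum_mult_of_bool_eq)
    also have "\<dots> = (\<Sum>i<length w. of_bool (w ! i = HL) * S (\<lambda>a b c d. W x (take i w) b c * W x (drop (Suc i) w) d a)) * T x ts + 
         (\<Sum>j<length ts. (\<Sum>i<length (ts ! j). of_bool (ts ! j ! i = HL) * S (\<lambda>a b c d. W x w b a * W x (sdr i (ts ! j)) d c)) * T x (rest j))"
      unfolding S_add S_mult S_sum ..
    also have "\<dots> = (\<Sum>i<length w. of_bool (w ! i = HL) *
       (T x ((PL # take i w) # (PL # drop (Suc i) w) # ts) + T x ((PL # wrev (take i w) @ PL # drop (Suc i) w) # ts))) +
     (\<Sum>j<length ts. \<Sum>i<length (ts ! j). of_bool (ts ! j ! i = HL) *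
       (T x ((PL # sdr i (ts ! j) @ PL # w) # rest j) + T x ((PL # wrev (sdr i (ts ! j)) @ PL # w) # rest j)))"
    proof -
      have "S (\<lambda>a b c d. W x w1 b c * W x w2 d a) = wt r P u v x (PL # w1) * wt r P u v x (PL # w2) + wt r P u v x (PL # wrev w1 @ PL # w2)" for w1 w2
        unfolding S_def W_def by (rule contract_split[OF psd]) (rule sx)
      moreover have "S (\<lambda>a b c d. W x w1 b a * W x w2 d c) = wt r P u v x (PL # w2 @ PL # w1) + wt r P u v x (PL # wrev w2 @ PL # w1)" for w1 w2
        unfolding S_def W_def by (rule contract_merge[OF psd]) (rule sx)
      ultimately show ?thesis
        by (simp add: T_def sum_distrib_left sum_distrib_right algebra_simps del: sum_of_bool_mult_eq sum_mult_of_bool_eq)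
    qed
    finally show "(\<Sum>a<r. \<Sum>b<r. \<Sum>c<r. \<Sum>d<r. H_cov P (a, b) (c, d) * D a b (c, d) (H_ent P \<omega>)) = \<dots>"
      unfolding S_def x_def .
  qed
  also have "\<dots> = (\<Sum>i<length w. of_bool (w ! i = HL) *
       (word_exp ((PL # take i w) # (PL # drop (Suc i) w) # ts) r P u v +
        word_exp ((PL # wrev (take i w) @ PL # drop (Suc i) w) # ts) r P u v)) +
    (\<Sum>j<length ts. \<Sum>i<length (ts ! j). of_bool (ts ! j ! i = HL) *
       (word_exp ((PL # sdr i (ts ! j) @ PL # w) # rest j) r P u v +
        word_exp ((PL # wrev (sdr i (ts ! j)) @ PL # w) # rest j) r P u v))"
  proof -
    have "word_exp ss r P u v = (\<integral>\<omega>. T (H_ent P \<omega>) ss \<partial>gauss_entries r)" for ss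
      by (simp add: word_exp_def T_def)
    then show ?thesis
      by (simp only: Bochner_Integration.integral_add Bochner_Integration.integral_sum Bochner_Integration.integrable_add
        Bochner_Integration.integrable_sum iT Bochner_Integration.integrable_mult_right Bochner_Integration.integral_mult_right)
  qed
  finally show ?thesis unfolding rest_def .
qed

lemma word_exp_mset: "mset ts = mset ts' \<Longrightarrow> word_exp ts = word_exp ts'"
proof -
  assume "mset ts = mset ts'"
  then have "(\<Prod>t\<leftarrow>ts. wt r P u v x t) = (\<Prod>t\<leftarrow>ts'. wt r P u v x t)" for r P u v x
    by (metis mset_map prod_mset_prod_list)
  then show ?thesis by (intro ext) (simp add: word_exp_def)
qed

lemma word_exp_rotate: "word_exp ((w @ w') # ts) = word_exp ((w' @ w) # ts)"
  by (intro ext) (simp add: word_exp_def wt_rotate[of _ _ _ _ _ w])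

section \<open>Letter counts and the number of traces\<close>

definition nH :: "letter list \<Rightarrow> nat" where "nH w = count_list w HL"
definition nR :: "letter list \<Rightarrow> nat" where "nR w = count_list w RL + count_list w RT"

lemma nH_simps [simp]: "nH [] = 0" "nH (z # w) = (if z = HL then 1 else 0) + nH w" "nH (w @ w') = nH w + nH w'"
  "nH (wrev w) = nH w" 
proof -
  have *: "(flip z = HL) = (z = HL)" for z by (cases z) auto
  show "nH (wrev w) = nH w" by (induction w) (auto simp: nH_def wrev_def *)
qed (auto simp: nH_def)

lemma nR_simps [simp]: "nR [] = 0" "nR (z # w) = (if z \<in> {RL, RT} then 1 else 0) + nR w" "nR (w @ w') = nR w + nR w'"
  "nR (wrev w) = nR w" 
proof -
  have *: "(flip z = RL) = (z = RT)" "(flip z = RT) = (z = RL)" for z by (cases z; auto)+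
  show "nR (wrev w) = nR w" by (induction w) (auto simp: nR_def wrev_def *)
qed (auto simp: nR_def)

lemma n_split:
  assumes "i < length w" "w ! i = HL"
  shows "nH w = Suc (nH (take i w) + nH (drop (Suc i) w))" "nR w = nR (take i w) + nR (drop (Suc i) w)"
proof -
  have "w = take i w @ HL # drop (Suc i) w" using assms id_take_nth_drop[of i w] by simp
  then have "nH w = nH (take i w @ HL # drop (Suc i) w)" "nR w = nR (take i w @ HL # drop (Suc i) w)" by simp_all
  then show "nH w = Suc (nH (take i w) + nH (drop (Suc i) w))" "nR w = nR (take i w) + nR (drop (Suc i) w)" by simp_all
qed

lemma sum_list_split:
  assumes "j < length ts"
  shows "(\<Sum>t\<leftarrow>ts. f t) = f (ts ! j) + (\<Sum>t\<leftarrow>take j ts @ drop (Suc j) ts. f t :: nat)"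
proof -
  have "ts = take j ts @ ts ! j # drop (Suc j) ts" using assms by (rule id_take_nth_drop)
  then have "(\<Sum>t\<leftarrow>ts. f t) = (\<Sum>t\<leftarrow>take j ts @ ts ! j # drop (Suc j) ts. f t)" by simp
  then show ?thesis by simp
qed

lemma sdr_counts [simp]:
  assumes "i < length w" "w ! i = HL"
  shows "nH w = Suc (nH (sdr i w))" "nR (sdr i w) = nR w"
  using n_split[OF assms] by (simp_all add: sdr_def)

lemma wm_replicate_PL:
  assumes psd: "psd_mat r P" and "a < r" "b < r"
  shows "wm r P u v x (replicate k PL) a b = (P ^\<^sub>m k) $$ (a, b)"
  using assms(2)
proof (induction k arbitrary: a)
  case 0
  then show ?case using assms psd_matD(3)[OF psd] by simp
next
  case (Suc k)
  have "wm r P u v x (replicate (Suc k) PL) a b = (\<Sum>c<r. (P ^\<^sub>m Suc 0) $$ (a, c) * (P ^\<^sub>m k) $$ (c, b))"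
    using Suc by (simp add: pow_1_entry[OF psd] del: pow_mat.simps)
  then show ?case using pow_mult_entry[OF psd Suc.prems assms(3), of "Suc 0" k] by (simp del: pow_mat.simps)
qed

lemma wt_replicate_PL: "psd_mat r P \<Longrightarrow> wt r P u v x (replicate k PL) = mtrace (P ^\<^sub>m k)"
  unfolding wt_def mtrace_def using wm_replicate_PL[of r P] psd_matD(3)[of r P] by simp

lemma wt_R_PL:
  assumes "psd_mat r P" "z \<in> {RL, RT}"
  shows "wt r P u v x (z # replicate k PL) = form r P k u v"
proof -
  have "wt r P u v x (z # replicate k PL) = (\<Sum>a<r. \<Sum>c<r. lent P u v x z a c * (P ^\<^sub>m k) $$ (c, a))"
    unfolding wt_def using wm_replicate_PL[OF assms(1)] by simp
  also have "\<dots> = form r P k u v"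
  proof (cases "z = RL")
    case True
    then show ?thesis unfolding form_def by (subst sum.swap) (simp add: mult_ac)
  next
    case False
    then have z: "z = RT" using assms by auto
    show ?thesis unfolding form_def z
      by (intro sum.cong refl) (simp add: pow_sym[OF assms(1)] mult_ac)
  qed
  finally show ?thesis .
qed

lemma word_PL: "nH w = 0 \<Longrightarrow> nR w = 0 \<Longrightarrow> w = replicate (length w) PL"
proof (induction w)
  case (Cons z w)
  then show ?case by (cases z) auto
qed simp

lemma word_PL_R:
  "nH w = 0 \<Longrightarrow> nR w = 1 \<Longrightarrow> \<exists>s t z. z \<in> {RL, RT} \<and> w = replicate s PL @ z # replicate t PL"
proof (induction w)
  case (Cons z w)
  show ?case
  proof (cases "z = PL")
    case True
    then obtain s t z' where "z' \<in> {RL, RT}" "w = replicate s PL @ z' # replicate t PL" using Cons by auto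
    then show ?thesis using True by (intro exI[of _ "Suc s"] exI[of _ t] exI[of _ z']) simp
  next
    case False
    then have "z \<in> {RL, RT}" "nR w = 0" "nH w = 0" using Cons.prems by (cases z; auto)+
    then show ?thesis using word_PL[of w] by (intro exI[of _ 0] exI[of _ "length w"] exI[of _ z]) simp
  qed
qed simp

lemma wt_no_H:
  assumes "psd_mat r P" "nH w = 0"
  shows "nR w = 0 \<Longrightarrow> wt r P u v x w = mtrace (P ^\<^sub>m length w)"
    and "nR w = 1 \<Longrightarrow> wt r P u v x w = form r P (length w - 1) u v"
proof -
  show "wt r P u v x w = mtrace (P ^\<^sub>m length w)" if "nR w = 0"
    using word_PL[OF assms(2) that] wt_replicate_PL[OF assms(1)] by metis
  show "wt r P u v x w = form r P (length w - 1) u v" if R: "nR w = 1"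
  proof -
    obtain s t z where z: "z \<in> {RL, RT}" "w = replicate s PL @ z # replicate t PL" using word_PL_R[OF assms(2) R] by blast
    have "wt r P u v x w = wt r P u v x (z # replicate (t + s) PL)"
      unfolding z(2) by (subst wt_rotate) (simp add: replicate_add)
    also have "\<dots> = form r P (length w - 1) u v" using z by (simp add: wt_R_PL[OF assms(1)] add.commute)
    finally show ?thesis .
  qed
qed

lemma prob_space_gauss_entries: "prob_space (gauss_entries r)"
  unfolding gauss_entries_def by (intro prob_space_PiM prob_space_std_normal)

text \<open>Without H the words are deterministic. The single letter R or R' turns one of them into
  a bilinear form, whose exponent is the length without that letter; the others are traces.\<close>

lemma word_exp_no_H:
  assumes psd: "psd_mat r P" and H: "\<forall>t\<in>set ts. nH t = 0" and R: "(\<Sum>t\<leftarrow>ts. nR t) = 1"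
  shows "word_exp ts r P u v = (\<Prod>t\<leftarrow>ts. if nR t = 0 then mtrace (P ^\<^sub>m length t) else form r P (length t - 1) u v)"
proof -
  interpret prob_space "gauss_entries r" by (rule prob_space_gauss_entries)
  have le: "nR t = 0 \<or> nR t = 1" if "t \<in> set ts" for t
    using member_le_sum_list[of "nR t" "map nR ts"] that R by auto
  have "wt r P u v x t = (if nR t = 0 then mtrace (P ^\<^sub>m length t) else form r P (length t - 1) u v)" if "t \<in> set ts" for x t
    using wt_no_H[OF psd, of t] H le[OF that] that by auto
  then have "(\<Prod>t\<leftarrow>ts. wt r P u v x t) = (\<Prod>t\<leftarrow>ts. if nR t = 0 then mtrace (P ^\<^sub>m length t) else form r P (length t - 1) u v)" for x
    by (intro arg_cong[where f = prod_list] map_cong) auto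
  then show ?thesis unfolding word_exp_def by (simp add: prob_space)
qed

lemma trace_poly_no_H:
  "(\<Sum>t\<leftarrow>ts. nR t) = 1 \<Longrightarrow>
    trace_poly (length ts) (\<lambda>r P u v. \<Prod>t\<leftarrow>ts. if nR t = 0 then mtrace (P ^\<^sub>m length t) else form r P (length t - 1) u v)"
proof (induction ts)
  case (Cons t ts)
  show ?case
  proof (cases "nR t = 0")
    case True
    then show ?thesis using trace_poly_trace_mult[OF Cons.IH, of "length t"] Cons.prems by simp
  next
    case False
    then have "\<forall>t\<in>set ts. nR t = 0" using Cons.prems by (cases "nR t") auto
    then have "trace_poly (Suc (length ts)) (\<lambda>r P u v. (\<Prod>t\<leftarrow>ts. if nR t = 0 then mtrace (P ^\<^sub>m length t) else form r P (length t - 1) u v) * form r P k u v)" for k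
    proof (induction ts)
      case Nil
      then show ?case using trace_poly_form[of 0 k] by simp
    next
      case (Cons t ts)
      have "trace_poly (Suc (length ts)) (\<lambda>r P u v. (\<Prod>t\<leftarrow>ts. if nR t = 0 then mtrace (P ^\<^sub>m length t) else form r P (length t - 1) u v) * form r P k u v)"
        using Cons by simp
      from trace_poly_trace_mult[OF this, of "length t"] show ?case using Cons.prems by (simp add: mult.assoc)
    qed
    then show ?thesis using False by (simp add: mult.commute)
  qed
qed simp

text \<open>Factors commute and words are cyclic, so any H can be moved to the front of the first
  word.\<close>

lemma word_exp_pull:
  assumes "t \<in> set ts" "nH t > 0"
  obtains w ts' where "word_exp ts = word_exp ((HL # w) # ts')" "(\<Sum>t\<leftarrow>ts. nR t) = nR w + (\<Sum>t\<leftarrow>ts'. nR t)"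
    "(\<Sum>t\<leftarrow>ts. nH t) = Suc (nH w + (\<Sum>t\<leftarrow>ts'. nH t))" "length ts = Suc (length ts')"
proof -
  obtain xs ys where ts: "ts = xs @ t # ys" using assms(1) by (meson split_list)
  have "HL \<in> set t" using assms(2) unfolding nH_def by (metis count_list_0_iff less_irrefl)
  then obtain s s' where t: "t = s @ HL # s'" by (meson split_list)
  have "word_exp ts = word_exp (t # xs @ ys)" by (rule word_exp_mset) (simp add: ts)
  also have "\<dots> = word_exp ((HL # s' @ s) # xs @ ys)" unfolding t by (subst word_exp_rotate) simp
  finally show ?thesis by (intro that[of "s' @ s" "xs @ ys"]) (simp_all add: ts t)
qed

lemma trace_poly_bool:
  "(b \<Longrightarrow> trace_poly d g) \<Longrightarrow> trace_poly d (\<lambda>r P u v. of_bool b * g r P u v)"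
  by (cases b) (simp_all add: trace_poly_zero)

text \<open>A contraction within a word yields at most one new word, and one between two words merges
  them.\<close>

lemma word_exp_trace_poly:
  assumes "(\<Sum>t\<leftarrow>ts. nR t) = 1"
  shows "trace_poly (length ts + (\<Sum>t\<leftarrow>ts. nH t) div 2) (word_exp ts)"
  using assms
proof (induction "\<Sum>t\<leftarrow>ts. nH t" arbitrary: ts rule: less_induct)
  case less
  show ?case
  proof (cases "\<forall>t\<in>set ts. nH t = 0")
    case True
    then have "map nH ts = map (\<lambda>_. 0) ts" by simp
    then have "length ts + (\<Sum>t\<leftarrow>ts. nH t) div 2 = length ts" by (simp only:) simp
    then show ?thesis using trace_poly_cong[OF trace_poly_no_H[OF less.prems] word_exp_no_H[OF _ True less.prems, symmetric]]
      by (simp only:)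
  next
    case False
    then obtain w ts' where wt: "word_exp ts = word_exp ((HL # w) # ts')" "(\<Sum>t\<leftarrow>ts. nR t) = nR w + (\<Sum>t\<leftarrow>ts'. nR t)"
        "(\<Sum>t\<leftarrow>ts. nH t) = Suc (nH w + (\<Sum>t\<leftarrow>ts'. nH t))" "length ts = Suc (length ts')"
      by (metis word_exp_pull neq0_conv)
    have IH: "trace_poly (length ts + (\<Sum>t\<leftarrow>ts. nH t) div 2) (word_exp ss)"
      if "(\<Sum>t\<leftarrow>ss. nR t) = nR w + (\<Sum>t\<leftarrow>ts'. nR t)" "Suc (\<Sum>t\<leftarrow>ss. nH t) = nH w + (\<Sum>t\<leftarrow>ts'. nH t)" "length ss \<le> Suc (length ts)" for ss
    proof -
      have "trace_poly (length ss + (\<Sum>t\<leftarrow>ss. nH t) div 2) (word_exp ss)"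
        by (rule less.hyps) (use that wt less.prems in auto)
      moreover have "length ss + (\<Sum>t\<leftarrow>ss. nH t) div 2 \<le> length ts + (\<Sum>t\<leftarrow>ts. nH t) div 2"
        using wt(3) that by linarith
      ultimately show ?thesis by (rule trace_poly_mono)
    qed
    show ?thesis
    proof (rule trace_poly_cong)
      show "trace_poly (length ts + (\<Sum>t\<leftarrow>ts. nH t) div 2) (\<lambda>r P u v. (\<Sum>i<length w. of_bool (w ! i = HL) *
       (word_exp ((PL # take i w) # (PL # drop (Suc i) w) # ts') r P u v +
        word_exp ((PL # wrev (take i w) @ PL # drop (Suc i) w) # ts') r P u v)) +
    (\<Sum>j<length ts'. \<Sum>i<length (ts' ! j). of_bool (ts' ! j ! i = HL) *
       (word_exp ((PL # sdr i (ts' ! j) @ PL # w) # take j ts' @ drop (Suc j) ts') r P u v +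
        word_exp ((PL # wrev (sdr i (ts' ! j)) @ PL # w) # take j ts' @ drop (Suc j) ts') r P u v)))"
      proof (intro trace_poly_add trace_poly_sum trace_poly_bool IH, goal_cases)
        case (1 i) then show ?case using n_split[of i w] by simp
      next
        case (2 i) then show ?case using n_split[of i w] by simp
      next
        case (3 i) then show ?case using wt(4) by simp
      next
        case (4 i) then show ?case using n_split[of i w] by simp
      next
        case (5 i) then show ?case using n_split[of i w] by simp
      next
        case (6 i) then show ?case using wt(4) by simp
      next
        case (7 j i) then show ?case using sum_list_split[of j ts' nR] by simp
      next
        case (8 j i) then show ?case using sum_list_split[of j ts' nH] by simp
      next
        case (9 j i) then show ?case using wt(4) by simp
      next
        case (10 j i) then show ?case using sum_list_split[of j ts' nR] by simp
      next
        case (11 j i) then show ?case using sum_list_split[of j ts' nH] by simp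
      next
        case (12 j i) then show ?case using wt(4) by simp
      qed
    qed (simp add: wt(1) word_exp_stein)
  qed
qed

text \<open>\<open>tree_sum \<psi> (2 * n) \<phi>\<close> is the sum over the plane trees with \<open>n\<close> edges of the product of the
  weights of their vertices: \<open>\<phi> k\<close> for a root and \<open>\<psi> k\<close> for another vertex with \<open>k\<close> children. The
  odd values vanish.\<close>

function tree_sum :: "(nat \<Rightarrow> real) \<Rightarrow> nat \<Rightarrow> (nat \<Rightarrow> real) \<Rightarrow> real" where
  "tree_sum \<psi> 0 \<phi> = \<phi> 0"
| "tree_sum \<psi> (Suc n) \<phi> = (\<Sum>m<n. tree_sum \<psi> m \<psi> * tree_sum \<psi> (n - 1 - m) (\<lambda>b. \<phi> (Suc b)))"
  by pat_completeness auto
termination by (relation "Wellfounded.measure (\<lambda>(\<psi>, n, \<phi>). n)") auto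

text \<open>\<open>h_word (b, a, k)\<close> is, up to rotation, \<open>P\<^sup>a H\<^sup>k\<close>, multiplied by \<open>R\<close> if \<open>b\<close>.\<close>

definition h_word :: "bool \<times> nat \<times> nat \<Rightarrow> letter list" where
  "h_word = (\<lambda>(b, a, k). replicate k HL @ (if b then [RL] else []) @ replicate a PL)"

text \<open>The exponent of P at a vertex counts one P for each child and one for the edge to the
  parent, hence \<open>P ^\<^sub>m Suc c\<close>; the root starts with the given P^a instead. If the
  word contains R, its root carries the bilinear form.\<close>

definition h_lead :: "bool \<times> nat \<times> nat \<Rightarrow> nat \<Rightarrow> real mat \<Rightarrow> (nat \<Rightarrow> real) \<Rightarrow> (nat \<Rightarrow> real) \<Rightarrow> real" where
  "h_lead = (\<lambda>(b, a, k) r P u v. tree_sum (\<lambda>c. mtrace (P ^\<^sub>m Suc c)) k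
     (\<lambda>c. if b then form r P (a + c) u v else mtrace (P ^\<^sub>m (a + c))))"

lemma count_replicate [simp]: "nH (replicate k z) = (if z = HL then k else 0)" "nR (replicate k z) = (if z \<in> {RL, RT} then k else 0)"
  by (induction k) auto

lemma h_word_counts [simp]: "nH (h_word (b, a, k)) = k" "nR (h_word (b, a, k)) = of_bool b"
  by (auto simp: h_word_def)

text \<open>Only the splittings of the word of the leading H keep the maximal number of traces, and
  they yield words of the same shape, so they obey the recursion of \<open>tree_sum\<close>. Several
  words are treated at once because splitting produces them. All other pairings are absorbed in the
  error, whose bound is smaller by one trace.\<close>

lemma word_exp_lead:
  assumes "(\<Sum>(b, a, k)\<leftarrow>ts. of_bool b) = (1 :: nat)"
  shows "trace_poly (length ts + (\<Sum>(b, a, k)\<leftarrow>ts. k) div 2 - 1)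
    (\<lambda>r P u v. word_exp (map h_word ts) r P u v - (\<Prod>t\<leftarrow>ts. h_lead t r P u v))"
  using assms
proof (induction "\<Sum>(b, a, k)\<leftarrow>ts. k" arbitrary: ts rule: less_induct)
  case less
  have nR: "(\<Sum>t\<leftarrow>map h_word ts. nR t) = (\<Sum>(b, a, k)\<leftarrow>ts. of_bool b)" for ts
    by (induction ts) auto
  have nH: "(\<Sum>t\<leftarrow>map h_word ts. nH t) = (\<Sum>(b, a, k)\<leftarrow>ts. k)" for ts
    by (induction ts) auto
  show ?case
  proof (cases "\<forall>(b, a, k)\<in>set ts. k = 0")
    case True
    have "word_exp (map h_word ts) r P u v = (\<Prod>t\<leftarrow>ts. h_lead t r P u v)" if psd: "psd_mat r P" for r P u v
    proof -
      have "\<forall>t\<in>set (map h_word ts). nH t = 0" using True by auto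
      then have "word_exp (map h_word ts) r P u v = (\<Prod>t\<leftarrow>map h_word ts. if nR t = 0 then mtrace (P ^\<^sub>m length t) else form r P (length t - 1) u v)"
        by (rule word_exp_no_H[OF psd]) (use nR[of ts] less.prems in simp)
      also have "\<dots> = (\<Prod>t\<leftarrow>ts. h_lead t r P u v)"
      proof -
        have "(if nR (h_word t) = 0 then mtrace (P ^\<^sub>m length (h_word t)) else form r P (length (h_word t) - 1) u v) = h_lead t r P u v"
          if t: "t \<in> set ts" for t
        proof -
          obtain b a where "t = (b, a, 0)" using True t by (cases t) auto
          then show ?thesis by (simp add: h_lead_def h_word_def)
        qed
        then show ?thesis unfolding list.map_comp comp_def by (intro arg_cong[where f = prod_list] map_cong) auto
      qed
      finally show ?thesis .
    qed
    then show ?thesis by (intro trace_poly_cong[OF trace_poly_zero]) simp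
  next
    case False
    then obtain b a k where "(b, a, k) \<in> set ts" "k \<noteq> 0" by auto
    then obtain n where "(b, a, Suc n) \<in> set ts" by (cases k) auto
    then obtain xs ys where ts: "ts = xs @ (b, a, Suc n) # ys" by (meson split_list)
    define ts' where "ts' = xs @ ys"
    define T where "T = map h_word ts'"
    define w where "w = replicate n HL @ (if b then [RL] else []) @ replicate a PL"
    define D where "D = length ts + (\<Sum>(b, a, k)\<leftarrow>ts. k) div 2 - 1"
    have E: "word_exp (map h_word ts) = word_exp ((HL # w) # T)"
      by (rule word_exp_mset) (simp add: ts ts'_def T_def w_def h_word_def)
    have lts: "length ts = Suc (length ts')" by (simp add: ts ts'_def)
    have kts: "(\<Sum>(b, a, k)\<leftarrow>ts. k) = Suc n + (\<Sum>(b, a, k)\<leftarrow>ts'. k)" by (simp add: ts ts'_def)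
    have bts: "(\<Sum>(b, a, k)\<leftarrow>ts. of_bool b) = of_bool b + (\<Sum>(b, a, k)\<leftarrow>ts'. of_bool b :: nat)" by (simp add: ts ts'_def)
    have nw: "nH w = n" "nR w = of_bool b" by (simp_all add: w_def)
    \<comment> \<open>A reversal or a joining leaves at most \<open>length ts\<close> words and two
      H fewer; the general bound then already lies within the error \<open>D\<close>.\<close>
    have crude: "trace_poly D (word_exp ss)" 
      if "(\<Sum>t\<leftarrow>ss. nR t) = nR w + (\<Sum>t\<leftarrow>T. nR t)" "Suc (\<Sum>t\<leftarrow>ss. nH t) = nH w + (\<Sum>t\<leftarrow>T. nH t)" "length ss \<le> length ts" for ss
    proof -
      have 1: "(\<Sum>t\<leftarrow>ss. nR t) = 1" using that(1) less.prems bts nR[of ts'] unfolding T_def nw by simp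
      have "Suc (Suc (\<Sum>t\<leftarrow>ss. nH t)) = (\<Sum>(b, a, k)\<leftarrow>ts. k)" using that(2) kts nH[of ts'] unfolding T_def nw by simp
      then have "(\<Sum>(b, a, k)\<leftarrow>ts. k) div 2 = Suc ((\<Sum>t\<leftarrow>ss. nH t) div 2)" by presburger
      then have "length ss + (\<Sum>t\<leftarrow>ss. nH t) div 2 \<le> D" using that(3) unfolding D_def by simp
      with word_exp_trace_poly[OF 1] show ?thesis by (rule trace_poly_mono)
    qed
    \<comment> \<open>The words after pairing the leading H with the letter i of \<open>w\<close>:
      the enclosed H^i with one new P is the first subtree, and the rest keeps the root, now with
      P^(a+1).\<close>
    define f where "f = (\<lambda>i. (False, 1 :: nat, i) # (b, Suc a, n - 1 - i) # ts')"
    have main: "trace_poly D (\<lambda>r P u v. word_exp (map h_word (f i)) r P u v - (\<Prod>t\<leftarrow>f i. h_lead t r P u v))" if "i < n" for i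
    proof -
      have k: "Suc (Suc (\<Sum>(b, a, k)\<leftarrow>f i. k)) = (\<Sum>(b, a, k)\<leftarrow>ts. k)" using kts that by (simp add: f_def)
      then have "length (f i) + (\<Sum>(b, a, k)\<leftarrow>f i. k) div 2 - 1 = D" 
        unfolding D_def k[symmetric] lts by (simp add: f_def)
      moreover have "trace_poly (length (f i) + (\<Sum>(b, a, k)\<leftarrow>f i. k) div 2 - 1) 
          (\<lambda>r P u v. word_exp (map h_word (f i)) r P u v - (\<Prod>t\<leftarrow>f i. h_lead t r P u v))"
        by (rule less.hyps) (use k less.prems bts in \<open>simp_all add: f_def\<close>)
      ultimately show ?thesis by simp
    qed
    have wi: "w ! i = HL \<longleftrightarrow> i < n" if "i < length w" for i
      using that by (auto simp: w_def nth_append nth_Cons' split: if_splits)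
    have ln: "n \<le> length w" by (simp add: w_def)
    have Ef: "word_exp ((PL # take i w) # (PL # drop (Suc i) w) # T) = word_exp (map h_word (f i))" if "i < n" for i
    proof -
      have tk: "take i w = replicate i HL" "drop (Suc i) w = replicate (n - 1 - i) HL @ (if b then [RL] else []) @ replicate a PL"
        using that by (auto simp: w_def)
      have "word_exp ((PL # take i w) # (PL # drop (Suc i) w) # T) = word_exp ((replicate i HL @ [PL]) # (PL # drop (Suc i) w) # T)"
        unfolding tk using word_exp_rotate[of "[PL]"] by simp
      also have "\<dots> = word_exp (([PL] @ drop (Suc i) w) # (replicate i HL @ [PL]) # T)"
        by (rule word_exp_mset) simp
      also have "\<dots> = word_exp ((drop (Suc i) w @ [PL]) # (replicate i HL @ [PL]) # T)"
        by (rule word_exp_rotate)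
      also have "\<dots> = word_exp (map h_word (f i))"
        unfolding tk by (rule word_exp_mset) (simp add: f_def h_word_def T_def replicate_append_same)
      finally show ?thesis .
    qed
    have lead: "(\<Prod>t\<leftarrow>ts. h_lead t r P u v) = (\<Sum>i<n. \<Prod>t\<leftarrow>f i. h_lead t r P u v)" for r P u v
    proof -
      have "(\<Prod>t\<leftarrow>ts. h_lead t r P u v) = h_lead (b, a, Suc n) r P u v * (\<Prod>t\<leftarrow>ts'. h_lead t r P u v)"
        by (simp add: ts ts'_def)
      also have "\<dots> = (\<Sum>i<n. \<Prod>t\<leftarrow>f i. h_lead t r P u v)"
        by (simp add: h_lead_def f_def sum_distrib_right mult.assoc del: pow_mat.simps cong: if_cong)
      finally show ?thesis .
    qed
    have "trace_poly D (\<lambda>r P u v. (\<Sum>i<n. word_exp (map h_word (f i)) r P u v - (\<Prod>t\<leftarrow>f i. h_lead t r P u v)) +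
      ((\<Sum>i<length w. of_bool (w ! i = HL) * word_exp ((PL # wrev (take i w) @ PL # drop (Suc i) w) # T) r P u v) +
       (\<Sum>j<length T. \<Sum>i<length (T ! j). of_bool (T ! j ! i = HL) *
       (word_exp ((PL # sdr i (T ! j) @ PL # w) # take j T @ drop (Suc j) T) r P u v +
        word_exp ((PL # wrev (sdr i (T ! j)) @ PL # w) # take j T @ drop (Suc j) T) r P u v))))"
    proof (intro trace_poly_add trace_poly_sum trace_poly_bool crude main, goal_cases)
      case (2 i) then show ?case using n_split[of i w] by simp
    next
      case (3 i) then show ?case using n_split[of i w] by simp
    next
      case (4 i) then show ?case using lts by (simp add: T_def)
    next
      case (5 j i) then show ?case using sum_list_split[of j T nR] by simp
    next
      case (6 j i) then show ?case using sum_list_split[of j T nH] by simp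
    next
      case (7 j i) then show ?case using lts by (simp add: T_def)
    next
      case (8 j i) then show ?case using sum_list_split[of j T nR] by simp
    next
      case (9 j i) then show ?case using sum_list_split[of j T nH] by simp
    next
      case (10 j i) then show ?case using lts by (simp add: T_def)
    qed simp
    then show ?thesis unfolding D_def[symmetric]
    proof (rule trace_poly_cong)
      fix r P u v assume psd: "psd_mat r P"
      have "(\<Sum>i<length w. of_bool (w ! i = HL) * word_exp ((PL # take i w) # (PL # drop (Suc i) w) # T) r P u v)
        = (\<Sum>i<n. word_exp (map h_word (f i)) r P u v)"
        by (rule sum.mono_neutral_cong_right) (use wi ln Ef in auto)
      then show "(\<Sum>i<n. word_exp (map h_word (f i)) r P u v - (\<Prod>t\<leftarrow>f i. h_lead t r P u v)) +
        ((\<Sum>i<length w. of_bool (w ! i = HL) * word_exp ((PL # wrev (take i w) @ PL # drop (Suc i) w) # T) r P u v) +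
       (\<Sum>j<length T. \<Sum>i<length (T ! j). of_bool (T ! j ! i = HL) *
       (word_exp ((PL # sdr i (T ! j) @ PL # w) # take j T @ drop (Suc j) T) r P u v +
        word_exp ((PL # wrev (sdr i (T ! j)) @ PL # w) # take j T @ drop (Suc j) T) r P u v)))
        = word_exp (map h_word ts) r P u v - (\<Prod>t\<leftarrow>ts. h_lead t r P u v)"
        unfolding E word_exp_stein[OF psd] lead distrib_left sum.distrib sum_subtractf by linarith
    qed
  qed
qed

definition unit_fun :: "nat \<Rightarrow> nat \<Rightarrow> real" where "unit_fun i a = of_bool (a = i)"

lemma wm_replicate_HL:
  assumes psd: "psd_mat r P" and "a < r" "b < r"
  shows "wm r P u v (H_ent P w) (replicate k HL) a b = (H_mat P w ^\<^sub>m k) $$ (a, b)"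
  using assms(2)
proof (induction k arbitrary: a)
  case 0
  then show ?case using assms H_mat_carrier[OF psd, of w] by simp
next
  case (Suc k)
  note H = H_mat_carrier[OF psd, of w]
  have Hk: "H_mat P w ^\<^sub>m k \<in> carrier_mat r r" using H by simp
  have "H_mat P w ^\<^sub>m Suc k = H_mat P w * H_mat P w ^\<^sub>m k"
    using pow_mat_add[OF H, of "Suc 0" k] pow_mat_1[OF H] by (simp del: pow_mat.simps)
  then have "(H_mat P w ^\<^sub>m Suc k) $$ (a, b) = (\<Sum>c<r. H_mat P w $$ (a, c) * (H_mat P w ^\<^sub>m k) $$ (c, b))"
    using mult_mat_index[OF H Hk Suc.prems assms(3)] by simp
  then show ?case using Suc by (simp add: H_ent_def del: pow_mat.simps)
qed

text \<open>With u = e_i and v = e_j the matrix R is e_j e_i', and Tr(R H^k) is the entry (i, j) of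
  H^k.\<close>

lemma wt_h_word_unit:
  assumes psd: "psd_mat r P" and ij: "i < r" "j < r"
  shows "wt r P (unit_fun i) (unit_fun j) (H_ent P w) (h_word (True, 0, k)) = (H_mat P w ^\<^sub>m k) $$ (i, j)"
proof -
  have "wt r P (unit_fun i) (unit_fun j) (H_ent P w) (h_word (True, 0, k)) = wt r P (unit_fun i) (unit_fun j) (H_ent P w) ([RL] @ replicate k HL)"
  proof -
    have "h_word (True, 0, k) = replicate k HL @ [RL]" by (simp add: h_word_def)
    then show ?thesis by (simp only: wt_rotate[of _ _ _ _ _ "replicate k HL"])
  qed
  also have "\<dots> = (\<Sum>a<r. \<Sum>c<r. unit_fun j a * unit_fun i c * (H_mat P w ^\<^sub>m k) $$ (c, a))"
    unfolding wt_def using wm_replicate_HL[OF psd] by simp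
  also have "\<dots> = (\<Sum>a<r. \<Sum>c<r. of_bool (a = j) * (of_bool (c = i) * (H_mat P w ^\<^sub>m k) $$ (c, a)))"
    by (simp add: unit_fun_def mult.assoc del: sum_of_bool_mult_eq sum_mult_of_bool_eq)
  also have "\<dots> = (H_mat P w ^\<^sub>m k) $$ (i, j)"
  proof -
    have "(\<Sum>c<r. of_bool (c = l) * g c) = g l" if "l < r" for l and g :: "nat \<Rightarrow> real"
      using that by (simp add: of_bool_def if_distrib[of "\<lambda>x. x * _"] cong: if_cong)
    then show ?thesis using ij by (simp only: sum_distrib_left[symmetric])
  qed
  finally show ?thesis .
qed

lemma H_moment_word_exp:
  assumes psd: "psd_mat r P" and ij: "i < r" "j < r"
  shows "H_moment k P $$ (i, j) = word_exp [h_word (True, 0, k)] r P (unit_fun i) (unit_fun j)"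
  using ij psd_matD(3)[OF psd]
  by (simp add: H_moment_def mat_expectation_def word_exp_def wt_h_word_unit[OF psd])

lemma H_moment_lead:
  "trace_poly n (\<lambda>r P u v. word_exp [h_word (True, 0, 2 * n)] r P u v -
     tree_sum (\<lambda>c. mtrace (P ^\<^sub>m Suc c)) (2 * n) (\<lambda>c. form r P c u v))"
  using word_exp_lead[of "[(True, 0, 2 * n)]"] by (simp add: h_lead_def)

section \<open>Plane trees and non-crossing partitions\<close>

text \<open>The recursion splits n - 2 into two parts, one of which is odd if n is.\<close>

lemma tree_sum_odd: "odd n \<Longrightarrow> tree_sum \<psi> n \<phi> = 0"
proof (induction n arbitrary: \<phi> rule: less_induct)
  case (less n)
  then obtain k where n: "n = Suc k" "even k" by (cases n) auto
  have "tree_sum \<psi> m \<psi> * tree_sum \<psi> (k - 1 - m) (\<lambda>b. \<phi> (Suc b)) = 0" if "m < k" for m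
  proof (cases "odd m")
    case True
    then show ?thesis using less.IH[of m] that n by simp
  next
    case False
    then have "odd (k - 1 - m)" using that n by auto
    then show ?thesis using less.IH[of "k - 1 - m"] that n by simp
  qed
  then show ?case using n by (auto intro!: sum.neutral)
qed

lemma tree_sum_even_Suc:
  "tree_sum \<psi> (2 * Suc n) \<phi> = (\<Sum>k\<le>n. tree_sum \<psi> (2 * k) \<psi> * tree_sum \<psi> (2 * (n - k)) (\<lambda>b. \<phi> (Suc b)))"
proof -
  have "tree_sum \<psi> (2 * Suc n) \<phi> = (\<Sum>m<Suc (2 * n). tree_sum \<psi> m \<psi> * tree_sum \<psi> (2 * n - m) (\<lambda>b. \<phi> (Suc b)))"
    by simp
  also have "\<dots> = (\<Sum>m\<in>(\<lambda>k. 2 * k) ` {..n}. tree_sum \<psi> m \<psi> * tree_sum \<psi> (2 * n - m) (\<lambda>b. \<phi> (Suc b)))"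
  proof (rule sum.mono_neutral_right)
    show "\<forall>m\<in>{..<Suc (2 * n)} - (\<lambda>k. 2 * k) ` {..n}. tree_sum \<psi> m \<psi> * tree_sum \<psi> (2 * n - m) (\<lambda>b. \<phi> (Suc b)) = 0"
    proof
      fix m assume m: "m \<in> {..<Suc (2 * n)} - (\<lambda>k. 2 * k) ` {..n}"
      then have "odd m" by (auto elim!: evenE)
      then show "tree_sum \<psi> m \<psi> * tree_sum \<psi> (2 * n - m) (\<lambda>b. \<phi> (Suc b)) = 0" by (simp add: tree_sum_odd)
    qed
  qed auto
  also have "\<dots> = (\<Sum>k\<le>n. tree_sum \<psi> (2 * k) \<psi> * tree_sum \<psi> (2 * (n - k)) (\<lambda>b. \<phi> (Suc b)))"
    by (subst sum.reindex) (auto simp: inj_on_def right_diff_distrib')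
  finally show ?thesis .
qed

section \<open>Non-crossing partitions of intervals\<close>

definition nc_on :: "nat set \<Rightarrow> nat set set set" where
  "nc_on A = {\<pi>. partition_on A \<pi> \<and> \<not> crossing \<pi>}"

lemma finite_nc_on: "finite A \<Longrightarrow> finite (nc_on A)"
  by (rule finite_subset[of _ "Pow (Pow A)"]) (auto simp: nc_on_def partition_on_def)

text \<open>The weight of a plane tree with n edges: the blocks are the vertices with children, and
  the other vertices are leaves. The tree has one leaf more than the exponent shows; the missing
  \<open>\<psi> 0\<close> is supplied in \<open>sum_nc_on_both\<close>.\<close>

definition block_prod :: "(nat \<Rightarrow> real) \<Rightarrow> nat \<Rightarrow> nat set set \<Rightarrow> real" where
  "block_prod \<psi> n \<pi> = (\<Prod>B\<in>\<pi>. \<psi> (card B)) * \<psi> 0 ^ (n - card \<pi>)"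

definition rooted_prod :: "(nat \<Rightarrow> real) \<Rightarrow> (nat \<Rightarrow> real) \<Rightarrow> nat \<Rightarrow> nat \<Rightarrow> nat set set \<Rightarrow> real" where
  "rooted_prod \<psi> \<phi> n a \<pi> = \<phi> (card (block_of \<pi> a)) * (\<Prod>B\<in>\<pi> - {block_of \<pi> a}. \<psi> (card B)) * \<psi> 0 ^ (n - card \<pi>)"

lemma block_of_eq:
  assumes "partition_on A \<pi>" "B \<in> \<pi>" "a \<in> B"
  shows "block_of \<pi> a = B"
  unfolding block_of_def
  by (rule the_equality) (use assms in \<open>auto simp: partition_on_def disjoint_def\<close>)

lemma block_of_in:
  assumes "partition_on A \<pi>" "a \<in> A"
  shows "block_of \<pi> a \<in> \<pi>" "a \<in> block_of \<pi> a"
proof -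
  obtain B where "B \<in> \<pi>" "a \<in> B" using assms by (auto simp: partition_on_def)
  then show "block_of \<pi> a \<in> \<pi>" "a \<in> block_of \<pi> a" using block_of_eq[OF assms(1)] by auto
qed

lemma finite_partition: "finite A \<Longrightarrow> partition_on A \<pi> \<Longrightarrow> finite \<pi>"
  by (rule finite_elements)

lemma card_partition_le: 
  assumes "finite A" "partition_on A \<pi>"
  shows "card \<pi> \<le> card A"
proof -
  have "card \<pi> \<le> (\<Sum>B\<in>\<pi>. card B)"
  proof -
    have "1 \<le> card B" if "B \<in> \<pi>" for B
      using that assms by (metis One_nat_def Suc_leI card_gt_0_iff finite_subset partition_onD1 partition_onD3 Sup_upper)
    then have "(\<Sum>B\<in>\<pi>. 1) \<le> (\<Sum>B\<in>\<pi>. card B)" by (intro sum_mono) auto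
    then show ?thesis by simp
  qed
  also have "\<dots> = card (\<Union>\<pi>)"
    using assms finite_partition[OF assms]
    by (subst card_Union_disjoint) (auto simp: partition_on_def disjoint_def pairwise_def disjnt_def intro: finite_subset)
  finally show ?thesis using assms by (simp add: partition_on_def)
qed

lemma block_prod_rooted:
  assumes "finite A" "partition_on A \<pi>" "a \<in> A"
  shows "block_prod \<psi> n \<pi> = rooted_prod \<psi> \<psi> n a \<pi>"
  unfolding block_prod_def rooted_prod_def
  by (subst prod.remove[OF finite_partition[OF assms(1,2)] block_of_in(1)[OF assms(2,3)]]) simp

text \<open>Enlarging blocks while keeping them distinct preserves a crossing; read backwards, parts
  of a non-crossing partition are non-crossing.\<close>

lemma crossing_mono:
  assumes "crossing \<rho>" "\<And>X. X \<in> \<rho> \<Longrightarrow> f X \<in> \<pi> \<and> X \<subseteq> f X" "inj_on f \<rho>"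
  shows "crossing \<pi>"
proof -
  obtain i j k l X Y where *: "X \<in> \<rho>" "Y \<in> \<rho>" "i < j" "j < k" "k < l" "X \<noteq> Y" "i \<in> X" "k \<in> X" "j \<in> Y" "l \<in> Y"
    using assms(1) unfolding crossing_def by blast
  then have "f X \<noteq> f Y" using assms(3) by (auto simp: inj_on_def)
  then show ?thesis using * assms(2)[OF *(1)] assms(2)[OF *(2)] unfolding crossing_def by blast
qed

lemma nc_on_empty: "nc_on {} = {{}}"
  by (auto simp: nc_on_def crossing_def partition_on_empty)

text \<open>A non-crossing partition of \<open>{a..<b}\<close> in which \<open>a\<close> is not a singleton is a pair of
  non-crossing partitions of \<open>{Suc a..<q}\<close> and \<open>{q..<b}\<close>, where \<open>q\<close> is the next element of the
  block of \<open>a\<close>.\<close>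

definition nc_join :: "nat \<Rightarrow> nat \<times> nat set set \<times> nat set set \<Rightarrow> nat set set" where
  "nc_join a = (\<lambda>(q, \<sigma>, \<rho>). \<sigma> \<union> (\<rho> - {block_of \<rho> q}) \<union> {insert a (block_of \<rho> q)})"

definition nc_split :: "nat \<Rightarrow> nat set set \<Rightarrow> nat \<times> nat set set \<times> nat set set" where
  "nc_split a \<pi> = (let B = block_of \<pi> a - {a}; q = Min B in
     (q, {X\<in>\<pi>. X \<subseteq> {Suc a..<q}}, insert B {X\<in>\<pi>. X \<subseteq> {q..}}))"

text \<open>Adding a to the block of q raises its size by one, hence \<open>\<phi> (Suc k)\<close>;
  there is one more element but no new block, which accounts for the factor
  \<open>\<psi> 0\<close>.\<close>

lemma nc_join:
  assumes q: "q \<in> {Suc a..<b}" and s: "\<sigma> \<in> nc_on {Suc a..<q}" and r: "\<rho> \<in> nc_on {q..<b}"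
  shows "nc_join a (q, \<sigma>, \<rho>) \<in> nc_on {a..<b}"
    and "block_of (nc_join a (q, \<sigma>, \<rho>)) a = insert a (block_of \<rho> q)"
    and "nc_split a (nc_join a (q, \<sigma>, \<rho>)) = (q, \<sigma>, \<rho>)"
    and "rooted_prod \<psi> \<phi> (b - a) a (nc_join a (q, \<sigma>, \<rho>)) =
      \<psi> 0 * (block_prod \<psi> (q - Suc a) \<sigma> * rooted_prod \<psi> (\<lambda>k. \<phi> (Suc k)) (b - q) q \<rho>)"
proof -
  define C where "C = block_of \<rho> q"
  define \<pi> where "\<pi> = nc_join a (q, \<sigma>, \<rho>)"
  have ps: "partition_on {Suc a..<q} \<sigma>" and pr: "partition_on {q..<b} \<rho>" using s r by (auto simp: nc_on_def)
  have C: "C \<in> \<rho>" "q \<in> C" using block_of_in[OF pr, of q] q by (auto simp: C_def)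
  have \<pi>: "\<pi> = \<sigma> \<union> (\<rho> - {C}) \<union> {insert a C}" by (simp add: \<pi>_def nc_join_def C_def)
  have sub: "X \<subseteq> {Suc a..<q}" "X \<noteq> {}" if "X \<in> \<sigma>" for X using ps that by (auto simp: partition_on_def)
  have rub: "X \<subseteq> {q..<b}" "X \<noteq> {}" if "X \<in> \<rho>" for X using pr that by (auto simp: partition_on_def)
  have aC: "a \<notin> C" using rub[OF C(1)] q by auto
  have part: "partition_on {a..<b} \<pi>"
  proof (rule partition_onI)
    have "\<Union>\<sigma> = {Suc a..<q}" "\<Union>\<rho> = {q..<b}" using ps pr by (auto simp: partition_on_def)
    moreover have "\<Union>\<pi> = insert a (\<Union>\<sigma> \<union> \<Union>\<rho>)" unfolding \<pi> using C by auto
    ultimately show "\<Union>\<pi> = {a..<b}" using q by auto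
    show "{} \<notin> \<pi>" unfolding \<pi> using sub(2) rub(2) by blast
    fix X Y assume XY: "X \<in> \<pi>" "Y \<in> \<pi>" "X \<noteq> Y"
    have d: "X \<inter> Y = {}" if "X \<in> \<sigma>" "Y \<in> \<rho>" for X Y using sub[OF that(1)] rub[OF that(2)] by fastforce
    have ds: "X \<inter> Y = {}" if "X \<in> \<sigma>" "Y \<in> \<sigma>" "X \<noteq> Y" for X Y using ps that by (simp add: partition_on_def disjoint_def)
    have dr: "X \<inter> Y = {}" if "X \<in> \<rho>" "Y \<in> \<rho>" "X \<noteq> Y" for X Y using pr that by (simp add: partition_on_def disjoint_def)
    have dC: "X \<inter> insert a C = {}" if "X \<in> \<sigma> \<union> (\<rho> - {C})" for X
    proof -
      have "a \<notin> X" using that sub rub q by fastforce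
      moreover have "X \<inter> C = {}" using that d[OF _ C(1)] dr[OF _ C(1)] by blast
      ultimately show ?thesis by auto
    qed
    have d2: "X \<inter> Y = {}" if "X \<in> \<sigma> \<union> (\<rho> - {C})" "Y \<in> \<sigma> \<union> (\<rho> - {C})" "X \<noteq> Y" for X Y
      using that d ds dr by (metis Diff_iff Int_commute Un_iff)
    show "disjnt X Y" using XY d2 dC unfolding \<pi> disjnt_def by blast
  qed
  have nc: "\<not> crossing \<pi>"
  proof
    assume "crossing \<pi>"
    then obtain i j k l X Y where *: "X \<in> \<pi>" "Y \<in> \<pi>" "i < j" "j < k" "k < l" "X \<noteq> Y" "i \<in> X" "k \<in> X" "j \<in> Y" "l \<in> Y"
      unfolding crossing_def by blast
    have ia: "a \<le> i" using part * by (auto simp: partition_on_def)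
    define g where "g = (\<lambda>X. if X = insert a C then C else X)"
    have gr: "g X \<in> \<rho>" if "X \<in> \<pi>" "X \<notin> \<sigma>" for X using that C unfolding \<pi> g_def by auto
    have ge: "x \<in> g X" "q \<le> x" if "X \<in> \<pi>" "X \<notin> \<sigma>" "x \<in> X" "x \<noteq> a" for X x
    proof -
      show "x \<in> g X" using that by (auto simp: g_def)
      then show "q \<le> x" using rub(1)[OF gr[OF that(1,2)]] by auto
    qed
    consider "X \<in> \<sigma>" "Y \<in> \<sigma>" | "X \<in> \<sigma>" "Y \<notin> \<sigma>" | "X \<notin> \<sigma>" "Y \<in> \<sigma>" | "X \<notin> \<sigma>" "Y \<notin> \<sigma>" by blast
    then show False
    proof cases
      case 1
      then have "crossing \<sigma>" using * unfolding crossing_def by blast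
      then show ?thesis using s by (simp add: nc_on_def)
    next
      case 2
      then have "q \<le> j" "k < q" using ge[OF *(2) 2(2) *(9)] sub[OF 2(1)] * ia by auto
      then show ?thesis using * by simp
    next
      case 3
      then have "q \<le> k" "l < q" using ge[OF *(1) 3(1) *(8)] sub[OF 3(2)] * ia by auto
      then show ?thesis using * by simp
    next
      case 4
      have 5: "k \<in> g X" "j \<in> g Y" "l \<in> g Y" "q \<le> j" using ge[OF *(1) 4(1) *(8)] ge[OF *(2) 4(2)] * ia by auto
      have ne: "g X \<noteq> g Y"
      proof
        assume "g X = g Y"
        then have "k \<in> X \<inter> Y" using 5(1) *(8) by (auto simp: g_def split: if_splits)
        then show False using *(1,2,6) part by (auto simp: partition_on_def disjoint_def)
      qed
      \<comment> \<open>A crossing that starts at a can be started at q instead, since q lies in the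
        same block and before j.\<close>
      have "\<exists>i'. i' \<in> g X \<and> i' < j"
      proof (cases "i = a")
        case True
        then have "X = insert a C" using *(1,7) part block_of_eq[OF part] \<pi> by (metis UnCI insertI1)
        then have gX: "g X = C" by (simp add: g_def)
        have "g X \<inter> g Y = {}" using pr gr[OF *(1) 4(1)] gr[OF *(2) 4(2)] ne by (simp add: partition_on_def disjoint_def)
        then have "q \<in> g X" "j \<noteq> q" using C(2) 5(2) unfolding gX by auto
        then show ?thesis using 5(4) by (intro exI[of _ q]) auto
      next
        case False
        then show ?thesis using ge[OF *(1) 4(1) *(7)] * by blast
      qed
      then have "crossing \<rho>" using 5 * ne gr[OF *(1) 4(1)] gr[OF *(2) 4(2)] unfolding crossing_def by blast
      then show ?thesis using r by (simp add: nc_on_def)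
    qed
  qed
  show "nc_join a (q, \<sigma>, \<rho>) \<in> nc_on {a..<b}" using part nc by (simp add: nc_on_def \<pi>_def)
  have bl: "block_of \<pi> a = insert a C" by (rule block_of_eq[OF part]) (auto simp: \<pi>)
  then show "block_of (nc_join a (q, \<sigma>, \<rho>)) a = insert a (block_of \<rho> q)" by (simp add: \<pi>_def C_def)
  have fC: "finite C" using rub[OF C(1)] finite_subset by blast
  have Mq: "Min C = q" using C rub[OF C(1)] fC by (intro Min_eqI) auto
  have "{X \<in> \<pi>. X \<subseteq> {Suc a..<q}} = \<sigma>"
    unfolding \<pi> using sub rub C(1) by fastforce
  moreover have "insert C {X \<in> \<pi>. X \<subseteq> {q..}} = \<rho>"
  proof -
    have "X \<notin> \<sigma>" if "X \<subseteq> {q..}" for X using sub[of X] that by fastforce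
    moreover have "X \<subseteq> {q..}" if "X \<in> \<rho>" for X using rub[OF that] by auto
    ultimately show ?thesis unfolding \<pi> using C(1) q by auto
  qed
  ultimately show "nc_split a (nc_join a (q, \<sigma>, \<rho>)) = (q, \<sigma>, \<rho>)"
    unfolding nc_split_def \<pi>_def[symmetric] bl using aC Mq by (simp add: Let_def insert_Diff_if)
  have fs: "finite \<sigma>" "finite \<rho>" using finite_partition[OF _ ps] finite_partition[OF _ pr] by auto
  have disj: "\<sigma> \<inter> (\<rho> - {C}) = {}" using sub rub by fastforce
  have iC: "insert a C \<notin> \<sigma> \<union> (\<rho> - {C})" using sub rub q by fastforce
  have "\<pi> - {insert a C} = \<sigma> \<union> (\<rho> - {C})" unfolding \<pi> using iC by auto
  then have pr1: "(\<Prod>B\<in>\<pi> - {insert a C}. \<psi> (card B)) = (\<Prod>B\<in>\<sigma>. \<psi> (card B)) * (\<Prod>B\<in>\<rho> - {C}. \<psi> (card B))"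
    using fs disj by (simp add: prod.union_disjoint)
  have "card \<pi> = Suc (card (\<sigma> \<union> (\<rho> - {C})))" unfolding \<pi> using iC fs by simp
  also have "\<dots> = card \<sigma> + card \<rho>" using fs disj C(1) by (simp add: card_Un_disjoint card_Diff_singleton) (metis C(1) One_nat_def Suc_pred card_gt_0_iff empty_iff)
  finally have c: "card \<pi> = card \<sigma> + card \<rho>" .
  have "card \<sigma> \<le> q - Suc a" "card \<rho> \<le> b - q" using card_partition_le[OF _ ps] card_partition_le[OF _ pr] by auto
  then have "b - a - card \<pi> = Suc ((q - Suc a - card \<sigma>) + (b - q - card \<rho>))" using q c by auto
  then have p0: "\<psi> 0 ^ (b - a - card \<pi>) = \<psi> 0 * (\<psi> 0 ^ (q - Suc a - card \<sigma>) * \<psi> 0 ^ (b - q - card \<rho>))" by (simp add: power_add)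
  show "rooted_prod \<psi> \<phi> (b - a) a (nc_join a (q, \<sigma>, \<rho>)) =
      \<psi> 0 * (block_prod \<psi> (q - Suc a) \<sigma> * rooted_prod \<psi> (\<lambda>k. \<phi> (Suc k)) (b - q) q \<rho>)"
    unfolding \<pi>_def[symmetric] rooted_prod_def block_prod_def bl pr1 p0 C_def[symmetric]
    using aC fC by simp
qed

text \<open>q is the second element of the block of a. Another block with elements on both sides of
  q would cross the block of a, so the partition falls apart at q.\<close>

lemma nc_split:
  assumes pi: "\<pi> \<in> nc_on {a..<b}" and ab: "a < b" and ne: "block_of \<pi> a \<noteq> {a}"
  obtains q \<sigma> \<rho> where "nc_split a \<pi> = (q, \<sigma>, \<rho>)" "q \<in> {Suc a..<b}" "\<sigma> \<in> nc_on {Suc a..<q}" "\<rho> \<in> nc_on {q..<b}" "nc_join a (q, \<sigma>, \<rho>) = \<pi>"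
proof -
  have part: "partition_on {a..<b} \<pi>" and nc: "\<not> crossing \<pi>" using pi by (auto simp: nc_on_def)
  define A where "A = block_of \<pi> a"
  have A: "A \<in> \<pi>" "a \<in> A" using block_of_in[OF part, of a] ab by (auto simp: A_def)
  define B where "B = A - {a}"
  have Asub: "A \<subseteq> {a..<b}" using A part by (auto simp: partition_on_def)
  have fB: "finite B" "B \<noteq> {}" using Asub finite_subset A ne by (auto simp: B_def A_def)
  define q where "q = Min B"
  have qB: "q \<in> B" "\<And>x. x \<in> B \<Longrightarrow> q \<le> x" using fB by (auto simp: q_def)
  have q: "q \<in> {Suc a..<b}" using qB Asub by (auto simp: B_def)
  define \<sigma> where "\<sigma> = {X\<in>\<pi>. X \<subseteq> {Suc a..<q}}"
  define \<rho> where "\<rho> = insert B {X\<in>\<pi>. X \<subseteq> {q..}}"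
  have dis: "X \<inter> Y = {}" if "X \<in> \<pi>" "Y \<in> \<pi>" "X \<noteq> Y" for X Y using that part by (auto simp: partition_on_def disjoint_def)
  have U: "\<Union>\<pi> = {a..<b}" using part by (auto simp: partition_on_def)
  have dich: "X \<in> \<sigma> \<or> X \<subseteq> {q..}" if X: "X \<in> \<pi>" "X \<noteq> A" for X
  proof (rule ccontr)
    assume "\<not> (X \<in> \<sigma> \<or> X \<subseteq> {q..})"
    then have "\<not> X \<subseteq> {Suc a..<q}" "\<not> X \<subseteq> {q..}" using X(1) by (simp_all add: \<sigma>_def)
    then obtain x y where xy: "x \<in> X" "x < q" "y \<in> X" "y \<notin> {Suc a..<q}" by (meson atLeast_iff not_le subsetI)
    have "a \<notin> X" "q \<notin> X" using dis[OF X(1) A(1) X(2)] A qB by (auto simp: B_def)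
    moreover have "X \<subseteq> {a..<b}" using Union_upper[OF X(1)] unfolding U .
    ultimately have "a \<le> x" "a \<le> y" "x \<noteq> a" "y \<noteq> a" "y \<noteq> q" using xy by auto
    then have "a < x" "q < y" using xy(4) by auto
    then show False using nc xy X A qB(1) unfolding crossing_def B_def by blast
  qed
  have AX: "\<not> A \<subseteq> {q..}" "\<not> A \<subseteq> {Suc a..<q}" using A q by auto
  have "partition_on {Suc a..<q} \<sigma>"
  proof (rule partition_onI)
    show "\<Union>\<sigma> = {Suc a..<q}"
    proof
      show "{Suc a..<q} \<subseteq> \<Union>\<sigma>"
      proof
        fix x assume x: "x \<in> {Suc a..<q}"
        then have "x \<in> \<Union>\<pi>" using U q by auto
        then obtain X where X: "X \<in> \<pi>" "x \<in> X" by blast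
        have "X \<noteq> A" using x X qB(2)[of x] by (auto simp: B_def)
        then show "x \<in> \<Union>\<sigma>" using dich[OF X(1)] X x by auto
      qed
    qed (auto simp: \<sigma>_def)
  qed (use part dis in \<open>auto simp: \<sigma>_def partition_on_def disjnt_def\<close>)
  moreover have "\<not> crossing \<sigma>" using crossing_mono[of \<sigma> id \<pi>] nc by (auto simp: \<sigma>_def)
  ultimately have s: "\<sigma> \<in> nc_on {Suc a..<q}" by (simp add: nc_on_def)
  have Bd: "B \<inter> X = {}" if "X \<in> \<pi>" "X \<subseteq> {q..}" for X 
    using dis[OF A(1) that(1)] that AX unfolding B_def by blast
  have "partition_on {q..<b} \<rho>"
  proof (rule partition_onI)
    show "\<Union>\<rho> = {q..<b}"
    proof
      show "\<Union>\<rho> \<subseteq> {q..<b}" using U Asub qB(2) unfolding \<rho>_def B_def by fastforce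
      show "{q..<b} \<subseteq> \<Union>\<rho>"
      proof
        fix x assume x: "x \<in> {q..<b}"
        then have "x \<in> \<Union>\<pi>" using U q by auto
        then obtain X where X: "X \<in> \<pi>" "x \<in> X" by blast
        show "x \<in> \<Union>\<rho>"
        proof (cases "X = A")
          case True
          then show ?thesis using X x q by (auto simp: \<rho>_def B_def)
        next
          case False
          then show ?thesis using dich[OF X(1)] X x by (auto simp: \<rho>_def \<sigma>_def)
        qed
      qed
    qed
    show "{} \<notin> \<rho>" using part fB by (auto simp: \<rho>_def partition_on_def)
    fix X Y assume "X \<in> \<rho>" "Y \<in> \<rho>" "X \<noteq> Y"
    then show "disjnt X Y" using Bd dis unfolding \<rho>_def disjnt_def by blast
  qed
  note pr = this
  have "\<not> crossing \<rho>"
  proof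
    assume "crossing \<rho>"
    then have "crossing \<pi>"
    proof (rule crossing_mono[where f = "\<lambda>X. if X = B then A else X"])
      show "inj_on (\<lambda>X. if X = B then A else X) \<rho>" using AX by (auto simp: inj_on_def \<rho>_def)
    qed (use A in \<open>auto simp: \<rho>_def B_def\<close>)
    then show False using nc by simp
  qed
  with pr have r: "\<rho> \<in> nc_on {q..<b}" by (simp add: nc_on_def)
  have bq: "block_of \<rho> q = B" by (rule block_of_eq[OF pr]) (use qB in \<open>auto simp: \<rho>_def\<close>)
  have "nc_join a (q, \<sigma>, \<rho>) = \<pi>"
  proof -
    have "B \<notin> {X\<in>\<pi>. X \<subseteq> {q..}}" using Bd fB(2) by fastforce
    then have "\<rho> - {B} = {X\<in>\<pi>. X \<subseteq> {q..}}" by (auto simp: \<rho>_def)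
    moreover have "insert a B = A" using A by (auto simp: B_def)
    ultimately have "nc_join a (q, \<sigma>, \<rho>) = \<sigma> \<union> {X\<in>\<pi>. X \<subseteq> {q..}} \<union> {A}" by (simp add: nc_join_def bq)
    also have "\<dots> = \<pi>" using dich A by (auto simp: \<sigma>_def)
    finally show ?thesis .
  qed
  moreover have "nc_split a \<pi> = (q, \<sigma>, \<rho>)"
    by (simp add: nc_split_def Let_def A_def[symmetric] B_def[symmetric] q_def[symmetric] \<sigma>_def \<rho>_def)
  ultimately show ?thesis using that q s r by blast
qed

text \<open>The two claims need each other in the induction: the plain sum is the rooted one for
  \<open>\<phi> = \<psi>\<close>, and the rooted sum splits at the second element of the first block
  just as \<open>tree_sum_even_Suc\<close> splits off the first subtree, which is a plain sum. For n
  = 0 there is no block of a, so the rooted claim starts at n = 1.\<close>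

lemma sum_nc_on_both:
  "\<psi> 0 * (\<Sum>\<pi>\<in>nc_on {a..<a + n}. block_prod \<psi> n \<pi>) = tree_sum \<psi> (2 * n) \<psi> \<and>
   (0 < n \<longrightarrow> \<psi> 0 * (\<Sum>\<pi>\<in>nc_on {a..<a + n}. rooted_prod \<psi> \<phi> n a \<pi>) = tree_sum \<psi> (2 * n) \<phi>)"
proof (induction n arbitrary: a \<phi> rule: less_induct)
  case (less n)
  have IH1: "\<psi> 0 * (\<Sum>\<pi>\<in>nc_on {a..<a + m}. block_prod \<psi> m \<pi>) = tree_sum \<psi> (2 * m) \<psi>" if "m < n" for m a
    using less.IH[OF that] by blast
  have IH2: "\<psi> 0 * (\<Sum>\<pi>\<in>nc_on {a..<a + m}. rooted_prod \<psi> \<phi> m a \<pi>) = tree_sum \<psi> (2 * m) \<phi>" if "m < n" "0 < m" for m a \<phi>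
    using less.IH[OF that(1)] that(2) by blast
  have rooted: "\<psi> 0 * (\<Sum>\<pi>\<in>nc_on {a..<a + n}. rooted_prod \<psi> \<phi> n a \<pi>) = tree_sum \<psi> (2 * n) \<phi>" if n: "0 < n" for \<phi>
  proof -
    define b where "b = a + n"
    have ab: "a < b" using n by (simp add: b_def)
    define S where "S = {\<pi>\<in>nc_on {a..<b}. block_of \<pi> a = {a}}"
    define N where "N = {\<pi>\<in>nc_on {a..<b}. block_of \<pi> a \<noteq> {a}}"
    define X where "X = (SIGMA q:{Suc a..<b}. nc_on {Suc a..<q} \<times> nc_on {q..<b})"
    \<comment> \<open>A singleton block is a root with one child: this is the last term k = n - 1 of
      the recursion, in which the remaining tree is a bare root of weight
      \<open>\<phi> 1\<close>.\<close>
    have single: "\<psi> 0 * (\<Sum>\<pi>\<in>S. rooted_prod \<psi> \<phi> n a \<pi>) = tree_sum \<psi> (2 * (n - 1)) \<psi> * \<phi> 1"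
    proof -
      have "(\<Sum>\<pi>\<in>S. rooted_prod \<psi> \<phi> n a \<pi>) = (\<Sum>\<sigma>\<in>nc_on {Suc a..<b}. block_prod \<psi> (n - 1) \<sigma> * \<phi> 1)"
      proof (rule sum.reindex_bij_witness[where i = "insert {a}" and j = "\<lambda>\<pi>. \<pi> - {{a}}"])
        fix \<pi> assume "\<pi> \<in> S"
        then have pi: "\<pi> \<in> nc_on {a..<b}" "partition_on {a..<b} \<pi>" "\<not> crossing \<pi>" "block_of \<pi> a = {a}" by (auto simp: S_def nc_on_def)
        have a: "{a} \<in> \<pi>" using block_of_in[OF pi(2), of a] pi(4) ab by simp
        show "insert {a} (\<pi> - {{a}}) = \<pi>" using a by auto
        have U: "\<Union>\<pi> = {a..<b}" and D: "\<And>X Y. X \<in> \<pi> \<Longrightarrow> Y \<in> \<pi> \<Longrightarrow> X \<noteq> Y \<Longrightarrow> X \<inter> Y = {}" "{} \<notin> \<pi>"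
          using pi(2) by (auto simp: partition_on_def disjoint_def)
        have "\<Union>(\<pi> - {{a}}) = {Suc a..<b}"
        proof -
          have "a \<notin> X" if "X \<in> \<pi> - {{a}}" for X using D(1)[OF _ a, of X] that by auto
          then have "\<Union>(\<pi> - {{a}}) = \<Union>\<pi> - {a}" by auto
          then show ?thesis unfolding U by auto
        qed
        then have "partition_on {Suc a..<b} (\<pi> - {{a}})" using D by (intro partition_onI) (simp_all add: disjnt_def)
        moreover have "\<not> crossing (\<pi> - {{a}})" using pi(3) crossing_mono[of "\<pi> - {{a}}" id \<pi>] by auto
        ultimately show "\<pi> - {{a}} \<in> nc_on {Suc a..<b}" by (simp add: nc_on_def)
        have "card (\<pi> - {{a}}) = card \<pi> - 1" "0 < card \<pi>" using a finite_partition[OF _ pi(2)] by (auto simp: card_gt_0_iff)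
        then have "n - 1 - card (\<pi> - {{a}}) = n - card \<pi>" by simp
        then show "block_prod \<psi> (n - 1) (\<pi> - {{a}}) * \<phi> 1 = rooted_prod \<psi> \<phi> n a \<pi>"
          unfolding block_prod_def rooted_prod_def pi(4) by simp
      next
        fix \<sigma> assume "\<sigma> \<in> nc_on {Suc a..<b}"
        then have s: "partition_on {Suc a..<b} \<sigma>" "\<not> crossing \<sigma>" by (auto simp: nc_on_def)
        then have U: "\<Union>\<sigma> = {Suc a..<b}" and D: "\<And>X Y. X \<in> \<sigma> \<Longrightarrow> Y \<in> \<sigma> \<Longrightarrow> X \<noteq> Y \<Longrightarrow> X \<inter> Y = {}" "{} \<notin> \<sigma>"
          by (auto simp: partition_on_def disjoint_def)
        have a: "a \<notin> X" if "X \<in> \<sigma>" for X using Union_upper[OF that] unfolding U by auto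
        then show "insert {a} \<sigma> - {{a}} = \<sigma>" by auto
        have p: "partition_on {a..<b} (insert {a} \<sigma>)"
        proof (rule partition_onI)
          show "\<Union>(insert {a} \<sigma>) = {a..<b}" using U ab by auto
        qed (use D a in \<open>auto simp: disjnt_def\<close>)
        have "\<not> crossing (insert {a} \<sigma>)"
        proof
          assume "crossing (insert {a} \<sigma>)"
          then obtain i j k l X Y where *: "X \<in> insert {a} \<sigma>" "Y \<in> insert {a} \<sigma>" "i < j" "j < k" "k < l" "X \<noteq> Y" "i \<in> X" "k \<in> X" "j \<in> Y" "l \<in> Y"
            unfolding crossing_def by blast
          then have "X \<noteq> {a}" "Y \<noteq> {a}" by auto
          then have "crossing \<sigma>" using * unfolding crossing_def by blast
          then show False using s(2) by simp
        qed
        then show "insert {a} \<sigma> \<in> S" using p block_of_eq[OF p, of "{a}" a] by (simp add: S_def nc_on_def)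
      qed
      then have "\<psi> 0 * (\<Sum>\<pi>\<in>S. rooted_prod \<psi> \<phi> n a \<pi>) = (\<psi> 0 * (\<Sum>\<sigma>\<in>nc_on {Suc a..<Suc a + (n - 1)}. block_prod \<psi> (n - 1) \<sigma>)) * \<phi> 1"
        using n by (simp add: b_def sum_distrib_right)
      also have "\<dots> = tree_sum \<psi> (2 * (n - 1)) \<psi> * \<phi> 1" using IH1[of "n - 1" "Suc a"] n by simp
      finally show ?thesis .
    qed
    have "(\<Sum>\<pi>\<in>N. rooted_prod \<psi> \<phi> n a \<pi>) = (\<Sum>(q, \<sigma>, \<rho>)\<in>X. \<psi> 0 * (block_prod \<psi> (q - Suc a) \<sigma> * rooted_prod \<psi> (\<lambda>k. \<phi> (Suc k)) (b - q) q \<rho>))"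
    proof (rule sum.reindex_bij_witness[where i = "nc_join a" and j = "nc_split a"])
      fix \<pi> assume "\<pi> \<in> N"
      then have pi: "\<pi> \<in> nc_on {a..<b}" "block_of \<pi> a \<noteq> {a}" by (auto simp: N_def)
      obtain q \<sigma> \<rho> where q: "nc_split a \<pi> = (q, \<sigma>, \<rho>)" "q \<in> {Suc a..<b}" "\<sigma> \<in> nc_on {Suc a..<q}" "\<rho> \<in> nc_on {q..<b}" "nc_join a (q, \<sigma>, \<rho>) = \<pi>"
        by (rule nc_split[OF pi(1) ab pi(2)])
      show "nc_join a (nc_split a \<pi>) = \<pi>" "nc_split a \<pi> \<in> X" using q by (auto simp: X_def)
      show "(case nc_split a \<pi> of (q, \<sigma>, \<rho>) \<Rightarrow> \<psi> 0 * (block_prod \<psi> (q - Suc a) \<sigma> * rooted_prod \<psi> (\<lambda>k. \<phi> (Suc k)) (b - q) q \<rho>)) = rooted_prod \<psi> \<phi> n a \<pi>"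
        using nc_join(4)[OF q(2,3,4), of \<psi> \<phi>] q(1,5) by (simp add: b_def)
    next
      fix x assume "x \<in> X"
      then obtain q \<sigma> \<rho> where x: "x = (q, \<sigma>, \<rho>)" "q \<in> {Suc a..<b}" "\<sigma> \<in> nc_on {Suc a..<q}" "\<rho> \<in> nc_on {q..<b}" by (auto simp: X_def)
      show "nc_split a (nc_join a x) = x" using nc_join(3)[OF x(2-4)] x(1) by simp
      have "q \<in> block_of \<rho> q" using block_of_in(2)[of "{q..<b}" \<rho> q] x by (auto simp: nc_on_def)
      then have "insert a (block_of \<rho> q) \<noteq> {a}" using x(2) by auto
      then show "nc_join a x \<in> N" using nc_join(1,2)[OF x(2-4)] x(1) by (simp add: N_def)
    qed
    also have "\<dots> = (\<Sum>q\<in>{Suc a..<b}. \<psi> 0 * ((\<Sum>\<sigma>\<in>nc_on {Suc a..<q}. block_prod \<psi> (q - Suc a) \<sigma>) * (\<Sum>\<rho>\<in>nc_on {q..<b}. rooted_prod \<psi> (\<lambda>k. \<phi> (Suc k)) (b - q) q \<rho>)))"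
    proof -
      have "(\<Sum>(\<sigma>, \<rho>)\<in>A \<times> B. k * (f \<sigma> * g \<rho>)) = k * (sum f A * sum g B)" for k :: real and f g and A B :: "nat set set set"
        unfolding sum_product sum.cartesian_product unfolding sum_distrib_left by (simp add: case_prod_unfold)
      note pairs = this
      have "(\<Sum>(q, \<sigma>, \<rho>)\<in>X. \<psi> 0 * (block_prod \<psi> (q - Suc a) \<sigma> * rooted_prod \<psi> (\<lambda>k. \<phi> (Suc k)) (b - q) q \<rho>))
        = (\<Sum>q\<in>{Suc a..<b}. \<Sum>(\<sigma>, \<rho>)\<in>nc_on {Suc a..<q} \<times> nc_on {q..<b}. \<psi> 0 * (block_prod \<psi> (q - Suc a) \<sigma> * rooted_prod \<psi> (\<lambda>k. \<phi> (Suc k)) (b - q) q \<rho>))"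
        unfolding X_def by (rule sum.Sigma[symmetric]) (simp_all add: finite_nc_on)
      then show ?thesis unfolding pairs .
    qed
    finally have N1: "(\<Sum>\<pi>\<in>N. rooted_prod \<psi> \<phi> n a \<pi>) = \<dots>" .
    \<comment> \<open>One factor \<open>\<psi> 0\<close> stands in front and one comes from
      \<open>nc_join\<close>; each of the two subtrees absorbs one of them.\<close>
    have "\<psi> 0 * (\<Sum>\<pi>\<in>N. rooted_prod \<psi> \<phi> n a \<pi>) = (\<Sum>q\<in>{Suc a..<b}. tree_sum \<psi> (2 * (q - Suc a)) \<psi> * tree_sum \<psi> (2 * (b - q)) (\<lambda>k. \<phi> (Suc k)))"
      unfolding N1
    proof (subst sum_distrib_left, rule sum.cong[OF refl])
      have alg: "x * (x * (y * z)) = (x * y) * (x * z)" for x y z :: real by simp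
      fix q assume q: "q \<in> {Suc a..<b}"
      then have lt: "q - Suc a < n" "b - q < n" "0 < b - q" unfolding b_def atLeastLessThan_iff by arith+
      have 1: "\<psi> 0 * (\<Sum>\<sigma>\<in>nc_on {Suc a..<q}. block_prod \<psi> (q - Suc a) \<sigma>) = tree_sum \<psi> (2 * (q - Suc a)) \<psi>"
        using IH1[OF lt(1), of "Suc a"] q by (simp add: b_def)
      have 2: "\<psi> 0 * (\<Sum>\<rho>\<in>nc_on {q..<b}. rooted_prod \<psi> (\<lambda>k. \<phi> (Suc k)) (b - q) q \<rho>) = tree_sum \<psi> (2 * (b - q)) (\<lambda>k. \<phi> (Suc k))"
        using IH2[OF lt(2,3), of "\<lambda>k. \<phi> (Suc k)" q] q by (simp add: b_def)
      show "\<psi> 0 * (\<psi> 0 * ((\<Sum>\<sigma>\<in>nc_on {Suc a..<q}. block_prod \<psi> (q - Suc a) \<sigma>) * (\<Sum>\<rho>\<in>nc_on {q..<b}. rooted_prod \<psi> (\<lambda>k. \<phi> (Suc k)) (b - q) q \<rho>))) =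
        tree_sum \<psi> (2 * (q - Suc a)) \<psi> * tree_sum \<psi> (2 * (b - q)) (\<lambda>k. \<phi> (Suc k))"
        by (rule trans[OF _ arg_cong2[where f = "(*)", OF 1 2]]) (rule alg)
    qed
    also have "\<dots> = (\<Sum>k<n - 1. tree_sum \<psi> (2 * k) \<psi> * tree_sum \<psi> (2 * (n - 1 - k)) (\<lambda>k. \<phi> (Suc k)))"
    proof -
      have eq: "{Suc a..<b} = {0 + Suc a..<(n - 1) + Suc a}" using n by (simp add: b_def add.commute)
      have d: "Suc a + k - Suc a = k" "b - (Suc a + k) = n - 1 - k" for k by (simp_all add: b_def)
      show ?thesis unfolding eq sum.atLeastLessThan_shift_bounds atLeast0LessThan comp_def d ..
    qed
    finally have N: "\<psi> 0 * (\<Sum>\<pi>\<in>N. rooted_prod \<psi> \<phi> n a \<pi>) = \<dots>" .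
    have "(\<Sum>\<pi>\<in>nc_on {a..<b}. rooted_prod \<psi> \<phi> n a \<pi>) = (\<Sum>\<pi>\<in>N. rooted_prod \<psi> \<phi> n a \<pi>) + (\<Sum>\<pi>\<in>S. rooted_prod \<psi> \<phi> n a \<pi>)"
    proof -
      have "nc_on {a..<b} = N \<union> S" "N \<inter> S = {}" by (auto simp: N_def S_def)
      moreover have "finite N" "finite S" using finite_nc_on[of "{a..<b}"] by (auto simp: N_def S_def)
      ultimately show ?thesis by (simp add: sum.union_disjoint)
    qed
    then have "\<psi> 0 * (\<Sum>\<pi>\<in>nc_on {a..<b}. rooted_prod \<psi> \<phi> n a \<pi>) = 
       (\<Sum>k<n - 1. tree_sum \<psi> (2 * k) \<psi> * tree_sum \<psi> (2 * (n - 1 - k)) (\<lambda>k. \<phi> (Suc k))) + tree_sum \<psi> (2 * (n - 1)) \<psi> * \<phi> 1"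
      using N single by (simp add: distrib_left)
    also have "\<dots> = (\<Sum>k<Suc (n - 1). tree_sum \<psi> (2 * k) \<psi> * tree_sum \<psi> (2 * (n - 1 - k)) (\<lambda>k. \<phi> (Suc k)))"
      by simp
    also have "\<dots> = tree_sum \<psi> (2 * Suc (n - 1)) \<phi>" unfolding tree_sum_even_Suc lessThan_Suc_atMost ..
    finally show ?thesis using n by (simp add: b_def)
  qed
  have "\<psi> 0 * (\<Sum>\<pi>\<in>nc_on {a..<a + n}. block_prod \<psi> n \<pi>) = tree_sum \<psi> (2 * n) \<psi>"
  proof (cases "n = 0")
    case True
    then show ?thesis by (simp add: nc_on_empty block_prod_def)
  next
    case False
    have "(\<Sum>\<pi>\<in>nc_on {a..<a + n}. block_prod \<psi> n \<pi>) = (\<Sum>\<pi>\<in>nc_on {a..<a + n}. rooted_prod \<psi> \<psi> n a \<pi>)"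
      using False by (intro sum.cong refl block_prod_rooted[of "{a..<a + n}"]) (auto simp: nc_on_def)
    then show ?thesis using rooted[of \<psi>] False by simp
  qed
  then show ?case using rooted by blast
qed

lemmas sum_nc_on = sum_nc_on_both[THEN conjunct1] sum_nc_on_both[THEN conjunct2, rule_format]

text \<open>Blocks are grouped by size, and every size lies between 1 and n. The exponent of the
  size 0 is the number of elements minus the number of blocks.\<close>

lemma prod_block_count:
  assumes "partition_on {1..n} \<pi>"
  shows "(\<Prod>i=0..n. f i ^ block_count n \<pi> i) = f 0 ^ (n - card \<pi>) * (\<Prod>B\<in>\<pi>. f (card B) :: real)"
    and "(\<Prod>i=1..n. f i ^ block_count n \<pi> i) = (\<Prod>B\<in>\<pi>. f (card B) :: real)"
proof -
  have fin: "finite \<pi>" using finite_partition[OF _ assms] by simp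
  have sz: "card ` \<pi> \<subseteq> {1..n}"
  proof
    fix k assume "k \<in> card ` \<pi>"
    then obtain B where B: "B \<in> \<pi>" "k = card B" by blast
    then have "B \<subseteq> {1..n}" "B \<noteq> {}" using assms by (auto simp: partition_on_def)
    then have "card B \<le> card {1..n}" "0 < card B" using card_mono[of "{1..n}" B] by (auto simp: card_gt_0_iff intro: finite_subset)
    then show "k \<in> {1..n}" using B by simp
  qed
  have "(\<Sum>k=1..n. card {B \<in> \<pi>. card B = k}) = (\<Sum>k=1..n. \<Sum>B\<in>{B \<in> \<pi>. card B = k}. 1)" by simp
  also have "\<dots> = (\<Sum>B\<in>\<pi>. 1)" by (rule sum.group[OF fin _ sz]) simp
  finally have c: "(\<Sum>k=1..n. card {B \<in> \<pi>. card B = k}) = card \<pi>" by simp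
  have "(\<Prod>i=1..n. f i ^ block_count n \<pi> i) = (\<Prod>i=1..n. \<Prod>B\<in>{B \<in> \<pi>. card B = i}. f (card B))"
    by (intro prod.cong refl) (auto simp: block_count_def)
  also have "\<dots> = (\<Prod>B\<in>\<pi>. f (card B))" by (rule prod.group[OF fin _ sz]) simp
  finally show 1: "(\<Prod>i=1..n. f i ^ block_count n \<pi> i) = (\<Prod>B\<in>\<pi>. f (card B))" .
  have "(\<Prod>i=0..n. f i ^ block_count n \<pi> i) = f 0 ^ block_count n \<pi> 0 * (\<Prod>i=1..n. f i ^ block_count n \<pi> i)"
    by (simp add: prod.atLeast_Suc_atMost)
  then show "(\<Prod>i=0..n. f i ^ block_count n \<pi> i) = f 0 ^ (n - card \<pi>) * (\<Prod>B\<in>\<pi>. f (card B))"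
    unfolding 1 using c by (simp add: block_count_def)
qed

lemma form_unit:
  assumes "i < r" "j < r"
  shows "form r P k (unit_fun i) (unit_fun j) = (P ^\<^sub>m k) $$ (i, j)"
proof -
  have s: "(\<Sum>c<r. of_bool (c = l) * g c) = g l" if "l < r" for l and g :: "nat \<Rightarrow> real"
    using that by (simp add: of_bool_def if_distrib[of "\<lambda>x. x * _"] cong: if_cong)
  have "form r P k (unit_fun i) (unit_fun j) = (\<Sum>a<r. of_bool (a = i) * (\<Sum>b<r. of_bool (b = j) * (P ^\<^sub>m k) $$ (a, b)))"
    unfolding form_def unit_fun_def sum_distrib_left by (intro sum.cong refl) (simp only: mult_ac)
  then show ?thesis using s assms by simp
qed

lemma psd_mtrace_pow_0:
  assumes "psd_mat r P" "mtrace (P ^\<^sub>m Suc k) = 0" "k \<ge> 1"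
  shows "P ^\<^sub>m k = 0\<^sub>m r r"
  using psd_pow_Suc_0[OF assms(1,3)] psd_trace_0[OF psd_mat_pow[OF assms(1)] assms(2)] by blast

text \<open>Put \<psi>(c) = Tr(P^(c+1)). The leading factor Tr(P) is the \<open>\<psi> 0\<close>
  missing in \<open>block_prod\<close>, and the quotient replaces the weight of the first block by a
  bilinear form, so that the sum is a tree sum rooted at the first block.\<close>

lemma Sigma_central_entry:
  assumes psd: "psd_mat r P" and ij: "i < r" "j < r" and n: "n \<ge> 1"
  shows "Sigma_central n P $$ (i, j) =
    tree_sum (\<lambda>c. mtrace (P ^\<^sub>m Suc c)) (2 * n) (\<lambda>c. form r P c (unit_fun i) (unit_fun j))"
proof -
  define \<psi> where "\<psi> = (\<lambda>c. mtrace (P ^\<^sub>m Suc c))"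
  define \<phi> where "\<phi> = (\<lambda>c. form r P c (unit_fun i) (unit_fun j))"
  have nc: "nc_parts n = nc_on {1..<1 + n}" by (simp add: nc_parts_def nc_on_def atLeastLessThanSuc_atLeastAtMost)
  have \<psi>0: "\<psi> 0 = mtrace P" using pow_mat_1[OF psd_matD(1)[OF psd]] by (simp add: \<psi>_def del: pow_mat.simps)
  have "Sigma_central n P $$ (i, j) = \<psi> 0 * (\<Sum>\<pi>\<in>nc_parts n. ((\<Prod>i=0..n. \<psi> i ^ block_count n \<pi> i) / \<psi> (card (first_block \<pi>))) * \<phi> (card (first_block \<pi>)))"
  proof -
    have "dim_row (P ^\<^sub>m k) = r" "dim_col (P ^\<^sub>m k) = r" for k using psd_matD(4)[OF psd, of k] by auto
    then show ?thesis using ij psd_matD(3)[OF psd] unfolding \<psi>0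
      by (simp add: Sigma_central_def mat_sum_def \<phi>_def \<psi>_def form_unit del: pow_mat.simps)
  qed
  moreover have "(\<Sum>\<pi>\<in>nc_parts n. ((\<Prod>i=0..n. \<psi> i ^ block_count n \<pi> i) / \<psi> (card (first_block \<pi>))) * \<phi> (card (first_block \<pi>))) =
     (\<Sum>\<pi>\<in>nc_parts n. rooted_prod \<psi> \<phi> n 1 \<pi>)"
  proof (rule sum.cong[OF refl])
    fix \<pi> assume "\<pi> \<in> nc_parts n"
    then have p: "partition_on {1..n} \<pi>" by (simp add: nc_parts_def)
    define B where "B = first_block \<pi>"
    have B: "B \<in> \<pi>" "1 \<in> B" using block_of_in[OF p, of 1] n by (auto simp: B_def first_block_def)
    have "B \<subseteq> {1..n}" using B p by (auto simp: partition_on_def)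
    then have cB: "1 \<le> card B" using B(2) by (metis One_nat_def Suc_leI card_gt_0_iff empty_iff finite_atLeastAtMost finite_subset)
    have "(\<Prod>i=0..n. \<psi> i ^ block_count n \<pi> i) = \<psi> (card B) * (\<psi> 0 ^ (n - card \<pi>) * (\<Prod>B\<in>\<pi> - {B}. \<psi> (card B)))"
      unfolding prod_block_count(1)[OF p] using prod.remove[OF finite_partition[OF _ p] B(1), of "\<lambda>B. \<psi> (card B)"] by simp
    \<comment> \<open>For a zero denominator the convention x / 0 = 0 agrees with the rooted
      product, because the power of P vanishes as well.\<close>
    moreover have "\<phi> (card B) = 0" if "\<psi> (card B) = 0"
      using psd_mtrace_pow_0[OF psd _ cB] that ij form_unit[OF ij, of P "card B"] unfolding \<psi>_def \<phi>_def by simp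
    ultimately show "((\<Prod>i=0..n. \<psi> i ^ block_count n \<pi> i) / \<psi> (card (first_block \<pi>))) * \<phi> (card (first_block \<pi>)) = rooted_prod \<psi> \<phi> n 1 \<pi>"
      unfolding rooted_prod_def B_def[symmetric] first_block_def[symmetric] by (cases "\<psi> (card B) = 0") simp_all
  qed
  moreover have "\<psi> 0 * (\<Sum>\<pi>\<in>nc_parts n. rooted_prod \<psi> \<phi> n 1 \<pi>) = tree_sum \<psi> (2 * n) \<phi>"
    unfolding nc using sum_nc_on(2)[where n = n and a = 1 and \<psi> = \<psi> and \<phi> = \<phi>] n by simp
  ultimately show ?thesis by (simp add: \<psi>_def \<phi>_def)
qed

section \<open>Pairings and Wick's formula\<close>

definition pairings :: "nat set \<Rightarrow> nat set set set" where
  "pairings S = {\<pi>. partition_on S \<pi> \<and> (\<forall>B\<in>\<pi>. card B = 2)}"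

lemma finite_pairings: "finite S \<Longrightarrow> finite (pairings S)"
  by (rule finite_subset[of _ "Pow (Pow S)"]) (auto simp: pairings_def partition_on_def)

lemma pairings_empty: "pairings {} = {{}}"
  by (auto simp: pairings_def partition_on_empty)

lemma pairings_insert:
  assumes "i \<in> S" "j \<in> S - {i}" "\<pi> \<in> pairings (S - {i, j})"
  shows "insert {i, j} \<pi> \<in> pairings S" "{i, j} \<notin> \<pi>"
proof -
  have p: "partition_on (S - {i, j}) \<pi>" "\<forall>B\<in>\<pi>. card B = 2" using assms by (auto simp: pairings_def)
  show 1: "{i, j} \<notin> \<pi>" using p(1) by (auto simp: partition_on_def)
  have "partition_on S (insert {i, j} \<pi>)"
  proof (rule partition_onI)
    have U: "\<Union>\<pi> = S - {i, j}" using p(1) by (simp add: partition_on_def)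
    then show "\<Union>(insert {i, j} \<pi>) = S" using assms by auto
    fix X Y assume XY: "X \<in> insert {i, j} \<pi>" "Y \<in> insert {i, j} \<pi>" "X \<noteq> Y"
    have "disjnt {i, j} Z" if "Z \<in> \<pi>" for Z using U that by (auto simp: disjnt_def)
    moreover have "disjnt X Y" if "X \<in> \<pi>" "Y \<in> \<pi>"
      using that XY(3) p(1) by (simp add: partition_on_def disjoint_def disjnt_def)
    ultimately show "disjnt X Y" using XY by (auto simp: disjnt_sym)
  qed (use p in \<open>auto simp: partition_on_def\<close>)
  then show "insert {i, j} \<pi> \<in> pairings S" using p(2) assms(2) by (simp add: pairings_def)
qed

text \<open>Sorts the pairings by the partner j of a fixed element i, the combinatorial counterpart
  of one integration by parts.\<close>

lemma sum_pairings:
  assumes fin: "finite S" and i: "i \<in> S"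
  shows "(\<Sum>\<pi>\<in>pairings S. F \<pi>) = (\<Sum>j\<in>S - {i}. \<Sum>\<pi>\<in>pairings (S - {i, j}). F (insert {i, j} \<pi>))"
proof -
  let ?h = "\<lambda>(j, \<pi>). insert {i, j} \<pi>"
  define X where "X = (SIGMA j:S - {i}. pairings (S - {i, j}))"
  have inj: "inj_on ?h X"
  proof (rule inj_onI)
    fix x y assume "x \<in> X" "y \<in> X" and eq: "?h x = ?h y"
    then obtain j \<pi> j' \<pi>' where xy: "x = (j, \<pi>)" "y = (j', \<pi>')" "j \<in> S - {i}" "j' \<in> S - {i}"
      "\<pi> \<in> pairings (S - {i, j})" "\<pi>' \<in> pairings (S - {i, j'})" by (auto simp: X_def)
    note 1 = pairings_insert[OF i xy(3,5)] and 2 = pairings_insert[OF i xy(4,6)]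
    have eq': "insert {i, j} \<pi> = insert {i, j'} \<pi>'" using eq xy by simp
    have p: "partition_on S (insert {i, j} \<pi>)" using 1(1) by (simp add: pairings_def)
    have "{i, j} = {i, j'}" using block_of_eq[OF p, of "{i, j}" i] block_of_eq[OF p, of "{i, j'}" i] eq' by auto
    then have "j = j'" using xy by auto
    moreover have "\<pi> = \<pi>'" using eq' 1(2) 2(2) unfolding \<open>j = j'\<close> by (simp add: insert_ident)
    ultimately show "x = y" using xy(1,2) by simp
  qed
  have img: "?h ` X = pairings S"
  proof
    show "?h ` X \<subseteq> pairings S" using pairings_insert(1)[OF i] by (auto simp: X_def)
    show "pairings S \<subseteq> ?h ` X"
    proof
      fix \<pi> assume pi: "\<pi> \<in> pairings S"
      then have p: "partition_on S \<pi>" and c: "\<And>B. B \<in> \<pi> \<Longrightarrow> card B = 2" by (auto simp: pairings_def)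
      define B where "B = block_of \<pi> i"
      have B: "B \<in> \<pi>" "i \<in> B" using block_of_in[OF p i] by (auto simp: B_def)
      obtain j where j: "B = {i, j}" "j \<noteq> i" using c[OF B(1)] B(2) by (auto simp: card_2_iff)
      have jS: "j \<in> S - {i}" using p B j by (auto simp: partition_on_def)
      have "partition_on (S - {i, j}) (\<pi> - {B})"
      proof (rule partition_onI)
        have d: "X \<inter> B = {}" if "X \<in> \<pi> - {B}" for X using that B p by (auto simp: partition_on_def disjoint_def)
        show "\<Union>(\<pi> - {B}) = S - {i, j}"
        proof -
          have "\<Union>(\<pi> - {B}) = \<Union>\<pi> - B" using d by auto
          then show ?thesis using p j by (simp add: partition_on_def)
        qed
      qed (use p in \<open>auto simp: partition_on_def disjoint_def disjnt_def\<close>)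
      then have "\<pi> - {B} \<in> pairings (S - {i, j})" using c by (simp add: pairings_def)
      then have "(j, \<pi> - {B}) \<in> X" using jS by (simp add: X_def)
      moreover have "?h (j, \<pi> - {B}) = \<pi>" using B(1) j by auto
      ultimately show "\<pi> \<in> ?h ` X" by (metis image_eqI)
    qed
  qed
  have "(\<Sum>\<pi>\<in>pairings S. F \<pi>) = (\<Sum>x\<in>X. F (?h x))"
    unfolding img[symmetric] by (rule sum.reindex[OF inj, unfolded comp_def])
  also have "\<dots> = (\<Sum>j\<in>S - {i}. \<Sum>\<pi>\<in>pairings (S - {i, j}). F (insert {i, j} \<pi>))"
    unfolding X_def using fin by (subst sum.Sigma) (auto simp: finite_pairings case_prod_unfold)
  finally show ?thesis .
qed

text \<open>Integration by parts removes the variable of the least index together with each possible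
  partner; this is the recursion of the pairings.\<close>

lemma (in gauss_family) wick:
  assumes "prob_space M" "finite S" "\<And>i. i \<in> S \<Longrightarrow> f i \<in> A"
  shows "(\<integral>\<omega>. (\<Prod>i\<in>S. \<xi> \<omega> (f i)) \<partial>M) = (\<Sum>\<pi>\<in>pairings S. \<Prod>B\<in>\<pi>. c (f (Min B)) (f (Max B)))"
  using assms(2,3)
proof (induction "card S" arbitrary: S rule: less_induct)
  case less
  show ?case
  proof (cases "S = {}")
    case True
    interpret prob_space M by fact
    show ?thesis by (simp add: True pairings_empty prob_space)
  next
    case False
    \<comment> \<open>The least index is taken so that \<open>Min\<close> and \<open>Max\<close> of
      the new pair are i and j in this order.\<close>
    define i where "i = Min S"
    have i: "i \<in> S" "\<And>j. j \<in> S \<Longrightarrow> i \<le> j" using False less.prems by (auto simp: i_def)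
    define I where "I = S - {i}"
    have I: "finite I" "\<And>j. j \<in> I \<Longrightarrow> f j \<in> A" using less.prems by (auto simp: I_def)
    have pg: "poly_grad A (\<lambda>x. \<Prod>j\<in>I. x (f j)) (\<lambda>b x. \<Sum>j\<in>I. of_bool (b = f j) * (\<Prod>k\<in>I - {j}. x (f k)))"
      by (rule poly_grad_prod[OF fin I(1) poly_grad_var[OF fin I(2)]])
    have int: "integrable M (\<lambda>\<omega>. \<Prod>k\<in>I - {j}. \<xi> \<omega> (f k))" for j
      by (rule integrable_poly[OF poly_grad_prod[OF fin _ poly_grad_var[OF fin]]]) (use I in auto)
    have "(\<integral>\<omega>. (\<Prod>i\<in>S. \<xi> \<omega> (f i)) \<partial>M) = (\<integral>\<omega>. \<xi> \<omega> (f i) * (\<Prod>j\<in>I. \<xi> \<omega> (f j)) \<partial>M)"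
      unfolding I_def by (intro Bochner_Integration.integral_cong refl prod.remove less.prems(1) i(1))
    also have "\<dots> = (\<Sum>b\<in>A. c (f i) b * (\<integral>\<omega>. (\<Sum>j\<in>I. of_bool (b = f j) * (\<Prod>k\<in>I - {j}. \<xi> \<omega> (f k))) \<partial>M))"
      by (rule stein[OF pg]) (use i less.prems in auto)
    also have "\<dots> = (\<Sum>b\<in>A. \<Sum>j\<in>I. of_bool (b = f j) * (c (f i) (f j) * (\<integral>\<omega>. (\<Prod>k\<in>I - {j}. \<xi> \<omega> (f k)) \<partial>M)))"
    proof (rule sum.cong[OF refl])
      fix b
      have "(\<integral>\<omega>. (\<Sum>j\<in>I. of_bool (b = f j) * (\<Prod>k\<in>I - {j}. \<xi> \<omega> (f k))) \<partial>M) = (\<Sum>j\<in>I. of_bool (b = f j) * (\<integral>\<omega>. (\<Prod>k\<in>I - {j}. \<xi> \<omega> (f k)) \<partial>M))"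
        by (subst Bochner_Integration.integral_sum) (auto intro: int)
      then show "c (f i) b * (\<integral>\<omega>. (\<Sum>j\<in>I. of_bool (b = f j) * (\<Prod>k\<in>I - {j}. \<xi> \<omega> (f k))) \<partial>M) = 
        (\<Sum>j\<in>I. of_bool (b = f j) * (c (f i) (f j) * (\<integral>\<omega>. (\<Prod>k\<in>I - {j}. \<xi> \<omega> (f k)) \<partial>M)))"
        by (simp add: sum_distrib_left del: sum_of_bool_mult_eq sum_mult_of_bool_eq) (auto intro!: sum.cong)
    qed
    also have "\<dots> = (\<Sum>j\<in>I. c (f i) (f j) * (\<integral>\<omega>. (\<Prod>k\<in>I - {j}. \<xi> \<omega> (f k)) \<partial>M))"
      by (subst sum.swap) (auto simp: of_bool_def if_distrib[of "\<lambda>x. x * _"] fin I(2) cong: if_cong intro!: sum.cong)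
    also have "\<dots> = (\<Sum>j\<in>S - {i}. \<Sum>\<pi>\<in>pairings (S - {i, j}). \<Prod>B\<in>insert {i, j} \<pi>. c (f (Min B)) (f (Max B)))"
      unfolding I_def
    proof (rule sum.cong[OF refl])
      fix j assume j: "j \<in> S - {i}"
      have e: "S - {i} - {j} = S - {i, j}" by auto
      have "card (S - {i, j}) < card S" using i j less.prems by (intro psubset_card_mono) auto
      then have "(\<integral>\<omega>. (\<Prod>k\<in>S - {i} - {j}. \<xi> \<omega> (f k)) \<partial>M) = (\<Sum>\<pi>\<in>pairings (S - {i, j}). \<Prod>B\<in>\<pi>. c (f (Min B)) (f (Max B)))"
        unfolding e by (rule less.hyps) (use less.prems in auto)
      moreover have "(\<Prod>B\<in>insert {i, j} \<pi>. c (f (Min B)) (f (Max B))) = c (f i) (f j) * (\<Prod>B\<in>\<pi>. c (f (Min B)) (f (Max B)))"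
        if "\<pi> \<in> pairings (S - {i, j})" for \<pi>
      proof -
        have "finite \<pi>" using that finite_partition[of "S - {i, j}" \<pi>] less.prems by (simp add: pairings_def)
        moreover have "Min {i, j} = i" "Max {i, j} = j" using i(2)[of j] j by auto
        ultimately show ?thesis using pairings_insert(2)[OF i(1) j that] by simp
      qed
      ultimately show "c (f i) (f j) * (\<integral>\<omega>. (\<Prod>k\<in>S - {i} - {j}. \<xi> \<omega> (f k)) \<partial>M) =
        (\<Sum>\<pi>\<in>pairings (S - {i, j}). \<Prod>B\<in>insert {i, j} \<pi>. c (f (Min B)) (f (Max B)))"
        by (simp add: sum_distrib_left)
    qed
    also have "\<dots> = (\<Sum>\<pi>\<in>pairings S. \<Prod>B\<in>\<pi>. c (f (Min B)) (f (Max B)))"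
      by (rule sum_pairings[OF less.prems(1) i(1), symmetric])
    finally show ?thesis .
  qed
qed

text \<open>n blocks of size at least 2 cover exactly 2n points only if all have size 2: the excess
  sizes \<open>card B - 2\<close> sum to 0.\<close>

lemma parts_no_singleton_pairings: "parts_no_singleton (2 * n) n = pairings {1..2 * n}"
proof -
  have c: "(\<Sum>B\<in>\<pi>. card B) = 2 * n" "finite \<pi>" if p: "partition_on {1..2 * n} \<pi>" for \<pi>
  proof -
    have "finite B" if B: "B \<in> \<pi>" for B
    proof (rule finite_subset)
      show "B \<subseteq> {1..2 * n}" using Union_upper[OF B] partition_onD1[OF p] by simp
    qed simp
    then show "(\<Sum>B\<in>\<pi>. card B) = 2 * n" using product_partition[OF p] by simp
    show "finite \<pi>" using finite_partition[OF _ p] by simp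
  qed
  have "card \<pi> = n \<and> (\<forall>B\<in>\<pi>. card B \<noteq> 1) \<longleftrightarrow> (\<forall>B\<in>\<pi>. card B = 2)" if p: "partition_on {1..2 * n} \<pi>" for \<pi>
  proof
    assume *: "card \<pi> = n \<and> (\<forall>B\<in>\<pi>. card B \<noteq> 1)"
    have ge: "2 \<le> card B" if "B \<in> \<pi>" for B
    proof -
      have "B \<subseteq> {1..2 * n}" "B \<noteq> {}" using p that by (auto simp: partition_on_def)
      then have "0 < card B" using finite_subset[of B "{1..2 * n}"] by (auto simp: card_gt_0_iff)
      then show ?thesis using * that by (metis One_nat_def Suc_1 Suc_leI le_neq_implies_less)
    qed
    have "(\<Sum>B\<in>\<pi>. card B - 2) + (\<Sum>B\<in>\<pi>. 2) = (\<Sum>B\<in>\<pi>. card B)"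
    proof -
      have "card B - 2 + 2 = card B" if "B \<in> \<pi>" for B using ge[OF that] by simp
      then show ?thesis unfolding sum.distrib[symmetric] by (intro sum.cong refl)
    qed
    then have "(\<Sum>B\<in>\<pi>. card B - 2) = 0" using c(1)[OF p] * by simp
    then show "\<forall>B\<in>\<pi>. card B = 2" using ge c(2)[OF p] by fastforce
  next
    assume *: "\<forall>B\<in>\<pi>. card B = 2"
    then have "(\<Sum>B\<in>\<pi>. card B) = (\<Sum>B\<in>\<pi>. 2)" by (intro sum.cong) auto
    then show "card \<pi> = n \<and> (\<forall>B\<in>\<pi>. card B \<noteq> 1)" using * c(1)[OF p] by simp
  qed
  then show ?thesis by (auto simp: parts_no_singleton_def parts_def pairings_def)
qed

section \<open>Path expansions of matrix products\<close>

text \<open>The list of index paths is independent of F, so the same paths expand the products of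
  XX' - P and of H, and they are fixed before integrating.\<close>

definition path_list :: "nat \<Rightarrow> nat \<Rightarrow> nat \<Rightarrow> nat \<Rightarrow> nat \<Rightarrow> (nat \<Rightarrow> nat) list \<Rightarrow> bool" where
  "path_list r k m a b ps \<longleftrightarrow> (\<forall>p\<in>set ps. p k = a \<and> (\<forall>i\<in>{k..k + m}. p i < r)) \<and>
    (\<forall>F :: nat \<Rightarrow> real mat. (\<forall>i. F i \<in> carrier_mat r r) \<longrightarrow>
      foldr (\<lambda>i A. F i * A) [k..<k + m] (1\<^sub>m r) \<in> carrier_mat r r \<and>
      foldr (\<lambda>i A. F i * A) [k..<k + m] (1\<^sub>m r) $$ (a, b) = (\<Sum>p\<leftarrow>ps. \<Prod>i\<in>{k..<k + m}. F i $$ (p i, p (Suc i))))"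

lemma path_list_foldr:
  fixes F :: "nat \<Rightarrow> real mat"
  assumes "path_list r k m a b ps" "\<And>i. F i \<in> carrier_mat r r"
  shows "foldr (\<lambda>i A. F i * A) [k..<k + m] (1\<^sub>m r) \<in> carrier_mat r r"
    "foldr (\<lambda>i A. F i * A) [k..<k + m] (1\<^sub>m r) $$ (a, b) = (\<Sum>p\<leftarrow>ps. \<Prod>i\<in>{k..<k + m}. F i $$ (p i, p (Suc i)))"
proof -
  note * = assms(1)[unfolded path_list_def, THEN conjunct2, rule_format, of F, OF assms(2)]
  show "foldr (\<lambda>i A. F i * A) [k..<k + m] (1\<^sub>m r) \<in> carrier_mat r r"
    by (rule *[THEN conjunct1])
  show "foldr (\<lambda>i A. F i * A) [k..<k + m] (1\<^sub>m r) $$ (a, b) = (\<Sum>p\<leftarrow>ps. \<Prod>i\<in>{k..<k + m}. F i $$ (p i, p (Suc i)))"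
    by (rule *[THEN conjunct2])
qed

lemma sum_list_concat_map: "sum_list (map f (concat (map g xs))) = (\<Sum>x\<leftarrow>xs. \<Sum>y\<leftarrow>g x. f y)"
  by (induction xs) auto

lemma path_list_exists:
  assumes "a < r" "b < r"
  shows "\<exists>ps. path_list r k m a b ps"
  using assms(1)
proof (induction m arbitrary: k a)
  case 0
  show ?case
    by (rule exI[of _ "if a = b then [\<lambda>_. a] else []"]) (use 0 assms in \<open>auto simp: path_list_def\<close>)
next
  case (Suc m)
  have "\<forall>c. \<exists>ps. c < r \<longrightarrow> path_list r (Suc k) m c b ps"
    using Suc.IH by blast
  then obtain Q where GQ: "\<And>c. c < r \<Longrightarrow> path_list r (Suc k) m c b (Q c)" by metis
  have Q: "p (Suc k) = c \<and> (\<forall>i\<in>{Suc k..Suc k + m}. p i < r)" if "c < r" "p \<in> set (Q c)" for c p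
    using GQ[OF that(1)] that(2) by (simp add: path_list_def)
  note Q2 = path_list_foldr[OF GQ]
  define ps where "ps = concat (map (\<lambda>c. map (\<lambda>p. p(k := a)) (Q c)) [0..<r])"
  have u: "[k..<k + Suc m] = k # [Suc k..<Suc k + m]" by (simp add: upt_conv_Cons)
  show ?case
    unfolding path_list_def
  proof (intro exI[of _ ps] conjI allI impI ballI)
    fix p assume "p \<in> set ps"
    then obtain c q where q: "c < r" "q \<in> set (Q c)" "p = q(k := a)" by (auto simp: ps_def)
    then show "p k = a" by simp
    fix i assume "i \<in> {k..k + Suc m}"
    then show "p i < r" using Q[OF q(1,2)] q(3) Suc.prems by auto
  next
    fix F :: "nat \<Rightarrow> real mat" assume "\<forall>i. F i \<in> carrier_mat r r"
    then have F: "\<And>i. F i \<in> carrier_mat r r" by blast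
    define R where "R = foldr (\<lambda>i A. F i * A) [Suc k..<Suc k + m] (1\<^sub>m r)"
    have R: "R \<in> carrier_mat r r" using Q2(1)[OF Suc.prems F] by (simp add: R_def)
    have f: "foldr (\<lambda>i A. F i * A) [k..<k + Suc m] (1\<^sub>m r) = F k * R" unfolding u R_def by simp
    show "foldr (\<lambda>i A. F i * A) [k..<k + Suc m] (1\<^sub>m r) \<in> carrier_mat r r" unfolding f by (rule mult_carrier_mat[OF F R])
    have "(F k * R) $$ (a, b) = (\<Sum>c<r. F k $$ (a, c) * R $$ (c, b))"
      by (rule mult_mat_index[OF F R Suc.prems assms(2)])
    also have "\<dots> = (\<Sum>c<r. \<Sum>p\<leftarrow>Q c. \<Prod>i\<in>{k..<k + Suc m}. F i $$ ((p(k := a)) i, (p(k := a)) (Suc i)))"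
    proof (rule sum.cong[OF refl])
      fix c assume "c \<in> {..<r}"
      then have c: "c < r" by simp
      have "F k $$ (a, c) * R $$ (c, b) = (\<Sum>p\<leftarrow>Q c. F k $$ (a, c) * (\<Prod>i\<in>{Suc k..<Suc k + m}. F i $$ (p i, p (Suc i))))"
        using Q2(2)[OF c F] by (simp add: R_def sum_list_const_mult)
      also have "\<dots> = (\<Sum>p\<leftarrow>Q c. \<Prod>i\<in>{k..<k + Suc m}. F i $$ ((p(k := a)) i, (p(k := a)) (Suc i)))"
      proof (intro arg_cong[where f = sum_list] map_cong refl)
        fix p assume "p \<in> set (Q c)"
        then have "p (Suc k) = c" using Q[OF c] by blast
        then show "F k $$ (a, c) * (\<Prod>i\<in>{Suc k..<Suc k + m}. F i $$ (p i, p (Suc i))) = (\<Prod>i\<in>{k..<k + Suc m}. F i $$ ((p(k := a)) i, (p(k := a)) (Suc i)))"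
          by (subst prod.atLeast_Suc_lessThan) (auto intro!: prod.cong)
      qed
      finally show "F k $$ (a, c) * R $$ (c, b) = \<dots>" .
    qed
    also have "\<dots> = (\<Sum>p\<leftarrow>ps. \<Prod>i\<in>{k..<k + Suc m}. F i $$ (p i, p (Suc i)))"
      unfolding ps_def by (simp add: sum_list_concat_map comp_def interv_sum_list_conv_sum_set_nat atLeast0LessThan)
    finally show "foldr (\<lambda>i A. F i * A) [k..<k + Suc m] (1\<^sub>m r) $$ (a, b) = \<dots>" unfolding f .
  qed
qed

lemma mat_prod_paths:
  assumes "a < r" "b < r"
  obtains m :: nat and p :: "nat \<Rightarrow> nat \<Rightarrow> nat" where "\<And>j i. j < m \<Longrightarrow> i \<in> {1..Suc n} \<Longrightarrow> p j i < r"
    "\<And>F :: nat \<Rightarrow> real mat. (\<And>i. F i \<in> carrier_mat r r) \<Longrightarrow> mat_prod r n F $$ (a, b) = (\<Sum>j<m. \<Prod>i\<in>{1..n}. F i $$ (p j i, p j (Suc i)))"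
proof -
  obtain ps :: "(nat \<Rightarrow> nat) list" where ps: "\<And>p i. p \<in> set ps \<Longrightarrow> i \<in> {1..1 + n} \<Longrightarrow> p i < r"
    "\<And>F :: nat \<Rightarrow> real mat. (\<And>i. F i \<in> carrier_mat r r) \<Longrightarrow>
      foldr (\<lambda>i A. F i * A) [1..<1 + n] (1\<^sub>m r) $$ (a, b) = (\<Sum>p\<leftarrow>ps. \<Prod>i\<in>{1..<1 + n}. F i $$ (p i, p (Suc i)))"
    using path_list_exists[OF assms, of 1 n] unfolding path_list_def by meson
  show ?thesis
  proof (rule that[of "length ps" "\<lambda>j. ps ! j"])
    show "(ps ! j) i < r" if "j < length ps" "i \<in> {1..Suc n}" for i j using ps(1)[of "ps ! j" i] that by simp
    show "mat_prod r n F $$ (a, b) = (\<Sum>j<length ps. \<Prod>i\<in>{1..n}. F i $$ ((ps ! j) i, (ps ! j) (Suc i)))"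
      if "\<And>i. F i \<in> carrier_mat r r" for F :: "nat \<Rightarrow> real mat"
      using ps(2)[OF that] by (simp add: mat_prod_def sum_list_sum_nth atLeast0LessThan atLeastLessThanSuc_atLeastAtMost)
  qed
qed

lemma mat_prod_const:
  assumes "(H :: real mat) \<in> carrier_mat r r"
  shows "mat_prod r n (\<lambda>_. H) = H ^\<^sub>m n"
proof -
  have "foldr (\<lambda>i A. H * A) xs (1\<^sub>m r) = H ^\<^sub>m length xs" for xs :: "nat list"
  proof (induction xs)
    case (Cons x xs)
    then show ?case using pow_mat_add[OF assms, of "Suc 0" "length xs"] pow_mat_1[OF assms] by (simp del: pow_mat.simps)
  qed (use assms in simp)
  then show ?thesis unfolding mat_prod_def by (simp del: upt_Suc)
qed

section \<open>Numbering of blocks, low moments and independence\<close>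

lemma Min_block_eq:
  assumes p: "partition_on A \<pi>" and fin: "finite A" and B: "B \<in> \<pi>" "C \<in> \<pi>" "Min B = Min C"
  shows "B = C"
proof (rule ccontr)
  assume "B \<noteq> C"
  then have "B \<inter> C = {}" using p B by (auto simp: partition_on_def disjoint_def)
  moreover have "finite B" "B \<noteq> {}" "finite C" "C \<noteq> {}"
    using p B fin by (auto simp: partition_on_def intro: finite_subset[of _ A])
  then have "Min B \<in> B" "Min C \<in> C" by auto
  ultimately show False using B(3) by auto
qed

definition block_rank :: "nat set set \<Rightarrow> nat set \<Rightarrow> nat" where
  "block_rank \<pi> B = card {C \<in> \<pi>. Min C \<le> Min B}"

lemma block_rank_inj:
  assumes p: "partition_on A \<pi>" and fin: "finite A"
  shows "inj_on (block_rank \<pi>) \<pi>"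
proof (rule inj_onI, rule ccontr)
  fix B C assume *: "B \<in> \<pi>" "C \<in> \<pi>" "block_rank \<pi> B = block_rank \<pi> C" "B \<noteq> C"
  have less: "block_rank \<pi> B < block_rank \<pi> C" if "Min B < Min C" "B \<in> \<pi>" "C \<in> \<pi>" for B C
  proof -
    have "C \<in> {D \<in> \<pi>. Min D \<le> Min C} - {D \<in> \<pi>. Min D \<le> Min B}" using that by auto
    moreover have "{D \<in> \<pi>. Min D \<le> Min B} \<subseteq> {D \<in> \<pi>. Min D \<le> Min C}" using that by auto
    ultimately have "{D \<in> \<pi>. Min D \<le> Min B} \<subset> {D \<in> \<pi>. Min D \<le> Min C}" by blast
    then show ?thesis unfolding block_rank_def by (rule psubset_card_mono[rotated]) (use finite_partition[OF fin p] in simp)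
  qed
  have "Min B \<noteq> Min C" using Min_block_eq[OF p fin *(1,2)] * by blast
  then show False using less[of B C] less[of C B] * by (auto simp: neq_iff)
qed

lemma block_index_rank:
  assumes "partition_on A \<pi>" "B \<in> \<pi>" "i \<in> B"
  shows "block_index \<pi> i = block_rank \<pi> B"
  using block_of_eq[OF assms] by (simp add: block_index_def block_rank_def)

lemma block_index_eq_iff:
  assumes "partition_on A \<pi>" "finite A" "i \<in> A" "j \<in> A"
  shows "block_index \<pi> i = block_index \<pi> j \<longleftrightarrow> block_of \<pi> i = block_of \<pi> j"
  using block_index_rank[OF assms(1) block_of_in[OF assms(1,3)]] block_index_rank[OF assms(1) block_of_in[OF assms(1,4)]]
    block_rank_inj[OF assms(1,2)] block_of_in(1)[OF assms(1,3)] block_of_in(1)[OF assms(1,4)]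
  by (auto simp: inj_on_def)

text \<open>For the second identity x a is integrated by parts: its pairing with x b leaves the
  centered factor for c and d, of mean 0, and the pairings with x c and x d give the two terms of
  \<open>H_cov\<close>.\<close>

lemma gaussian_law_moments:
  assumes psd: "psd_mat r P" and "a < r" "b < r" "c < r" "d < r"
  shows "(\<integral>x. x a * x b \<partial>gaussian_law P) = P $$ (a, b)"
    and "(\<integral>x. (x a * x b - P $$ (a, b)) * (x c * x d - P $$ (c, d)) \<partial>gaussian_law P) = H_cov P (a, b) (c, d)"
proof -
  let ?M = "gaussian_law P"
  interpret g: gauss_family ?M "{..<r}" "\<lambda>\<omega>. \<omega>" "\<lambda>i j. P $$ (i, j)" by (rule gauss_family_vector[OF psd])
  interpret prob_space ?M by (rule gauss_family_vector(2)[OF psd])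
  have fin: "finite {..<r}" by simp
  have delta: "(\<Sum>j<r. P $$ (i, j) * of_bool (j = k)) = P $$ (i, k)" if "k < r" for i k
    using that by (simp add: of_bool_def if_distrib[of "\<lambda>x. _ * x"] cong: if_cong)
  note var = poly_grad_var[OF fin]
  have int2: "integrable ?M (\<lambda>x. x i * x j)" if "i < r" "j < r" for i j
    using g.integrable_var_mult[OF var[of j], of i] that by simp
  have E2: "(\<integral>x. x a * x b \<partial>?M) = P $$ (a, b)" if "a < r" "b < r" for a b
    using g.stein[OF var[of b], of a] that by (simp add: delta prob_space del: sum_mult_of_bool_eq)
  have pg: "poly_grad {..<r} (\<lambda>x. x b * (x c * x d + (- P $$ (c, d))))
    (\<lambda>e x. of_bool (e = b) * (x c * x d + (- P $$ (c, d))) + x b * ((of_bool (e = c) * x d + x c * of_bool (e = d)) + 0))"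
    by (intro poly_grad_mult poly_grad_add var poly_grad_const) (use assms in auto)
  have i2: "integrable ?M (\<lambda>x. x c * x d - P $$ (c, d))" using int2[OF assms(4,5)] by simp
  have E0: "(\<integral>x. x c * x d - P $$ (c, d) \<partial>?M) = 0"
    using int2[OF assms(4,5)] E2[OF assms(4,5)] by (simp add: prob_space)
  have D: "(\<integral>x. of_bool (e = b) * (x c * x d - P $$ (c, d)) + x b * (of_bool (e = c) * x d + x c * of_bool (e = d)) \<partial>?M)
    = of_bool (e = c) * P $$ (b, d) + of_bool (e = d) * P $$ (b, c)" for e
  proof -
    have "(\<integral>x. of_bool (e = b) * (x c * x d - P $$ (c, d)) + (of_bool (e = c) * (x b * x d) + of_bool (e = d) * (x b * x c)) \<partial>?M)
      = of_bool (e = b) * (\<integral>x. x c * x d - P $$ (c, d) \<partial>?M) + (of_bool (e = c) * (\<integral>x. x b * x d \<partial>?M) + of_bool (e = d) * (\<integral>x. x b * x c \<partial>?M))"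
      using i2 int2 assms by (subst Bochner_Integration.integral_add, simp, simp, subst Bochner_Integration.integral_add) auto
    then show ?thesis unfolding E0 using assms by (simp add: E2 algebra_simps)
  qed
  have int: "integrable ?M (\<lambda>x. x a * (x b * (x c * x d - P $$ (c, d))))"
    using g.integrable_var_mult[OF pg, of a] assms by simp
  have "(\<integral>x. x a * (x b * (x c * x d - P $$ (c, d))) \<partial>?M) = (\<Sum>e<r. P $$ (a, e) * (of_bool (e = c) * P $$ (b, d) + of_bool (e = d) * P $$ (b, c)))"
    using g.stein[OF pg, of a] assms by (simp add: D del: sum_mult_of_bool_eq)
  also have "\<dots> = (\<Sum>e<r. P $$ (a, e) * of_bool (e = c)) * P $$ (b, d) + (\<Sum>e<r. P $$ (a, e) * of_bool (e = d)) * P $$ (b, c)"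
    by (simp add: distrib_left sum.distrib sum_distrib_right mult.assoc del: sum_mult_of_bool_eq)
  finally have E4: "(\<integral>x. x a * (x b * (x c * x d - P $$ (c, d))) \<partial>?M) = H_cov P (a, b) (c, d)"
    using assms by (simp only: delta) (simp add: H_cov_def)
  have "(\<integral>x. (x a * x b - P $$ (a, b)) * (x c * x d - P $$ (c, d)) \<partial>?M) =
    (\<integral>x. x a * (x b * (x c * x d - P $$ (c, d))) - P $$ (a, b) * (x c * x d - P $$ (c, d)) \<partial>?M)"
    by (intro Bochner_Integration.integral_cong refl) (simp add: algebra_simps)
  also have "\<dots> = (\<integral>x. x a * (x b * (x c * x d - P $$ (c, d))) \<partial>?M) - P $$ (a, b) * (\<integral>x. x c * x d - P $$ (c, d) \<partial>?M)"
    using int i2 by (subst Bochner_Integration.integral_diff) auto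
  finally show "(\<integral>x. (x a * x b - P $$ (a, b)) * (x c * x d - P $$ (c, d)) \<partial>?M) = H_cov P (a, b) (c, d)"
    by (simp add: E0 E4)
  show "(\<integral>x. x a * x b \<partial>?M) = P $$ (a, b)" by (rule E2[OF assms(2,3)])
qed

lemma prod_blocks:
  assumes p: "partition_on A \<pi>" and fin: "finite A"
  shows "(\<Prod>i\<in>A. g i) = (\<Prod>B\<in>\<pi>. \<Prod>i\<in>B. g i :: 'a :: comm_monoid_mult)"
proof -
  have "(\<Prod>i\<in>\<Union>\<pi>. g i) = (\<Prod>B\<in>\<pi>. \<Prod>i\<in>B. g i)"
    by (subst prod.Union_disjoint) (use p fin in \<open>auto simp: partition_on_def disjoint_def intro: finite_subset[of _ A]\<close>)
  then show ?thesis using p by (simp add: partition_on_def)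
qed

text \<open>Blocks have different ranks, so they use different independent copies, and the
  expectation factorizes over the blocks.\<close>

lemma gaussian_copies_blocks:
  fixes g :: "nat \<Rightarrow> (nat \<Rightarrow> real) \<Rightarrow> real"
  assumes psd: "psd_mat r P" and p: "partition_on {1..n} \<pi>"
    and int: "\<And>B. B \<in> \<pi> \<Longrightarrow> integrable (gaussian_law P) (\<lambda>x. \<Prod>i\<in>B. g i x)"
  shows "integrable (gaussian_copies P) (\<lambda>X. \<Prod>i\<in>{1..n}. g i (X (block_index \<pi> i)))"
    and "(\<integral>X. (\<Prod>i\<in>{1..n}. g i (X (block_index \<pi> i))) \<partial>gaussian_copies P) = (\<Prod>B\<in>\<pi>. \<integral>x. (\<Prod>i\<in>B. g i x) \<partial>gaussian_law P)"
proof -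
  define K where "K = block_rank \<pi> ` \<pi>"
  define f where "f = (\<lambda>k x. \<Prod>i\<in>inv_into \<pi> (block_rank \<pi>) k. g i x)"
  have inj: "inj_on (block_rank \<pi>) \<pi>" by (rule block_rank_inj[OF p]) simp
  have K: "finite K" using finite_partition[OF _ p] by (simp add: K_def)
  have e: "(\<Prod>i\<in>{1..n}. g i (X (block_index \<pi> i))) = (\<Prod>k\<in>K. f k (X k))" for X
  proof -
    have "(\<Prod>i\<in>{1..n}. g i (X (block_index \<pi> i))) = (\<Prod>B\<in>\<pi>. \<Prod>i\<in>B. g i (X (block_index \<pi> i)))"
      by (rule prod_blocks[OF p]) simp
    also have "\<dots> = (\<Prod>B\<in>\<pi>. f (block_rank \<pi> B) (X (block_rank \<pi> B)))"
      by (intro prod.cong refl) (simp add: f_def inj block_index_rank[OF p])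
    also have "\<dots> = (\<Prod>k\<in>K. f k (X k))" unfolding K_def by (subst prod.reindex[OF inj]) simp
    finally show ?thesis .
  qed
  have intf: "integrable (gaussian_law P) (f k)" if "k \<in> K" for k
    using that int by (auto simp: K_def f_def inj)
  note cp = gaussian_copies_prod[OF psd K, of f, OF intf]
  show "integrable (gaussian_copies P) (\<lambda>X. \<Prod>i\<in>{1..n}. g i (X (block_index \<pi> i)))"
    unfolding e by (rule cp)
  have "(\<Prod>k\<in>K. \<integral>x. f k x \<partial>gaussian_law P) = (\<Prod>B\<in>\<pi>. \<integral>x. (\<Prod>i\<in>B. g i x) \<partial>gaussian_law P)"
    unfolding K_def by (subst prod.reindex[OF inj]) (simp add: f_def inj)
  then show "(\<integral>X. (\<Prod>i\<in>{1..n}. g i (X (block_index \<pi> i))) \<partial>gaussian_copies P) = (\<Prod>B\<in>\<pi>. \<integral>x. (\<Prod>i\<in>B. g i x) \<partial>gaussian_law P)"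
    unfolding e using cp(2) by simp
qed

lemma outer_carrier: "outer r x \<in> carrier_mat r r"
  by (simp add: outer_def)

text \<open>Along each index path both sides become the sum over pairings of products of
  \<open>H_cov\<close>: for H by Wick's formula, for the central moments because the partitions
  themselves are the pairings and each block contributes the covariance of its two factors.\<close>

lemma M_central_eq_H_moment:
  assumes psd: "psd_mat r P"
  shows "M_central (2 * n) n P = H_moment (2 * n) P"
proof (rule eq_matI)
  have r: "dim_row P = r" and Pc: "P \<in> carrier_mat r r" using psd_matD[OF psd] by auto
  show "dim_row (M_central (2 * n) n P) = dim_row (H_moment (2 * n) P)" "dim_col (M_central (2 * n) n P) = dim_col (H_moment (2 * n) P)"
    by (simp_all add: M_central_def Let_def mat_sum_def H_moment_def mat_expectation_def)
  fix a b assume "a < dim_row (H_moment (2 * n) P)" "b < dim_col (H_moment (2 * n) P)"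
  then have ab: "a < r" "b < r" by (simp_all add: H_moment_def mat_expectation_def r)
  obtain m :: nat and p :: "nat \<Rightarrow> nat \<Rightarrow> nat" where p: "\<And>j i. j < m \<Longrightarrow> i \<in> {1..Suc (2 * n)} \<Longrightarrow> p j i < r"
    "\<And>F :: nat \<Rightarrow> real mat. (\<And>i. F i \<in> carrier_mat r r) \<Longrightarrow> mat_prod r (2 * n) F $$ (a, b) = (\<Sum>j<m. \<Prod>i\<in>{1..2 * n}. F i $$ (p j i, p j (Suc i)))"
    using mat_prod_paths[OF ab, of "2 * n"] by blast
  define e where "e = (\<lambda>j i. (p j i, p j (Suc i)))"
  have er: "fst (e j i) < r" "snd (e j i) < r" if "j < m" "i \<in> {1..2 * n}" for i j
    using p(1)[OF that(1), of i] p(1)[OF that(1), of "Suc i"] that by (auto simp: e_def)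
  define V where "V = (\<Sum>j<m. \<Sum>\<pi>\<in>pairings {1..2 * n}. \<Prod>B\<in>\<pi>. H_cov P (e j (Min B)) (e j (Max B)))"
  interpret H: gauss_family "gauss_entries r" "{..<r} \<times> {..<r}" "H_ent P" "H_cov P" by (rule gauss_family_H[OF psd])
  have "H_moment (2 * n) P $$ (a, b) = (\<integral>w. (\<Sum>j<m. \<Prod>i\<in>{1..2 * n}. H_ent P w (e j i)) \<partial>gauss_entries r)"
    using ab p(2)[OF H_mat_carrier[OF psd]]
    by (simp add: H_moment_def mat_expectation_def r mat_prod_const[OF H_mat_carrier[OF psd], symmetric] H_ent_def e_def)
  also have "\<dots> = (\<Sum>j<m. \<integral>w. (\<Prod>i\<in>{1..2 * n}. H_ent P w (e j i)) \<partial>gauss_entries r)"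
  proof (rule Bochner_Integration.integral_sum)
    fix j assume "j \<in> {..<m}"
    then have "e j i \<in> {..<r} \<times> {..<r}" if "i \<in> {1..2 * n}" for i using er[of j i] that by (auto simp: mem_Times_iff)
    then show "integrable (gauss_entries r) (\<lambda>w. \<Prod>i\<in>{1..2 * n}. H_ent P w (e j i))"
      by (intro H.integrable_poly[OF poly_grad_prod[OF _ _ poly_grad_var]]) auto
  qed
  also have "\<dots> = V"
    unfolding V_def
  proof (rule sum.cong[OF refl])
    fix j assume "j \<in> {..<m}"
    then have "e j i \<in> {..<r} \<times> {..<r}" if "i \<in> {1..2 * n}" for i using er[of j i] that by (auto simp: mem_Times_iff)
    then show "(\<integral>w. (\<Prod>i\<in>{1..2 * n}. H_ent P w (e j i)) \<partial>gauss_entries r) = (\<Sum>\<pi>\<in>pairings {1..2 * n}. \<Prod>B\<in>\<pi>. H_cov P (e j (Min B)) (e j (Max B)))"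
      by (intro H.wick prob_space_gauss_entries) auto
  qed
  finally have HV: "H_moment (2 * n) P $$ (a, b) = V" .
  define G where "G = (\<lambda>j i (x :: nat \<Rightarrow> real). x (fst (e j i)) * x (snd (e j i)) - P $$ (e j i))"
  interpret g: gauss_family "gaussian_law P" "{..<r}" "\<lambda>\<omega>. \<omega>" "\<lambda>i j. P $$ (i, j)" by (rule gauss_family_vector[OF psd])
  have blk: "(\<integral>X. mat_prod r (2 * n) (\<lambda>i. outer r (X (block_index \<pi> i)) - P) $$ (a, b) \<partial>gaussian_copies P) =
    (\<Sum>j<m. \<Prod>B\<in>\<pi>. H_cov P (e j (Min B)) (e j (Max B)))" if pi: "\<pi> \<in> pairings {1..2 * n}" for \<pi>
  proof -
    have part: "partition_on {1..2 * n} \<pi>" using pi by (simp add: pairings_def)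
    have int: "integrable (gaussian_law P) (\<lambda>x. \<Prod>i\<in>B. G j i x)" if "j < m" "B \<in> \<pi>" for j B
    proof -
      have B: "B \<subseteq> {1..2 * n}" using part that by (simp add: partition_on_def) blast
      have "poly_grad {..<r} (\<lambda>x. \<Prod>i\<in>B. (x (fst (e j i)) * x (snd (e j i)) + (- P $$ (e j i))))
         (\<lambda>b x. \<Sum>i\<in>B. ((of_bool (b = fst (e j i)) * x (snd (e j i)) + x (fst (e j i)) * of_bool (b = snd (e j i))) + 0) * (\<Prod>k\<in>B - {i}. (x (fst (e j k)) * x (snd (e j k)) + (- P $$ (e j k)))))"
        by (intro poly_grad_prod poly_grad_add poly_grad_mult poly_grad_var poly_grad_const finite_subset[OF B])
          (use er[OF that(1)] B in auto)
      from g.integrable_poly[OF this] show ?thesis by (simp add: G_def)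
    qed
    have "mat_prod r (2 * n) (\<lambda>i. outer r (X (block_index \<pi> i)) - P) $$ (a, b) = (\<Sum>j<m. \<Prod>i\<in>{1..2 * n}. G j i (X (block_index \<pi> i)))" for X
    proof -
      have "mat_prod r (2 * n) (\<lambda>i. outer r (X (block_index \<pi> i)) - P) $$ (a, b) = (\<Sum>j<m. \<Prod>i\<in>{1..2 * n}. (outer r (X (block_index \<pi> i)) - P) $$ (p j i, p j (Suc i)))"
        by (rule p(2)) (use Pc in \<open>auto intro!: minus_carrier_mat\<close>)
      also have "\<dots> = (\<Sum>j<m. \<Prod>i\<in>{1..2 * n}. G j i (X (block_index \<pi> i)))"
        using er Pc by (intro sum.cong prod.cong refl) (auto simp: G_def e_def outer_def)
      finally show ?thesis .
    qed
    then have "(\<integral>X. mat_prod r (2 * n) (\<lambda>i. outer r (X (block_index \<pi> i)) - P) $$ (a, b) \<partial>gaussian_copies P) =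
      (\<integral>X. (\<Sum>j<m. \<Prod>i\<in>{1..2 * n}. G j i (X (block_index \<pi> i))) \<partial>gaussian_copies P)" by simp
    also have "\<dots> = (\<Sum>j<m. \<integral>X. (\<Prod>i\<in>{1..2 * n}. G j i (X (block_index \<pi> i))) \<partial>gaussian_copies P)"
      by (rule Bochner_Integration.integral_sum, rule gaussian_copies_blocks(1)[OF psd part]) (use int in auto)
    also have "\<dots> = (\<Sum>j<m. \<Prod>B\<in>\<pi>. \<integral>x. (\<Prod>i\<in>B. G j i x) \<partial>gaussian_law P)"
      by (rule sum.cong[OF refl], rule gaussian_copies_blocks(2)[OF psd part]) (use int in auto)
    also have "\<dots> = (\<Sum>j<m. \<Prod>B\<in>\<pi>. H_cov P (e j (Min B)) (e j (Max B)))"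
    proof (intro sum.cong prod.cong refl)
      fix j B assume "j \<in> {..<m}" "B \<in> \<pi>"
      then have j: "j < m" and B: "card B = 2" "B \<subseteq> {1..2 * n}" using pi part by (auto simp: pairings_def partition_on_def)
      obtain i k where ik: "B = {i, k}" "i < k" using B(1) by (metis card_2_iff doubleton_eq_iff linorder_neqE_nat)
      have mm: "Min B = i" "Max B = k" using ik by auto
      have "(\<integral>x. (\<Prod>i\<in>B. G j i x) \<partial>gaussian_law P) = (\<integral>x. G j i x * G j k x \<partial>gaussian_law P)" using ik by simp
      also have "\<dots> = H_cov P (e j i) (e j k)"
      proof -
        have "i \<in> {1..2 * n}" "k \<in> {1..2 * n}" using ik B(2) by auto
        then show ?thesis
          unfolding G_def using gaussian_law_moments(2)[OF psd er[OF j, of i] er[OF j, of k]] by simp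
      qed
      finally show "(\<integral>x. (\<Prod>i\<in>B. G j i x) \<partial>gaussian_law P) = H_cov P (e j (Min B)) (e j (Max B))" unfolding mm .
    qed
    finally show ?thesis .
  qed
  have "M_central (2 * n) n P $$ (a, b) = (\<Sum>\<pi>\<in>pairings {1..2 * n}. \<integral>X. mat_prod r (2 * n) (\<lambda>i. outer r (X (block_index \<pi> i)) - P) $$ (a, b) \<partial>gaussian_copies P)"
    using ab by (simp add: M_central_def Let_def mat_sum_def mat_expectation_def r parts_no_singleton_pairings)
  also have "\<dots> = (\<Sum>\<pi>\<in>pairings {1..2 * n}. \<Sum>j<m. \<Prod>B\<in>\<pi>. H_cov P (e j (Min B)) (e j (Max B)))"
    using blk by (intro sum.cong refl) blast
  also have "\<dots> = V" unfolding V_def by (rule sum.swap)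
  finally show "M_central (2 * n) n P $$ (a, b) = H_moment (2 * n) P $$ (a, b)" using HV by simp
qed

section \<open>The leading term of a chain\<close>

text \<open>Edge i stands between position i and the next position of T, and z marks the start with
  u. Positions are kept as a set of numbers, so that deleting one requires no renumbering.\<close>

definition chain_left :: "nat \<Rightarrow> (nat \<Rightarrow> nat) \<Rightarrow> nat \<Rightarrow> endpoint" where
  "chain_left z c i = (if i = z then LeftEnd else Colour (c i))"

definition chain_right :: "nat set \<Rightarrow> (nat \<Rightarrow> nat) \<Rightarrow> nat \<Rightarrow> endpoint" where
  "chain_right T c i = (if {j \<in> T. i < j} = {} then RightEnd else Colour (c (Min {j \<in> T. i < j})))"

text \<open>The expectation of \<open>u' P\<^sup>e\<^sup>(\<^sup>z\<^sup>) \<Prod>i\<in>T. X(c i) X(c i)' P\<^sup>e\<^sup>(\<^sup>i\<^sup>) v\<close>, the factors being ordered as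
  the elements of \<open>T\<close>, which are larger than \<open>z\<close>.\<close>

definition chain_exp :: "nat \<Rightarrow> nat set \<Rightarrow> (nat \<Rightarrow> nat) \<Rightarrow> (nat \<Rightarrow> nat) \<Rightarrow>
    nat \<Rightarrow> real mat \<Rightarrow> (nat \<Rightarrow> real) \<Rightarrow> (nat \<Rightarrow> real) \<Rightarrow> real" where
  "chain_exp z T c e = edge_exp (insert z T) (chain_left z c) e (chain_right T c)"

text \<open>The number of traces in the leading term of a non-crossing chain; for a partition of [n]
  into m blocks it is n - m.\<close>

definition defect :: "nat set \<Rightarrow> (nat \<Rightarrow> nat) \<Rightarrow> nat" where
  "defect T c = card T - card (c ` T)"

text \<open>The chords over the gap to the right of \<open>i\<close>. The classes of gaps with the same chords over them
  are the faces of the arc diagram.\<close>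

definition chords :: "nat set \<Rightarrow> (nat \<Rightarrow> nat) \<Rightarrow> nat \<Rightarrow> (nat \<times> nat) set" where
  "chords T c i = {(a, b). a \<in> T \<and> b \<in> T \<and> c a = c b \<and> a \<le> i \<and> i < b}"

definition crosses :: "nat set \<Rightarrow> (nat \<Rightarrow> nat) \<Rightarrow> bool" where
  "crosses T c \<longleftrightarrow> (\<exists>i\<in>T. \<exists>j\<in>T. \<exists>k\<in>T. \<exists>l\<in>T. i < j \<and> j < k \<and> k < l \<and> c i = c k \<and> c j = c l \<and> c i \<noteq> c j)"

text \<open>The least gap of every face except that of z, which is the outer face and carries the
  bilinear form instead of a trace.\<close>

definition face_reps :: "nat \<Rightarrow> nat set \<Rightarrow> (nat \<Rightarrow> nat) \<Rightarrow> nat set" where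
  "face_reps z T c = {i \<in> T. \<forall>j\<in>insert z T. j < i \<longrightarrow> chords T c j \<noteq> chords T c i}"

text \<open>A loop of edges is closed by as many covariances as it has edges, hence
  \<open>Suc (e j)\<close> for each gap. The open path through the outer face has one covariance
  fewer, whence the - 1 in \<open>chain_lead\<close>.\<close>

definition face_sum :: "nat \<Rightarrow> nat set \<Rightarrow> (nat \<Rightarrow> nat) \<Rightarrow> (nat \<Rightarrow> nat) \<Rightarrow> nat \<Rightarrow> nat" where
  "face_sum z T c e i = (\<Sum>j\<in>insert z T. if chords T c j = chords T c i then Suc (e j) else 0)"

definition chain_lead :: "nat \<Rightarrow> nat set \<Rightarrow> (nat \<Rightarrow> nat) \<Rightarrow> (nat \<Rightarrow> nat) \<Rightarrow>
    nat \<Rightarrow> real mat \<Rightarrow> (nat \<Rightarrow> real) \<Rightarrow> (nat \<Rightarrow> real) \<Rightarrow> real" where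
  "chain_lead z T c e r P u v = (if crosses T c then 0 else
     (\<Prod>i\<in>face_reps z T c. mtrace (P ^\<^sub>m face_sum z T c e i)) * form r P (face_sum z T c e z - 1) u v)"

section \<open>Removing one position from a chain\<close>

lemma Min_remove:
  assumes "finite S" "x \<in> S" "x < (p :: nat)"
  shows "Min (S - {p}) = Min S"
proof (rule Min_eqI)
  have "Min S \<le> x" using assms by simp
  moreover have "Min S \<in> S" by (rule Min_in) (use assms in auto)
  ultimately show "Min S \<in> S - {p}" using assms(3) by (cases "Min S = p") simp_all
qed (use assms in auto)

text \<open>The vector at p has one other end, on the edge m before p, so integration by parts just
  joins the edges m and p. No chord begins or ends at p, hence the gaps m and p lie in the same face
  and the leading term is unchanged.\<close>

lemma chain_exp_singleton:
  fixes e :: "nat \<Rightarrow> nat"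
  assumes fin: "finite T" and z: "\<And>i. i \<in> T \<Longrightarrow> z < i" and p: "p \<in> T" "\<And>j. j \<in> T \<Longrightarrow> c j = c p \<Longrightarrow> j = p"
  defines "m \<equiv> Max {j \<in> insert z T. j < p}"
  defines "e' \<equiv> e(m := Suc (e p + e m))"
  shows "psd_mat r P \<Longrightarrow> chain_exp z T c e r P u v = chain_exp z (T - {p}) c e' r P u v"
    and "chain_lead z T c e = chain_lead z (T - {p}) c e'"
    and "defect T c = defect (T - {p}) c"
proof -
  let ?T = "T - {p}"
  let ?N = "insert z T"
  have zp: "z < p" using z p by auto
  have "m \<in> {j \<in> ?N. j < p}" unfolding m_def by (rule Max_in) (use fin zp in auto)
  then have m: "m \<in> ?N" "m < p" by auto
  have mm: "j \<le> m" if "j \<in> ?N" "j < p" for j unfolding m_def by (rule Max_ge) (use fin that in auto)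
  have J: "?N - {p} = insert z ?T" using zp by auto
  have right: "chain_right ?T c j = ((chain_right T c)(m := chain_right T c p)) j" if j: "j \<in> insert z ?T" for j
  proof (cases "j = m")
    case True
    have "{i \<in> ?T. m < i} = {i \<in> T. p < i}" using mm m p by fastforce
    then show ?thesis using True by (simp add: chain_right_def)
  next
    case False
    have "p < j \<or> j < m" using mm[of j] j False zp by (cases "j < p") auto
    then show ?thesis
    proof
      assume 1: "p < j"
      then have "{i \<in> ?T. j < i} = {i \<in> T. j < i}" by auto
      then show ?thesis using False by (simp add: chain_right_def)
    next
      assume "j < m"
      then have mT: "m \<in> {i \<in> T. j < i}" using m j z by force
      have e: "{i \<in> ?T. j < i} = {i \<in> T. j < i} - {p}" by auto
      have "Min {i \<in> ?T. j < i} = Min {i \<in> T. j < i}" unfolding e using Min_remove[OF _ mT m(2)] fin by simp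
      moreover have "{i \<in> ?T. j < i} \<noteq> {}" "{i \<in> T. j < i} \<noteq> {}" using mT m by auto
      ultimately show ?thesis using False by (simp add: chain_right_def)
    qed
  qed
  \<comment> \<open>Among the remaining edges, only m has the vector at p as its right end.\<close>
  have qm: "chain_right T c j = Colour (c p) \<longleftrightarrow> j = m" if j: "j \<in> insert z ?T" for j
  proof
    assume "chain_right T c j = Colour (c p)"
    then have ne: "{i \<in> T. j < i} \<noteq> {}" and cM: "c (Min {i \<in> T. j < i}) = c p" by (auto simp: chain_right_def split: if_splits)
    have M: "Min {i \<in> T. j < i} \<in> {i \<in> T. j < i}" by (rule Min_in) (use ne fin in auto)
    then have pM: "p = Min {i \<in> T. j < i}" using p(2)[OF _ cM] by simp
    then have "j < p" using M by simp
    then have "j \<le> m" using mm j by auto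
    moreover have "\<not> j < m"
    proof
      assume "j < m"
      then have "m \<in> {i \<in> T. j < i}" using m j z by force
      then have "p \<le> m" unfolding pM using fin by simp
      then show False using m by simp
    qed
    ultimately show "j = m" by simp
  next
    assume "j = m"
    have "Min {i \<in> T. m < i} = p"
    proof (rule Min_eqI)
      fix y assume "y \<in> {i \<in> T. m < i}"
      then show "p \<le> y" using mm[of y] by force
    qed (use fin m p in auto)
    moreover have "{i \<in> T. m < i} \<noteq> {}" using m p by auto
    ultimately show "chain_right T c j = Colour (c p)" using \<open>j = m\<close> by (simp add: chain_right_def)
  qed
  have qp: "chain_right T c p \<noteq> Colour (c p)"
  proof
    assume "chain_right T c p = Colour (c p)"
    then have ne: "{i \<in> T. p < i} \<noteq> {}" and cM: "c (Min {i \<in> T. p < i}) = c p" by (auto simp: chain_right_def split: if_splits)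
    have M: "Min {i \<in> T. p < i} \<in> {i \<in> T. p < i}" by (rule Min_in) (use ne fin in auto)
    then show False using p(2)[OF _ cM] by auto
  qed
  have lj: "chain_left z c j \<noteq> Colour (c p)" if "j \<in> insert z ?T" for j
    using that p(2) by (auto simp: chain_left_def)
  have mJ: "m \<in> insert z ?T" using m by auto
  show "chain_exp z T c e r P u v = chain_exp z ?T c e' r P u v" if psd: "psd_mat r P"
  proof -
    have "chain_exp z T c e r P u v = of_bool (chain_right T c p = Colour (c p)) * (mtrace (P ^\<^sub>m Suc (e p)) * edge_exp (?N - {p}) (chain_left z c) e (chain_right T c) r P u v) +
      (\<Sum>j\<in>?N - {p}. of_bool (chain_left z c j = Colour (c p)) * edge_exp (?N - {p}) ((chain_left z c)(j := chain_right T c p)) (e(j := Suc (e p + e j))) (chain_right T c) r P u v +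
       of_bool (chain_right T c j = Colour (c p)) * edge_exp (?N - {p}) (chain_left z c) (e(j := Suc (e p + e j))) ((chain_right T c)(j := chain_right T c p)) r P u v)"
      unfolding chain_exp_def by (rule edge_exp_stein[OF psd]) (use fin p zp in \<open>auto simp: chain_left_def\<close>)
    also have "\<dots> = (\<Sum>j\<in>insert z ?T. if j = m then edge_exp (insert z ?T) (chain_left z c) (e(j := Suc (e p + e j))) ((chain_right T c)(j := chain_right T c p)) r P u v else 0)"
    proof -
      have "(\<Sum>j\<in>insert z ?T. of_bool (chain_left z c j = Colour (c p)) * edge_exp (insert z ?T) ((chain_left z c)(j := chain_right T c p)) (e(j := Suc (e p + e j))) (chain_right T c) r P u v +
       of_bool (chain_right T c j = Colour (c p)) * edge_exp (insert z ?T) (chain_left z c) (e(j := Suc (e p + e j))) ((chain_right T c)(j := chain_right T c p)) r P u v)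
       = (\<Sum>j\<in>insert z ?T. if j = m then edge_exp (insert z ?T) (chain_left z c) (e(j := Suc (e p + e j))) ((chain_right T c)(j := chain_right T c p)) r P u v else 0)"
        by (rule sum.cong[OF refl]) (simp add: lj qm)
      then show ?thesis unfolding J using qp by simp
    qed
    also have "\<dots> = edge_exp (insert z ?T) (chain_left z c) e' ((chain_right T c)(m := chain_right T c p)) r P u v"
      using mJ fin by (simp add: e'_def)
    also have "\<dots> = chain_exp z ?T c e' r P u v"
      unfolding chain_exp_def using right by (subst edge_exp_cong[where l' = "chain_left z c" and e' = e' and q' = "chain_right ?T c"]) auto
    finally show ?thesis .
  qed
  have ch: "chords T c = chords ?T c"
  proof
    fix i show "chords T c i = chords ?T c i" using p(2) unfolding chords_def by (auto dest: sym) 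
  qed
  have chm: "chords T c p = chords T c m"
  proof -
    have "a \<le> p \<longleftrightarrow> a \<le> m" if "a \<in> ?T" for a using mm[of a] m that by force
    moreover have "p < b \<longleftrightarrow> m < b" if "b \<in> ?T" for b using mm[of b] m that by force
    ultimately show ?thesis unfolding ch unfolding chords_def by blast
  qed
  have cr: "crosses T c = crosses ?T c"
  proof
    assume "crosses T c"
    then obtain i j k l where *: "i \<in> T" "j \<in> T" "k \<in> T" "l \<in> T" "i < j" "j < k" "k < l" "c i = c k" "c j = c l" "c i \<noteq> c j"
      unfolding crosses_def by blast
    then have "i \<noteq> p" "j \<noteq> p" "k \<noteq> p" "l \<noteq> p" using p(2)[of i] p(2)[of j] p(2)[of k] p(2)[of l] by auto
    then show "crosses ?T c" using * unfolding crosses_def by blast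
  qed (auto simp: crosses_def)
  have rp: "face_reps z T c = face_reps z ?T c"
  proof (rule Set.set_eqI)
    fix i
    have Nj: "insert z T = insert p (insert z ?T)" using p by auto
    have "(\<forall>j\<in>insert z T. j < i \<longrightarrow> chords T c j \<noteq> chords T c i) \<longleftrightarrow> (\<forall>j\<in>insert z ?T. j < i \<longrightarrow> chords T c j \<noteq> chords T c i)"
    proof
      assume *: "\<forall>j\<in>insert z ?T. j < i \<longrightarrow> chords T c j \<noteq> chords T c i"
      have "chords T c p \<noteq> chords T c i" if "p < i" using *[rule_format, OF mJ] that m chm by simp
      then show "\<forall>j\<in>insert z T. j < i \<longrightarrow> chords T c j \<noteq> chords T c i" unfolding Nj using * by simp
    qed auto
    moreover have "p \<notin> face_reps z T c" using m chm by (auto simp: face_reps_def)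
    ultimately show "i \<in> face_reps z T c \<longleftrightarrow> i \<in> face_reps z ?T c"
      unfolding face_reps_def ch[symmetric] by (cases "i = p") auto
  qed
  have fs: "face_sum z T c e = face_sum z ?T c e'"
  proof
    fix i
    define h where "h = (\<lambda>e j. if chords T c j = chords T c i then Suc (e j) else 0 :: nat)"
    have "face_sum z T c e i = h e p + (\<Sum>j\<in>insert z ?T. h e j)"
      unfolding face_sum_def h_def J[symmetric] by (rule sum.remove) (use fin p in auto)
    also have "(\<Sum>j\<in>insert z ?T. h e j) = h e m + (\<Sum>j\<in>insert z ?T - {m}. h e j)"
      by (rule sum.remove) (use fin mJ in auto)
    also have "(\<Sum>j\<in>insert z ?T - {m}. h e j) = (\<Sum>j\<in>insert z ?T - {m}. h e' j)"
      by (rule sum.cong[OF refl]) (simp add: h_def e'_def)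
    also have "h e p + (h e m + (\<Sum>j\<in>insert z ?T - {m}. h e' j)) = h e' m + (\<Sum>j\<in>insert z ?T - {m}. h e' j)"
      using chm by (simp add: h_def e'_def)
    also have "\<dots> = (\<Sum>j\<in>insert z ?T. h e' j)" 
      by (rule sum.remove[symmetric]) (use fin mJ in auto)
    finally show "face_sum z T c e i = face_sum z ?T c e' i" by (simp add: face_sum_def h_def ch)
  qed
  show "chain_lead z T c e = chain_lead z ?T c e'"
    by (intro ext) (simp add: chain_lead_def cr rp fs)
  have "c ` ?T = c ` T - {c p}" using p by auto
  then have "card (c ` ?T) = card (c ` T) - 1" using p fin by (simp add: card_Diff_singleton)
  moreover have "card ?T = card T - 1" using p fin by (simp add: card_Diff_singleton)
  moreover have "0 < card (c ` T)" using p fin by (auto simp: card_gt_0_iff)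
  ultimately show "defect T c = defect ?T c" by (simp add: defect_def)
qed

text \<open>If p and its successor carry the same vector, the edge p closes to a trace. Joining it
  to another end of the same colour merely raises an exponent and forgoes that trace. The chord from
  p to its successor covers the gap p alone, so this gap is a face of its own.\<close>

lemma chain_exp_consecutive:
  assumes fin: "finite T" and z: "\<And>i. i \<in> T \<Longrightarrow> z < i" and p: "p \<in> T" "{j \<in> T. p < j} \<noteq> {}" "c (Min {j \<in> T. p < j}) = c p"
  shows "psd_mat r P \<Longrightarrow> chain_exp z T c e r P u v = mtrace (P ^\<^sub>m Suc (e p)) * chain_exp z (T - {p}) c e r P u v +
      (\<Sum>j\<in>insert z (T - {p}). of_bool (chain_left z c j = Colour (c p)) * chain_exp z (T - {p}) c (e(j := Suc (e p + e j))) r P u v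
        + of_bool (chain_right T c j = Colour (c p)) * chain_exp z (T - {p}) c (e(j := Suc (e p + e j))) r P u v)"
    and "chain_lead z T c e r P u v = mtrace (P ^\<^sub>m Suc (e p)) * chain_lead z (T - {p}) c e r P u v"
    and "defect T c = Suc (defect (T - {p}) c)"
proof -
  let ?T = "T - {p}"
  let ?N = "insert z T"
  define s where "s = Min {j \<in> T. p < j}"
  have zp: "z < p" using z p by auto
  have "s \<in> {j \<in> T. p < j}" unfolding s_def by (rule Min_in) (use fin p in auto)
  then have s: "s \<in> T" "p < s" by auto
  have sm: "s \<le> j" if "j \<in> T" "p < j" for j unfolding s_def by (rule Min_le) (use fin that in auto)
  have cs: "c s = c p" using p by (simp add: s_def)
  have J: "?N - {p} = insert z ?T" using zp by auto
  \<comment> \<open>The successor s has the colour of p and takes its place, so deleting p changes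
    no right end.\<close>
  have right: "chain_right ?T c j = chain_right T c j" if j: "j \<in> insert z ?T" for j
  proof (cases "\<exists>x. x \<in> T \<and> j < x \<and> x < p")
    case True
    then obtain x where x: "x \<in> {i \<in> T. j < i}" "x < p" by auto
    have e: "{i \<in> ?T. j < i} = {i \<in> T. j < i} - {p}" by auto
    have "Min {i \<in> ?T. j < i} = Min {i \<in> T. j < i}" unfolding e using Min_remove[OF _ x] fin by simp
    moreover have "{i \<in> ?T. j < i} \<noteq> {}" "{i \<in> T. j < i} \<noteq> {}" using x by auto
    ultimately show ?thesis by (simp add: chain_right_def)
  next
    case F: False
    show ?thesis
    proof (cases "p < j")
      case True
      then have "{i \<in> ?T. j < i} = {i \<in> T. j < i}" by auto
      then show ?thesis by (simp add: chain_right_def)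
    next
      case False
      then have jp: "j < p" using j zp by auto
      have "Min {i \<in> T. j < i} = p" by (rule Min_eqI) (use fin jp p F in \<open>auto simp: not_less\<close>)
      moreover have "Min {i \<in> ?T. j < i} = s"
      proof (rule Min_eqI)
        fix y assume "y \<in> {i \<in> ?T. j < i}"
        then show "s \<le> y" using sm[of y] F by (metis (mono_tags, lifting) DiffE insertI1 linorder_neqE_nat mem_Collect_eq)
      qed (use fin s jp in auto)
      moreover have "{i \<in> ?T. j < i} \<noteq> {}" "{i \<in> T. j < i} \<noteq> {}" using s jp by auto
      ultimately show ?thesis using cs by (simp add: chain_right_def)
    qed
  qed
  have qp: "chain_right T c p = Colour (c p)" using p by (simp add: chain_right_def)
  have ce: "edge_exp (insert z ?T) (chain_left z c) \<epsilon> (chain_right T c) = chain_exp z ?T c \<epsilon>" for \<epsilon>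
    unfolding chain_exp_def by (rule edge_exp_cong) (simp_all add: right)
  show "chain_exp z T c e r P u v = mtrace (P ^\<^sub>m Suc (e p)) * chain_exp z ?T c e r P u v +
      (\<Sum>j\<in>insert z ?T. of_bool (chain_left z c j = Colour (c p)) * chain_exp z ?T c (e(j := Suc (e p + e j))) r P u v
        + of_bool (chain_right T c j = Colour (c p)) * chain_exp z ?T c (e(j := Suc (e p + e j))) r P u v)" if psd: "psd_mat r P"
  proof -
    have st: "chain_exp z T c e r P u v = of_bool (chain_right T c p = Colour (c p)) * (mtrace (P ^\<^sub>m Suc (e p)) * edge_exp (?N - {p}) (chain_left z c) e (chain_right T c) r P u v) +
      (\<Sum>j\<in>?N - {p}. of_bool (chain_left z c j = Colour (c p)) * edge_exp (?N - {p}) ((chain_left z c)(j := chain_right T c p)) (e(j := Suc (e p + e j))) (chain_right T c) r P u v +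
       of_bool (chain_right T c j = Colour (c p)) * edge_exp (?N - {p}) (chain_left z c) (e(j := Suc (e p + e j))) ((chain_right T c)(j := chain_right T c p)) r P u v)"
      unfolding chain_exp_def by (rule edge_exp_stein[OF psd]) (use fin p zp in \<open>auto simp: chain_left_def\<close>)
    have L: "of_bool (chain_left z c j = Colour (c p)) * edge_exp (insert z ?T) ((chain_left z c)(j := chain_right T c p)) \<epsilon> (chain_right T c) r P u v
      = of_bool (chain_left z c j = Colour (c p)) * chain_exp z ?T c \<epsilon> r P u v" for j \<epsilon>
      unfolding qp ce[symmetric] by (cases "chain_left z c j = Colour (c p)") (auto simp: fun_upd_idem)
    have R: "of_bool (chain_right T c j = Colour (c p)) * edge_exp (insert z ?T) (chain_left z c) \<epsilon> ((chain_right T c)(j := chain_right T c p)) r P u v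
      = of_bool (chain_right T c j = Colour (c p)) * chain_exp z ?T c \<epsilon> r P u v" for j \<epsilon>
      unfolding qp ce[symmetric] by (cases "chain_right T c j = Colour (c p)") (auto simp: fun_upd_idem)
    show ?thesis using st unfolding J ce L R by (simp only: qp of_bool_eq simp_thms mult_1_left)
  qed
  have cr: "crosses T c = crosses ?T c"
  proof
    assume "crosses T c"
    then obtain i j k l where *: "i \<in> T" "j \<in> T" "k \<in> T" "l \<in> T" "i < j" "j < k" "k < l" "c i = c k" "c j = c l" "c i \<noteq> c j"
      unfolding crosses_def by blast
    \<comment> \<open>p is moved to s, which has the same colour and no position in between; this
      turns a crossing on T into one without p.\<close>
    define f where "f = (\<lambda>x. if x = p then s else x)"
    have f: "f x \<in> ?T" "c (f x) = c x" if "x \<in> T" for x using that s cs by (auto simp: f_def)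
    have mono: "f x < f y" if "x \<in> T" "y \<in> T" "x < y" "c x \<noteq> c y" for x y
    proof -
      have "y \<noteq> s" if "x = p" using that cs \<open>c x \<noteq> c y\<close> by auto
      then show ?thesis using that sm[of y] s by (auto simp: f_def le_less)
    qed
    have "f i < f j" "f j < f k" "f k < f l" using * by (auto intro!: mono)
    moreover have "f i \<in> ?T" "f j \<in> ?T" "f k \<in> ?T" "f l \<in> ?T" "c (f i) = c (f k)" "c (f j) = c (f l)" "c (f i) \<noteq> c (f j)"
      using * f by auto
    ultimately show "crosses ?T c" unfolding crosses_def by blast
  qed (auto simp: crosses_def)
  have pj: "chords T c j \<noteq> chords T c p" if "j \<in> insert z ?T" for j
  proof
    assume eq: "chords T c j = chords T c p"
    have "(p, s) \<in> chords T c p" using p s cs by (auto simp: chords_def)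
    then have "p \<le> j" "j < s" unfolding eq[symmetric] by (auto simp: chords_def)
    then show False using that zp sm[of j] by auto
  qed
  \<comment> \<open>A chord with end point p is traded for the one with end point s, which covers
    the same of the remaining gaps.\<close>
  have sub: "chords T c j \<subseteq> chords T c i" if eq: "chords ?T c i = chords ?T c j" and ij: "i \<in> insert z ?T" "j \<in> insert z ?T" for i j
  proof
    fix x assume x: "x \<in> chords T c j"
    obtain a b where ab: "x = (a, b)" "a \<in> T" "b \<in> T" "c a = c b" "a \<le> j" "j < b" using x by (auto simp: chords_def)
    have ne: "i \<noteq> p" "j \<noteq> p" using ij zp by auto
    have lt: "y < s \<longleftrightarrow> y < p" if "y \<in> insert z ?T" for y using that sm[of y] s zp by force
    have ge: "s \<le> y \<longleftrightarrow> p \<le> y" if "y \<in> insert z ?T" for y using lt[OF that] by auto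
    consider "a \<noteq> p" "b \<noteq> p" | "a = p" "b \<noteq> p" | "a \<noteq> p" "b = p" using ab by force
    then show "x \<in> chords T c i"
    proof cases
      case 1
      then have "(a, b) \<in> chords ?T c j" using ab by (simp add: chords_def)
      then show ?thesis unfolding eq[symmetric] ab by (auto simp: chords_def)
    next
      case 2
      then have "(s, b) \<in> chords ?T c j" using ab s cs ge[OF ij(2)] by (simp add: chords_def)
      then have "(s, b) \<in> chords ?T c i" unfolding eq .
      then show ?thesis using ab 2 p ge[OF ij(1)] by (auto simp: chords_def)
    next
      case 3
      then have "(a, s) \<in> chords ?T c j" using ab s cs lt[OF ij(2)] by (simp add: chords_def)
      then have "(a, s) \<in> chords ?T c i" unfolding eq .
      then show ?thesis using ab 3 p lt[OF ij(1)] by (auto simp: chords_def)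
    qed
  qed
  have restr: "chords ?T c i = chords T c i \<inter> ?T \<times> ?T" for i by (auto simp: chords_def)
  have ch: "chords T c i = chords T c j \<longleftrightarrow> chords ?T c i = chords ?T c j" if ij: "i \<in> insert z ?T" "j \<in> insert z ?T" for i j
    using sub[OF _ ij] sub[OF _ ij(2,1)] restr by (metis subset_antisym)
  have rp: "face_reps z T c = insert p (face_reps z ?T c)"
  proof (rule Set.set_eqI)
    fix i
    have Nj: "insert z T = insert p (insert z ?T)" using p by auto
    show "i \<in> face_reps z T c \<longleftrightarrow> i \<in> insert p (face_reps z ?T c)"
    proof (cases "i = p")
      case True
      then show ?thesis using p pj unfolding face_reps_def Nj by auto
    next
      case False
      show ?thesis
      proof (cases "i \<in> T")
        case True
        then have iN: "i \<in> insert z ?T" using False by simp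
        have "i \<in> face_reps z T c \<longleftrightarrow> (\<forall>j\<in>insert z ?T. j < i \<longrightarrow> chords T c j \<noteq> chords T c i)"
          using True pj[OF iN] unfolding face_reps_def Nj by auto
        also have "\<dots> \<longleftrightarrow> i \<in> face_reps z ?T c" using True False ch[OF _ iN] unfolding face_reps_def by auto
        finally show ?thesis using False by simp
      next
        case no: False
        then show ?thesis using False by (simp add: face_reps_def)
      qed
    qed
  qed
  have pn: "p \<notin> face_reps z ?T c" by (simp add: face_reps_def)
  have split: "(\<Sum>j\<in>?N. h j) = h p + (\<Sum>j\<in>insert z ?T. h j)" for h :: "nat \<Rightarrow> nat"
    unfolding J[symmetric] by (rule sum.remove) (use fin p in auto)
  have fp: "face_sum z T c e p = Suc (e p)"
    unfolding face_sum_def split using pj by simp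
  have fs: "face_sum z T c e i = face_sum z ?T c e i" if i: "i \<in> insert z ?T" for i
    unfolding face_sum_def split using pj[OF i] ch[OF _ i] by (auto intro!: sum.cong)
  have fr: "finite (face_reps z ?T c)" using fin by (simp add: face_reps_def)
  have "(\<Prod>i\<in>face_reps z T c. mtrace (P ^\<^sub>m face_sum z T c e i)) = mtrace (P ^\<^sub>m Suc (e p)) * (\<Prod>i\<in>face_reps z ?T c. mtrace (P ^\<^sub>m face_sum z ?T c e i))"
    unfolding rp using fr pn fp fs by (auto simp: face_reps_def simp del: pow_mat.simps)
  then show "chain_lead z T c e r P u v = mtrace (P ^\<^sub>m Suc (e p)) * chain_lead z ?T c e r P u v"
    by (simp add: chain_lead_def cr fs del: pow_mat.simps)
  have "c ` T = insert (c p) (c ` ?T)" using p(1) by auto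
  moreover have "c p \<in> c ` ?T" using s cs by (intro image_eqI[of _ _ s]) auto
  ultimately have "c ` T = c ` ?T" by (simp only: insert_absorb)
  moreover have "card T = Suc (card ?T)" by (rule card.remove[OF fin p(1)])
  moreover have "card (c ` ?T) \<le> card ?T" using fin by (intro card_image_le) simp
  ultimately show "defect T c = Suc (defect ?T c)" by (simp add: defect_def)
qed

text \<open>Take a pair p < s of equal colour at the least distance. The successor t of p has
  another colour and lies before s; by minimality its partner lies outside the interval from p to s,
  and the two pairs cross.\<close>

lemma crosses_if_no_neighbours:
  assumes fin: "finite T" and ne: "T \<noteq> {}"
    and ns: "\<And>p. p \<in> T \<Longrightarrow> \<exists>j\<in>T. j \<noteq> p \<and> c j = c p"
    and nc: "\<And>p. p \<in> T \<Longrightarrow> {j \<in> T. p < j} \<noteq> {} \<Longrightarrow> c (Min {j \<in> T. p < j}) \<noteq> c p"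
  shows "crosses T c"
proof -
  define Q where "Q = (\<lambda>d. \<exists>p\<in>T. \<exists>s\<in>T. p < s \<and> c p = c s \<and> d = s - p)"
  obtain p where "p \<in> T" using ne by blast
  then obtain j where "j \<in> T" "j \<noteq> p" "c j = c p" using ns by blast
  then have "Q (p - j) \<or> Q (j - p)" using \<open>p \<in> T\<close> unfolding Q_def by (metis linorder_neqE_nat)
  then have QL: "Q (LEAST d. Q d)" by (metis LeastI)
  then obtain p s where ps: "p \<in> T" "s \<in> T" "p < s" "c p = c s" "(LEAST d. Q d) = s - p" unfolding Q_def by blast
  have min: "s - p \<le> y - x" if "x \<in> T" "y \<in> T" "x < y" "c x = c y" for x y
    unfolding ps(5)[symmetric] by (rule Least_le) (use that in \<open>auto simp: Q_def\<close>)
  define t where "t = Min {j \<in> T. p < j}"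
  have n: "{j \<in> T. p < j} \<noteq> {}" using ps by auto
  have "t \<in> {j \<in> T. p < j}" unfolding t_def by (rule Min_in) (use fin n in auto)
  moreover have "t \<le> s" unfolding t_def by (rule Min_le) (use fin ps in auto)
  moreover have ct: "c t \<noteq> c p" using nc[OF ps(1) n] by (simp add: t_def)
  ultimately have t: "t \<in> T" "p < t" "t < s" using ps by (auto simp: le_less)
  obtain t' where t': "t' \<in> T" "t' \<noteq> t" "c t' = c t" using ns[OF t(1)] by blast
  have "\<not> (p < t' \<and> t' < s)"
  proof
    assume "p < t' \<and> t' < s"
    moreover have "s - p \<le> max t t' - min t t'"
      using t t' min[of t t'] min[of t' t] by (cases "t < t'") (auto simp: max_def min_def)
    ultimately show False using t by (auto simp: max_def min_def split: if_splits)
  qed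
  moreover have "t' \<noteq> p" "t' \<noteq> s" using t' ct ps by auto
  ultimately consider "t' < p" | "s < t'" by force
  then show ?thesis
  proof cases
    case 1
    then show ?thesis unfolding crosses_def using t t' ps ct
      by (intro bexI[of _ t'] bexI[of _ p] bexI[of _ t] bexI[of _ s]) auto
  next
    case 2
    then show ?thesis unfolding crosses_def using t t' ps ct
      by (intro bexI[of _ p] bexI[of _ t] bexI[of _ s] bexI[of _ t']) auto
  qed
qed

text \<open>No edge closes at once, so the inner edges weigh 1 and the two at u and v weigh 0, in
  total |T| - 1. Every colour occurs at least twice, so the defect is at least |T| / 2, which
  exceeds half the weight.\<close>

lemma chain_exp_crude:
  assumes fin: "finite T" and ne: "T \<noteq> {}" and z: "\<And>i. i \<in> T \<Longrightarrow> z < i"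
    and ns: "\<And>p. p \<in> T \<Longrightarrow> \<exists>j\<in>T. j \<noteq> p \<and> c j = c p"
    and nc: "\<And>p. p \<in> T \<Longrightarrow> {j \<in> T. p < j} \<noteq> {} \<Longrightarrow> c (Min {j \<in> T. p < j}) \<noteq> c p"
  shows "trace_poly (defect T c) (chain_exp z T c e)"
proof -
  let ?N = "insert z T"
  define M where "M = Max T"
  have M: "M \<in> T" "\<And>j. j \<in> T \<Longrightarrow> j \<le> M" using fin ne by (auto simp: M_def)
  have zM: "z < M" "z \<notin> T" using z M by auto
  have fN: "finite ?N" using fin by simp
  have re: "chain_right T c i = RightEnd \<longleftrightarrow> i = M" if "i \<in> ?N" for i
  proof -
    have "{j \<in> T. i < j} = {} \<longleftrightarrow> i = M" using M zM that by (auto simp: not_less) (metis le_antisym)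
    then show ?thesis by (simp add: chain_right_def)
  qed
  have rl: "chain_right T c i \<noteq> LeftEnd" for i by (simp add: chain_right_def)
  have le: "chain_left z c i = LeftEnd \<longleftrightarrow> i = z" "chain_left z c i \<noteq> RightEnd" for i by (auto simp: chain_left_def)
  have "(\<Sum>i\<in>?N. of_bool (chain_left z c i = LeftEnd) + of_bool (chain_right T c i = LeftEnd)) = (\<Sum>i\<in>?N. if i = z then 1 else 0 :: nat)"
    by (intro sum.cong refl) (simp add: le rl)
  then have LE: "(\<Sum>i\<in>?N. of_bool (chain_left z c i = LeftEnd) + of_bool (chain_right T c i = LeftEnd)) = (1 :: nat)"
    using fN by simp
  have "(\<Sum>i\<in>?N. of_bool (chain_left z c i = RightEnd) + of_bool (chain_right T c i = RightEnd)) = (\<Sum>i\<in>?N. if i = M then 1 else 0 :: nat)"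
    by (intro sum.cong refl) (simp add: le re)
  then have RE: "(\<Sum>i\<in>?N. of_bool (chain_left z c i = RightEnd) + of_bool (chain_right T c i = RightEnd)) = (1 :: nat)"
    using fN M by simp
  have wt: "edge_wt (chain_left z c i) (chain_right T c i) = (if i = z \<or> i = M then 0 else 1)" if "i \<in> ?N" for i
  proof (cases "i = z \<or> i = M")
    case True
    then show ?thesis using le re[OF that] by (auto simp: edge_wt_def)
  next
    case False
    then have iT: "i \<in> T" "{j \<in> T. i < j} \<noteq> {}" using that re[OF that] by (auto simp: chain_right_def split: if_splits)
    then show ?thesis using nc[OF iT] False by (simp add: edge_wt_def chain_right_def chain_left_def)
  qed
  have "(\<Sum>i\<in>?N. edge_wt (chain_left z c i) (chain_right T c i)) = (\<Sum>i\<in>?N - {z, M}. 1)"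
    by (rule sum.mono_neutral_cong_right) (use fN wt in auto)
  also have "\<dots> = card T - 1"
  proof -
    have "?N - {z, M} = T - {M}" using zM by auto
    then show ?thesis using M fin by (simp add: card_Diff_singleton)
  qed
  finally have tp: "trace_poly (Suc ((card T - 1) div 2)) (chain_exp z T c e)"
    using edge_exp_trace_poly[OF fN LE RE, of e] by (simp add: chain_exp_def)
  have "2 * card (c ` T) \<le> card T"
  proof -
    have "card T = (\<Sum>k\<in>c ` T. card {i \<in> T. c i = k})"
      using sum.group[of T "c ` T" c "\<lambda>_. 1 :: nat"] fin by simp
    also have "\<dots> \<ge> (\<Sum>k\<in>c ` T. 2)"
    proof (rule sum_mono)
      fix k assume "k \<in> c ` T"
      then obtain p where p: "p \<in> T" "k = c p" by blast
      then obtain j where j: "j \<in> T" "j \<noteq> p" "c j = c p" using ns by blast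
      have "card {p, j} \<le> card {i \<in> T. c i = k}" by (rule card_mono) (use fin p j in auto)
      then show "2 \<le> card {i \<in> T. c i = k}" using j by simp
    qed
    finally show ?thesis by simp
  qed
  moreover have "0 < card T" using fin ne by (simp add: card_gt_0_iff)
  ultimately have "Suc ((card T - 1) div 2) \<le> defect T c" unfolding defect_def by presburger
  with tp show ?thesis by (rule trace_poly_mono)
qed

text \<open>Both bounds go through one induction: for equal neighbours the error contains whole
  chains, to which the first bound applies. If neither reduction is possible, the chain is crossing,
  its leading term is 0, and the crude bound is the claim.\<close>

lemma chain_exp_lead:
  assumes "finite T" "\<And>i. i \<in> T \<Longrightarrow> z < i"
  shows "trace_poly (Suc (defect T c)) (chain_exp z T c e) \<and>
    trace_poly (defect T c) (\<lambda>r P u v. chain_exp z T c e r P u v - chain_lead z T c e r P u v)"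
  using assms
proof (induction "card T" arbitrary: T e rule: less_induct)
  case less
  note fin = less.prems(1) and z = less.prems(2)
  have IH: "trace_poly (Suc (defect (T - {p}) c)) (chain_exp z (T - {p}) c \<epsilon>)"
    "trace_poly (defect (T - {p}) c) (\<lambda>r P u v. chain_exp z (T - {p}) c \<epsilon> r P u v - chain_lead z (T - {p}) c \<epsilon> r P u v)"
    if "p \<in> T" for p \<epsilon>
  proof -
    have "card (T - {p}) < card T" using that fin by (rule card_Diff1_less[rotated])
    from less.hyps[OF this, of \<epsilon>] fin z show "trace_poly (Suc (defect (T - {p}) c)) (chain_exp z (T - {p}) c \<epsilon>)"
      "trace_poly (defect (T - {p}) c) (\<lambda>r P u v. chain_exp z (T - {p}) c \<epsilon> r P u v - chain_lead z (T - {p}) c \<epsilon> r P u v)" by auto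
  qed
  consider (empty) "T = {}" | (single) "\<exists>p\<in>T. \<forall>j\<in>T. c j = c p \<longrightarrow> j = p"
    | (consec) "\<exists>p\<in>T. {j \<in> T. p < j} \<noteq> {} \<and> c (Min {j \<in> T. p < j}) = c p"
    | (none) "T \<noteq> {}" "\<forall>p\<in>T. \<exists>j\<in>T. j \<noteq> p \<and> c j = c p" "\<forall>p\<in>T. {j \<in> T. p < j} \<noteq> {} \<longrightarrow> c (Min {j \<in> T. p < j}) \<noteq> c p"
    by blast
  then show ?case
  proof cases
    case empty
    have d: "defect T c = 0" by (simp add: defect_def empty)
    have ex: "chain_exp z T c e r P u v = form r P (e z) u v" if "psd_mat r P" for r P u v
      using edge_exp_const(1)[OF that] by (simp add: chain_exp_def empty chain_left_def chain_right_def)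
    have ld: "chain_lead z T c e r P u v = form r P (e z) u v" for r P u v
      by (simp add: chain_lead_def empty crosses_def face_reps_def face_sum_def)
    show ?thesis unfolding d
      by (intro conjI trace_poly_cong[OF trace_poly_form[of _ "e z"]] trace_poly_cong[OF trace_poly_zero]) (simp_all add: ex ld)
  next
    case single
    then obtain p where p: "p \<in> T" "\<And>j. j \<in> T \<Longrightarrow> c j = c p \<Longrightarrow> j = p" by blast
    define \<epsilon> where "\<epsilon> = e(Max {j \<in> insert z T. j < p} := Suc (e p + e (Max {j \<in> insert z T. j < p})))"
    have ex: "chain_exp z (T - {p}) c \<epsilon> r P u v = chain_exp z T c e r P u v" if "psd_mat r P" for r P u v
      unfolding \<epsilon>_def by (rule chain_exp_singleton(1)[OF fin z p that, symmetric])
    have ld: "chain_lead z (T - {p}) c \<epsilon> = chain_lead z T c e"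
      unfolding \<epsilon>_def by (rule chain_exp_singleton(2)[OF fin z p, symmetric])
    have d: "defect T c = defect (T - {p}) c" by (rule chain_exp_singleton(3)[OF fin z p])
    have 1: "trace_poly (Suc (defect T c)) (chain_exp z T c e)"
      unfolding d by (rule trace_poly_cong[OF IH(1)[OF p(1), of \<epsilon>] ex])
    have 2: "trace_poly (defect T c) (\<lambda>r P u v. chain_exp z T c e r P u v - chain_lead z T c e r P u v)"
      unfolding d by (rule trace_poly_cong[OF IH(2)[OF p(1), of \<epsilon>]]) (simp only: ex ld)
    show ?thesis using 1 2 by blast
  next
    case consec
    then obtain p where consec: "p \<in> T" "{j \<in> T. p < j} \<noteq> {}" "c (Min {j \<in> T. p < j}) = c p" by blast
    note s = chain_exp_consecutive(1,2)[OF fin z consec]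
    have d: "defect T c = Suc (defect (T - {p}) c)" by (rule chain_exp_consecutive(3)[OF fin z consec])
    have rest: "trace_poly (defect T c) (\<lambda>r P u v. \<Sum>j\<in>insert z (T - {p}). of_bool (chain_left z c j = Colour (c p)) * chain_exp z (T - {p}) c (e(j := Suc (e p + e j))) r P u v
        + of_bool (chain_right T c j = Colour (c p)) * chain_exp z (T - {p}) c (e(j := Suc (e p + e j))) r P u v)"
      unfolding d by (intro trace_poly_sum trace_poly_add trace_poly_cmult IH consec)
    have a: "trace_poly (Suc (defect T c)) (\<lambda>r P u v. mtrace (P ^\<^sub>m Suc (e p)) * chain_exp z (T - {p}) c e r P u v)"
      unfolding d by (intro trace_poly_trace_mult IH consec)
    have b: "trace_poly (defect T c) (\<lambda>r P u v. mtrace (P ^\<^sub>m Suc (e p)) * (chain_exp z (T - {p}) c e r P u v - chain_lead z (T - {p}) c e r P u v))"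
      unfolding d by (intro trace_poly_trace_mult IH consec)
    show ?thesis
    proof
      show "trace_poly (Suc (defect T c)) (chain_exp z T c e)"
        by (rule trace_poly_cong[OF trace_poly_add[OF a trace_poly_mono[OF rest]]]) (simp_all add: s(1) del: pow_mat.simps sum_of_bool_mult_eq)
      show "trace_poly (defect T c) (\<lambda>r P u v. chain_exp z T c e r P u v - chain_lead z T c e r P u v)"
        by (rule trace_poly_cong[OF trace_poly_add[OF b rest]]) (simp add: s right_diff_distrib del: pow_mat.simps sum_of_bool_mult_eq)
    qed
  next
    case none
    have t: "trace_poly (defect T c) (chain_exp z T c e)" by (rule chain_exp_crude[OF fin none(1) z]) (use none in auto)
    have "crosses T c" by (rule crosses_if_no_neighbours[OF fin none(1)]) (use none in auto)
    then show ?thesis using t trace_poly_mono[OF t, of "Suc (defect T c)"] by (simp add: chain_lead_def)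
  qed
qed

section \<open>The dual partition as faces of the arc diagram\<close>

lemma crossingI:
  "X \<in> \<pi> \<Longrightarrow> Y \<in> \<pi> \<Longrightarrow> X \<noteq> Y \<Longrightarrow> i < j \<Longrightarrow> j < k \<Longrightarrow> k < l \<Longrightarrow> i \<in> X \<Longrightarrow> k \<in> X \<Longrightarrow> j \<in> Y \<Longrightarrow> l \<in> Y \<Longrightarrow> crossing \<pi>"
  unfolding crossing_def by blast

text \<open>Gap i is the new node after i on the circle. The gap n lies under no chord, just as the
  gap 0 before the first point, which is left out here.\<close>

definition faces :: "nat \<Rightarrow> (nat \<Rightarrow> nat) \<Rightarrow> nat set set" where
  "faces n c = (\<lambda>i. {j \<in> {1..n}. chords {1..n} c j = chords {1..n} c i}) ` {1..n}"

lemma partition_faces: "partition_on {1..n} (faces n c)"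
  by (rule partition_onI) (auto simp: faces_def disjnt_def)

text \<open>If i < j < k and the gaps i and k have the same chords over them, each of these chords
  covers j too. A crossing thus gives both inclusions between the two sets of chords.\<close>

lemma not_crossing_faces: "\<not> crossing (faces n c)"
proof
  let ?ch = "chords {1..n} c"
  assume "crossing (faces n c)"
  then obtain i j k l X Y where *: "X \<in> faces n c" "Y \<in> faces n c" "i < j" "j < k" "k < l" "X \<noteq> Y" "i \<in> X" "k \<in> X" "j \<in> Y" "l \<in> Y"
    unfolding crossing_def by blast
  obtain x y where xy: "X = {j \<in> {1..n}. ?ch j = ?ch x}" "Y = {j \<in> {1..n}. ?ch j = ?ch y}"
    using *(1,2) by (auto simp: faces_def)
  have e: "?ch i = ?ch k" "?ch j = ?ch l" "?ch i \<noteq> ?ch j" using * xy by auto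
  have "?ch i = ?ch j"
  proof (intro equalityI subsetI)
    fix p assume p: "p \<in> ?ch i"
    moreover have "p \<in> ?ch k" using p e by simp
    ultimately show "p \<in> ?ch j" using * by (auto simp: chords_def)
  next
    fix p assume p: "p \<in> ?ch j"
    moreover have "p \<in> ?ch l" using p e by simp
    ultimately have "p \<in> ?ch k" using * by (auto simp: chords_def)
    then show "p \<in> ?ch i" using e by simp
  qed
  then show False using e by simp
qed

context
  fixes n :: nat and \<pi> :: "nat set set" and c :: "nat \<Rightarrow> nat"
  assumes part: "partition_on {1..n} \<pi>"
    and col: "\<And>i j. i \<in> {1..n} \<Longrightarrow> j \<in> {1..n} \<Longrightarrow> c i = c j \<longleftrightarrow> block_of \<pi> i = block_of \<pi> j"
begin

lemma block_range: "X \<in> \<pi> \<Longrightarrow> i \<in> X \<Longrightarrow> i \<in> {1..n}"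
  using part by (auto simp: partition_on_def)

lemma same_block: "X \<in> \<pi> \<Longrightarrow> i \<in> X \<Longrightarrow> j \<in> X \<Longrightarrow> c i = c j"
  using block_of_eq[OF part] col[OF block_range block_range] by metis

lemma same_colour: "i \<in> {1..n} \<Longrightarrow> j \<in> {1..n} \<Longrightarrow> c i = c j \<Longrightarrow> \<exists>X\<in>\<pi>. i \<in> X \<and> j \<in> X"
  using block_of_in[OF part] col by metis

lemma crosses_iff_crossing: "crosses {1..n} c \<longleftrightarrow> crossing \<pi>"
proof
  assume "crosses {1..n} c"
  then obtain i j k l where *: "i \<in> {1..n}" "j \<in> {1..n}" "k \<in> {1..n}" "l \<in> {1..n}" "i < j" "j < k" "k < l" "c i = c k" "c j = c l" "c i \<noteq> c j"
    unfolding crosses_def by blast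
  obtain X where X: "X \<in> \<pi>" "i \<in> X" "k \<in> X" using same_colour[OF *(1,3,8)] by blast
  obtain Y where Y: "Y \<in> \<pi>" "j \<in> Y" "l \<in> Y" using same_colour[OF *(2,4,9)] by blast
  have "X \<noteq> Y" using same_block[OF X(1,2)] Y(2) *(10) by blast
  then show "crossing \<pi>" using X Y * unfolding crossing_def by blast
next
  assume "crossing \<pi>"
  then obtain i j k l X Y where *: "X \<in> \<pi>" "Y \<in> \<pi>" "i < j" "j < k" "k < l" "X \<noteq> Y" "i \<in> X" "k \<in> X" "j \<in> Y" "l \<in> Y"
    unfolding crossing_def by blast
  have "c i \<noteq> c j"
  proof
    assume "c i = c j"
    then have "block_of \<pi> i = block_of \<pi> j" using col[of i j] block_range * by blast
    then show False using block_of_eq[OF part *(1,7)] block_of_eq[OF part *(2,9)] *(6) by simp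
  qed
  then show "crosses {1..n} c"
    unfolding crosses_def using * same_block[OF *(1,7,8)] same_block[OF *(2,9,10)] block_range
    by (intro bexI[of _ i] bexI[of _ j] bexI[of _ k] bexI[of _ l]) auto
qed

text \<open>In the doubled numbering 2i - 1 < 2j means i \<le> j, and 2j < 2k - 1 means j < k. So a
  crossing of the chord (i, k) with a pair j, l from a block of \<sigma> says that exactly one of
  the gaps j and l lies under (i, k).\<close>

lemma chords_const_iff:
  assumes s: "partition_on {1..n} \<sigma>"
  shows "(\<exists>i j k l. \<exists>X\<in>\<pi>. \<exists>Y\<in>\<sigma>. i \<in> X \<and> k \<in> X \<and> j \<in> Y \<and> l \<in> Y \<and>
      (2 * i - 1 < 2 * j \<and> 2 * j < 2 * k - 1 \<and> 2 * k - 1 < 2 * l \<or> 2 * j < 2 * i - 1 \<and> 2 * i - 1 < 2 * l \<and> 2 * l < 2 * k - 1)) \<longleftrightarrow>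
    \<not> (\<forall>Y\<in>\<sigma>. \<forall>j\<in>Y. \<forall>l\<in>Y. chords {1..n} c j = chords {1..n} c l)"
    (is "?L = (\<not> ?R)")
proof
  assume ?L
  then obtain i j k l X Y where *: "X \<in> \<pi>" "Y \<in> \<sigma>" "i \<in> X" "k \<in> X" "j \<in> Y" "l \<in> Y"
    "2 * i - 1 < 2 * j \<and> 2 * j < 2 * k - 1 \<and> 2 * k - 1 < 2 * l \<or> 2 * j < 2 * i - 1 \<and> 2 * i - 1 < 2 * l \<and> 2 * l < 2 * k - 1"
    by blast
  have ik: "i \<in> {1..n}" "k \<in> {1..n}" "c i = c k" using block_range same_block * by blast+
  have "i \<le> j \<and> j < k \<and> k \<le> l \<or> j < i \<and> i \<le> l \<and> l < k" using *(7) ik by auto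
  then have "((i, k) \<in> chords {1..n} c j) \<noteq> ((i, k) \<in> chords {1..n} c l)" using ik by (auto simp: chords_def)
  then show "\<not> ?R" using *(2,5,6) by blast
next
  assume "\<not> ?R"
  then obtain Y x y where Y: "Y \<in> \<sigma>" "x \<in> Y" "y \<in> Y" "chords {1..n} c x \<noteq> chords {1..n} c y" by blast
  have "\<exists>j\<in>Y. \<exists>l\<in>Y. \<exists>p. p \<in> chords {1..n} c j \<and> p \<notin> chords {1..n} c l" using Y by blast
  then obtain j l i k where jl: "j \<in> Y" "l \<in> Y" "(i, k) \<in> chords {1..n} c j" "(i, k) \<notin> chords {1..n} c l" by auto
  then have ik: "i \<in> {1..n}" "k \<in> {1..n}" "c i = c k" "i \<le> j" "j < k" "\<not> (i \<le> l \<and> l < k)" by (auto simp: chords_def)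
  obtain X where X: "X \<in> \<pi>" "i \<in> X" "k \<in> X" using same_colour[OF ik(1-3)] by blast
  consider "k \<le> l" | "l < i" using ik(6) by force
  then show ?L
  proof cases
    case 1
    then have "2 * i - 1 < 2 * j \<and> 2 * j < 2 * k - 1 \<and> 2 * k - 1 < 2 * l" using ik by auto
    then show ?thesis using X Y(1) jl by blast
  next
    case 2
    then have "2 * l < 2 * i - 1 \<and> 2 * i - 1 < 2 * j \<and> 2 * j < 2 * k - 1" using ik by auto
    then show ?thesis using X Y(1) jl by blast
  qed
qed

text \<open>Parity tells the two partitions apart, so a crossing lies within \<pi>, within \<sigma>,
  or between them; the last case means that some block of \<sigma> contains gaps with different
  chords over them.\<close>

lemma crossing_interleave:
  assumes s: "partition_on {1..n} \<sigma>"
  shows "crossing (interleave \<pi> \<sigma>) \<longleftrightarrow> crossing \<pi> \<or> crossing \<sigma> \<or> 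
    \<not> (\<forall>Y\<in>\<sigma>. \<forall>j\<in>Y. \<forall>l\<in>Y. chords {1..n} c j = chords {1..n} c l)" (is "_ \<longleftrightarrow> ?R")
proof -
  let ?f = "\<lambda>i. 2 * i - 1 :: nat" and ?g = "\<lambda>i. 2 * i :: nat"
  have fmono: "?f i < ?f j \<longleftrightarrow> i < j" if "i \<in> {1..n}" "j \<in> {1..n}" for i j using that by auto
  have finj: "?f i = ?f j \<longleftrightarrow> i = j" if "i \<in> {1..n}" "j \<in> {1..n}" for i j using that by auto
  have odd: "odd (?f i)" if "i \<in> {1..n}" for i using that by auto
  have fb: "?f ` X \<noteq> ?g ` Y" "?g ` Y \<noteq> ?f ` X" if "X \<in> \<pi>" for X Y
  proof -
    have "X \<noteq> {}" using partition_onD3[OF part] that by blast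
    then obtain i where "i \<in> X" by blast
    then have "?f i \<in> ?f ` X" "odd (?f i)" using odd[OF block_range[OF that]] by blast+
    moreover have "even x" if "x \<in> ?g ` Y" for x using that by auto
    ultimately show "?f ` X \<noteq> ?g ` Y" "?g ` Y \<noteq> ?f ` X" by blast+
  qed
  have fX: "?f ` X \<noteq> ?f ` X'" if X: "X \<in> \<pi>" "X' \<in> \<pi>" "X \<noteq> X'" for X X'
  proof
    assume eq: "?f ` X = ?f ` X'"
    have "inj_on ?f {1..n}" by (rule inj_onI) (use finj in blast)
    moreover have "X \<subseteq> {1..n}" "X' \<subseteq> {1..n}" using block_range X by blast+
    ultimately show False using eq X(3) by (simp add: inj_on_image_eq_iff)
  qed
  have gX: "?g ` X \<noteq> ?g ` X'" if "X \<noteq> X'" for X X'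
    using that by (simp add: inj_image_eq_iff inj_on_def)
  have srange: "j \<in> {1..n}" if "Y \<in> \<sigma>" "j \<in> Y" for Y j using s that by (auto simp: partition_on_def)
  show ?thesis
  proof
    assume "crossing (interleave \<pi> \<sigma>)"
    then obtain i j k l X Y where *: "X \<in> interleave \<pi> \<sigma>" "Y \<in> interleave \<pi> \<sigma>" "i < j" "j < k" "k < l" "X \<noteq> Y" "i \<in> X" "k \<in> X" "j \<in> Y" "l \<in> Y"
      unfolding crossing_def by blast
    have "(\<exists>X'\<in>\<pi>. X = ?f ` X') \<or> (\<exists>X'\<in>\<sigma>. X = ?g ` X')" "(\<exists>Y'\<in>\<pi>. Y = ?f ` Y') \<or> (\<exists>Y'\<in>\<sigma>. Y = ?g ` Y')"
      using *(1,2) by (auto simp: interleave_def)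
    then consider (pp) "\<exists>Z\<in>\<pi>. X = ?f ` Z" "\<exists>Z\<in>\<pi>. Y = ?f ` Z"
      | (ss) "\<exists>Z\<in>\<sigma>. X = ?g ` Z" "\<exists>Z\<in>\<sigma>. Y = ?g ` Z"
      | (ps) "\<exists>Z\<in>\<pi>. X = ?f ` Z" "\<exists>Z\<in>\<sigma>. Y = ?g ` Z"
      | (sp) "\<exists>Z\<in>\<sigma>. X = ?g ` Z" "\<exists>Z\<in>\<pi>. Y = ?f ` Z" by argo
    then show ?R
    proof cases
      case pp
      then obtain X' Y' where pp: "X' \<in> \<pi>" "Y' \<in> \<pi>" "X = ?f ` X'" "Y = ?f ` Y'" by blast
      obtain i' k' j' l' where i: "i' \<in> X'" "k' \<in> X'" "j' \<in> Y'" "l' \<in> Y'" "i = ?f i'" "k = ?f k'" "j = ?f j'" "l = ?f l'"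
        using *(7-10) pp(3,4) by blast
      have "i' < j'" "j' < k'" "k' < l'" using *(3-5) unfolding i(5-8) by linarith+
      moreover have "X' \<noteq> Y'" using *(6) pp by blast
      ultimately have "crossing \<pi>" by (intro crossingI[OF pp(1,2) _ _ _ _ i(1-4)])
      then show ?thesis by blast
    next
      case ss
      then obtain X' Y' where ss: "X' \<in> \<sigma>" "Y' \<in> \<sigma>" "X = ?g ` X'" "Y = ?g ` Y'" by blast
      obtain i' k' j' l' where i: "i' \<in> X'" "k' \<in> X'" "j' \<in> Y'" "l' \<in> Y'" "i = ?g i'" "k = ?g k'" "j = ?g j'" "l = ?g l'"
        using *(7-10) ss(3,4) by blast
      have "i' < j'" "j' < k'" "k' < l'" using *(3-5) unfolding i(5-8) by linarith+
      moreover have "X' \<noteq> Y'" using *(6) ss by blast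
      ultimately have "crossing \<sigma>" by (intro crossingI[OF ss(1,2) _ _ _ _ i(1-4)])
      then show ?thesis by blast
    next
      case ps
      then obtain X' Y' where ps: "X' \<in> \<pi>" "Y' \<in> \<sigma>" "X = ?f ` X'" "Y = ?g ` Y'" by blast
      obtain i' k' j' l' where i: "i' \<in> X'" "k' \<in> X'" "j' \<in> Y'" "l' \<in> Y'" "i = ?f i'" "k = ?f k'" "j = ?g j'" "l = ?g l'"
        using *(7-10) ps(3,4) by blast
      have "\<not> (\<forall>Y\<in>\<sigma>. \<forall>j\<in>Y. \<forall>l\<in>Y. chords {1..n} c j = chords {1..n} c l)"
        unfolding chords_const_iff[OF s, symmetric]
        using *(3-5) ps(1,2) i(1-4) unfolding i(5-8) by blast
      then show ?thesis by blast
    next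
      case sp
      then obtain X' Y' where sp: "X' \<in> \<sigma>" "Y' \<in> \<pi>" "X = ?g ` X'" "Y = ?f ` Y'" by blast
      obtain i' k' j' l' where i: "i' \<in> X'" "k' \<in> X'" "j' \<in> Y'" "l' \<in> Y'" "i = ?g i'" "k = ?g k'" "j = ?f j'" "l = ?f l'"
        using *(7-10) sp(3,4) by blast
      have "\<not> (\<forall>Y\<in>\<sigma>. \<forall>j\<in>Y. \<forall>l\<in>Y. chords {1..n} c j = chords {1..n} c l)"
        unfolding chords_const_iff[OF s, symmetric]
        using *(3-5) sp(1,2) i(1-4) unfolding i(5-8) by blast
      then show ?thesis by blast
    qed
  next
    assume ?R
    then consider (p) "crossing \<pi>" | (s) "crossing \<sigma>" | (m) "\<not> (\<forall>Y\<in>\<sigma>. \<forall>j\<in>Y. \<forall>l\<in>Y. chords {1..n} c j = chords {1..n} c l)" by blast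
    then show "crossing (interleave \<pi> \<sigma>)"
    proof cases
      case p
      then obtain i j k l X Y where *: "X \<in> \<pi>" "Y \<in> \<pi>" "i < j" "j < k" "k < l" "X \<noteq> Y" "i \<in> X" "k \<in> X" "j \<in> Y" "l \<in> Y"
        unfolding crossing_def by blast
      have r: "i \<in> {1..n}" "j \<in> {1..n}" "k \<in> {1..n}" "l \<in> {1..n}" using block_range * by blast+
      have "?f i < ?f j" "?f j < ?f k" "?f k < ?f l" using *(3-5) fmono r by blast+
      note lt = this
      have "?f ` X \<in> interleave \<pi> \<sigma>" "?f ` Y \<in> interleave \<pi> \<sigma>" using *(1,2) by (auto simp: interleave_def)
      then show ?thesis by (rule crossingI[OF _ _ fX[OF *(1,2,6)] lt]) (use *(7-10) in \<open>blast+\<close>)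
    next
      case s
      then obtain i j k l X Y where *: "X \<in> \<sigma>" "Y \<in> \<sigma>" "i < j" "j < k" "k < l" "X \<noteq> Y" "i \<in> X" "k \<in> X" "j \<in> Y" "l \<in> Y"
        unfolding crossing_def by blast
      have "?g i < ?g j" "?g j < ?g k" "?g k < ?g l" using *(3-5) by simp_all
      note lt = this
      have "?g ` X \<in> interleave \<pi> \<sigma>" "?g ` Y \<in> interleave \<pi> \<sigma>" using *(1,2) by (auto simp: interleave_def)
      then show ?thesis by (rule crossingI[OF _ _ gX[OF *(6)] lt]) (use *(7-10) in \<open>blast+\<close>)
    next
      case m
      then obtain i j k l X Y where *: "X \<in> \<pi>" "Y \<in> \<sigma>" "i \<in> X" "k \<in> X" "j \<in> Y" "l \<in> Y"
        "?f i < ?g j \<and> ?g j < ?f k \<and> ?f k < ?g l \<or> ?g j < ?f i \<and> ?f i < ?g l \<and> ?g l < ?f k"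
        unfolding chords_const_iff[OF assms, symmetric] by blast
      have XY: "?f ` X \<in> interleave \<pi> \<sigma>" "?g ` Y \<in> interleave \<pi> \<sigma>" using *(1,2) by (auto simp: interleave_def)
      have el: "?f i \<in> ?f ` X" "?f k \<in> ?f ` X" "?g j \<in> ?g ` Y" "?g l \<in> ?g ` Y" using *(3-6) by blast+
      from *(7) show ?thesis
      proof
        assume "?f i < ?g j \<and> ?g j < ?f k \<and> ?f k < ?g l"
        then show ?thesis by (elim conjE) (rule crossingI[OF XY fb(1)[OF *(1)] _ _ _ el])
      next
        assume "?g j < ?f i \<and> ?f i < ?g l \<and> ?g l < ?f k"
        then show ?thesis by (elim conjE) (rule crossingI[OF XY(2,1) fb(2)[OF *(1)] _ _ _ el(3,4,1,2)])
      qed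
    qed
  qed
qed

text \<open>By \<open>crossing_interleave\<close> the admissible partitions are the non-crossing
  ones on whose blocks the set of chords is constant, that is, the non-crossing refinements of
  \<open>faces n c\<close>, which is itself admissible.\<close>

lemma Xi_eq_faces:
  assumes nc: "\<not> crossing \<pi>"
  shows "Xi n \<pi> = faces n c"
  unfolding Xi_def
proof (rule the_equality)
  let ?R = "\<lambda>\<sigma>. \<forall>Y\<in>\<sigma>. \<forall>j\<in>Y. \<forall>l\<in>Y. chords {1..n} c j = chords {1..n} c l"
  have fnc: "faces n c \<in> nc_parts n" using partition_faces not_crossing_faces by (simp add: nc_parts_def)
  have fR: "?R (faces n c)" by (auto simp: faces_def)
  have fint: "\<not> crossing (interleave \<pi> (faces n c))"
    unfolding crossing_interleave[OF partition_faces] using nc fR not_crossing_faces by blast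
  have fmax: "refines {1..n} \<sigma> (faces n c)" if s: "\<sigma> \<in> nc_parts n" "\<not> crossing (interleave \<pi> \<sigma>)" for \<sigma>
  proof -
    have p: "partition_on {1..n} \<sigma>" using s(1) by (simp add: nc_parts_def)
    have R: "?R \<sigma>" using s(2) unfolding crossing_interleave[OF p] by blast
    have "\<exists>Y\<in>faces n c. X \<subseteq> Y" if X: "X \<in> \<sigma>" for X
    proof -
      have "X \<noteq> {}" using partition_onD3[OF p] X by blast
      then obtain i where i: "i \<in> X" by blast
      have Xs: "X \<subseteq> {1..n}" using p X by (auto simp: partition_on_def)
      have "X \<subseteq> {j \<in> {1..n}. chords {1..n} c j = chords {1..n} c i}" using R X i Xs by blast
      moreover have "{j \<in> {1..n}. chords {1..n} c j = chords {1..n} c i} \<in> faces n c" using i Xs by (auto simp: faces_def)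
      ultimately show ?thesis by blast
    qed
    then show ?thesis using p partition_faces by (simp add: refines_def)
  qed
  show "faces n c \<in> nc_parts n \<and> \<not> crossing (interleave \<pi> (faces n c)) \<and>
     (\<forall>\<sigma>'\<in>nc_parts n. \<not> crossing (interleave \<pi> \<sigma>') \<longrightarrow> refines {1..n} \<sigma>' (faces n c))"
    using fnc fint fmax by blast
  fix \<sigma> assume s: "\<sigma> \<in> nc_parts n \<and> \<not> crossing (interleave \<pi> \<sigma>) \<and>
     (\<forall>\<sigma>'\<in>nc_parts n. \<not> crossing (interleave \<pi> \<sigma>') \<longrightarrow> refines {1..n} \<sigma>' \<sigma>)"
  then have "refines {1..n} (faces n c) \<sigma>" "refines {1..n} \<sigma> (faces n c)" using fnc fint fmax by blast+
  then show "\<sigma> = faces n c" by (metis refines_asym)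
qed

text \<open>\<open>Max\<close> maps the visible blocks bijectively onto the gaps without chords: a
  chord over the gap after \<open>Max B\<close> would belong to a block that encloses B or crosses
  it.\<close>

lemma visible_blocks_eq:
  assumes nc: "\<not> crossing \<pi>"
  shows "visible_blocks \<pi> = card {j \<in> {1..n}. chords {1..n} c j = {}}"
proof -
  define V where "V = {B \<in> \<pi>. \<not> (\<exists>B'\<in>\<pi>. B' \<noteq> B \<and> Min B' < Min B \<and> Max B < Max B')}"
  have fin: "finite B" "B \<noteq> {}" if "B \<in> \<pi>" for B
  proof -
    have "B \<subseteq> {1..n}" using block_range[OF that] by blast
    then show "finite B" by (rule finite_subset) simp
    show "B \<noteq> {}" using partition_onD3[OF part] that by blast
  qed
  have mM: "Min B \<in> B" "Max B \<in> B" "\<And>x. x \<in> B \<Longrightarrow> Min B \<le> x \<and> x \<le> Max B" if "B \<in> \<pi>" for B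
    using fin[OF that] by auto
  have dis: "B = B'" if "B \<in> \<pi>" "B' \<in> \<pi>" "x \<in> B" "x \<in> B'" for B B' x
    using part that by (auto simp: partition_on_def disjoint_def)
  have inj: "inj_on Max V"
  proof (rule inj_onI)
    fix B B' assume *: "B \<in> V" "B' \<in> V" "Max B = Max B'"
    then have "B \<in> \<pi>" "B' \<in> \<pi>" by (simp_all add: V_def)
    then show "B = B'" using dis[of B B' "Max B"] mM(2)[of B] mM(2)[of B'] *(3) by simp
  qed
  have img: "Max ` V = {j \<in> {1..n}. chords {1..n} c j = {}}"
  proof (intro equalityI subsetI)
    fix j assume "j \<in> Max ` V"
    then obtain B where B: "B \<in> V" "j = Max B" by blast
    then have BP: "B \<in> \<pi>" by (simp add: V_def)
    have jB: "j \<in> B" using mM(2)[OF BP] B by simp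
    have "(a, b) \<notin> chords {1..n} c j" for a b
    proof
      assume "(a, b) \<in> chords {1..n} c j"
      then have ab: "a \<in> {1..n}" "b \<in> {1..n}" "c a = c b" "a \<le> j" "j < b" by (auto simp: chords_def)
      obtain B' where B': "B' \<in> \<pi>" "a \<in> B'" "b \<in> B'" using same_colour[OF ab(1-3)] by blast
      have "b \<notin> B" using mM(3)[OF BP, of b] ab B by auto
      then have ne: "B' \<noteq> B" using B' by blast
      have "Max B < Max B'" using mM(3)[OF B'(1,3)] ab B by simp
      then have "\<not> Min B' < Min B" using B(1) B'(1) ne by (auto simp: V_def)
      moreover have "Min B' \<noteq> Min B" using dis[OF B'(1) BP, of "Min B"] mM(1)[OF B'(1)] mM(1)[OF BP] ne by metis
      ultimately have "Min B < a" using mM(3)[OF B'(1,2)] by simp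
      moreover have "a \<noteq> j" using dis[OF B'(1) BP B'(2)] jB ne by blast
      ultimately have "Min B < a" "a < j" "j < b" using ab by auto
      then have "crossing \<pi>" using B'(1) BP ne mM(1)[OF BP] jB B'(2,3) unfolding crossing_def by blast
      then show False using nc by simp
    qed
    then show "j \<in> {j \<in> {1..n}. chords {1..n} c j = {}}" using block_range[OF BP jB] by auto
  next
    fix j assume "j \<in> {j \<in> {1..n}. chords {1..n} c j = {}}"
    then have j: "j \<in> {1..n}" "chords {1..n} c j = {}" by auto
    define B where "B = block_of \<pi> j"
    have B: "B \<in> \<pi>" "j \<in> B" using block_of_in[OF part j(1)] by (auto simp: B_def)
    have no: "\<not> (a \<le> j \<and> j < b)" if "X \<in> \<pi>" "a \<in> X" "b \<in> X" for a b X
    proof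
      assume "a \<le> j \<and> j < b"
      then have "(a, b) \<in> chords {1..n} c j"
        using same_block[OF that] block_range[OF that(1,2)] block_range[OF that(1,3)] by (simp add: chords_def)
      then show False using j by simp
    qed
    have "\<not> j < Max B" "j \<le> Max B" using no[OF B(1) B(2) mM(2)[OF B(1)]] mM(3)[OF B] by simp_all
    then have "Max B = j" by simp
    moreover have "B \<in> V"
      unfolding V_def
    proof (intro CollectI conjI notI)
      assume "\<exists>B'\<in>\<pi>. B' \<noteq> B \<and> Min B' < Min B \<and> Max B < Max B'"
      then obtain B' where B': "B' \<in> \<pi>" "Min B' < Min B" "Max B < Max B'" by blast
      then show False using no[OF B'(1) mM(1,2)[OF B'(1)]] \<open>Max B = j\<close> mM(3)[OF B] by simp
    qed (rule B)
    ultimately show "j \<in> Max ` V" by blast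
  qed
  show ?thesis using card_image[OF inj] unfolding img by (simp add: visible_blocks_def V_def)
qed

text \<open>The outer face consists of the gap 0 and the gaps without chords; the gap 0 cancels
  against the - 1 in the exponent, which leaves the number of visible blocks. All other faces give
  traces, and the division removes the trace of the outer face from the product over
  \<open>Xi n \<pi>\<close>.\<close>

lemma chain_lead_nc:
  assumes psd: "psd_mat r P" and nc: "\<not> crossing \<pi>" and n: "n \<ge> 1"
  shows "chain_lead 0 {1..n} c (\<lambda>_. 0) r P u v =
    (\<Prod>i=1..n. mtrace (P ^\<^sub>m i) ^ block_count n (Xi n \<pi>) i) / mtrace (P ^\<^sub>m visible_blocks \<pi>) * form r P (visible_blocks \<pi>) u v"
proof -
  let ?ch = "chords {1..n} c"
  define K where "K = (\<lambda>i. {j \<in> {1..n}. ?ch j = ?ch i})"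
  define U0 where "U0 = {j \<in> {1..n}. ?ch j = {}}"
  have ch0: "?ch 0 = {}" by (auto simp: chords_def)
  have chn: "?ch n = {}" by (auto simp: chords_def)
  have On: "U0 = K n" unfolding U0_def K_def chn ..
  have Of: "U0 \<in> faces n c" using n by (auto simp: faces_def On K_def)
  have cO: "card U0 = visible_blocks \<pi>" using visible_blocks_eq[OF nc] by (simp add: U0_def)
  have fs: "face_sum 0 {1..n} c (\<lambda>_. 0) i = card {j \<in> insert 0 {1..n}. ?ch j = ?ch i}" for i
    by (simp add: face_sum_def card_eq_sum sum.inter_filter[symmetric] del: card_eq_sum)
  have f0: "face_sum 0 {1..n} c (\<lambda>_. 0) 0 - 1 = card U0"
  proof -
    have "{j \<in> insert 0 {1..n}. ?ch j = ?ch 0} = insert 0 U0" by (auto simp: U0_def ch0 simp del: One_nat_def)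
    then show ?thesis unfolding fs by (simp add: U0_def)
  qed
  define R where "R = face_reps 0 {1..n} c"
  have Rn: "i \<in> {1..n}" "?ch i \<noteq> {}" if "i \<in> R" for i using that ch0 by (auto simp: R_def face_reps_def)
  have fi: "face_sum 0 {1..n} c (\<lambda>_. 0) i = card (K i)" if "i \<in> R" for i
  proof -
    have "{j \<in> insert 0 {1..n}. ?ch j = ?ch i} = K i" using Rn(2)[OF that] by (auto simp: K_def ch0 simp del: One_nat_def)
    then show ?thesis unfolding fs by (rule arg_cong)
  qed
  have inj: "inj_on K R"
  proof (rule inj_onI, rule ccontr)
    fix i j assume *: "i \<in> R" "j \<in> R" "K i = K j" "i \<noteq> j"
    then have "?ch i = ?ch j" using Rn(1)[of i] by (auto simp: K_def)
    then show False using * by (auto simp: R_def face_reps_def neq_iff)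
  qed
  have KR: "K ` R = faces n c - {U0}"
  proof (intro equalityI subsetI)
    fix X assume "X \<in> K ` R"
    then obtain i where i: "i \<in> R" "X = K i" by blast
    have "i \<in> K i" using Rn(1)[OF i(1)] by (simp add: K_def)
    then have "K i \<noteq> U0" using Rn(2)[OF i(1)] by (auto simp: U0_def)
    then show "X \<in> faces n c - {U0}" using i Rn(1)[OF i(1)] by (auto simp: faces_def K_def)
  next
    fix X assume X: "X \<in> faces n c - {U0}"
    have "faces n c = K ` {1..n}" unfolding faces_def K_def ..
    then obtain i where i: "i \<in> {1..n}" "X = K i" using X by blast
    have ne: "?ch i \<noteq> {}"
    proof
      assume "?ch i = {}"
      then have "K i = U0" by (simp add: K_def U0_def)
      then show False using X i(2) by blast
    qed
    define m where "m = Min (K i)"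
    have "finite (K i)" "K i \<noteq> {}" using i by (auto simp: K_def)
    then have m: "m \<in> K i" "\<And>x. x \<in> K i \<Longrightarrow> m \<le> x" by (auto simp: m_def)
    then have cm: "?ch m = ?ch i" "m \<in> {1..n}" by (auto simp: K_def)
    have "m \<in> R"
      unfolding R_def face_reps_def
    proof (intro CollectI conjI ballI impI notI)
      fix j assume j: "j \<in> insert 0 {1..n}" "j < m" "?ch j = ?ch m"
      then have "j \<noteq> 0" using ne cm ch0 by auto
      then have "j \<in> K i" using j cm by (auto simp: K_def)
      then show False using m(2)[of j] j by simp
    qed (rule cm)
    moreover have "K m = K i" using cm by (simp add: K_def)
    ultimately show "X \<in> K ` R" using i by blast
  qed
  have "(\<Prod>i\<in>R. mtrace (P ^\<^sub>m face_sum 0 {1..n} c (\<lambda>_. 0) i)) = (\<Prod>B\<in>faces n c - {U0}. mtrace (P ^\<^sub>m card B))"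
    unfolding KR[symmetric] by (subst prod.reindex[OF inj]) (simp add: fi del: One_nat_def)
  then have lead: "chain_lead 0 {1..n} c (\<lambda>_. 0) r P u v = (\<Prod>B\<in>faces n c - {U0}. mtrace (P ^\<^sub>m card B)) * form r P (card U0) u v"
    unfolding chain_lead_def R_def[symmetric] f0 using crosses_iff_crossing nc by simp
  have "(\<Prod>i=1..n. mtrace (P ^\<^sub>m i) ^ block_count n (Xi n \<pi>) i) = (\<Prod>B\<in>faces n c. mtrace (P ^\<^sub>m card B))"
    unfolding Xi_eq_faces[OF nc] by (rule prod_block_count(2)[OF partition_faces])
  also have "\<dots> = mtrace (P ^\<^sub>m card U0) * (\<Prod>B\<in>faces n c - {U0}. mtrace (P ^\<^sub>m card B))"
    by (rule prod.remove) (use Of finite_partition[OF _ partition_faces] in auto)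
  finally have pr: "(\<Prod>i=1..n. mtrace (P ^\<^sub>m i) ^ block_count n (Xi n \<pi>) i) = \<dots>" .
  \<comment> \<open>If the denominator is 0, so is the power of P, in agreement with x / 0 =
    0.\<close>
  have "form r P (card U0) u v = 0" if "mtrace (P ^\<^sub>m card U0) = 0"
    using psd_trace_0[OF psd_mat_pow[OF psd] that] by (simp add: form_def)
  then show ?thesis unfolding lead pr cO[symmetric] by (cases "mtrace (P ^\<^sub>m card U0) = 0") simp_all
qed

end

section \<open>The raw moments\<close>

lemma form_0: 
  assumes "psd_mat r P"
  shows "form r P 0 x y = (\<Sum>a<r. x a * y a)"
proof -
  have "form r P 0 x y = (\<Sum>a<r. \<Sum>b<r. x a * (if a = b then y b else 0))"
    unfolding form_def using psd_matD(3)[OF assms] by (intro sum.cong refl) auto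
  then show ?thesis by (simp add: if_distrib[of "\<lambda>x. _ * x"] cong: if_cong)
qed

text \<open>A product of rank-one matrices telescopes: neighbouring vectors meet in inner products,
  and the two outer ones stay.\<close>

lemma foldr_outer:
  assumes "a < r" "b < r"
  shows "foldr (\<lambda>i A. outer r (x i) * A) [k..<Suc (k + m)] (1\<^sub>m r) \<in> carrier_mat r r"
    and "foldr (\<lambda>i A. outer r (x i) * A) [k..<Suc (k + m)] (1\<^sub>m r) $$ (a, b) =
      x k a * (\<Prod>i\<in>{k..<k + m}. \<Sum>c<r. x i c * x (Suc i) c) * x (k + m) b"
proof -
  have "foldr (\<lambda>i A. outer r (x i) * A) [k..<Suc (k + m)] (1\<^sub>m r) \<in> carrier_mat r r \<and>
    foldr (\<lambda>i A. outer r (x i) * A) [k..<Suc (k + m)] (1\<^sub>m r) $$ (a, b) =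
      x k a * (\<Prod>i\<in>{k..<k + m}. \<Sum>c<r. x i c * x (Suc i) c) * x (k + m) b"
    using assms(1)
  proof (induction m arbitrary: k a)
    case 0
    then show ?case using assms(2) by (simp add: outer_def)
  next
    case (Suc m)
    define R where "R = foldr (\<lambda>i A. outer r (x i) * A) [Suc k..<Suc (Suc k + m)] (1\<^sub>m r)"
    have IH: "R \<in> carrier_mat r r" "c < r \<Longrightarrow> R $$ (c, b) = x (Suc k) c * (\<Prod>i\<in>{Suc k..<Suc k + m}. \<Sum>c<r. x i c * x (Suc i) c) * x (Suc k + m) b" for c
      using Suc.IH[of a "Suc k"] Suc.IH[of c "Suc k"] Suc.prems unfolding R_def by blast+
    have f: "foldr (\<lambda>i A. outer r (x i) * A) [k..<Suc (k + Suc m)] (1\<^sub>m r) = outer r (x k) * R"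
      unfolding R_def by (subst upt_conv_Cons) simp_all
    have "(outer r (x k) * R) $$ (a, b) = (\<Sum>c<r. outer r (x k) $$ (a, c) * R $$ (c, b))"
      by (rule mult_mat_index[OF outer_carrier IH(1) Suc.prems assms(2)])
    also have "\<dots> = (\<Sum>c<r. x k a * (x k c * x (Suc k) c) * ((\<Prod>i\<in>{Suc k..<Suc k + m}. \<Sum>c<r. x i c * x (Suc i) c) * x (Suc k + m) b))"
      using Suc.prems by (intro sum.cong refl) (simp add: IH(2) outer_def)
    also have "\<dots> = x k a * ((\<Sum>c<r. x k c * x (Suc k) c) * (\<Prod>i\<in>{Suc k..<Suc k + m}. \<Sum>c<r. x i c * x (Suc i) c)) * x (Suc k + m) b"
      by (simp add: sum_distrib_left sum_distrib_right mult_ac)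
    also have "(\<Sum>c<r. x k c * x (Suc k) c) * (\<Prod>i\<in>{Suc k..<Suc k + m}. \<Sum>c<r. x i c * x (Suc i) c) = (\<Prod>i\<in>{k..<k + Suc m}. \<Sum>c<r. x i c * x (Suc i) c)"
      by (simp add: prod.atLeast_Suc_lessThan)
    finally have e: "(outer r (x k) * R) $$ (a, b) = x k a * (\<Prod>i\<in>{k..<k + Suc m}. \<Sum>c<r. x i c * x (Suc i) c) * x (k + Suc m) b" by simp
    show ?case unfolding f using e mult_carrier_mat[OF outer_carrier IH(1)] by blast
  qed
  then show "foldr (\<lambda>i A. outer r (x i) * A) [k..<Suc (k + m)] (1\<^sub>m r) \<in> carrier_mat r r"
    "foldr (\<lambda>i A. outer r (x i) * A) [k..<Suc (k + m)] (1\<^sub>m r) $$ (a, b) =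
      x k a * (\<Prod>i\<in>{k..<k + m}. \<Sum>c<r. x i c * x (Suc i) c) * x (k + m) b" by blast+
qed

text \<open>Each inner product is a form with exponent 0; u = e_a and v = e_b select the outer
  coordinates.\<close>

lemma chain_exp_mat_prod:
  assumes psd: "psd_mat r P" and ab: "a < r" "b < r" and n: "n \<ge> 1"
  shows "(\<integral>X. mat_prod r n (\<lambda>i. outer r (X (c i))) $$ (a, b) \<partial>gaussian_copies P) =
    chain_exp 0 {1..n} c (\<lambda>_. 0) r P (unit_fun a) (unit_fun b)"
proof -
  obtain m where m: "n = Suc m" using n by (cases n) auto
  let ?u = "unit_fun a" and ?v = "unit_fun b"
  have unit: "(\<Sum>c<r. unit_fun d c * y c) = y d" "(\<Sum>c<r. y c * unit_fun d c) = y d" if "d < r" for d and y :: "nat \<Rightarrow> real"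
    using that by (simp_all add: unit_fun_def of_bool_def if_distrib[of "\<lambda>x. x * _"] if_distrib[of "\<lambda>x. _ * x"] cong: if_cong)
  have right: "chain_right {1..n} c i = (if i = n then RightEnd else Colour (c (Suc i)))" if "i \<le> n" for i
  proof -
    have "{j \<in> {1..n}. i < j} = {Suc i..n}" by auto
    moreover have "Min {Suc i..n} = Suc i" if "i < n" using that by (intro Min_eqI) auto
    ultimately show ?thesis using that by (auto simp: chain_right_def)
  qed
  note right' = right[unfolded One_nat_def]
  have "mat_prod r n (\<lambda>i. outer r (X (c i))) $$ (a, b) =
    (\<Prod>i\<in>insert 0 {1..n}. form r P 0 (end_val ?u ?v (\<lambda>(k, i). X k i) (chain_left 0 c i)) (end_val ?u ?v (\<lambda>(k, i). X k i) (chain_right {1..n} c i)))" for X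
  proof -
    define F where "F = (\<lambda>i. form r P 0 (end_val ?u ?v (\<lambda>(k, i). X k i) (chain_left 0 c i)) (end_val ?u ?v (\<lambda>(k, i). X k i) (chain_right {1..n} c i)))"
    have F0: "F 0 = X (c 1) a"
      using unit(1)[OF ab(1), of "\<lambda>i. X (c 1) i"] n by (simp add: F_def form_0[OF psd] right' chain_left_def end_val.simps)
    have Fn: "F n = X (c n) b"
      using unit(2)[OF ab(2), of "\<lambda>i. X (c n) i"] n by (simp add: F_def form_0[OF psd] right' chain_left_def end_val.simps)
    have Fi: "F i = (\<Sum>d<r. X (c i) d * X (c (Suc i)) d)" if "i \<in> {1..<n}" for i
      using that by (simp add: F_def form_0[OF psd] right' chain_left_def end_val.simps)
    have "insert 0 {1..n} = insert 0 (insert n {1..<n})" using n by auto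
    then have "(\<Prod>i\<in>insert 0 {1..n}. F i) = F 0 * (F n * (\<Prod>i\<in>{1..<n}. F i))" using n by simp
    also have "\<dots> = X (c 1) a * (\<Prod>i\<in>{1..<n}. \<Sum>d<r. X (c i) d * X (c (Suc i)) d) * X (c n) b"
      using Fi by (simp add: F0 Fn)
    also have "\<dots> = mat_prod r n (\<lambda>i. outer r (X (c i))) $$ (a, b)"
      unfolding mat_prod_def using foldr_outer(2)[OF ab, of "\<lambda>i. X (c i)" 1 m] by (simp only: m plus_1_eq_Suc)
    finally show ?thesis by (simp add: F_def)
  qed
  then show ?thesis unfolding chain_exp_def edge_exp_def by simp
qed

lemma M_raw_entry:
  assumes psd: "psd_mat r P" and ab: "a < r" "b < r" and n: "n \<ge> 1"
  shows "M_raw n m P $$ (a, b) = (\<Sum>\<pi>\<in>parts n m. chain_exp 0 {1..n} (block_index \<pi>) (\<lambda>_. 0) r P (unit_fun a) (unit_fun b))"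
  using ab psd_matD(3)[OF psd]
  by (simp add: M_raw_def Let_def mat_sum_def mat_expectation_def chain_exp_mat_prod[OF psd ab n])

lemma defect_block_index:
  assumes "\<pi> \<in> parts n m"
  shows "defect {1..n} (block_index \<pi>) = n - m"
proof -
  have p: "partition_on {1..n} \<pi>" "card \<pi> = m" using assms by (auto simp: parts_def)
  have "block_index \<pi> ` {1..n} = block_rank \<pi> ` \<pi>"
  proof (intro equalityI subsetI)
    fix k assume "k \<in> block_index \<pi> ` {1..n}"
    then obtain i where "i \<in> {1..n}" "k = block_index \<pi> i" by blast
    then show "k \<in> block_rank \<pi> ` \<pi>" using block_index_rank[OF p(1) block_of_in[OF p(1)]] block_of_in(1)[OF p(1)] by blast
  next
    fix k assume "k \<in> block_rank \<pi> ` \<pi>"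
    then obtain B where B: "B \<in> \<pi>" "k = block_rank \<pi> B" by blast
    then have "B \<noteq> {}" using partition_onD3[OF p(1)] by blast
    then obtain i where i: "i \<in> B" by blast
    then have "i \<in> {1..n}" using B p(1) by (auto simp: partition_on_def)
    moreover have "k = block_index \<pi> i" using block_index_rank[OF p(1) B(1) i] B(2) by simp
    ultimately show "k \<in> block_index \<pi> ` {1..n}" by blast
  qed
  then have "card (block_index \<pi> ` {1..n}) = m" using card_image[OF block_rank_inj[OF p(1)]] p(2) by simp
  then show ?thesis by (simp add: defect_def)
qed

definition raw_lead :: "nat \<Rightarrow> nat \<Rightarrow> nat \<Rightarrow> real mat \<Rightarrow> (nat \<Rightarrow> real) \<Rightarrow> (nat \<Rightarrow> real) \<Rightarrow> real" where
  "raw_lead n m r P u v = (\<Sum>\<pi>\<in>parts n m. chain_lead 0 {1..n} (block_index \<pi>) (\<lambda>_. 0) r P u v)"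

lemma finite_parts: "finite (parts n m)"
  by (rule finite_subset[of _ "Pow (Pow {1..n})"]) (auto simp: parts_def partition_on_def)

text \<open>Crossing partitions contribute 0 to \<open>raw_lead\<close>, so the sum over all
  partitions reduces to the non-crossing ones.\<close>

lemma Sigma_raw_entry:
  assumes psd: "psd_mat r P" and ab: "a < r" "b < r" and n: "n \<ge> 1"
  shows "Sigma_raw n m P $$ (a, b) = raw_lead n m r P (unit_fun a) (unit_fun b)"
proof -
  have d: "dim_row (P ^\<^sub>m k) = r" "dim_col (P ^\<^sub>m k) = r" for k using psd_matD(4)[OF psd, of k] by auto
  have sub: "nc_parts_card n m = {\<pi> \<in> parts n m. \<not> crossing \<pi>}"
    by (auto simp: nc_parts_card_def nc_parts_def parts_def)
  have col: "block_index \<pi> i = block_index \<pi> j \<longleftrightarrow> block_of \<pi> i = block_of \<pi> j"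
    if "\<pi> \<in> parts n m" "i \<in> {1..n}" "j \<in> {1..n}" for \<pi> i j
    using block_index_eq_iff[of "{1..n}" \<pi> i j] that by (simp add: parts_def)
  have "Sigma_raw n m P $$ (a, b) = (\<Sum>\<pi>\<in>nc_parts_card n m. ((\<Prod>i=1..n. mtrace (P ^\<^sub>m i) ^ block_count n (Xi n \<pi>) i) /
     mtrace (P ^\<^sub>m visible_blocks \<pi>)) * (P ^\<^sub>m visible_blocks \<pi>) $$ (a, b))"
    using ab psd_matD(3)[OF psd] d by (simp add: Sigma_raw_def mat_sum_def)
  also have "\<dots> = (\<Sum>\<pi>\<in>nc_parts_card n m. chain_lead 0 {1..n} (block_index \<pi>) (\<lambda>_. 0) r P (unit_fun a) (unit_fun b))"
  proof (rule sum.cong[OF refl])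
    fix \<pi> assume pi: "\<pi> \<in> nc_parts_card n m"
    then have p: "partition_on {1..n} \<pi>" "\<not> crossing \<pi>" "\<pi> \<in> parts n m" by (auto simp: sub parts_def)
    show "((\<Prod>i=1..n. mtrace (P ^\<^sub>m i) ^ block_count n (Xi n \<pi>) i) / mtrace (P ^\<^sub>m visible_blocks \<pi>)) * (P ^\<^sub>m visible_blocks \<pi>) $$ (a, b)
      = chain_lead 0 {1..n} (block_index \<pi>) (\<lambda>_. 0) r P (unit_fun a) (unit_fun b)"
      using chain_lead_nc[OF p(1) col[OF p(3)] psd p(2) n, of "unit_fun a" "unit_fun b"] form_unit[OF ab] by simp
  qed
  also have "\<dots> = raw_lead n m r P (unit_fun a) (unit_fun b)"
    unfolding raw_lead_def
  proof (rule sum.mono_neutral_left[OF finite_parts])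
    show "\<forall>\<pi>\<in>parts n m - nc_parts_card n m. chain_lead 0 {1..n} (block_index \<pi>) (\<lambda>_. 0) r P (unit_fun a) (unit_fun b) = 0"
    proof
      fix \<pi> assume "\<pi> \<in> parts n m - nc_parts_card n m"
      then have p: "partition_on {1..n} \<pi>" "crossing \<pi>" "\<pi> \<in> parts n m" by (auto simp: sub parts_def)
      have "crosses {1..n} (block_index \<pi>)" using crosses_iff_crossing[OF p(1) col[OF p(3)]] p(2) by blast
      then show "chain_lead 0 {1..n} (block_index \<pi>) (\<lambda>_. 0) r P (unit_fun a) (unit_fun b) = 0" by (simp add: chain_lead_def)
    qed
  qed (auto simp: sub)
  finally show ?thesis .
qed

lemma M_raw_lead:
  "trace_poly (n - m) (\<lambda>r P u v. (\<Sum>\<pi>\<in>parts n m. chain_exp 0 {1..n} (block_index \<pi>) (\<lambda>_. 0) r P u v) - raw_lead n m r P u v)"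
proof -
  have "trace_poly (n - m) (\<lambda>r P u v. \<Sum>\<pi>\<in>parts n m. chain_exp 0 {1..n} (block_index \<pi>) (\<lambda>_. 0) r P u v - chain_lead 0 {1..n} (block_index \<pi>) (\<lambda>_. 0) r P u v)"
  proof (rule trace_poly_sum)
    fix \<pi> assume "\<pi> \<in> parts n m"
    then show "trace_poly (n - m) (\<lambda>r P u v. chain_exp 0 {1..n} (block_index \<pi>) (\<lambda>_. 0) r P u v - chain_lead 0 {1..n} (block_index \<pi>) (\<lambda>_. 0) r P u v)"
      using chain_exp_lead[of "{1..n}" 0 "block_index \<pi>" "\<lambda>_. 0"] defect_block_index by simp
  qed
  then show ?thesis by (rule trace_poly_cong) (simp add: raw_lead_def sum_subtractf)
qed

section \<open>Remainders\<close>

text \<open>A polynomial in P(r) whose coefficients are polynomials in traces of powers of P(r). The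
  list is the same for all r and has at most k traces per term, which makes the family of order
  r^k.\<close>

definition trace_mat :: "nat \<Rightarrow> (nat \<Rightarrow> real mat) \<Rightarrow> (nat \<Rightarrow> real mat) \<Rightarrow> bool" where
  "trace_mat k P R \<longleftrightarrow> (\<exists>ts. (\<forall>(c, bs, e)\<in>set ts. length bs \<le> k) \<and> (\<forall>r. R r \<in> carrier_mat r r \<and>
     (\<forall>i<r. \<forall>j<r. R r $$ (i, j) = (\<Sum>(c, bs, e)\<leftarrow>ts. c * (\<Prod>b\<leftarrow>bs. mtrace (P r ^\<^sub>m b)) * (P r ^\<^sub>m e) $$ (i, j)))))"

text \<open>Unit vectors turn the scalar identity into one for matrix entries. For d = 0 the list of
  terms is empty.\<close>

lemma trace_poly_mat:
  assumes "trace_poly d g" and psd: "\<And>r. psd_mat r (P r)" and R: "\<And>r. R r \<in> carrier_mat r r"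
    "\<And>r i j. i < r \<Longrightarrow> j < r \<Longrightarrow> R r $$ (i, j) = g r (P r) (unit_fun i) (unit_fun j)"
  shows "d = 0 \<Longrightarrow> R r = 0\<^sub>m r r" and "0 < d \<Longrightarrow> trace_mat (d - 1) P R"
proof -
  obtain ts where ts: "\<forall>(c, bs, e)\<in>set ts. length bs < d" "\<forall>r P u v. psd_mat r P \<longrightarrow> g r P u v = tp_eval ts r P u v"
    using assms(1) unfolding trace_poly_def by (elim exE conjE)
  have e: "R r $$ (i, j) = (\<Sum>(c, bs, e)\<leftarrow>ts. c * (\<Prod>b\<leftarrow>bs. mtrace (P r ^\<^sub>m b)) * (P r ^\<^sub>m e) $$ (i, j))" if "i < r" "j < r" for r i j
    using R(2)[OF that] ts(2) psd[of r] by (simp add: tp_eval_def form_unit[OF that])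
  show "R r = 0\<^sub>m r r" if "d = 0"
  proof -
    have "ts = []" using ts(1) that by (cases ts) auto
    then show ?thesis using e R(1)[of r] by (intro eq_matI) auto
  qed
  show "trace_mat (d - 1) P R" if "0 < d"
    unfolding trace_mat_def
  proof (intro exI[of _ ts] conjI allI impI R(1))
    show "\<forall>(c, bs, e)\<in>set ts. length bs \<le> d - 1" using ts(1) by auto
  qed (rule e)
qed

lemma trace_matE:
  assumes "trace_mat k P R"
  obtains ts where "\<forall>(c, bs, e)\<in>set ts. length bs \<le> k" "\<forall>r. R r \<in> carrier_mat r r"
     "\<forall>r i j. i < r \<longrightarrow> j < r \<longrightarrow> R r $$ (i, j) = (\<Sum>(c, bs, e)\<leftarrow>ts. c * (\<Prod>b\<leftarrow>bs. mtrace (P r ^\<^sub>m b)) * (P r ^\<^sub>m e) $$ (i, j))"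
proof -
  from assms[unfolded trace_mat_def] obtain ts where *: "(\<forall>(c, bs, e)\<in>set ts. length bs \<le> k) \<and> (\<forall>r. R r \<in> carrier_mat r r \<and>
     (\<forall>i<r. \<forall>j<r. R r $$ (i, j) = (\<Sum>(c, bs, e)\<leftarrow>ts. c * (\<Prod>b\<leftarrow>bs. mtrace (P r ^\<^sub>m b)) * (P r ^\<^sub>m e) $$ (i, j))))"
    by (rule exE)
  show ?thesis by (rule that[of ts]) (simp_all add: *[THEN conjunct1] *[THEN conjunct2, rule_format])
qed

text \<open>Concatenating the lists of traces and adding the exponents of P multiplies two such
  families. Hence every power of a remainder is again of this form, and its trace is a polynomial in
  traces.\<close>

lemma trace_mat_mult:
  assumes psd: "\<And>r. psd_mat r (P r)" and A: "trace_mat k P A" and B: "trace_mat l P B"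
  shows "trace_mat (k + l) P (\<lambda>r. A r * B r)"
proof -
  let ?t = "\<lambda>r bs. \<Prod>b\<leftarrow>bs. mtrace (P r ^\<^sub>m b)"
  obtain ts where ts0: "\<forall>(c, bs, e)\<in>set ts. length bs \<le> k" "\<forall>r. A r \<in> carrier_mat r r"
     "\<forall>r i j. i < r \<longrightarrow> j < r \<longrightarrow> A r $$ (i, j) = (\<Sum>(c, bs, e)\<leftarrow>ts. c * ?t r bs * (P r ^\<^sub>m e) $$ (i, j))"
    by (rule trace_matE[OF A])
  note ts = ts0(1) ts0(2)[rule_format] ts0(3)[rule_format]
  obtain us where us0: "\<forall>(c, bs, e)\<in>set us. length bs \<le> l" "\<forall>r. B r \<in> carrier_mat r r"
     "\<forall>r i j. i < r \<longrightarrow> j < r \<longrightarrow> B r $$ (i, j) = (\<Sum>(c, bs, e)\<leftarrow>us. c * ?t r bs * (P r ^\<^sub>m e) $$ (i, j))"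
    by (rule trace_matE[OF B])
  note us = us0(1) us0(2)[rule_format] us0(3)[rule_format]
  define ws where "ws = concat (map (\<lambda>(c, bs, e). map (\<lambda>(c', bs', e'). (c * c', bs @ bs', e + e')) us) ts)"
  have prod: "(\<Sum>q<r. (\<Sum>(c, bs, e)\<leftarrow>ts. c * ?t r bs * (P r ^\<^sub>m e) $$ (i, q)) * (\<Sum>(c, bs, e)\<leftarrow>us. c * ?t r bs * (P r ^\<^sub>m e) $$ (q, j)))
    = (\<Sum>(c, bs, e)\<leftarrow>ws. c * ?t r bs * (P r ^\<^sub>m e) $$ (i, j))" if ij: "i < r" "j < r" for r i j
  proof -
    have inner: "(\<Sum>q<r. c * ?t r bs * (P r ^\<^sub>m e) $$ (i, q) * (\<Sum>(c, bs, e)\<leftarrow>us. c * ?t r bs * (P r ^\<^sub>m e) $$ (q, j)))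
      = (\<Sum>(c, bs, e)\<leftarrow>map (\<lambda>(c', bs', e'). (c * c', bs @ bs', e + e')) us. c * ?t r bs * (P r ^\<^sub>m e) $$ (i, j))" for c bs e
    proof (induction us)
      case (Cons t us)
      obtain c' bs' e' where t: "t = (c', bs', e')" by (cases t)
      have "(\<Sum>q<r. c * ?t r bs * (P r ^\<^sub>m e) $$ (i, q) * (c' * ?t r bs' * (P r ^\<^sub>m e') $$ (q, j)))
        = c * c' * (?t r bs * ?t r bs') * (\<Sum>q<r. (P r ^\<^sub>m e) $$ (i, q) * (P r ^\<^sub>m e') $$ (q, j))"
        by (simp add: sum_distrib_left mult_ac)
      also have "\<dots> = c * c' * (?t r bs * ?t r bs') * (P r ^\<^sub>m (e + e')) $$ (i, j)"
        using pow_mult_entry[OF psd ij] by simp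
      finally show ?case using Cons by (simp add: t distrib_left sum.distrib)
    qed simp
    show ?thesis unfolding ws_def
    proof (induction ts)
      case (Cons t ts)
      obtain c bs e where t: "t = (c, bs, e)" by (cases t)
      show ?case using Cons inner[of c bs e] by (simp add: t distrib_right sum.distrib)
    qed simp
  qed
  show ?thesis
    unfolding trace_mat_def
  proof (intro exI[of _ ws] conjI allI impI)
    show "\<forall>(c, bs, e)\<in>set ws. length bs \<le> k + l"
    proof
      fix w assume "w \<in> set ws"
      then obtain c bs e c' bs' e' where "(c, bs, e) \<in> set ts" "(c', bs', e') \<in> set us" "w = (c * c', bs @ bs', e + e')"
        by (auto simp: ws_def)
      moreover from this have "length bs \<le> k" "length bs' \<le> l" using ts(1) us(1) by fast+
      ultimately show "case w of (c, bs, e) \<Rightarrow> length bs \<le> k + l" by simp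
    qed
    show "A r * B r \<in> carrier_mat r r" for r by (rule mult_carrier_mat[OF ts(2) us(2)])
    show "(A r * B r) $$ (i, j) = (\<Sum>(c, bs, e)\<leftarrow>ws. c * ?t r bs * (P r ^\<^sub>m e) $$ (i, j))" if ij: "i < r" "j < r" for r i j
      unfolding mult_mat_index[OF ts(2) us(2) ij] prod[OF ij, symmetric]
      by (rule sum.cong[OF refl]) (simp add: ts(3) us(3) ij)
  qed
qed

lemma trace_mat_pow:
  assumes psd: "\<And>r. psd_mat r (P r)" and A: "trace_mat k P A"
  shows "trace_mat (p * k) P (\<lambda>r. A r ^\<^sub>m p)"
proof (induction p)
  case 0
  have "A r \<in> carrier_mat r r" for r using A unfolding trace_mat_def by (elim exE) simp
  then have d: "dim_row (A r) = r" "dim_row (P r) = r" for r using psd_matD(3)[OF psd] by auto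
  show ?case
    unfolding trace_mat_def by (rule exI[of _ "[(1, [], 0)]"]) (simp add: d)
next
  case (Suc p)
  show ?case using trace_mat_mult[OF psd Suc A] by (simp add: add.commute)
qed

context
  fixes P :: "nat \<Rightarrow> real mat" and \<tau> :: "nat \<Rightarrow> real"
  assumes psd: "\<And>r. psd_mat r (P r)"
    and conv: "\<And>n. n \<ge> 1 \<Longrightarrow> (\<lambda>r. mtrace (P r ^\<^sub>m n) / real r) \<longlonglongrightarrow> \<tau> n"
begin

text \<open>Convergence bounds the normalized traces over all r at once; the power 0, outside the
  hypothesis, has trace r.\<close>

lemma mtrace_pow_bound: "\<exists>C\<ge>0. \<forall>r. \<bar>mtrace (P r ^\<^sub>m b)\<bar> \<le> C * real r"
proof (cases "b = 0")
  case True
  have "mtrace (P r ^\<^sub>m b) = real r" for r using psd_matD(3)[OF psd] True by (simp add: mtrace_def)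
  then show ?thesis by (intro exI[of _ 1]) simp
next
  case False
  then have "Bseq (\<lambda>r. mtrace (P r ^\<^sub>m b) / real r)" using conv[of b] by (intro convergent_imp_Bseq) (auto simp: convergent_def)
  then obtain C where C: "C > 0" "\<And>r. \<bar>mtrace (P r ^\<^sub>m b) / real r\<bar> \<le> C" unfolding Bseq_def by auto
  have "\<bar>mtrace (P r ^\<^sub>m b)\<bar> \<le> C * real r" for r
  proof (cases "r = 0")
    case True
    then show ?thesis using psd_matD(3)[OF psd, of 0] by (simp add: mtrace_def)
  next
    case False
    then show ?thesis using C(2)[of r] by (simp add: abs_divide divide_le_eq)
  qed
  then show ?thesis using C(1) by (intro exI[of _ C]) auto
qed

lemma prod_mtrace_bound: "\<exists>C\<ge>0. \<forall>r. \<bar>\<Prod>b\<leftarrow>bs. mtrace (P r ^\<^sub>m b)\<bar> \<le> C * real r ^ length bs"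
proof (induction bs)
  case Nil
  then show ?case by (intro exI[of _ 1]) simp
next
  case (Cons b bs)
  then obtain C where C: "C \<ge> 0" "\<And>r. \<bar>\<Prod>b\<leftarrow>bs. mtrace (P r ^\<^sub>m b)\<bar> \<le> C * real r ^ length bs" by blast
  obtain D where D: "D \<ge> 0" "\<And>r. \<bar>mtrace (P r ^\<^sub>m b)\<bar> \<le> D * real r" using mtrace_pow_bound[of b] by blast
  have "\<bar>\<Prod>b\<leftarrow>b # bs. mtrace (P r ^\<^sub>m b)\<bar> \<le> (D * C) * real r ^ length (b # bs)" for r
    using mult_mono[OF D(2)[of r] C(2)[of r]] C(1) D(1) by (simp add: abs_mult mult_ac)
  then show ?case using C(1) D(1) by (intro exI[of _ "D * C"]) auto
qed

text \<open>Stated for an abstract quantity f attached to P^e, with bound h, in order to serve both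
  for traces and for quadratic forms. With r \<ge> 1 a term with fewer than k traces is still
  bounded by r^k.\<close>

lemma trace_list_bound:
  fixes f :: "nat \<Rightarrow> nat \<Rightarrow> 'x \<Rightarrow> real"
  assumes "\<forall>(c, bs, e)\<in>set ts. length bs \<le> k" and h: "\<And>r x. x \<in> X r \<Longrightarrow> 0 \<le> h r x"
    and f: "\<And>e. \<exists>C\<ge>0. \<forall>r\<ge>N. \<forall>x\<in>X r. \<bar>f e r x\<bar> \<le> C * h r x"
  shows "\<exists>C\<ge>0. \<forall>r\<ge>max 1 N. \<forall>x\<in>X r. \<bar>\<Sum>(c, bs, e)\<leftarrow>ts. c * (\<Prod>b\<leftarrow>bs. mtrace (P r ^\<^sub>m b)) * f e r x\<bar> \<le> C * (real r ^ k * h r x)"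
  using assms(1)
proof (induction ts)
  case Nil
  then show ?case by (intro exI[of _ 0]) simp
next
  case (Cons t ts)
  obtain c bs e where t: "t = (c, bs, e)" by (cases t)
  obtain C where C: "C \<ge> 0" "\<And>r x. r \<ge> max 1 N \<Longrightarrow> x \<in> X r \<Longrightarrow> \<bar>\<Sum>(c, bs, e)\<leftarrow>ts. c * (\<Prod>b\<leftarrow>bs. mtrace (P r ^\<^sub>m b)) * f e r x\<bar> \<le> C * (real r ^ k * h r x)"
    using Cons.IH Cons.prems by auto
  obtain D where D: "D \<ge> 0" "\<And>r. \<bar>\<Prod>b\<leftarrow>bs. mtrace (P r ^\<^sub>m b)\<bar> \<le> D * real r ^ length bs" using prod_mtrace_bound[of bs] by blast
  obtain E where E: "E \<ge> 0" "\<And>r x. r \<ge> N \<Longrightarrow> x \<in> X r \<Longrightarrow> \<bar>f e r x\<bar> \<le> E * h r x" using f[of e] by blast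
  have "\<bar>\<Sum>(c, bs, e)\<leftarrow>t # ts. c * (\<Prod>b\<leftarrow>bs. mtrace (P r ^\<^sub>m b)) * f e r x\<bar> \<le> (\<bar>c\<bar> * D * E + C) * (real r ^ k * h r x)"
    if r: "r \<ge> max 1 N" and x: "x \<in> X r" for r x
  proof -
    have "real r ^ length bs \<le> real r ^ k" using Cons.prems r t by (intro power_increasing) auto
    then have "\<bar>\<Prod>b\<leftarrow>bs. mtrace (P r ^\<^sub>m b)\<bar> \<le> D * real r ^ k" using D(2)[of r] D(1) by (meson mult_left_mono order_trans)
    then have "\<bar>\<Prod>b\<leftarrow>bs. mtrace (P r ^\<^sub>m b)\<bar> * \<bar>f e r x\<bar> \<le> (D * real r ^ k) * (E * h r x)"
      using E(2)[of r x] r x by (intro mult_mono) (auto simp: D(1))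
    then have "\<bar>c * (\<Prod>b\<leftarrow>bs. mtrace (P r ^\<^sub>m b)) * f e r x\<bar> \<le> \<bar>c\<bar> * ((D * real r ^ k) * (E * h r x))"
      unfolding abs_mult mult.assoc[of "\<bar>c\<bar>"] by (rule mult_left_mono) simp
    moreover have "\<bar>\<Sum>(c, bs, e)\<leftarrow>t # ts. c * (\<Prod>b\<leftarrow>bs. mtrace (P r ^\<^sub>m b)) * f e r x\<bar> \<le>
      \<bar>c * (\<Prod>b\<leftarrow>bs. mtrace (P r ^\<^sub>m b)) * f e r x\<bar> + \<bar>\<Sum>(c, bs, e)\<leftarrow>ts. c * (\<Prod>b\<leftarrow>bs. mtrace (P r ^\<^sub>m b)) * f e r x\<bar>"
      by (simp add: t)
    ultimately show ?thesis using C(2)[OF r x] by (simp add: algebra_simps)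
  qed
  moreover have "\<bar>c\<bar> * D * E + C \<ge> 0" using C(1) D(1) E(1) by simp
  ultimately show ?case by blast
qed

text \<open>The trace of the final power of P contributes one factor r beyond r^k.\<close>

lemma trace_mat_mtrace_bound:
  assumes "trace_mat k P A"
  shows "\<exists>C\<ge>0. \<forall>r\<ge>1. \<bar>mtrace (A r)\<bar> \<le> C * (real r ^ k * real r)"
proof -
  obtain ts where ts0: "\<forall>(c, bs, e)\<in>set ts. length bs \<le> k" "\<forall>r. A r \<in> carrier_mat r r"
     "\<forall>r i j. i < r \<longrightarrow> j < r \<longrightarrow> A r $$ (i, j) = (\<Sum>(c, bs, e)\<leftarrow>ts. c * (\<Prod>b\<leftarrow>bs. mtrace (P r ^\<^sub>m b)) * (P r ^\<^sub>m e) $$ (i, j))"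
    by (rule trace_matE[OF assms])
  note ts = ts0(1) ts0(2)[rule_format] ts0(3)[rule_format]
  have "mtrace (A r) = (\<Sum>(c, bs, e)\<leftarrow>ts. c * (\<Prod>b\<leftarrow>bs. mtrace (P r ^\<^sub>m b)) * mtrace (P r ^\<^sub>m e))" for r
  proof -
    have "mtrace (A r) = (\<Sum>i<r. \<Sum>(c, bs, e)\<leftarrow>ts. c * (\<Prod>b\<leftarrow>bs. mtrace (P r ^\<^sub>m b)) * (P r ^\<^sub>m e) $$ (i, i))"
      using ts(2)[of r] ts(3) by (simp add: mtrace_def)
    also have "\<dots> = (\<Sum>(c, bs, e)\<leftarrow>ts. c * (\<Prod>b\<leftarrow>bs. mtrace (P r ^\<^sub>m b)) * (\<Sum>i<r. (P r ^\<^sub>m e) $$ (i, i)))"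
      by (induction ts) (auto simp: sum.distrib sum_distrib_left)
    also have "(\<lambda>e. \<Sum>i<r. (P r ^\<^sub>m e) $$ (i, i)) = (\<lambda>e. mtrace (P r ^\<^sub>m e))"
      using psd_matD(3)[OF psd, of r] by (simp add: mtrace_def)
    finally show ?thesis by (meson)
  qed
  moreover have "\<exists>C\<ge>0. \<forall>r\<ge>max 1 0. \<forall>x\<in>{()}. \<bar>\<Sum>(c, bs, e)\<leftarrow>ts. c * (\<Prod>b\<leftarrow>bs. mtrace (P r ^\<^sub>m b)) * mtrace (P r ^\<^sub>m e)\<bar> \<le> C * (real r ^ k * real r)"
    by (rule trace_list_bound[OF ts(1), where f = "\<lambda>e r x. mtrace (P r ^\<^sub>m e)" and h = "\<lambda>r x. real r" and X = "\<lambda>r. {()}" and N = 0])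
      (use mtrace_pow_bound in auto)
  ultimately show ?thesis by simp
qed

lemma trace_mat_sym:
  assumes "trace_mat k P A"
  shows "A r \<in> carrier_mat r r" "transpose_mat (A r) = A r"
proof -
  obtain ts where ts0: "\<forall>(c, bs, e)\<in>set ts. length bs \<le> k" "\<forall>r. A r \<in> carrier_mat r r"
     "\<forall>r i j. i < r \<longrightarrow> j < r \<longrightarrow> A r $$ (i, j) = (\<Sum>(c, bs, e)\<leftarrow>ts. c * (\<Prod>b\<leftarrow>bs. mtrace (P r ^\<^sub>m b)) * (P r ^\<^sub>m e) $$ (i, j))"
    by (rule trace_matE[OF assms])
  note ts = ts0(1) ts0(2)[rule_format] ts0(3)[rule_format]
  show "A r \<in> carrier_mat r r" by (rule ts(2))
  have "A r $$ (i, j) = A r $$ (j, i)" if "i < r" "j < r" for i j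
    unfolding ts(3)[OF that] ts(3)[OF that(2,1)] pow_sym[OF psd that] ..
  then show "transpose_mat (A r) = A r" using ts(2)[of r] by (intro eq_matI) auto
qed

lemma trace_mat_form_bound:
  assumes A: "trace_mat k P A" and K: "\<forall>r\<ge>N. loewner_le r (P r) (K \<cdot>\<^sub>m 1\<^sub>m r)"
  shows "\<exists>C\<ge>0. \<forall>r\<ge>max 1 N. \<forall>v\<in>carrier_vec r. \<bar>scalar_prod v (A r *\<^sub>v v)\<bar> \<le> C * (real r ^ k * scalar_prod v v)"
proof -
  obtain ts where ts0: "\<forall>(c, bs, e)\<in>set ts. length bs \<le> k" "\<forall>r. A r \<in> carrier_mat r r"
     "\<forall>r i j. i < r \<longrightarrow> j < r \<longrightarrow> A r $$ (i, j) = (\<Sum>(c, bs, e)\<leftarrow>ts. c * (\<Prod>b\<leftarrow>bs. mtrace (P r ^\<^sub>m b)) * (P r ^\<^sub>m e) $$ (i, j))"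
    by (rule trace_matE[OF A])
  note ts = ts0(1) ts0(2)[rule_format] ts0(3)[rule_format]
  have form: "scalar_prod v (A r *\<^sub>v v) = (\<Sum>(c, bs, e)\<leftarrow>ts. c * (\<Prod>b\<leftarrow>bs. mtrace (P r ^\<^sub>m b)) * scalar_prod v (P r ^\<^sub>m e *\<^sub>v v))"
    if v: "v \<in> carrier_vec r" for r v
  proof -
    have "scalar_prod v (A r *\<^sub>v v) = (\<Sum>i<r. \<Sum>j<r. v $ i * (\<Sum>(c, bs, e)\<leftarrow>ts. c * (\<Prod>b\<leftarrow>bs. mtrace (P r ^\<^sub>m b)) * (P r ^\<^sub>m e) $$ (i, j)) * v $ j)"
      unfolding quadratic_sum[OF ts(2) v v] by (intro sum.cong refl) (simp add: ts(3))
    also have "\<dots> = (\<Sum>(c, bs, e)\<leftarrow>ts. c * (\<Prod>b\<leftarrow>bs. mtrace (P r ^\<^sub>m b)) * (\<Sum>i<r. \<Sum>j<r. v $ i * (P r ^\<^sub>m e) $$ (i, j) * v $ j))"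
      by (induction ts) (auto simp: sum.distrib sum_distrib_left distrib_left distrib_right mult_ac)
    finally show ?thesis unfolding quadratic_sum[OF psd_matD(4)[OF psd] v v] .
  qed
  \<comment> \<open>The bounds for powers ask for a positive constant.\<close>
  define K' where "K' = max K 1"
  have K': "scalar_prod v (P r *\<^sub>v v) \<le> K' * scalar_prod v v" if "r \<ge> N" "v \<in> carrier_vec r" for r v
  proof -
    have "psd_mat r (K \<cdot>\<^sub>m 1\<^sub>m r - P r)" using K that(1) by (simp add: loewner_le_def)
    from psd_matD(5)[OF this that(2)] have "scalar_prod v (P r *\<^sub>v v) \<le> K * scalar_prod v v"
      using that(2) psd_matD(1)[OF psd, of r]
      by (simp add: minus_mult_distrib_mat_vec[of _ r r] scalar_prod_minus_distrib[of _ r] smult_mat_vec[of _ r r])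
    also have "\<dots> \<le> K' * scalar_prod v v" by (intro mult_right_mono scalar_prod_ge_0_real) (simp add: K'_def)
    finally show ?thesis .
  qed
  have "\<exists>C\<ge>0. \<forall>r\<ge>max 1 N. \<forall>v\<in>carrier_vec r. \<bar>\<Sum>(c, bs, e)\<leftarrow>ts. c * (\<Prod>b\<leftarrow>bs. mtrace (P r ^\<^sub>m b)) * scalar_prod v (P r ^\<^sub>m e *\<^sub>v v)\<bar> \<le> C * (real r ^ k * scalar_prod v v)"
  proof (rule trace_list_bound[OF ts(1), where f = "\<lambda>e r v. scalar_prod v (P r ^\<^sub>m e *\<^sub>v v)" and h = "\<lambda>r v. scalar_prod v v" and X = carrier_vec])
    show "\<exists>C\<ge>0. \<forall>r\<ge>N. \<forall>v\<in>carrier_vec r. \<bar>scalar_prod v (P r ^\<^sub>m e *\<^sub>v v)\<bar> \<le> C * scalar_prod v v" for e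
      by (rule exI[of _ "1 + (K' ^ e)\<^sup>2"]) (use pow_mat_form_bound[OF psd, of K'] K' in \<open>auto simp: K'_def\<close>)
  qed (rule scalar_prod_ge_0_real)
  then show ?thesis using form by (metis (no_types, lifting))
qed

text \<open>The p-th power has at most p k traces per term, and its own trace contributes one more
  r, which the normalization removes. The operator bound enters the Loewner estimate only.\<close>

lemma trace_mat_bigo:
  assumes A: "trace_mat k P A"
  shows "matrix_bigo P A (\<lambda>r. real r ^ k)"
proof -
  have "(\<lambda>r. mtrace (A r ^\<^sub>m p) / real r) \<in> O(\<lambda>r. (real r ^ k) ^ p)" for p
  proof -
    obtain C where C: "\<And>r. r \<ge> 1 \<Longrightarrow> \<bar>mtrace (A r ^\<^sub>m p)\<bar> \<le> C * (real r ^ (p * k) * real r)"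
      using trace_mat_mtrace_bound[OF trace_mat_pow[OF psd A, of p]] by blast
    show ?thesis
    proof (rule bigoI[of _ C], rule eventually_sequentiallyI[of 1])
      fix r :: nat assume r: "1 \<le> r"
      then have "\<bar>mtrace (A r ^\<^sub>m p)\<bar> / real r \<le> C * real r ^ (p * k)" using C[OF r] by (simp add: divide_le_eq mult.assoc)
      then show "norm (mtrace (A r ^\<^sub>m p) / real r) \<le> C * norm ((real r ^ k) ^ p)"
        by (simp add: power_mult[symmetric] mult.commute)
    qed
  qed
  then have tb: "trace_bigo A (\<lambda>r. real r ^ k)" using trace_mat_sym[OF A] by (simp add: trace_bigo_def)
  have "loewner_bigo A (\<lambda>r. real r ^ k)" if bd: "\<exists>K. \<forall>\<^sub>F r in sequentially. loewner_le r (P r) (K \<cdot>\<^sub>m 1\<^sub>m r)"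
  proof -
    obtain K N where KN: "\<forall>r\<ge>N. loewner_le r (P r) (K \<cdot>\<^sub>m 1\<^sub>m r)" using bd unfolding eventually_sequentially by blast
    obtain C where C0: "C \<ge> 0 \<and> (\<forall>r\<ge>max 1 N. \<forall>v\<in>carrier_vec r. \<bar>scalar_prod v (A r *\<^sub>v v)\<bar> \<le> C * (real r ^ k * scalar_prod v v))"
      using trace_mat_form_bound[OF A KN] by (rule exE)
    note C = C0[THEN conjunct1] C0[THEN conjunct2, rule_format]
    have "loewner_le r ((- (C * real r ^ k)) \<cdot>\<^sub>m 1\<^sub>m r) (A r) \<and> loewner_le r (A r) ((C * real r ^ k) \<cdot>\<^sub>m 1\<^sub>m r)" if r: "r \<ge> max 1 N" for r
    proof -
      note Ar = trace_mat_sym[OF A, of r]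
      have sym: "A r $$ (i, j) = A r $$ (j, i)" if "i < r" "j < r" for i j
        using Ar that by (metis carrier_matD index_transpose_mat(1))
      have "0 \<le> scalar_prod v ((A r - (- (C * real r ^ k)) \<cdot>\<^sub>m 1\<^sub>m r) *\<^sub>v v)" "0 \<le> scalar_prod v (((C * real r ^ k) \<cdot>\<^sub>m 1\<^sub>m r - A r) *\<^sub>v v)" if v: "v \<in> carrier_vec r" for v
        using C(2)[OF r v] v Ar(1)
        by (simp_all add: minus_mult_distrib_mat_vec[of _ r r] scalar_prod_minus_distrib[of _ r] smult_mat_vec[of _ r r] mult.assoc abs_le_iff)
      then show ?thesis
        unfolding loewner_le_def psd_mat_def using Ar sym by (auto intro!: eq_matI)
    qed
    then show ?thesis unfolding loewner_bigo_def eventually_sequentially by blast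
  qed
  with tb show ?thesis by (simp add: matrix_bigo_def)
qed

end

text \<open>Serves for n = m, where the remainder vanishes. The restriction p \<ge> 1 in
  \<open>trace_bigo\<close> matters here, as the power 0 of the zero matrix is the identity.\<close>

lemma zero_bigo:
  assumes "\<And>r. A r = 0\<^sub>m r r"
  shows "matrix_bigo P A g"
proof -
  have "(\<lambda>r. mtrace (A r ^\<^sub>m p) / real r) \<in> O(\<lambda>r. g r ^ p)" if p: "p \<ge> 1" for p
  proof -
    obtain q where q: "p = Suc q" using p by (cases p) auto
    have "mtrace (A r ^\<^sub>m p) = 0" for r
    proof -
      have "A r ^\<^sub>m p = 0\<^sub>m r r" unfolding q assms by (simp add: right_mult_zero_mat[of _ r r])
      then show ?thesis by (simp add: mtrace_def)
    qed
    then show ?thesis by simp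
  qed
  moreover have "loewner_le r (0 \<cdot>\<^sub>m 1\<^sub>m r) (0\<^sub>m r r) \<and> loewner_le r (0\<^sub>m r r) (0 \<cdot>\<^sub>m 1\<^sub>m r)" for r
  proof -
    have "(0 \<cdot>\<^sub>m 1\<^sub>m r :: real mat) = 0\<^sub>m r r" by auto
    then show ?thesis by (auto simp: loewner_le_def psd_mat_def scalar_prod_def)
  qed
  then have "loewner_bigo A g" unfolding loewner_bigo_def assms by (intro exI[of _ 0]) simp
  ultimately show ?thesis by (simp add: matrix_bigo_def trace_bigo_def assms)
qed

lemma minus_mat_entry:
  assumes "A \<in> carrier_mat r r" "(B :: real mat) \<in> carrier_mat r r" "i < r" "j < r"
  shows "(A - B) $$ (i, j) = A $$ (i, j) - B $$ (i, j)"
  using assms by simp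

lemma moment_carriers:
  assumes "psd_mat r P"
  shows "H_moment n P \<in> carrier_mat r r" "Sigma_central n P \<in> carrier_mat r r"
    "M_raw n m P \<in> carrier_mat r r" "Sigma_raw n m P \<in> carrier_mat r r"
  using psd_matD(3)[OF assms]
  by (simp_all add: H_moment_def mat_expectation_def Sigma_central_def M_raw_def Sigma_raw_def mat_sum_def Let_def)

lemma H_moment_bigo:
  assumes psd: "\<And>r. psd_mat r (P r)"
    and conv: "\<And>k. k \<ge> 1 \<Longrightarrow> (\<lambda>r. mtrace (P r ^\<^sub>m k) / real r) \<longlonglongrightarrow> \<tau> k"
    and n: "n \<ge> 1"
  shows "matrix_bigo P (\<lambda>r. H_moment (2 * n) (P r) - Sigma_central n (P r)) (\<lambda>r. real r ^ (n - 1))"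
proof (rule trace_mat_bigo[OF psd conv], assumption, rule trace_poly_mat(2)[OF H_moment_lead[of n] psd])
  show "H_moment (2 * n) (P r) - Sigma_central n (P r) \<in> carrier_mat r r" for r
    using moment_carriers[OF psd] by (intro minus_carrier_mat)
  show "(H_moment (2 * n) (P r) - Sigma_central n (P r)) $$ (i, j) =
      word_exp [h_word (True, 0, 2 * n)] r (P r) (unit_fun i) (unit_fun j) -
      tree_sum (\<lambda>c. mtrace (P r ^\<^sub>m Suc c)) (2 * n) (\<lambda>c. form r (P r) c (unit_fun i) (unit_fun j))" if "i < r" "j < r" for r i j
    unfolding minus_mat_entry[OF moment_carriers(1)[OF psd] moment_carriers(2)[OF psd] that]
      H_moment_word_exp[OF psd that] Sigma_central_entry[OF psd that n] ..
qed (use n in simp)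

text \<open>For n = m the remainder has no terms at all, which suits the order r^(-1); for n > m the
  integer exponent is the natural number n - m - 1.\<close>

lemma M_raw_bigo:
  assumes psd: "\<And>r. psd_mat r (P r)"
    and conv: "\<And>k. k \<ge> 1 \<Longrightarrow> (\<lambda>r. mtrace (P r ^\<^sub>m k) / real r) \<longlonglongrightarrow> \<tau> k"
    and nm: "n \<ge> m" "m \<ge> 1"
  shows "matrix_bigo P (\<lambda>r. M_raw n m (P r) - Sigma_raw n m (P r)) (\<lambda>r. real r powi (int n - int m - 1))"
proof -
  have n: "n \<ge> 1" using nm by simp
  have c: "M_raw n m (P r) - Sigma_raw n m (P r) \<in> carrier_mat r r" for r
    using moment_carriers[OF psd] by (intro minus_carrier_mat)
  have e: "(M_raw n m (P r) - Sigma_raw n m (P r)) $$ (i, j) =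
      (\<Sum>\<pi>\<in>parts n m. chain_exp 0 {1..n} (block_index \<pi>) (\<lambda>_. 0) r (P r) (unit_fun i) (unit_fun j)) -
      raw_lead n m r (P r) (unit_fun i) (unit_fun j)" if "i < r" "j < r" for r i j
    unfolding minus_mat_entry[OF moment_carriers(3)[OF psd] moment_carriers(4)[OF psd] that]
      M_raw_entry[OF psd that n] Sigma_raw_entry[OF psd that n] ..
  note tp = trace_poly_mat[OF M_raw_lead[of n m] psd c e]
  show ?thesis
  proof (cases "n = m")
    case True
    then have "n - m = 0" by simp
    then show ?thesis by (intro zero_bigo tp(1))
  next
    case False
    then have "int n - int m - 1 = int (n - m - 1)" using nm by (simp add: of_nat_diff)
    then have "(\<lambda>r. real r powi (int n - int m - 1)) = (\<lambda>r. real r ^ (n - m - 1))" by (simp only: power_int_of_nat)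
    then show ?thesis using trace_mat_bigo[OF psd conv tp(2)] False nm by simp
  qed
qed

theorem theorem1p2:
  fixes \<Omega> :: "'w measure"
    and P :: "nat \<Rightarrow> 'w \<Rightarrow> real mat"
    and \<tau> :: "nat \<Rightarrow> 'w \<Rightarrow> real"
  assumes "prob_space \<Omega>"
    and cov: "\<And>r \<omega>. \<omega> \<in> space \<Omega> \<Longrightarrow> psd_mat r (P r \<omega>)"
    and meas: "\<And>r i j. i < r \<Longrightarrow> j < r \<Longrightarrow> (\<lambda>\<omega>. P r \<omega> $$ (i, j)) \<in> borel_measurable \<Omega>"
    and conv: "\<And>n. n \<ge> 1 \<Longrightarrow>
      AE \<omega> in \<Omega>. (\<lambda>r. mtrace (P r \<omega> ^\<^sub>m n) / real r) \<longlonglongrightarrow> \<tau> n \<omega>"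
  shows "(\<forall>n\<ge>1. \<forall>r. \<forall>\<omega>\<in>space \<Omega>. M_central (2 * n) n (P r \<omega>) = H_moment (2 * n) (P r \<omega>)) \<and>
    (\<forall>n\<ge>1. AE \<omega> in \<Omega>. matrix_bigo (\<lambda>r. P r \<omega>)
        (\<lambda>r. H_moment (2 * n) (P r \<omega>) - Sigma_central n (P r \<omega>))
        (\<lambda>r. real r ^ (n - 1))) \<and>
    (\<forall>n m. n \<ge> m \<and> m \<ge> 1 \<longrightarrow> (AE \<omega> in \<Omega>. matrix_bigo (\<lambda>r. P r \<omega>)
        (\<lambda>r. M_raw n m (P r \<omega>) - Sigma_raw n m (P r \<omega>))
        (\<lambda>r. real r powi (int n - int m - 1))))"
proof -
  \<comment> \<open>The exceptional sets belong to countably many n, so one null set serves all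
    exponents.\<close>
  have "AE \<omega> in \<Omega>. \<forall>n. n \<ge> 1 \<longrightarrow> (\<lambda>r. mtrace (P r \<omega> ^\<^sub>m n) / real r) \<longlonglongrightarrow> \<tau> n \<omega>"
    unfolding AE_all_countable using conv by auto
  then have AE_all: "AE \<omega> in \<Omega>. (\<forall>r. psd_mat r (P r \<omega>)) \<and> (\<forall>n\<ge>1. (\<lambda>r. mtrace (P r \<omega> ^\<^sub>m n) / real r) \<longlonglongrightarrow> \<tau> n \<omega>)"
    using AE_space by eventually_elim (auto simp: cov)
  show ?thesis
  proof (intro conjI allI impI ballI)
    show "M_central (2 * n) n (P r \<omega>) = H_moment (2 * n) (P r \<omega>)" if "\<omega> \<in> space \<Omega>" for n r \<omega>
      by (rule M_central_eq_H_moment[OF cov[OF that]])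
    show "AE \<omega> in \<Omega>. matrix_bigo (\<lambda>r. P r \<omega>) (\<lambda>r. H_moment (2 * n) (P r \<omega>) - Sigma_central n (P r \<omega>)) (\<lambda>r. real r ^ (n - 1))"
      if "n \<ge> 1" for n
      using AE_all
    proof eventually_elim
      case (elim \<omega>)
      show ?case by (rule H_moment_bigo[where \<tau> = "\<lambda>n. \<tau> n \<omega>"]) (use elim that in auto)
    qed
    show "AE \<omega> in \<Omega>. matrix_bigo (\<lambda>r. P r \<omega>) (\<lambda>r. M_raw n m (P r \<omega>) - Sigma_raw n m (P r \<omega>)) (\<lambda>r. real r powi (int n - int m - 1))"
      if "n \<ge> m \<and> m \<ge> 1" for n m
      using AE_all
    proof eventually_elim
      case (elim \<omega>)
      show ?case by (rule M_raw_bigo[where \<tau> = "\<lambda>n. \<tau> n \<omega>"]) (use elim that in auto)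
    qed
  qed
qed

end
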